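(* Let $\omega$ be irrational, $1<\beta\le 2$, $\gamma\in(0,1)$ with $\beta\gamma\ge1$, and define $\Lambda:\mathbb{T}\times\mathbb{R}^2\to\mathbb{T}\times\mathbb{R}^2$ by $$\Lambda(\theta,\xi)=\Big(\theta+\omega,\ \frac{\beta}{1+\|\xi\|_2^2}\begin{pmatrix}1&0\\0&\gamma\end{pmatrix}R_\theta\,\xi\Big),\qquad R_\theta=\begin{pmatrix}\cos 2\pi\theta&\sin2\pi\theta\\-\sin2\pi\theta&\cos2\pi\theta\end{pmatrix}.$$ Let $C>0$ be sufficiently large that $X:=\mathbb{T}\times B_C(0)$ satisfies $\Lambda(X)\subseteq\mathrm{int}(X)$, and let $\mathcal{G}:=\bigcap_{n\in\mathbb{N}}\Lambda^n(X)$. Then: (a) $\Lambda$ has a strange nonchaotic attractor which is a quasiperiodic two-point attractor: there is a measurable two-valued invariant graph $\Phi$ for $\Lambda$, which is non-continuous and has negative Lyapunov exponents in the fibers, and which attracts Lebesgue-almost every initial condition in $X$, i.e. for Lebesgue-a.e. $(\theta,\xi)\in X$ one has $\mathrm{dist}(\Lambda^n_\theta(\xi),\Phi(\theta+n\omega))\to0$ as $n\to\infty$. (b) The attractor is embedded in a $\Lambda$-invariant set $\mathcal{T}_0\subset X$ homeomorphic to the two-dimensional torus, and $\mathcal{T}_0$ is the boundary of the global attractor $\mathcal{G}$ in the three-dimensional phase space. (c) $\Lambda$ has sensitive dependence on initial conditions both on the whole phase space $X$ and restricted to the attractor (the topological closure of $\Phi$).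
   Context: $\mathbb{T}=\mathbb{R}/\mathbb{Z}$; $B_C(0)\subset\mathbb{R}^2$ is the closed Euclidean ball of radius $C$; $\Lambda^n_\theta(\xi)$ is the $\mathbb{R}^2$-component of $\Lambda^n(\theta,\xi)$. A measurable two-valued invariant graph is a measurable assignment $\theta\mapsto\Phi(\theta)$ of a two-point subset of $B_C(0)$ to each (Lebesgue-a.e.) $\theta$ with $\Lambda_\theta(\Phi(\theta))=\Phi(\theta+\omega)$; two such graphs equal a.e. are identified, and $\Phi$ is non-continuous if it is not a.e. equal to a continuous two-point-set-valued map. Associated with $\Phi$ is the invariant probability measure $\mu_\Phi(B)=\frac12\int_{\mathbb{T}}\#\{\xi\in\Phi(\theta):(\theta,\xi)\in B\}\,d\theta$; the (essential) topological closure of $\Phi$ is the topological support of $\mu_\Phi$. The Lyapunov exponents in the fibers are those of the derivative cocycle $D_\xi\Lambda^n_\theta(\xi)$ ($2\times2$ matrices) with respect to $\mu_\Phi$; negativity means that the largest one, $\lim_n\frac1n\int\log\|D_\xi\Lambda_\theta^n(\xi)\|\,d\mu_\Phi$, is negative. A map $g:Y\to Y$ of a metric space $(Y,d)$ has sensitive dependence on initial conditions if there is $\varepsilon>0$ such that for all $\delta>0$ and $x\in Y$ there exist $n\ge 0$ and $y\in Y$ with $d(x,y)<\delta$ and $d(g^n(x),g^n(y))>\varepsilon$. *)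

theory Defs
  imports "HOL-Analysis.Analysis"
begin

quotient_type circle = real / "\<lambda>x y :: real. x - y \<in> \<int>"
  morphisms rep_circle to_circle
proof (rule equivpI)
  show "reflp (\<lambda>x y :: real. x - y \<in> \<int>)"
    by (rule reflpI) simp
  show "symp (\<lambda>x y :: real. x - y \<in> \<int>)"
  proof (rule sympI)
    fix x y :: real
    assume "x - y \<in> \<int>"
    from Ints_minus[OF this] show "y - x \<in> \<int>" by simp
  qed
  show "transp (\<lambda>x y :: real. x - y \<in> \<int>)"
  proof (rule transpI)
    fix x y z :: real
    assume "x - y \<in> \<int>" "y - z \<in> \<int>"
    from Ints_add[OF this] show "x - z \<in> \<int>" by simp
  qed
qed

instantiation circle :: ab_group_add
begin

lift_definition zero_circle :: circle is "0 :: real" .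

lift_definition plus_circle :: "circle \<Rightarrow> circle \<Rightarrow> circle" is "(+)"
proof -
  fix a b c d :: real
  assume "a - b \<in> \<int>" "c - d \<in> \<int>"
  from Ints_add[OF this] show "a + c - (b + d) \<in> \<int>" by (simp add: algebra_simps)
qed

lift_definition uminus_circle :: "circle \<Rightarrow> circle" is "uminus"
proof -
  fix a b :: real
  assume "a - b \<in> \<int>"
  from Ints_minus[OF this] show "- a - (- b) \<in> \<int>" by simp
qed

lift_definition minus_circle :: "circle \<Rightarrow> circle \<Rightarrow> circle" is "(-)"
proof -
  fix a b c d :: real
  assume "a - b \<in> \<int>" "c - d \<in> \<int>"
  from Ints_diff[OF this] show "a - c - (b - d) \<in> \<int>" by (simp add: algebra_simps)
qed

instance
  by standard (transfer; simp)+

end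

lemma infdist_Ints_le: "k \<in> \<int> \<Longrightarrow> infdist x \<int> \<le> \<bar>x - k\<bar>" for x :: real
  using infdist_le[of k \<int> x] by (simp add: dist_real_def)

lemma infdist_Ints_attained: "\<exists>k\<in>\<int>. infdist x \<int> = \<bar>x - k\<bar>" for x :: real
proof -
  have "(\<int> :: real set) \<noteq> {}" using Ints_0 by blast
  from infdist_attains_inf[OF closed_Ints this, of x] show ?thesis
    unfolding dist_real_def by blast
qed

lemma infdist_Ints_shift_le:
  fixes x y :: real
  assumes "x - y \<in> \<int>"
  shows "infdist x \<int> \<le> infdist y \<int>"
proof -
  obtain k where k: "k \<in> \<int>" "infdist y \<int> = \<bar>y - k\<bar>"
    using infdist_Ints_attained by blast
  have "infdist x \<int> \<le> \<bar>x - (k + (x - y))\<bar>"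
    by (rule infdist_Ints_le) (use k(1) assms in \<open>simp only: Ints_add\<close>)
  also have "x - (k + (x - y)) = y - k" by linarith
  finally show ?thesis using k(2) by (simp only:)
qed

instantiation circle :: metric_space
begin

lift_definition dist_circle :: "circle \<Rightarrow> circle \<Rightarrow> real" is "\<lambda>x y. infdist (x - y) \<int>"
proof -
  fix a b c d :: real
  assume *: "a - b \<in> \<int>" "c - d \<in> \<int>"
  from Ints_diff[OF *] have "(a - c) - (b - d) \<in> \<int>" by (simp add: algebra_simps)
  moreover from Ints_diff[OF *(2,1)] have "(b - d) - (a - c) \<in> \<int>" by (simp add: algebra_simps)
  ultimately show "infdist (a - c) \<int> = infdist (b - d) \<int>"
    by (intro antisym infdist_Ints_shift_le)
qed

definition uniformity_circle :: "(circle \<times> circle) filter" where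
  "uniformity_circle = (INF e\<in>{0 <..}. principal {(x, y). dist x y < e})"

definition open_circle :: "circle set \<Rightarrow> bool" where
  "open_circle U \<longleftrightarrow> (\<forall>x\<in>U. eventually (\<lambda>(x', y). x' = x \<longrightarrow> y \<in> U) uniformity)"

instance
proof
  show "uniformity = (INF e\<in>{0 <..}. principal {(x, y :: circle). dist x y < e})"
    by (rule uniformity_circle_def)
  show "open U \<longleftrightarrow> (\<forall>x\<in>U. eventually (\<lambda>(x', y). x' = x \<longrightarrow> y \<in> U) uniformity)" for U :: "circle set"
    by (rule open_circle_def)
  show "dist x y = 0 \<longleftrightarrow> x = y" for x y :: circle
  proof transfer
    fix x y :: real
    have "(\<int> :: real set) \<noteq> {}" using Ints_0 by blast
    from in_closed_iff_infdist_zero[OF closed_Ints this]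
    show "infdist (x - y) \<int> = 0 \<longleftrightarrow> x - y \<in> \<int>" by (rule sym)
  qed
  show "dist x y \<le> dist x z + dist y z" for x y z :: circle
  proof transfer
    fix x y z :: real
    obtain k where k: "k \<in> \<int>" "infdist (x - z) \<int> = \<bar>x - z - k\<bar>"
      using infdist_Ints_attained by blast
    obtain l where l: "l \<in> \<int>" "infdist (y - z) \<int> = \<bar>y - z - l\<bar>"
      using infdist_Ints_attained by blast
    have "infdist (x - y) \<int> \<le> \<bar>x - y - (k - l)\<bar>"
      by (rule infdist_Ints_le) (use k(1) l(1) in simp)
    also have "\<dots> \<le> \<bar>x - z - k\<bar> + \<bar>y - z - l\<bar>" by linarith
    finally show "infdist (x - y) \<int> \<le> infdist (x - z) \<int> + infdist (y - z) \<int>"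
      by (simp only: k(2) l(2))
  qed
qed

end

lemma dist_to_circle_le: "dist (to_circle y) (to_circle x) \<le> dist y x"
  unfolding dist_circle.abs_eq using infdist_Ints_le[of 0 "y - x"] by (simp add: dist_real_def)

instance circle :: second_countable_topology
proof
  let ?B = "(\<lambda>(q, r). ball (to_circle (of_rat q)) (of_rat r)) ` (UNIV :: (rat \<times> rat) set)"
  have "topological_basis ?B"
  proof (rule topological_basisI)
    fix U :: "circle set" and x
    assume "open U" "x \<in> U"
    then obtain e where e: "0 < e" "ball x e \<subseteq> U" by (rule openE)
    obtain t where t: "x = to_circle t" using Quotient3_abs_rep[OF Quotient3_circle] by metis
    obtain r where r: "0 < real_of_rat r" "real_of_rat r < e / 2"
      using of_rat_dense[of 0 "e / 2"] e(1) by auto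
    obtain q where q: "t < of_rat q" "of_rat q < t + of_rat r"
      using of_rat_dense[of t "t + of_rat r"] r(1) by auto
    have d: "dist (to_circle (of_rat q)) x < of_rat r"
      using dist_to_circle_le[of "of_rat q" t] q unfolding t dist_real_def by linarith
    have "ball (to_circle (of_rat q)) (of_rat r) \<subseteq> ball x e"
    proof
      fix y
      assume "y \<in> ball (to_circle (of_rat q)) (of_rat r)"
      then show "y \<in> ball x e"
        using dist_triangle[of x y "to_circle (of_rat q)"] d r(2) by (simp add: dist_commute)
    qed
    with e(2) d show "\<exists>B\<in>?B. x \<in> B \<and> B \<subseteq> U"
      by (intro bexI[of _ "ball (to_circle (of_rat q)) (of_rat r)"]) auto
  qed auto
  then show "\<exists>B :: circle set set. countable B \<and> open = generate_topology B"
    by (intro exI[of _ ?B] conjI topological_basis_imp_subbasis) auto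
qed

lemma continuous_on_to_circle: "continuous_on A to_circle"
proof (rule continuous_onI)
  fix x e :: real
  assume "0 < e"
  then show "\<exists>d>0. \<forall>x'\<in>A. dist x' x < d \<longrightarrow> dist (to_circle x') (to_circle x) \<le> e"
    using dist_to_circle_le by (intro exI[of _ e]) (meson less_imp_le order.trans)
qed

lift_definition cos_turn :: "circle \<Rightarrow> real" is "\<lambda>x. cos (2 * pi * x)"
proof -
  fix x y :: real
  assume "x - y \<in> \<int>"
  then obtain k :: int where "x - y = of_int k" by (rule Ints_cases)
  then have "x = y + of_int k" by simp
  then show "cos (2 * pi * x) = cos (2 * pi * y)"
    by (simp add: distrib_left cos_add)
qed

lift_definition sin_turn :: "circle \<Rightarrow> real" is "\<lambda>x. sin (2 * pi * x)"
proof -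
  fix x y :: real
  assume "x - y \<in> \<int>"
  then obtain k :: int where "x - y = of_int k" by (rule Ints_cases)
  then have "x = y + of_int k" by simp
  then show "sin (2 * pi * x) = sin (2 * pi * y)"
    by (simp add: distrib_left sin_add)
qed

definition lebesgue_circle :: "circle measure" where
  "lebesgue_circle = distr (restrict_space lborel {0..<1}) borel to_circle"

lemma measurable_to_circle [measurable]: "to_circle \<in> borel_measurable borel"
  by (rule borel_measurable_continuous_onI) (rule continuous_on_to_circle)

lemma sets_lebesgue_circle [simp, measurable_cong]: "sets lebesgue_circle = sets borel"
  by (simp add: lebesgue_circle_def)

lemma emeasure_lebesgue_circle_UNIV: "emeasure lebesgue_circle UNIV = 1"
proof -
  have "to_circle \<in> measurable (restrict_space lborel {0..<1}) borel"
    by (rule measurable_restrict_space1) simp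
  then show ?thesis
    unfolding lebesgue_circle_def
    by (subst emeasure_distr) (auto simp: emeasure_restrict_space space_restrict_space)
qed

type_synonym phase = "circle \<times> (real^2)"

definition R_mat :: "circle \<Rightarrow> real^2^2" where
  "R_mat \<theta> = vector [vector [cos_turn \<theta>, sin_turn \<theta>], vector [- sin_turn \<theta>, cos_turn \<theta>]]"

definition Lam :: "real \<Rightarrow> real \<Rightarrow> real \<Rightarrow> phase \<Rightarrow> phase" where
  "Lam \<omega> \<beta> \<gamma> = (\<lambda>(\<theta>, \<xi>).
     (\<theta> + to_circle \<omega>,
      (\<beta> / (1 + (norm \<xi>)\<^sup>2)) *\<^sub>R ((vector [vector [1, 0], vector [0, \<gamma>]] ** R_mat \<theta>) *v \<xi>)))"

definition phase_ball :: "real \<Rightarrow> phase set" where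
  "phase_ball C = UNIV \<times> cball 0 C"

definition global_attractor :: "(phase \<Rightarrow> phase) \<Rightarrow> phase set \<Rightarrow> phase set" where
  "global_attractor F X = (\<Inter>n. (F ^^ n) ` X)"

definition fibre_iter :: "(phase \<Rightarrow> phase) \<Rightarrow> nat \<Rightarrow> circle \<Rightarrow> real^2 \<Rightarrow> real^2" where
  "fibre_iter F n \<theta> \<xi> = snd ((F ^^ n) (\<theta>, \<xi>))"

text \<open>
  Graphs are represented by total set-valued functions whose values on Lebesgue null sets are
  irrelevant. Measurability is the usual one for set-valued maps: preimages (in the hitting
  sense) of open sets are Lebesgue measurable.
\<close>

definition two_valued_invariant_graph ::
    "real \<Rightarrow> (phase \<Rightarrow> phase) \<Rightarrow> real \<Rightarrow> (circle \<Rightarrow> (real^2) set) \<Rightarrow> bool" where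
  "two_valued_invariant_graph \<omega> F C \<Phi> \<longleftrightarrow>
     (\<forall>U. open U \<longrightarrow> {\<theta>. \<Phi> \<theta> \<inter> U \<noteq> {}} \<in> sets (completion lebesgue_circle)) \<and>
     (AE \<theta> in lebesgue_circle. card (\<Phi> \<theta>) = 2 \<and> \<Phi> \<theta> \<subseteq> cball 0 C) \<and>
     (AE \<theta> in lebesgue_circle. fibre_iter F 1 \<theta> ` \<Phi> \<theta> = \<Phi> (\<theta> + to_circle \<omega>))"

definition hausdorff_dist :: "'a::metric_space set \<Rightarrow> 'a set \<Rightarrow> real" where
  "hausdorff_dist A B = max (SUP a\<in>A. infdist a B) (SUP b\<in>B. infdist b A)"

definition continuous_two_valued :: "(circle \<Rightarrow> (real^2) set) \<Rightarrow> bool" where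
  "continuous_two_valued \<Psi> \<longleftrightarrow>
     (\<forall>\<theta>. card (\<Psi> \<theta>) = 2) \<and>
     (\<forall>\<theta>. ((\<lambda>t. hausdorff_dist (\<Psi> t) (\<Psi> \<theta>)) \<longlongrightarrow> 0) (at \<theta>))"

definition noncontinuous_graph :: "(circle \<Rightarrow> (real^2) set) \<Rightarrow> bool" where
  "noncontinuous_graph \<Phi> \<longleftrightarrow>
     \<not> (\<exists>\<Psi>. continuous_two_valued \<Psi> \<and> (AE \<theta> in lebesgue_circle. \<Phi> \<theta> = \<Psi> \<theta>))"

definition graph_measure :: "(circle \<Rightarrow> (real^2) set) \<Rightarrow> phase measure" where
  "graph_measure \<Phi> = measure_of UNIV (sets borel)
     (\<lambda>B. (1 / 2) * (\<integral>\<^sup>+ \<theta>. of_nat (card {\<xi> \<in> \<Phi> \<theta>. (\<theta>, \<xi>) \<in> B}) \<partial>lebesgue_circle))"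

definition measure_support :: "'a::topological_space measure \<Rightarrow> 'a set" where
  "measure_support \<mu> = {x. \<forall>U. open U \<and> x \<in> U \<longrightarrow> 0 < emeasure \<mu> U}"

definition graph_closure :: "(circle \<Rightarrow> (real^2) set) \<Rightarrow> phase set" where
  "graph_closure \<Phi> = measure_support (graph_measure \<Phi>)"

text \<open>
  The derivative cocycle may be singular, so the logarithm of its norm is extended by
  \<open>log 0 = -\<infinity>\<close> (note that \<open>ln 0 = 0\<close> in the library) and integrated as an extended real number,
  so that the exponent takes values in \<open>[-\<infinity>, \<infinity>)\<close>.
\<close>

definition ereal_log :: "real \<Rightarrow> ereal" where
  "ereal_log x = (if 0 < x then ereal (ln x) else - \<infinity>)"

definition ereal_integral :: "'a measure \<Rightarrow> ('a \<Rightarrow> ereal) \<Rightarrow> ereal" where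
  "ereal_integral M f =
     enn2ereal (\<integral>\<^sup>+ x. e2ennreal (f x) \<partial>M) - enn2ereal (\<integral>\<^sup>+ x. e2ennreal (- f x) \<partial>M)"

definition fibre_deriv_norm :: "(phase \<Rightarrow> phase) \<Rightarrow> nat \<Rightarrow> phase \<Rightarrow> real" where
  "fibre_deriv_norm F n = (\<lambda>(\<theta>, \<xi>). onorm (frechet_derivative (fibre_iter F n \<theta>) (at \<xi>)))"

definition is_max_fibre_exponent :: "(phase \<Rightarrow> phase) \<Rightarrow> phase measure \<Rightarrow> ereal \<Rightarrow> bool" where
  "is_max_fibre_exponent F \<mu> L \<longleftrightarrow>
     (\<lambda>n. ereal (1 / real n) * ereal_integral \<mu> (\<lambda>x. ereal_log (fibre_deriv_norm F n x)))
       \<longlonglongrightarrow> L"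

definition attracts_ae ::
    "real \<Rightarrow> (phase \<Rightarrow> phase) \<Rightarrow> phase set \<Rightarrow> (circle \<Rightarrow> (real^2) set) \<Rightarrow> bool" where
  "attracts_ae \<omega> F X \<Phi> \<longleftrightarrow>
     (AE (\<theta>, \<xi>) in lebesgue_circle \<Otimes>\<^sub>M lborel. (\<theta>, \<xi>) \<in> X \<longrightarrow>
        (\<lambda>n. infdist (fibre_iter F n \<theta> \<xi>) (\<Phi> (\<theta> + to_circle (real n * \<omega>)))) \<longlonglongrightarrow> 0)"

definition sensitive_on :: "'a::metric_space set \<Rightarrow> ('a \<Rightarrow> 'a) \<Rightarrow> bool" where
  "sensitive_on Y g \<longleftrightarrow>
     g ` Y \<subseteq> Y \<and>
     (\<exists>\<epsilon>>0. \<forall>\<delta>>0. \<forall>x\<in>Y. \<exists>n. \<exists>y\<in>Y. dist x y < \<delta> \<and> \<epsilon> < dist ((g ^^ n) x) ((g ^^ n) y))"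

end

(*
  In polar coordinates Lambda is a skew product over the projective action of the linear cocycle
  A(theta) = diag(1, gamma) R(theta); on the radius it acts by the monotone map r -> s r / (1 + r^2),
  which contracts the logarithm of r. Pulling back the radius 1 therefore yields a continuous positive
  radius r+(theta, direction) whose graph is the invariant torus and the boundary of the global attractor.

  Writing z = v^2 for a unit direction v and s = exp(-4 pi i theta), the projective action becomes
  z -> M(s z) with the Moebius map M(x) = (x + k) / (1 + k x), k = (1 - gamma) / (1 + gamma). This extends
  to the unit disc and has a holomorphic invariant graph f there. By the mean value property
  ln |1 + k s f(s)| has mean zero on the boundary, so both 1 - |f|^2 and the transversal derivative are
  cocycles with mean exponent ln (1 - k^2) < 0. Recurrence forces |f| = 1 almost everywhere: the boundary
  values of f are an invariant direction field with negative transversal exponent, and the two points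
  with this direction on the torus form the attractor. It attracts almost every point because linear
  maps of determinant gamma^n contract strongly only a set of vectors of summable measure.

  Non-continuity and both sensitivity statements share one reason: if a set of base points of positive
  measure followed a common orbit up to a small error, then by Steinhaus' theorem the directions on this
  orbit would form an almost invariant loop, but the rotation in A(theta) changes its winding number.
*)
theory Submission imports Defs "HOL-Complex_Analysis.Complex_Analysis"
begin

section \<open>Rotations of the circle\<close>

text \<open>The equation for an invariant direction field lives on the unit circle, where the
  Moebius map is no contraction and the solution turns out discontinuous. Inside the disc the
  additional factor s, of norm below 1, makes the same equation a strict contraction; this is why
  the field is built holomorphically and only then pushed to the boundary. The boundary values exist
  almost everywhere, so from there on pointwise claims are made on a forward invariant Borel set of
  full measure. A direction fixes a vector only up to sign, and the sign is not controlled along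
  orbits; hence squares of directions, and a graph with two values. Since \<beta> * \<gamma> = 1 is
  allowed, a single step may fail to expand at the origin, and the positive inner radius of the
  torus has to come from the irrationality of \<omega>. In the last part all tolerances are tied to
  \<gamma>: without the rotation, one step turns a squared direction by an angle bounded away from a
  half turn, and half of this margin is what the accumulated errors may use up.\<close>

lemma to_circle_eq_iff: "to_circle x = to_circle y \<longleftrightarrow> x - y \<in> \<int>"
  by (simp add: circle.abs_eq_iff)

lemma to_circle_surj: obtains x where "0 \<le> x" "x < 1" "\<theta> = to_circle x"
proof -
  obtain y where y: "\<theta> = to_circle y" using Quotient3_abs_rep[OF Quotient3_circle] by metis
  have "\<theta> = to_circle (frac y)"
    unfolding y to_circle_eq_iff frac_def by simp
  with frac_ge_0 frac_lt_1 that show thesis by metis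
qed

lemma to_circle_add: "to_circle (x + y) = to_circle x + to_circle y"
  by (simp add: plus_circle.abs_eq)

lemma to_circle_diff: "to_circle (x - y) = to_circle x - to_circle y"
  by (simp add: minus_circle.abs_eq)

lemma to_circle_of_int [simp]: "to_circle (of_int k) = 0"
  unfolding zero_circle_def to_circle_eq_iff by simp

lemma to_circle_one [simp]: "to_circle 1 = 0" and to_circle_zero [simp]: "to_circle 0 = 0"
  using to_circle_of_int[of 1] to_circle_of_int[of 0] by simp_all

lemma dist_circle_add [simp]: "dist (x + z) (y + z) = dist x y" for x y z :: circle
  by transfer simp

lemma dist_circle_diff: "dist x y = dist (x - y) 0" for x y :: circle
  using dist_circle_add[of x "- y" y] by simp

lemma continuous_on_circle_shift: "continuous_on A (\<lambda>\<theta>::circle. \<theta> + a)"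
  unfolding continuous_on_iff by auto

lemma compact_UNIV_circle: "compact (UNIV :: circle set)"
proof -
  have "UNIV = to_circle ` {0..1}" using to_circle_surj by (auto simp: image_iff) (metis less_imp_le atLeastAtMost_iff)
  then show ?thesis using compact_continuous_image[OF continuous_on_to_circle compact_Icc] by metis
qed

section \<open>Lebesgue measure on the circle and its invariance\<close>

lemma measurable_circle_shift [measurable]: "(\<lambda>\<theta>::circle. \<theta> + a) \<in> borel_measurable borel"
  by (rule borel_measurable_continuous_onI) (rule continuous_on_circle_shift)

lemma space_lebesgue_circle [simp]: "space lebesgue_circle = UNIV"
  by (simp add: lebesgue_circle_def)

interpretation lebesgue_circle: finite_measure lebesgue_circle
  by standard (simp add: emeasure_lebesgue_circle_UNIV)

lemma measure_lebesgue_circle_UNIV [simp]: "measure lebesgue_circle UNIV = 1"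
  by (simp add: measure_def emeasure_lebesgue_circle_UNIV)

lemma nn_integral_lebesgue_circle:
  assumes [measurable]: "f \<in> borel_measurable borel"
  shows "(\<integral>\<^sup>+ \<theta>. f \<theta> \<partial>lebesgue_circle) = (\<integral>\<^sup>+ x. f (to_circle x) * indicator {0..<1} x \<partial>lborel)"
  unfolding lebesgue_circle_def
  by (subst nn_integral_distr) (auto simp: measurable_restrict_space1 nn_integral_restrict_space)

lemma lborel_nn_integral_shift:
  fixes f :: "real \<Rightarrow> ennreal"
  assumes [measurable]: "f \<in> borel_measurable borel"
  shows "(\<integral>\<^sup>+ x. f (x + s) \<partial>lborel) = (\<integral>\<^sup>+ x. f x \<partial>lborel)"
  using nn_integral_real_affine[of f 1 s] by (simp add: add.commute)

text \<open>The interval [s, 1 + s) is cut at 1, and by periodicity the right piece is moved back to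
  [0, s), which completes [s, 1) to the fundamental domain.\<close>

lemma nn_integral_circle_shift:
  assumes [measurable]: "f \<in> borel_measurable borel"
  shows "(\<integral>\<^sup>+ \<theta>. f (\<theta> + a) \<partial>lebesgue_circle) = (\<integral>\<^sup>+ \<theta>. f \<theta> \<partial>lebesgue_circle)"
proof -
  obtain s where s: "0 \<le> s" "s < 1" "a = to_circle s" by (rule to_circle_surj)
  define g where "g x = f (to_circle x)" for x
  have [measurable]: "g \<in> borel_measurable borel" unfolding g_def by measurable
  have per: "g (x + 1) = g x" for x by (simp add: g_def to_circle_add)
  have "(\<integral>\<^sup>+ \<theta>. f (\<theta> + a) \<partial>lebesgue_circle) = (\<integral>\<^sup>+ x. g (x + s) * indicator {s..<1+s} (x + s) \<partial>lborel)"
    by (subst nn_integral_lebesgue_circle)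
       (auto simp: g_def s to_circle_add intro!: nn_integral_cong split: split_indicator)
  also have "\<dots> = (\<integral>\<^sup>+ x. g x * indicator {s..<1+s} x \<partial>lborel)"
    by (rule lborel_nn_integral_shift[where f="\<lambda>x. g x * indicator {s..<1+s} x"]) measurable
  also have "\<dots> = (\<integral>\<^sup>+ x. (g x * indicator {s..<1} x + g x * indicator {1..<1+s} x) \<partial>lborel)"
    by (rule nn_integral_cong) (use s in \<open>auto split: split_indicator\<close>)
  also have "\<dots> = (\<integral>\<^sup>+ x. g x * indicator {s..<1} x \<partial>lborel) + (\<integral>\<^sup>+ x. g x * indicator {1..<1+s} x \<partial>lborel)"
    by (rule nn_integral_add) measurable
  also have "(\<integral>\<^sup>+ x. g x * indicator {1..<1+s} x \<partial>lborel) = (\<integral>\<^sup>+ x. g x * indicator {0..<s} x \<partial>lborel)"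
    by (subst lborel_nn_integral_shift[where s=1, symmetric])
       (auto simp: per intro!: nn_integral_cong split: split_indicator)
  also have "(\<integral>\<^sup>+ x. g x * indicator {s..<1} x \<partial>lborel) + (\<integral>\<^sup>+ x. g x * indicator {0..<s} x \<partial>lborel)
     = (\<integral>\<^sup>+ x. (g x * indicator {s..<1} x + g x * indicator {0..<s} x) \<partial>lborel)"
    by (rule nn_integral_add[symmetric]) measurable
  also have "\<dots> = (\<integral>\<^sup>+ x. g x * indicator {0..<1} x \<partial>lborel)"
    by (rule nn_integral_cong) (use s in \<open>auto split: split_indicator\<close>)
  finally show ?thesis by (simp add: nn_integral_lebesgue_circle g_def)
qed

lemma distr_circle_shift: "distr lebesgue_circle borel (\<lambda>\<theta>. \<theta> + a) = lebesgue_circle"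
proof (rule measure_eqI)
  fix A assume "A \<in> sets (distr lebesgue_circle borel (\<lambda>\<theta>. \<theta> + a))"
  then have [measurable]: "A \<in> sets borel" by simp
  have "emeasure (distr lebesgue_circle borel (\<lambda>\<theta>. \<theta> + a)) A = (\<integral>\<^sup>+ \<theta>. indicator A (\<theta> + a) \<partial>lebesgue_circle)"
    using nn_integral_distr[of "\<lambda>\<theta>. \<theta> + a" lebesgue_circle borel "indicator A"] by simp
  also have "\<dots> = emeasure lebesgue_circle A"
    by (subst nn_integral_circle_shift) auto
  finally show "emeasure (distr lebesgue_circle borel (\<lambda>\<theta>. \<theta> + a)) A = emeasure lebesgue_circle A" .
qed simp

lemma integral_circle_shift:
  fixes f :: "circle \<Rightarrow> 'b::{banach,second_countable_topology}"
  assumes [measurable]: "f \<in> borel_measurable borel"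
  shows "(\<integral> \<theta>. f (\<theta> + a) \<partial>lebesgue_circle) = (\<integral> \<theta>. f \<theta> \<partial>lebesgue_circle)"
  using integral_distr[of "\<lambda>\<theta>. \<theta> + a" lebesgue_circle borel f] by (simp add: distr_circle_shift)

lemma emeasure_circle_shift:
  assumes [measurable]: "A \<in> sets borel"
  shows "emeasure lebesgue_circle {\<theta>. \<theta> + a \<in> A} = emeasure lebesgue_circle A"
  using emeasure_distr[of "\<lambda>\<theta>. \<theta> + a" lebesgue_circle borel A] by (simp add: distr_circle_shift vimage_def)

lemma AE_circle_shift:
  assumes "AE \<theta> in lebesgue_circle. P \<theta>"
  shows "AE \<theta> in lebesgue_circle. P (\<theta> + a)"
proof -
  from assms obtain N where N: "N \<in> sets borel" "emeasure lebesgue_circle N = 0" "{\<theta>. \<not> P \<theta>} \<subseteq> N"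
    by (auto elim: AE_E)
  show ?thesis
    by (rule AE_I[of _ _ "{\<theta>. \<theta> + a \<in> N}"]) (use N emeasure_circle_shift in \<open>auto\<close>)
qed

section \<open>Dense orbits, Steinhaus' theorem and ergodicity\<close>

lemma irrational_orbit_dense:
  assumes "\<omega> \<notin> \<rat>" "0 < e"
  obtains n where "n \<ge> N" "dist (to_circle (real n * \<omega>)) t < e"
proof -
  \<comment> \<open>The target is moved back by N steps before Kronecker's theorem is applied, so
    the time found, \<open>k + N\<close>, is at least N.\<close>
  obtain x where x: "t - to_circle (real N * \<omega>) = to_circle x" by (metis to_circle_surj)
  obtain k where k: "\<bar>frac (real k * \<omega>) - frac x\<bar> < e"
    using Kronecker_approx_1_explicit[OF assms(1) frac_ge_0 less_imp_le[OF frac_lt_1] assms(2)] by metis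
  have fr: "to_circle (frac y) = to_circle y" for y
    unfolding to_circle_eq_iff frac_def by simp
  have "dist (to_circle (frac (real k * \<omega>))) (to_circle (frac x)) < e"
    using dist_to_circle_le[of "frac (real k * \<omega>)" "frac x"] k by (simp add: dist_real_def)
  then have "dist (to_circle (real k * \<omega>) + to_circle (real N * \<omega>)) t < e"
    using x dist_circle_add[of "to_circle (real k * \<omega>)" "to_circle (real N * \<omega>)" "to_circle x"]
    unfolding fr x[symmetric] by simp
  then show thesis
    using that[of "k + N"] by (simp add: to_circle_add distrib_right)
qed

lemma emeasure_circle_ball_pos:
  assumes "0 < e" shows "0 < emeasure lebesgue_circle (ball x e)"
proof -
  \<comment> \<open>The cap 1/2 keeps \<open>{0..<c}\<close> inside the fundamental domain
    \<open>{0..<1}\<close>.\<close>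
  define c where "c = min e (1/2)"
  have c: "0 < c" "c \<le> 1/2" "c \<le> e" using assms by (auto simp: c_def)
  have "ennreal c = emeasure lborel {0..<c}" using c by simp
  also have "\<dots> = (\<integral>\<^sup>+ x. indicator {0..<c} x \<partial>lborel)" by simp
  also have "\<dots> \<le> (\<integral>\<^sup>+ x. indicator (ball 0 e) (to_circle x) * indicator {0..<1} x \<partial>lborel)"
  proof (rule nn_integral_mono)
    fix y
    have "dist 0 (to_circle y) < e" if "y \<in> {0..<c}"
      using dist_to_circle_le[of 0 y] that c by (simp add: dist_real_def)
    then show "indicator {0..<c} y \<le> (indicator (ball 0 e) (to_circle y) * indicator {0..<1} y :: ennreal)"
      using c by (auto split: split_indicator)
  qed
  also have "\<dots> = emeasure lebesgue_circle (ball 0 e)"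
    by (subst nn_integral_lebesgue_circle[symmetric]) (auto intro!: borel_measurable_indicator)
  also have "\<dots> = emeasure lebesgue_circle {\<theta>. \<theta> + (- x) \<in> ball 0 e}"
    by (subst emeasure_circle_shift) auto
  also have "{\<theta>. \<theta> + (- x) \<in> ball 0 e} = ball x e"
    using dist_circle_diff by (auto simp: dist_commute)
  finally show ?thesis using c(1) by (metis ennreal_eq_0_iff not_gr_zero le_zero_eq leD)
qed

text \<open>Take a compact K in E of positive measure and an open U around K with U - K of smaller
  measure than K. A translate of K by a small t stays inside U, so if it missed K it would have to
  fit into U - K.\<close>

lemma steinhaus_real:
  fixes E :: "real set"
  assumes E: "E \<in> sets borel" "E \<subseteq> {0..<1}" and pos: "0 < emeasure lborel E"
  obtains d where "0 < d" "\<And>t. \<bar>t\<bar> < d \<Longrightarrow> \<exists>x\<in>E. x + t \<in> E"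
proof -
  \<comment> \<open>Inner regularity is applied to a finite measure, hence the restriction to the
    unit interval.\<close>
  define M where "M = density lborel (indicator {0..<1::real})"
  have sM: "sets M = sets borel" by (simp add: M_def)
  have eM: "emeasure M A = emeasure lborel ({0..<1} \<inter> A)" if "A \<in> sets borel" for A
    using that unfolding M_def by (subst emeasure_density) (auto simp: indicator_inter_arith[symmetric] nn_integral_indicator)
  have fin: "emeasure M (space M) \<noteq> \<infinity>"
    unfolding eM[of "space M", unfolded sM[symmetric], OF sets.top]
    by (simp add: M_def)
  have "emeasure M E = (SUP K \<in> {K. K \<subseteq> E \<and> compact K}. emeasure M K)"
    using inner_regular[OF sM fin E(1)] .
  moreover have "0 < emeasure M E" using E pos by (simp add: eM Int_absorb1)
  ultimately obtain K where K: "K \<subseteq> E" "compact K" "0 < emeasure M K"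
    by (auto simp: less_SUP_iff)
  have bK: "K \<in> sets borel" using K(2) by (simp add: borel_compact)
  have Kpos: "0 < emeasure lborel K" using K(3) E(2) K(1) by (simp add: eM bK Int_absorb1 subset_trans)
  have Kfin: "emeasure lborel K < \<infinity>" using K(2) by (metis emeasure_compact_finite)
  define m where "m = measure lborel K"
  have mE: "emeasure lborel K = ennreal m" using Kfin by (simp add: m_def emeasure_eq_ennreal_measure)
  have m: "0 < m" using Kpos mE by (metis ennreal_0 ennreal_eq_0_iff linorder_not_le not_gr_zero)
  obtain U where U: "open U" "K \<subseteq> U" "emeasure lborel (U - K) < ennreal m"
    using outer_regular_lborel[OF bK m] by auto
  obtain d where d: "0 < d" "(\<Union>x\<in>K. ball x d) \<subseteq> U"
    using compact_subset_open_imp_ball_epsilon_subset[OF K(2) U(1,2)] by metis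
  have "\<exists>x\<in>E. x + t \<in> E" if t: "\<bar>t\<bar> < d" for t
  proof (rule ccontr)
    assume neg: "\<not> ?thesis"
    define K' where "K' = (\<lambda>x. x + t) ` K"
    have disj: "K \<inter> K' = {}" using neg K(1) unfolding K'_def by blast
    have "K' \<subseteq> U" using d(2) t unfolding K'_def by (force simp: dist_real_def)
    then have sub: "K' \<subseteq> U - K" using disj by auto
    have bK': "K' \<in> sets borel" unfolding K'_def
      by (intro borel_compact compact_continuous_image continuous_intros K(2))
    have "emeasure lborel K' = (\<integral>\<^sup>+ x. indicator K' (x + t) \<partial>lborel)"
      by (subst lborel_nn_integral_shift) (use bK' in auto)
    also have "\<dots> = (\<integral>\<^sup>+ x. indicator K x \<partial>lborel)"
      by (rule nn_integral_cong) (auto simp: K'_def split: split_indicator)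
    also have "\<dots> = ennreal m" using bK mE by simp
    finally have "ennreal m \<le> emeasure lborel (U - K)"
      using emeasure_mono[OF sub, of lborel] U(1) bK by auto
    with U(3) show False by simp
  qed
  with d(1) that show thesis by blast
qed

lemma steinhaus_circle:
  assumes [measurable]: "E \<in> sets borel" and pos: "0 < emeasure lebesgue_circle E"
  obtains d where "0 < d" "\<And>t. dist t 0 < d \<Longrightarrow> \<exists>\<theta>\<in>E. \<theta> + t \<in> E"
proof -
  define E' where "E' = {x. to_circle x \<in> E} \<inter> {0..<1}"
  have E': "E' \<in> sets borel" "E' \<subseteq> {0..<1}" unfolding E'_def by auto
  have "emeasure lborel E' = (\<integral>\<^sup>+ x. indicator E (to_circle x) * indicator {0..<1} x \<partial>lborel)"
    using nn_integral_indicator[of E' lborel] E'(1)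
    by (simp add: E'_def indicator_inter_arith) (simp add: indicator_def)
  also have "\<dots> = emeasure lebesgue_circle E"
    by (subst nn_integral_lebesgue_circle[symmetric]) auto
  finally obtain d where d: "0 < d" "\<And>t. \<bar>t\<bar> < d \<Longrightarrow> \<exists>x\<in>E'. x + t \<in> E'"
    using steinhaus_real[OF E'] pos by metis
  have "\<exists>\<theta>\<in>E. \<theta> + t \<in> E" if "dist t 0 < d" for t
  proof -
    obtain y where y: "t = to_circle y" by (metis to_circle_surj)
    have "infdist (y - 0) \<int> < d" using that y unfolding y by (metis dist_circle.abs_eq to_circle_zero)
    then obtain k where k: "k \<in> \<int>" "\<bar>y - k\<bar> < d" using infdist_Ints_attained[of "y-0"] by auto
    have ty: "t = to_circle (y - k)" unfolding y to_circle_eq_iff using k by simp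
    obtain x where "x \<in> E'" "x + (y - k) \<in> E'" using d(2)[OF k(2)] by auto
    then have "to_circle x \<in> E" "to_circle x + t \<in> E"
      by (auto simp: E'_def ty to_circle_add to_circle_diff)
    then show ?thesis by blast
  qed
  with d(1) that show thesis by blast
qed

lemma dist_circle_add_le: "dist (x + y) (x' + y') \<le> dist x x' + dist y y'" for x y :: circle
  using dist_triangle[of "x + y" "x' + y'" "x' + y"] dist_circle_add[of y x' y'] by (simp add: add.commute)

lemma continuous_on_circle_add [continuous_intros]:
  fixes f g :: "'a::topological_space \<Rightarrow> circle"
  assumes "continuous_on S f" "continuous_on S g"
  shows "continuous_on S (\<lambda>x. f x + g x)"
proof -
  have "continuous_on UNIV (\<lambda>p :: circle \<times> circle. fst p + snd p)"
  proof (rule continuous_onI)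
    fix p :: "circle \<times> circle" and e :: real assume e: "0 < e"
    have "dist (fst q + snd q) (fst p + snd p) \<le> e" if "dist q p < e / 2" for q
      using dist_circle_add_le[of "fst q" "snd q" "fst p" "snd p"] dist_fst_le[of q p] dist_snd_le[of q p] that by linarith
    then show "\<exists>d>0. \<forall>q\<in>UNIV. dist q p < d \<longrightarrow> dist (fst q + snd q) (fst p + snd p) \<le> e"
      using e by (intro exI[of _ "e/2"]) auto
  qed
  from continuous_on_compose2[OF this continuous_on_Pair[OF assms]] show ?thesis by simp
qed

text \<open>If A and its complement both had positive measure, Fubini would give a translation t
  that moves a set G of positive measure from A out of A. A time n with n * \<omega> close to t and
  Steinhaus' theorem for G give a point \<theta> of A whose n-th iterate lies outside A.\<close>

lemma irrational_rotation_ergodic: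
  assumes "\<omega> \<notin> \<rat>" and [measurable]: "A \<in> sets borel"
    and inv: "\<And>\<theta>. \<theta> + to_circle \<omega> \<in> A \<longleftrightarrow> \<theta> \<in> A"
  shows "emeasure lebesgue_circle A = 0 \<or> emeasure lebesgue_circle (- A) = 0"
proof (rule ccontr)
  assume neg: "\<not> ?thesis"
  have invn: "\<theta> + to_circle (real n * \<omega>) \<in> A \<longleftrightarrow> \<theta> \<in> A" for n \<theta>
  proof (induction n)
    case (Suc n)
    have "\<theta> + to_circle (real (Suc n) * \<omega>) = (\<theta> + to_circle (real n * \<omega>)) + to_circle \<omega>"
      by (simp add: distrib_right to_circle_add algebra_simps)
    with Suc inv show ?case by metis
  qed simp
  interpret pair_sigma_finite lebesgue_circle lebesgue_circle ..
  have [measurable]: "(\<lambda>p::circle \<times> circle. fst p + snd p) \<in> borel_measurable (borel \<Otimes>\<^sub>M borel)"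
    unfolding borel_prod by (rule borel_measurable_continuous_onI) (intro continuous_intros)
  have [measurable]: "(\<lambda>p::circle \<times> circle. snd p + fst p) \<in> borel_measurable (borel \<Otimes>\<^sub>M borel)"
    unfolding borel_prod by (rule borel_measurable_continuous_onI) (intro continuous_intros)
  define h where "h \<theta> t = (indicator A \<theta> * indicator (- A) (t + \<theta>) :: ennreal)" for \<theta> t
  have hm: "case_prod h \<in> borel_measurable (lebesgue_circle \<Otimes>\<^sub>M lebesgue_circle)"
    unfolding h_def case_prod_beta by measurable
  have "(\<integral>\<^sup>+ t. \<integral>\<^sup>+ \<theta>. h \<theta> t \<partial>lebesgue_circle \<partial>lebesgue_circle) = (\<integral>\<^sup>+ \<theta>. \<integral>\<^sup>+ t. h \<theta> t \<partial>lebesgue_circle \<partial>lebesgue_circle)"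
    using Fubini[OF hm] by simp
  also have "\<dots> = (\<integral>\<^sup>+ \<theta>. indicator A \<theta> * emeasure lebesgue_circle (- A) \<partial>lebesgue_circle)"
  proof (rule nn_integral_cong)
    fix \<theta>
    have "(\<integral>\<^sup>+ t. h \<theta> t \<partial>lebesgue_circle) = indicator A \<theta> * (\<integral>\<^sup>+ t. indicator (- A) (t + \<theta>) \<partial>lebesgue_circle)"
      unfolding h_def by (subst nn_integral_cmult) auto
    also have "(\<integral>\<^sup>+ t. indicator (- A) (t + \<theta>) \<partial>lebesgue_circle) = emeasure lebesgue_circle (- A)"
      by (subst nn_integral_circle_shift) (auto intro!: borel_measurable_indicator)
    finally show "(\<integral>\<^sup>+ t. h \<theta> t \<partial>lebesgue_circle) = indicator A \<theta> * emeasure lebesgue_circle (- A)" .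
  qed
  also have "\<dots> = emeasure lebesgue_circle A * emeasure lebesgue_circle (- A)"
    by (subst nn_integral_multc) auto
  finally have "(\<integral>\<^sup>+ t. \<integral>\<^sup>+ \<theta>. h \<theta> t \<partial>lebesgue_circle \<partial>lebesgue_circle) \<noteq> 0" using neg by auto
  then obtain t where t: "(\<integral>\<^sup>+ \<theta>. h \<theta> t \<partial>lebesgue_circle) \<noteq> 0"
    by fastforce
  define G where "G = {\<theta>\<in>A. t + \<theta> \<in> - A}"
  have G: "G \<in> sets borel"
  proof -
    have "G = A \<inter> {\<theta>. \<theta> + t \<in> - A}" by (auto simp: G_def add.commute)
    then show ?thesis by simp
  qed
  have "h \<theta> t = indicator G \<theta>" for \<theta> by (auto simp: h_def G_def split: split_indicator)
  with t G have "0 < emeasure lebesgue_circle G" by (simp add: zero_less_iff_neq_zero)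
  then obtain d where d: "0 < d" "\<And>t. dist t 0 < d \<Longrightarrow> \<exists>\<theta>\<in>G. \<theta> + t \<in> G" using steinhaus_circle[OF G] by metis
  obtain n where n: "dist (to_circle (real n * \<omega>)) t < d"
    using irrational_orbit_dense[OF assms(1) d(1)] by metis
  then have "dist (to_circle (real n * \<omega>) - t) 0 < d" by (simp flip: dist_circle_diff)
  then obtain \<theta> where \<theta>: "\<theta> \<in> G" "\<theta> + (to_circle (real n * \<omega>) - t) \<in> G" using d(2) by blast
  then have "\<theta> \<in> A" "\<theta> + to_circle (real n * \<omega>) \<notin> A" by (auto simp: G_def)
  with invn show False by blast
qed

section \<open>Birkhoff sums over the rotation\<close>

definition birkhoff_sum :: "real \<Rightarrow> (circle \<Rightarrow> real) \<Rightarrow> nat \<Rightarrow> circle \<Rightarrow> real" where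
  "birkhoff_sum \<omega> u n \<theta> = (\<Sum>k<n. u (\<theta> + to_circle (real k * \<omega>)))"

lemma birkhoff_sum_Suc: "birkhoff_sum \<omega> u (Suc n) \<theta> = u \<theta> + birkhoff_sum \<omega> u n (\<theta> + to_circle \<omega>)"
  unfolding birkhoff_sum_def
  by (subst sum.lessThan_Suc_shift) (auto simp: to_circle_add distrib_right algebra_simps intro!: sum.cong)

lemma birkhoff_sum_measurable [measurable]:
  assumes [measurable]: "u \<in> borel_measurable borel"
  shows "birkhoff_sum \<omega> u n \<in> borel_measurable borel"
  unfolding birkhoff_sum_def by measurable

text \<open>Garsia's proof of the maximal ergodic inequality, applied on the invariant set where the sums are
  unbounded above: there the increments \<open>F\<^sub>n\<^sub>+\<^sub>1 - F\<^sub>n \<circ> T\<close> of the running maxima decrease to \<open>u\<close>, but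
  their integrals are nonnegative.\<close>

lemma birkhoff_sum_bounded_above:
  assumes irr: "\<omega> \<notin> \<rat>" and um [measurable]: "u \<in> borel_measurable borel"
    and K: "\<And>\<theta>. \<bar>u \<theta>\<bar> \<le> K" and neg: "(\<integral>\<theta>. u \<theta> \<partial>lebesgue_circle) < 0"
  shows "AE \<theta> in lebesgue_circle. bdd_above (range (\<lambda>n. birkhoff_sum \<omega> u n \<theta>))"
proof -
  define S where "S = birkhoff_sum \<omega> u"
  define T where "T \<theta> = \<theta> + to_circle \<omega>" for \<theta>
  have [measurable]: "S n \<in> borel_measurable borel" for n unfolding S_def by measurable
  have [measurable]: "T \<in> borel_measurable borel" unfolding T_def[abs_def] by measurable
  have S0: "S 0 \<theta> = 0" and SS: "S (Suc n) \<theta> = u \<theta> + S n (T \<theta>)" for n \<theta>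
    unfolding S_def T_def birkhoff_sum_Suc by (auto simp: birkhoff_sum_def)
  define A where "A = {\<theta>. \<not> bdd_above (range (\<lambda>n. S n \<theta>))}"
  \<comment> \<open>Natural bounds suffice to express unboundedness, and turn A into a countable
    combination of Borel sets.\<close>
  have Aeq: "A = {\<theta>. \<forall>k::nat. \<exists>n. real k < S n \<theta>}"
  proof -
    have "bdd_above (range (\<lambda>n. S n \<theta>)) \<longleftrightarrow> (\<exists>k::nat. \<forall>n. S n \<theta> \<le> real k)" for \<theta>
      unfolding bdd_above_def by auto (metis order.trans real_arch_simple)
    then show ?thesis unfolding A_def by (auto simp: not_le)
  qed
  have Am [measurable]: "A \<in> sets borel" unfolding Aeq by measurable
  have Ainv: "T \<theta> \<in> A \<longleftrightarrow> \<theta> \<in> A" for \<theta>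
  proof -
    have "bdd_above (range (\<lambda>n. S n \<theta>)) \<longleftrightarrow> bdd_above (range (\<lambda>n. S n (T \<theta>)))"
    proof
      assume "bdd_above (range (\<lambda>n. S n \<theta>))"
      then obtain b where "\<And>n. S n \<theta> \<le> b" unfolding bdd_above_def by auto
      then have "S n (T \<theta>) \<le> b - u \<theta>" for n using SS[of n \<theta>] by (metis le_diff_eq add.commute)
      then show "bdd_above (range (\<lambda>n. S n (T \<theta>)))" unfolding bdd_above_def by auto
    next
      assume "bdd_above (range (\<lambda>n. S n (T \<theta>)))"
      then obtain b where b: "\<And>n. S n (T \<theta>) \<le> b" unfolding bdd_above_def by auto
      have "S n \<theta> \<le> max 0 (u \<theta> + b)" for n
      proof (cases n)
        case (Suc m) then show ?thesis using SS[of m \<theta>] b[of m] by simp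
      qed (simp add: S0)
      then show "bdd_above (range (\<lambda>n. S n \<theta>))" unfolding bdd_above_def by auto
    qed
    then show ?thesis by (simp add: A_def)
  qed
  \<comment> \<open>\<open>F n\<close> is the maximum of \<open>S 0\<close>, ...,
    \<open>S n\<close>, written as a recursion along the rotation.\<close>
  define F where "F = rec_nat (\<lambda>_::circle. 0::real) (\<lambda>_ f \<theta>. max 0 (u \<theta> + f (T \<theta>)))"
  have F0: "F 0 \<theta> = 0" and FS: "F (Suc n) \<theta> = max 0 (u \<theta> + F n (T \<theta>))" for n \<theta>
    by (auto simp: F_def)
  have [measurable]: "F n \<in> borel_measurable borel" for n
  proof (induction n)
    case 0 show ?case unfolding F0[abs_def] by simp
  next
    case (Suc n) note [measurable] = Suc show ?case unfolding FS[abs_def] by measurable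
  qed
  have Fnn: "0 \<le> F n \<theta>" for n \<theta> by (cases n) (auto simp: F0 FS)
  have Fmono: "F n \<theta> \<le> F (Suc n) \<theta>" for n \<theta>
  proof (induction n arbitrary: \<theta>)
    case 0 then show ?case by (simp add: F0 Fnn)
  next
    case (Suc n)
    have "max 0 (u \<theta> + F n (T \<theta>)) \<le> max 0 (u \<theta> + F (Suc n) (T \<theta>))"
      using Suc[of "T \<theta>"] by (intro max.mono add_left_mono) auto
    then show ?case by (simp only: FS[of n \<theta>] FS[of "Suc n" \<theta>])
  qed
  have FM: "F n \<theta> \<le> F k \<theta>" if "n \<le> k" for n k \<theta> using lift_Suc_mono_le[of "\<lambda>n. F n \<theta>"] Fmono that by blast
  have SF: "S n \<theta> \<le> F n \<theta>" for n \<theta>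
    by (induction n arbitrary: \<theta>) (auto simp: S0 F0 SS FS le_max_iff_disj add_left_mono)
  have Fb: "F n \<theta> \<le> real n * K" for n \<theta>
  proof (induction n arbitrary: \<theta>)
    case (Suc n)
    have "0 \<le> K" using K[of \<theta>] by linarith
    then show ?case using K[of \<theta>] Suc[of "T \<theta>"] unfolding FS by (auto simp: algebra_simps add_nonneg_nonneg)
  qed (simp add: F0)
  have intF: "integrable lebesgue_circle (F n)" "integrable lebesgue_circle (\<lambda>\<theta>. F n (T \<theta>))" for n
    by (rule lebesgue_circle.integrable_const_bound[where B="real n * K"]; use Fb Fnn in simp)+
  have intu: "integrable lebesgue_circle u"
    by (rule lebesgue_circle.integrable_const_bound[where B=K]; use K in simp)
  have "emeasure lebesgue_circle A = 0"
  proof (rule ccontr)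
    assume "emeasure lebesgue_circle A \<noteq> 0"
    then have "emeasure lebesgue_circle (- A) = 0"
      using irrational_rotation_ergodic[OF irr Am] Ainv unfolding T_def by blast
    then have AA: "AE \<theta> in lebesgue_circle. \<theta> \<in> A"
      by (intro AE_I[of _ _ "- A"]) auto
    have lim: "(\<lambda>n. \<integral>\<theta>. F (Suc n) \<theta> - F n (T \<theta>) \<partial>lebesgue_circle) \<longlonglongrightarrow> (\<integral>\<theta>. u \<theta> \<partial>lebesgue_circle)"
    proof (rule integral_dominated_convergence[where w="\<lambda>_. K"])
      show "AE \<theta> in lebesgue_circle. (\<lambda>n. F (Suc n) \<theta> - F n (T \<theta>)) \<longlonglongrightarrow> u \<theta>"
        using AA
      proof eventually_elim
        case (elim \<theta>)
        then have "T \<theta> \<in> A" by (simp add: Ainv)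
        obtain k :: nat where k: "K \<le> real k" using real_arch_simple by blast
        obtain n0 where n0: "real k < S n0 (T \<theta>)" using \<open>T \<theta> \<in> A\<close> unfolding Aeq by blast
        \<comment> \<open>Once \<open>F n (T \<theta>)\<close> exceeds K, the maximum with 0 is
          inactive and the increment is exactly u.\<close>
        have "F (Suc n) \<theta> - F n (T \<theta>) = u \<theta>" if "n \<ge> n0" for n
        proof -
          have "K < F n (T \<theta>)" using FM[OF that, of "T \<theta>"] SF[of n0 "T \<theta>"] n0 k by linarith
          then have "0 \<le> u \<theta> + F n (T \<theta>)" using K[of \<theta>] by linarith
          then show ?thesis unfolding FS by simp
        qed
        then show ?case by (intro tendsto_eventually eventually_sequentiallyI)
      qed
      show "AE \<theta> in lebesgue_circle. norm (F (Suc n) \<theta> - F n (T \<theta>)) \<le> K" for n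
      proof (rule AE_I2)
        fix \<theta> show "norm (F (Suc n) \<theta> - F n (T \<theta>)) \<le> K"
          using K[of \<theta>] Fnn[of n "T \<theta>"] unfolding FS by (auto simp: max_def abs_le_iff)
      qed
    qed (auto simp: lebesgue_circle.integrable_const)
    have "0 \<le> (\<integral>\<theta>. F (Suc n) \<theta> - F n (T \<theta>) \<partial>lebesgue_circle)" for n
    proof -
      have "(\<integral>\<theta>. F (Suc n) \<theta> - F n (T \<theta>) \<partial>lebesgue_circle) = (\<integral>\<theta>. F (Suc n) \<theta> \<partial>lebesgue_circle) - (\<integral>\<theta>. F n \<theta> \<partial>lebesgue_circle)"
        using integral_circle_shift[of "F n" "to_circle \<omega>"] by (subst Bochner_Integration.integral_diff) (use intF in \<open>auto simp: T_def\<close>)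
      also have "\<dots> \<ge> 0" using integral_mono[OF intF(1) intF(1) Fmono] by simp
      finally show ?thesis .
    qed
    then have "0 \<le> (\<integral>\<theta>. u \<theta> \<partial>lebesgue_circle)" using LIMSEQ_le_const[OF lim] by blast
    with neg show False by simp
  qed
  then show ?thesis
    using Am by (intro AE_I[of _ _ A]) (auto simp: A_def S_def)
qed

text \<open>The function u + c still has negative mean, so its sums are bounded above. This
  one-sided exponential rate is all that is used in place of the pointwise ergodic theorem.\<close>

corollary birkhoff_sum_linear_decay:
  assumes irr: "\<omega> \<notin> \<rat>" and um [measurable]: "u \<in> borel_measurable borel"
    and K: "\<And>\<theta>. \<bar>u \<theta>\<bar> \<le> K" and neg: "(\<integral>\<theta>. u \<theta> \<partial>lebesgue_circle) < - c"
  shows "AE \<theta> in lebesgue_circle. \<exists>B. \<forall>n. birkhoff_sum \<omega> u n \<theta> \<le> B - c * real n"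
proof -
  have intu: "integrable lebesgue_circle u"
    by (rule lebesgue_circle.integrable_const_bound[where B=K]; use K in simp)
  have "AE \<theta> in lebesgue_circle. bdd_above (range (\<lambda>n. birkhoff_sum \<omega> (\<lambda>\<theta>. u \<theta> + c) n \<theta>))"
  proof (rule birkhoff_sum_bounded_above[OF irr, where K="K + \<bar>c\<bar>"])
    show "\<bar>u \<theta> + c\<bar> \<le> K + \<bar>c\<bar>" for \<theta> using K[of \<theta>] by linarith
    show "(\<integral>\<theta>. u \<theta> + c \<partial>lebesgue_circle) < 0"
      using neg by (subst Bochner_Integration.integral_add) (auto simp: intu)
  qed simp
  then show ?thesis
  proof eventually_elim
    case (elim \<theta>)
    then obtain B where B: "birkhoff_sum \<omega> (\<lambda>\<theta>. u \<theta> + c) n \<theta> \<le> B" for n unfolding bdd_above_def by auto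
    have "birkhoff_sum \<omega> u n \<theta> \<le> B - c * real n" for n
      using B[of n] by (simp add: birkhoff_sum_def sum.distrib algebra_simps)
    then show ?case by blast
  qed
qed

section \<open>The holomorphic invariant graph of the projective cocycle\<close>

definition circle_cis :: "circle \<Rightarrow> complex" where
  "circle_cis \<theta> = Complex (cos_turn \<theta>) (sin_turn \<theta>)"

text \<open>\<open>R_mat \<theta>\<close> turns clockwise by 2 * pi * \<theta>, hence the conjugate;
  the square is its action on squared directions, where \<xi> and - \<xi> coincide.\<close>

definition rot2 :: "circle \<Rightarrow> complex" where
  "rot2 \<theta> = cnj (circle_cis \<theta>) ^ 2"

lemma circle_cis_to_circle: "circle_cis (to_circle x) = cis (2 * pi * x)"
  by (simp add: circle_cis_def cos_turn.abs_eq sin_turn.abs_eq cis.ctr)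

lemma circle_cis_add: "circle_cis (\<theta> + \<phi>) = circle_cis \<theta> * circle_cis \<phi>"
proof -
  obtain x y where "\<theta> = to_circle x" "\<phi> = to_circle y" by (metis to_circle_surj)
  then show ?thesis by (simp add: to_circle_add[symmetric] circle_cis_to_circle cis_mult distrib_left)
qed

lemma norm_circle_cis [simp]: "norm (circle_cis \<theta>) = 1"
proof -
  obtain x where "\<theta> = to_circle x" by (metis to_circle_surj)
  then show ?thesis by (simp add: circle_cis_to_circle)
qed

lemma dist_circle_cis: "dist (circle_cis \<theta>) (circle_cis \<phi>) \<le> 2 * pi * dist \<theta> \<phi>"
proof -
  obtain x y where xy: "\<theta> = to_circle x" "\<phi> = to_circle y" by (metis to_circle_surj)
  obtain k where k: "k \<in> \<int>" "infdist (x - y) \<int> = \<bar>x - y - k\<bar>" using infdist_Ints_attained by blast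
  have tx: "\<theta> = to_circle (x - k)" unfolding xy to_circle_eq_iff using k by simp
  define t where "t = 2 * pi * (x - k - y)"
  have "cis (2 * pi * (x - k)) = cis (2 * pi * y) * cis t"
    by (simp add: cis_mult t_def algebra_simps)
  then have "circle_cis \<theta> - circle_cis \<phi> = cis (2 * pi * y) * (cis t - 1)"
    unfolding tx xy(2) circle_cis_to_circle by (simp add: algebra_simps)
  then have "dist (circle_cis \<theta>) (circle_cis \<phi>) = norm (cis t - 1)"
    by (simp add: dist_norm norm_mult)
  also have "\<dots> = 2 * \<bar>sin (t / 2)\<bar>" using dist_exp_i_1[of t] by (simp add: cis_conv_exp)
  also have "\<dots> \<le> \<bar>t\<bar>" using abs_sin_x_le_abs_x[of "t/2"] by simp
  also have "t = 2 * pi * (x - y - k)" by (simp add: t_def algebra_simps)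
  also have "\<bar>\<dots>\<bar> = 2 * pi * dist \<theta> \<phi>"
    using k(2) xy by (simp add: dist_circle.abs_eq abs_mult)
  finally show ?thesis .
qed

lemma circle_cis_inj: "circle_cis \<theta> = circle_cis \<phi> \<longleftrightarrow> \<theta> = \<phi>"
proof
  assume eq: "circle_cis \<theta> = circle_cis \<phi>"
  obtain x y where xy: "\<theta> = to_circle x" "\<phi> = to_circle y" by (metis to_circle_surj)
  have "cis (2 * pi * x) = cis (2 * pi * y)" using eq xy by (simp add: circle_cis_to_circle)
  then have "sin (2 * pi * x) = sin (2 * pi * y) \<and> cos (2 * pi * x) = cos (2 * pi * y)"
    by (metis cis.sel)
  then obtain n :: int where "2 * pi * x = 2 * pi * y + 2 * pi * of_int n"
    using sin_cos_eq_iff by metis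
  then have "x = y + of_int n" by (simp flip: distrib_left)
  then show "\<theta> = \<phi>" unfolding xy to_circle_eq_iff by simp
qed simp

lemma circle_cis_surj: assumes "norm z = 1" obtains \<theta> where "circle_cis \<theta> = z"
proof -
  have "circle_cis (to_circle (Arg z / (2 * pi))) = z"
    using cis_Arg[of z] assms by (cases "z = 0") (auto simp: circle_cis_to_circle sgn_div_norm)
  then show thesis by (rule that)
qed

lemma continuous_on_circle_cis [continuous_intros]:
  assumes "continuous_on S f" shows "continuous_on S (\<lambda>x. circle_cis (f x))"
proof -
  have "continuous_on UNIV circle_cis"
  proof (rule continuous_onI)
    fix x :: circle and e :: real assume e: "0 < e"
    show "\<exists>d>0. \<forall>y\<in>UNIV. dist y x < d \<longrightarrow> dist (circle_cis y) (circle_cis x) \<le> e"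
    proof (intro exI[of _ "e / (2 * pi)"] conjI ballI impI)
      fix y assume "dist y x < e / (2 * pi)"
      then have "2 * pi * dist y x < e" by (simp add: field_simps)
      then show "dist (circle_cis y) (circle_cis x) \<le> e" using dist_circle_cis[of y x] by linarith
    qed (use e in simp)
  qed
  from continuous_on_compose2[OF this assms] show ?thesis by simp
qed

lemma continuous_on_rot2 [continuous_intros]:
  "continuous_on S f \<Longrightarrow> continuous_on S (\<lambda>x. rot2 (f x))"
  unfolding rot2_def by (intro continuous_intros)

lemma norm_rot2 [simp]: "norm (rot2 \<theta>) = 1" by (simp add: rot2_def norm_power)

lemma rot2_add: "rot2 (\<theta> + \<phi>) = rot2 \<theta> * rot2 \<phi>"
  by (simp add: rot2_def circle_cis_add power_mult_distrib)

lemma rot2_to_circle: "rot2 (to_circle x) = cis (- (4 * pi * x))"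
  by (simp add: rot2_def circle_cis_to_circle cis_cnj Complex.DeMoivre mult.assoc)

lemma measurable_rot2 [measurable]: "rot2 \<in> borel_measurable borel"
  by (rule borel_measurable_continuous_onI) (intro continuous_intros)

section \<open>Moebius maps of the disc and the pseudo-hyperbolic distance\<close>

definition mob :: "real \<Rightarrow> complex \<Rightarrow> complex" where
  "mob \<kappa> \<zeta> = (\<zeta> + of_real \<kappa>) / (1 + of_real \<kappa> * \<zeta>)"

lemma mob_denom:
  assumes "0 < \<kappa>" "\<kappa> < 1" "norm \<zeta> \<le> 1"
  shows "1 - \<kappa> \<le> Re (1 + of_real \<kappa> * \<zeta>)" "1 - \<kappa> \<le> norm (1 + of_real \<kappa> * \<zeta>)"
    "norm (1 + of_real \<kappa> * \<zeta>) \<le> 1 + \<kappa>" "1 + of_real \<kappa> * \<zeta> \<noteq> 0"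
proof -
  have "\<bar>Re \<zeta>\<bar> \<le> 1" using abs_Re_le_cmod[of \<zeta>] assms by linarith
  then have "\<kappa> * - 1 \<le> \<kappa> * Re \<zeta>" using assms(1) by (intro mult_left_mono) auto
  then show 1: "1 - \<kappa> \<le> Re (1 + of_real \<kappa> * \<zeta>)" by simp
  then show 2: "1 - \<kappa> \<le> norm (1 + of_real \<kappa> * \<zeta>)" using complex_Re_le_cmod order.trans by blast
  then show "1 + of_real \<kappa> * \<zeta> \<noteq> 0" using assms by auto
  have "norm (of_real \<kappa> * \<zeta>) \<le> \<kappa>" using assms mult_left_mono[of "norm \<zeta>" 1 \<kappa>] by (simp add: norm_mult)
  then show "norm (1 + of_real \<kappa> * \<zeta>) \<le> 1 + \<kappa>" using norm_triangle_ineq[of 1 "of_real \<kappa> * \<zeta>"] by simp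
qed

text \<open>Equality in the Schwarz-Pick inequality for a disc automorphism. Along an invariant
  graph it makes 1 - |\<psi>|^2 a multiplicative cocycle.\<close>

lemma one_minus_norm_mob:
  assumes "0 < \<kappa>" "\<kappa> < 1" "norm \<zeta> \<le> 1"
  shows "1 - (norm (mob \<kappa> \<zeta>))\<^sup>2 = (1 - \<kappa>\<^sup>2) * (1 - (norm \<zeta>)\<^sup>2) / (norm (1 + of_real \<kappa> * \<zeta>))\<^sup>2"
proof -
  have nz: "(norm (1 + of_real \<kappa> * \<zeta>))\<^sup>2 \<noteq> 0" using mob_denom[OF assms] by simp
  have "(norm (1 + of_real \<kappa> * \<zeta>))\<^sup>2 - (norm (\<zeta> + of_real \<kappa>))\<^sup>2 = (1 - \<kappa>\<^sup>2) * (1 - (norm \<zeta>)\<^sup>2)"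
    unfolding cmod_power2 by (simp add: algebra_simps power2_eq_square)
  then show ?thesis using nz by (simp add: mob_def norm_divide power_divide field_simps)
qed

lemma norm_mob_le:
  assumes "0 < \<kappa>" "\<kappa> < 1" "norm \<zeta> \<le> 1"
  shows "norm (mob \<kappa> \<zeta>) \<le> 1"
proof -
  have "0 \<le> (1 - \<kappa>\<^sup>2) * (1 - (norm \<zeta>)\<^sup>2) / (norm (1 + of_real \<kappa> * \<zeta>))\<^sup>2"
    using assms by (intro divide_nonneg_nonneg mult_nonneg_nonneg) (auto simp: power_le_one)
  then have "(norm (mob \<kappa> \<zeta>))\<^sup>2 \<le> 1" using one_minus_norm_mob[OF assms] by linarith
  then show ?thesis using power2_le_imp_le[of "norm (mob \<kappa> \<zeta>)" 1] by simp
qed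

lemma norm_mob_unit:
  assumes "0 < \<kappa>" "\<kappa> < 1" "norm \<zeta> = 1"
  shows "norm (mob \<kappa> \<zeta>) = 1"
proof -
  have "(norm (mob \<kappa> \<zeta>))\<^sup>2 = 1" using one_minus_norm_mob[of \<kappa> \<zeta>] assms by simp
  then show ?thesis by (simp add: power2_eq_1_iff) (metis norm_ge_zero not_one_le_zero neg_0_le_iff_le)
qed

lemma mob_diff:
  assumes "0 < \<kappa>" "\<kappa> < 1" "norm a \<le> 1" "norm b \<le> 1"
  shows "mob \<kappa> a - mob \<kappa> b = (1 - of_real \<kappa> ^ 2) * (a - b) / ((1 + of_real \<kappa> * a) * (1 + of_real \<kappa> * b))"
  using mob_denom(4)[OF assms(1,2,3)] mob_denom(4)[OF assms(1,2,4)]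
  unfolding mob_def by (simp add: field_simps power2_eq_square)

text \<open>Disc automorphisms preserve the pseudo-hyperbolic distance |a - b| / |1 - cnj a * b|.
  The inequality is kept in product form because the denominator vanishes when a = b lies on the
  unit circle.\<close>

lemma mob_pseudo_hyperbolic:
  assumes "0 < \<kappa>" "\<kappa> < 1" "norm a \<le> 1" "norm b \<le> 1"
    and le: "norm (a - b) \<le> q * norm (1 - cnj a * b)"
  shows "norm (mob \<kappa> a - mob \<kappa> b) \<le> q * norm (1 - cnj (mob \<kappa> a) * mob \<kappa> b)"
proof -
  define k where "k = (of_real \<kappa> :: complex)"
  have nz: "1 + k * a \<noteq> 0" "1 + k * b \<noteq> 0" using mob_denom(4) assms unfolding k_def by auto
  have nz': "1 + k * cnj a \<noteq> 0"
  proof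
    assume "1 + k * cnj a = 0"
    then have "cnj (1 + k * cnj a) = 0" by simp
    then show False using nz by (simp add: k_def)
  qed
  have ck: "cnj (mob \<kappa> a) = (cnj a + k) / (1 + k * cnj a)" by (simp add: mob_def k_def)
  have "1 - cnj (mob \<kappa> a) * mob \<kappa> b = (1 - k ^ 2) * (1 - cnj a * b) / ((1 + k * cnj a) * (1 + k * b))"
  proof -
    have "1 - cnj (mob \<kappa> a) * mob \<kappa> b
        = ((1 + k * cnj a) * (1 + k * b) - (cnj a + k) * (b + k)) / ((1 + k * cnj a) * (1 + k * b))"
      unfolding ck unfolding mob_def k_def[symmetric] using nz nz' by (simp add: diff_divide_distrib)
    also have "(1 + k * cnj a) * (1 + k * b) - (cnj a + k) * (b + k) = (1 - k ^ 2) * (1 - cnj a * b)"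
      by (simp add: algebra_simps power2_eq_square)
    finally show ?thesis .
  qed
  moreover have "norm (1 + k * cnj a) = norm (1 + k * a)"
    by (metis complex_cnj_add complex_cnj_complex_of_real complex_cnj_mult complex_cnj_one complex_mod_cnj k_def)
  ultimately have A: "norm (1 - cnj (mob \<kappa> a) * mob \<kappa> b) = norm (1 - k ^ 2) * norm (1 - cnj a * b) / (norm (1 + k * a) * norm (1 + k * b))"
    by (simp add: norm_mult norm_divide)
  have B: "norm (mob \<kappa> a - mob \<kappa> b) = norm (1 - k ^ 2) * norm (a - b) / (norm (1 + k * a) * norm (1 + k * b))"
    unfolding mob_diff[OF assms(1-4)] by (simp add: norm_mult norm_divide k_def)
  have "norm (1 - k ^ 2) * norm (a - b) \<le> q * (norm (1 - k ^ 2) * norm (1 - cnj a * b))"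
    using mult_left_mono[OF le, of "norm (1 - k^2)"] by (simp add: algebra_simps)
  from divide_right_mono[OF this, of "norm (1 + k * a) * norm (1 + k * b)"]
  show ?thesis unfolding A B by simp
qed

text \<open>The factor is attained by antipodal points of the unit circle, where cnj a * b = -1 and
  |s| = r; it is below 1 and increases with r.\<close>

lemma scaling_pseudo_hyperbolic:
  fixes a b s :: complex
  assumes "norm a \<le> 1" "norm b \<le> 1" "norm s \<le> r" "r < 1" "0 \<le> q"
    and le: "norm (a - b) \<le> q * norm (1 - cnj a * b)"
  shows "norm (s * a - s * b) \<le> (2 * r / (1 + r\<^sup>2)) * q * norm (1 - cnj (s * a) * (s * b))"
proof -
  define x where "x = cnj a * b"
  define t where "t = norm s"
  have t: "0 \<le> t" "t \<le> r" "t < 1" using assms by (auto simp: t_def)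
  have nx: "norm x \<le> 1" using assms mult_le_one[of "norm a" "norm b"] by (simp add: x_def norm_mult)
  have x2: "(Re x)\<^sup>2 + (Im x)\<^sup>2 \<le> 1" using nx by (metis cmod_power2 norm_ge_zero power_le_one)
  have cs: "cnj (s * a) * (s * b) = of_real (t\<^sup>2) * x"
    using complex_norm_square[of s] by (simp add: x_def t_def mult_ac)
  have key: "norm (1 - x) * (1 + t\<^sup>2) \<le> 2 * norm (1 - of_real (t\<^sup>2) * x)"
  proof -
    have "(norm (1 - x) * (1 + t\<^sup>2))\<^sup>2 \<le> (2 * norm (1 - of_real (t\<^sup>2) * x))\<^sup>2"
    proof -
      \<comment> \<open>The gap is a nonnegative combination of |1 + x|^2 and 1 - |x|^2, and
        vanishes at the extremal x = -1.\<close>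
      have "(2 * norm (1 - of_real (t\<^sup>2) * x))\<^sup>2 - (norm (1 - x) * (1 + t\<^sup>2))\<^sup>2
          = (1 - t\<^sup>2)\<^sup>2 * ((1 + Re x)\<^sup>2 + (Im x)\<^sup>2) + 2 * (1 + t\<^sup>2) * (1 - t\<^sup>2) * (1 - ((Re x)\<^sup>2 + (Im x)\<^sup>2))"
        unfolding power_mult_distrib cmod_power2 by (simp add: algebra_simps power2_eq_square)
      also have "\<dots> \<ge> 0"
        using t x2 by (intro add_nonneg_nonneg mult_nonneg_nonneg) (auto simp: power_le_one)
      finally show ?thesis by simp
    qed
    then show ?thesis by (rule power2_le_imp_le) simp
  qed
  have tr: "2 * t / (1 + t\<^sup>2) \<le> 2 * r / (1 + r\<^sup>2)"
  proof -
    have "0 \<le> (r - t) * (1 - r * t)" using t assms mult_le_one[of r t] by (intro mult_nonneg_nonneg) auto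
    then have "t * (1 + r\<^sup>2) \<le> r * (1 + t\<^sup>2)" by (simp add: algebra_simps power2_eq_square)
    then show ?thesis by (simp add: field_simps add_pos_nonneg)
  qed
  have "norm (s * a - s * b) = t * norm (a - b)" by (simp add: t_def norm_mult flip: right_diff_distrib)
  also have "\<dots> \<le> t * (q * norm (1 - x))" unfolding x_def using le t by (intro mult_left_mono) auto
  also have "norm (1 - x) \<le> 2 * norm (1 - of_real (t\<^sup>2) * x) / (1 + t\<^sup>2)"
    using key by (simp add: field_simps add_pos_nonneg)
  then have "t * (q * norm (1 - x)) \<le> t * (q * (2 * norm (1 - of_real (t\<^sup>2) * x) / (1 + t\<^sup>2)))"
    using t assms(5) by (intro mult_left_mono) auto
  also have "\<dots> = (2 * t / (1 + t\<^sup>2)) * (q * norm (1 - of_real (t\<^sup>2) * x))" by simp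
  also have "\<dots> \<le> (2 * r / (1 + r\<^sup>2)) * (q * norm (1 - of_real (t\<^sup>2) * x))"
    using tr assms(5) by (intro mult_right_mono) auto
  finally show ?thesis unfolding cs by (simp add: mult_ac)
qed

text \<open>The graph transform \<open>f \<mapsto> mob (s f(s))\<close> over the rotation by \<open>\<rho>\<close> maps holomorphic functions of the
  disc into itself and contracts the pseudo-hyperbolic distance on each smaller disc.\<close>

lemma holomorphic_invariant_graph:
  assumes k: "0 < \<kappa>" "\<kappa> < 1" and \<rho>: "norm \<rho> = 1"
  obtains f where "f holomorphic_on ball 0 1" "\<And>s. norm s < 1 \<Longrightarrow> norm (f s) \<le> 1"
    "\<And>s. norm s < 1 \<Longrightarrow> f (\<rho> * s) = mob \<kappa> (s * f s)"
proof -
  define \<rho>' where "\<rho>' = cnj \<rho>"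
  have \<rho>': "norm \<rho>' = 1" "\<rho>' * \<rho> = 1"
    using \<rho> complex_norm_square[of \<rho>] by (auto simp: \<rho>'_def mult.commute)
  define f where "f = rec_nat (\<lambda>_::complex. 0::complex) (\<lambda>_ g s. mob \<kappa> (\<rho>' * s * g (\<rho>' * s)))"
  have f0: "f 0 s = 0" and fS: "f (Suc n) s = mob \<kappa> (\<rho>' * s * f n (\<rho>' * s))" for n s by (auto simp: f_def)
  have nb: "norm (f n s) \<le> 1" if "norm s < 1" for n s using that
  proof (induction n arbitrary: s)
    case (Suc n)
    have "norm (\<rho>' * s) < 1" using Suc.prems \<rho>' by (simp add: norm_mult)
    then have "norm (\<rho>' * s * f n (\<rho>' * s)) \<le> 1" using Suc.IH[of "\<rho>' * s"]
      by (simp add: norm_mult mult_le_one)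
    then show ?case unfolding fS using norm_mob_le k by blast
  qed (simp add: f0)
  have nb': "norm (\<rho>' * s * f n (\<rho>' * s)) \<le> 1" if "norm s < 1" for n s
    using that nb[of "\<rho>' * s" n] \<rho>' by (simp add: norm_mult mult_le_one)
  have hol: "f n holomorphic_on ball 0 1" for n
  proof (induction n)
    case 0 show ?case unfolding f0[abs_def] by simp
  next
    case (Suc n)
    have "(f n \<circ> (\<lambda>s. \<rho>' * s)) holomorphic_on ball 0 1"
      by (rule holomorphic_on_compose_gen[OF _ Suc]) (auto intro!: holomorphic_intros simp: norm_mult \<rho>')
    then have h: "(\<lambda>s. f n (\<rho>' * s)) holomorphic_on ball 0 1" by (simp add: o_def)
    have "1 + of_real \<kappa> * (\<rho>' * s * f n (\<rho>' * s)) \<noteq> 0" if "s \<in> ball 0 1" for s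
      using mob_denom(4)[OF k nb'[of s n]] that by simp
    then show ?case unfolding fS[abs_def] mob_def by (intro holomorphic_intros h) auto
  qed
  \<comment> \<open>The automorphism keeps the distance and the factor s shrinks it. The induction
    can start since \<open>f 0\<close> vanishes, which makes the right-hand side 1.\<close>
  have contr: "norm (f (Suc n) s - f n s) \<le> (2 * r / (1 + r\<^sup>2)) ^ n * norm (1 - cnj (f (Suc n) s) * f n s)"
    if "norm s \<le> r" "r < 1" for n s r using that
  proof (induction n arbitrary: s)
    case 0
    then show ?case using nb[of s "Suc 0"] by (simp add: f0)
  next
    case (Suc n)
    define u where "u = \<rho>' * s"
    have u: "norm u \<le> r" "norm u < 1" using Suc.prems \<rho>' by (auto simp: u_def norm_mult)
    have r0: "0 \<le> r" using u norm_ge_zero order.trans by blast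
    have f1: "f (Suc (Suc n)) s = mob \<kappa> (u * f (Suc n) u)" and f2: "f (Suc n) s = mob \<kappa> (u * f n u)"
      by (simp_all only: fS[of "Suc n"] fS[of n] u_def)
    have nu: "norm (u * f m u) \<le> 1" for m using nb'[of s m] Suc.prems by (simp add: u_def)
    have "norm (u * f (Suc n) u - u * f n u) \<le>
        (2 * r / (1 + r\<^sup>2)) * (2 * r / (1 + r\<^sup>2)) ^ n * norm (1 - cnj (u * f (Suc n) u) * (u * f n u))"
      using scaling_pseudo_hyperbolic[OF nb[OF u(2)] nb[OF u(2)] u(1) Suc.prems(2) _ Suc.IH[OF u(1) Suc.prems(2)]] r0
      by simp
    from mob_pseudo_hyperbolic[OF k nu nu this] show ?case
      unfolding f1 f2 by simp
  qed
  have qlt: "0 \<le> 2 * r / (1 + r\<^sup>2)" "2 * r / (1 + r\<^sup>2) < 1" if "0 \<le> r" "r < 1" for r :: real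
  proof -
    have "0 < (1 - r)\<^sup>2" using that by simp
    then show "2 * r / (1 + r\<^sup>2) < 1" by (simp add: field_simps add_pos_nonneg power2_eq_square)
  qed (use that in simp)
  have bd: "norm (f (Suc n) s - f n s) \<le> 2 * (2 * r / (1 + r\<^sup>2)) ^ n" if "norm s \<le> r" "r < 1" for n s r
  proof -
    have s: "norm s < 1" "0 \<le> r" using that norm_ge_zero[of s] by linarith+
    have "norm (1 - cnj (f (Suc n) s) * f n s) \<le> 1 + norm (f (Suc n) s) * norm (f n s)"
      using norm_triangle_ineq4[of 1 "cnj (f (Suc n) s) * f n s"] by (simp add: norm_mult)
    also have "\<dots> \<le> 2" using nb[OF s(1)] mult_le_one[of "norm (f (Suc n) s)" "norm (f n s)"] by simp
    finally show ?thesis using contr[OF that, of n] qlt[OF s(2) that(2)] mult_left_mono[of _ 2 "(2 * r / (1 + r\<^sup>2)) ^ n"]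
      by (smt (verit) mult.commute zero_le_power)
  qed
  \<comment> \<open>The limit is a telescoping series, which suits the Weierstrass test;
    \<open>f 0\<close> contributes nothing.\<close>
  define g where "g s = (\<Sum>i. f (Suc i) s - f i s)" for s
  have tele: "(\<Sum>i<n. f (Suc i) s - f i s) = f n s" for n s
    using sum_lessThan_telescope[of "\<lambda>i. f i s" n] by (simp add: f0)
  have unif: "uniform_limit (cball 0 r) f g sequentially" if "0 \<le> r" "r < 1" for r
  proof -
    have "uniform_limit (cball 0 r) (\<lambda>n x. \<Sum>i<n. f (Suc i) x - f i x) (\<lambda>x. \<Sum>i. f (Suc i) x - f i x) sequentially"
      by (rule Weierstrass_m_test[where M="\<lambda>n. 2 * (2 * r / (1 + r\<^sup>2)) ^ n"])
         (use bd that qlt[OF that] in \<open>auto intro!: summable_mult summable_geometric\<close>)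
    then show ?thesis unfolding tele g_def .
  qed
  have lim: "(\<lambda>n. f n s) \<longlonglongrightarrow> g s" if "norm s < 1" for s
    using tendsto_uniform_limitI[OF unif[of "norm s"], of s] that by simp
  show thesis
  proof
    show "g holomorphic_on ball 0 1"
    proof (rule holomorphic_uniform_sequence[OF open_ball hol])
      fix x :: complex assume "x \<in> ball 0 1"
      then have x: "norm x < 1" by simp
      define d where "d = (1 - norm x) / 2"
      have d: "0 < d" "norm x + d < 1" using x by (auto simp: d_def field_simps)
      have sub: "cball x d \<subseteq> cball 0 (norm x + d)"
      proof
        fix y assume "y \<in> cball x d"
        then show "y \<in> cball 0 (norm x + d)" using norm_triangle_ineq2[of y x]
          by (auto simp: dist_norm norm_minus_commute)
      qed
      show "\<exists>d>0. cball x d \<subseteq> ball 0 1 \<and> uniform_limit (cball x d) f g sequentially"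
        using d sub uniform_limit_on_subset[OF unif sub] by (intro exI[of _ d]) auto
    qed
    show "norm (g s) \<le> 1" if "norm s < 1" for s
      by (rule LIMSEQ_le_const2[OF tendsto_norm[OF lim[OF that]]]) (use nb that in blast)
    show "g (\<rho> * s) = mob \<kappa> (s * g s)" if s: "norm s < 1" for s
    proof -
      have "f (Suc n) (\<rho> * s) = mob \<kappa> (s * f n s)" for n
        unfolding fS using \<rho>' by (simp flip: mult.assoc)
      moreover have "(\<lambda>n. f (Suc n) (\<rho> * s)) \<longlonglongrightarrow> g (\<rho> * s)"
        using LIMSEQ_Suc[OF lim[of "\<rho> * s"]] s \<rho> by (simp add: norm_mult)
      moreover have "norm (s * g s) \<le> 1"
        using s LIMSEQ_le_const2[OF tendsto_norm[OF lim[OF s]], of 1] nb[OF s] by (simp add: norm_mult mult_le_one)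
      then have "(\<lambda>n. mob \<kappa> (s * f n s)) \<longlonglongrightarrow> mob \<kappa> (s * g s)"
        unfolding mob_def by (intro tendsto_intros lim s mob_denom(4)[OF k])
      ultimately show ?thesis using LIMSEQ_unique by fastforce
    qed
  qed
qed

section \<open>Fourier series on the circle and boundary values in the disc\<close>

lemma integral_rot2_orthonormal:
  "(\<integral>\<theta>. rot2 \<theta> ^ k * cnj (rot2 \<theta> ^ j) \<partial>lebesgue_circle) = (if k = j then 1 else 0)"
proof (cases "k = j")
  case True
  have "rot2 \<theta> ^ k * cnj (rot2 \<theta> ^ j) = 1" for \<theta>
    using complex_norm_square[of "rot2 \<theta> ^ j"] True by (simp add: norm_power)
  then show ?thesis using True by simp
next
  case False
  define F where "F \<theta> = rot2 \<theta> ^ k * cnj (rot2 \<theta> ^ j)" for \<theta>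
  have [measurable]: "F \<in> borel_measurable borel"
    unfolding F_def[abs_def] by (rule borel_measurable_continuous_onI) (intro continuous_intros)
  \<comment> \<open>Rotation by x multiplies the integrand by cis (- pi) = -1 but leaves the
    integral unchanged, so the integral is its own negative.\<close>
  define y where "y = real k - real j"
  define x where "x = 1 / (4 * y)"
  have kj: "y \<noteq> 0" using False by (simp add: y_def)
  have "F (to_circle x) = cis (- (4 * pi * x) * real k) * cis (4 * pi * x * real j)"
    by (simp add: F_def rot2_to_circle Complex.DeMoivre cis_cnj mult_ac)
  also have "\<dots> = cis (- (4 * pi * x * (real k - real j)))" by (simp add: cis_mult algebra_simps)
  also have "4 * pi * x * (real k - real j) = pi" unfolding y_def[symmetric] using kj by (simp add: x_def)
  finally have Fx: "F (to_circle x) = -1" by (simp add: cis.ctr complex_eq_iff)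
  have "F (\<theta> + to_circle x) = F \<theta> * F (to_circle x)" for \<theta>
    by (simp add: F_def rot2_add power_mult_distrib)
  then have "(\<integral>\<theta>. F \<theta> \<partial>lebesgue_circle) = - (\<integral>\<theta>. F \<theta> \<partial>lebesgue_circle)"
    using integral_circle_shift[of F "to_circle x"] by (simp add: Fx)
  then show ?thesis using False by (simp add: F_def)
qed

lemma integral_rot2_series:
  fixes d :: "nat \<Rightarrow> complex"
  assumes d: "summable (\<lambda>k. norm (d k))"
  shows "(\<integral>\<theta>. (\<Sum>k. d k * rot2 \<theta> ^ k) * cnj (rot2 \<theta> ^ j) \<partial>lebesgue_circle) = d j"
proof -
  define f where "f k \<theta> = d k * (rot2 \<theta> ^ k * cnj (rot2 \<theta> ^ j))" for k \<theta>
  have nf: "norm (f k \<theta>) = norm (d k)" for k \<theta> by (simp add: f_def norm_mult norm_power)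
  have fm: "f k \<in> borel_measurable borel" for k
    unfolding f_def[abs_def] by (rule borel_measurable_continuous_onI) (intro continuous_intros)
  have int: "integrable lebesgue_circle (f k)" for k
    by (rule lebesgue_circle.integrable_const_bound[where B="norm (d k)"]) (use fm nf in auto)
  have "(\<Sum>k. f k \<theta>) = (\<Sum>k. d k * rot2 \<theta> ^ k) * cnj (rot2 \<theta> ^ j)" for \<theta>
  proof -
    have "summable (\<lambda>k. d k * rot2 \<theta> ^ k)"
      by (rule summable_norm_cancel) (simp add: norm_mult norm_power d)
    from suminf_mult2[OF this, of "cnj (rot2 \<theta> ^ j)"] show ?thesis by (simp add: f_def mult_ac)
  qed
  then have "(\<integral>\<theta>. (\<Sum>k. d k * rot2 \<theta> ^ k) * cnj (rot2 \<theta> ^ j) \<partial>lebesgue_circle)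
      = (\<integral>\<theta>. (\<Sum>k. f k \<theta>) \<partial>lebesgue_circle)" by simp
  also have "\<dots> = (\<Sum>k. \<integral>\<theta>. f k \<theta> \<partial>lebesgue_circle)"
    by (rule integral_suminf[OF int]) (auto simp: nf d)
  also have "\<dots> = (\<Sum>k. if k = j then d j else 0)"
    unfolding f_def by (subst integral_mult_right_zero, subst integral_rot2_orthonormal) (rule suminf_cong, simp)
  also have "\<dots> = d j" using sums_unique[OF sums_single[of j "\<lambda>_. d j"]] by simp
  finally show ?thesis .
qed

lemma measurable_rot2_series:
  fixes d :: "nat \<Rightarrow> complex"
  assumes d: "summable (\<lambda>k. norm (d k))"
  shows "(\<lambda>\<theta>. \<Sum>k. d k * rot2 \<theta> ^ k) \<in> borel_measurable borel"
  by measurable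

lemma parseval_rot2_series:
  fixes d :: "nat \<Rightarrow> complex"
  assumes d: "summable (\<lambda>k. norm (d k))"
  shows "(\<lambda>k. (norm (d k))\<^sup>2) sums (\<integral>\<theta>. (norm (\<Sum>k. d k * rot2 \<theta> ^ k))\<^sup>2 \<partial>lebesgue_circle)"
proof -
  define H where "H \<theta> = (\<Sum>k. d k * rot2 \<theta> ^ k)" for \<theta>
  have [measurable]: "H \<in> borel_measurable borel" unfolding H_def[abs_def] by (rule measurable_rot2_series[OF d])
  have sm: "summable (\<lambda>k. norm (d k * rot2 \<theta> ^ k))" for \<theta> by (simp add: norm_mult norm_power d)
  define B where "B = (\<Sum>k. norm (d k))"
  have HB: "norm (H \<theta>) \<le> B" for \<theta>
    using summable_norm[OF sm] unfolding H_def B_def by (simp add: norm_mult norm_power)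
  \<comment> \<open>Only the conjugate factor of |H|^2 is expanded, so that
    \<open>integral_rot2_series\<close> evaluates each term to |d k|^2.\<close>
  define f where "f k \<theta> = cnj (d k) * (H \<theta> * cnj (rot2 \<theta> ^ k))" for k \<theta>
  have nf: "norm (f k \<theta>) \<le> norm (d k) * B" for k \<theta>
    using HB mult_left_mono[OF HB, of "norm (d k)"] by (simp add: f_def norm_mult norm_power)
  have [measurable]: "(\<lambda>\<theta>. cnj (rot2 \<theta> ^ k)) \<in> borel_measurable borel" for k
    by (rule borel_measurable_continuous_onI) (intro continuous_intros)
  have fm: "f k \<in> borel_measurable borel" for k unfolding f_def[abs_def] by measurable
  have int: "integrable lebesgue_circle (f k)" for k
    by (rule lebesgue_circle.integrable_const_bound[where B="norm (d k) * B"]) (use nf fm in auto)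
  have s1: "summable (\<lambda>k. norm (f k \<theta>))" for \<theta>
    by (rule summable_comparison_test'[OF summable_mult2[OF d, of B]]) (use nf in auto)
  have s2: "summable (\<lambda>k. \<integral>\<theta>. norm (f k \<theta>) \<partial>lebesgue_circle)"
  proof (rule summable_comparison_test'[OF summable_mult2[OF d, of B]])
    fix k
    have "(\<integral>\<theta>. norm (f k \<theta>) \<partial>lebesgue_circle) \<le> (\<integral>\<theta>. norm (d k) * B \<partial>lebesgue_circle)"
      by (rule integral_mono) (use int nf in auto)
    then show "norm (\<integral>\<theta>. norm (f k \<theta>) \<partial>lebesgue_circle) \<le> norm (d k) * B" by simp
  qed
  have "(\<lambda>k. \<integral>\<theta>. f k \<theta> \<partial>lebesgue_circle) sums (\<integral>\<theta>. (\<Sum>k. f k \<theta>) \<partial>lebesgue_circle)"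
    by (rule sums_integral[OF int]) (auto simp: s1 s2)
  moreover have "(\<integral>\<theta>. f k \<theta> \<partial>lebesgue_circle) = of_real ((norm (d k))\<^sup>2)" for k
    unfolding f_def using integral_rot2_series[OF d, of k] complex_norm_square[of "d k"]
    by (simp add: H_def[symmetric] mult.commute)
  moreover have "(\<Sum>k. f k \<theta>) = of_real ((norm (H \<theta>))\<^sup>2)" for \<theta>
  proof -
    have sc: "(\<lambda>k. cnj (d k * rot2 \<theta> ^ k)) sums cnj (H \<theta>)"
      unfolding sums_cnj H_def by (rule summable_sums, rule summable_norm_cancel, rule sm)
    have "(\<lambda>k. H \<theta> * cnj (d k * rot2 \<theta> ^ k)) sums (H \<theta> * cnj (H \<theta>))" by (rule sums_mult[OF sc])
    also have "(\<lambda>k. H \<theta> * cnj (d k * rot2 \<theta> ^ k)) = (\<lambda>k. f k \<theta>)"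
      by (simp add: f_def fun_eq_iff)
    finally show ?thesis unfolding complex_norm_square by (rule sums_unique[symmetric])
  qed
  ultimately have "(\<lambda>k. complex_of_real ((norm (d k))\<^sup>2)) sums (\<integral>\<theta>. complex_of_real ((norm (H \<theta>))\<^sup>2) \<partial>lebesgue_circle)"
    by simp
  also have "(\<integral>\<theta>. complex_of_real ((norm (H \<theta>))\<^sup>2) \<partial>lebesgue_circle) = of_real (\<integral>\<theta>. (norm (H \<theta>))\<^sup>2 \<partial>lebesgue_circle)"
    by (rule integral_complex_of_real)
  finally show ?thesis unfolding sums_of_real_iff H_def .
qed

lemma holomorphic_disc_coeffs:
  assumes f: "f holomorphic_on ball 0 1"
  obtains c where "\<And>z. norm z < 1 \<Longrightarrow> (\<lambda>k. c k * z ^ k) sums f z" "c 0 = f 0"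
    "\<And>r. 0 \<le> r \<Longrightarrow> r < 1 \<Longrightarrow> summable (\<lambda>k. norm (c k * of_real r ^ k))"
proof
  define c where "c k = (deriv ^^ k) f 0 / fact k" for k
  show s: "(\<lambda>k. c k * z ^ k) sums f z" if "norm z < 1" for z
    using holomorphic_power_series[OF f, of z] that by (simp add: c_def)
  show "c 0 = f 0" by (simp add: c_def)
  show "summable (\<lambda>k. norm (c k * of_real r ^ k))" if "0 \<le> r" "r < 1" for r
  proof (rule powser_insidea)
    show "summable (\<lambda>k. c k * of_real ((1 + r) / 2) ^ k)"
      using s[of "of_real ((1 + r) / 2)"] that by (simp add: sums_iff del: of_real_divide of_real_add)
    show "norm (complex_of_real r) < norm (complex_of_real ((1 + r) / 2))" using that by (simp del: of_real_divide of_real_add)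
  qed
qed

text \<open>The mean is the zeroth Fourier coefficient of f on the circle of radius r, hence the
  constant Taylor coefficient. That \<open>rot2\<close> runs twice around the circle does not affect
  it.\<close>

lemma holomorphic_mean_value:
  assumes f: "f holomorphic_on ball 0 1" and r: "0 \<le> r" "r < 1"
  shows "(\<integral>\<theta>. f (of_real r * rot2 \<theta>) \<partial>lebesgue_circle) = f 0"
proof -
  obtain c where c: "\<And>z. norm z < 1 \<Longrightarrow> (\<lambda>k. c k * z ^ k) sums f z" "c 0 = f 0"
    "\<And>r. 0 \<le> r \<Longrightarrow> r < 1 \<Longrightarrow> summable (\<lambda>k. norm (c k * of_real r ^ k))"
    using holomorphic_disc_coeffs[OF f] by metis
  have "f (of_real r * rot2 \<theta>) = (\<Sum>k. c k * of_real r ^ k * rot2 \<theta> ^ k)" for \<theta>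
    using c(1)[of "of_real r * rot2 \<theta>"] r by (simp add: sums_iff norm_mult power_mult_distrib mult_ac)
  then show ?thesis using integral_rot2_series[OF c(3)[OF r], of 0] c(2) by simp
qed

text \<open>The coefficients of a bounded holomorphic function are square summable, hence by Parseval the circles
  of radius \<open>r\<^sub>j \<rightarrow> 1\<close> give a sequence that is so rapidly Cauchy in the mean that it converges almost
  everywhere.\<close>

lemma bounded_holomorphic_radial_limits:
  assumes f: "f holomorphic_on ball 0 1" and b: "\<And>z. norm z < 1 \<Longrightarrow> norm (f z) \<le> 1"
  obtains r where "\<And>j::nat. 0 \<le> r j" "\<And>j. r j < 1" "r \<longlonglongrightarrow> 1"
    "AE \<theta> in lebesgue_circle. convergent (\<lambda>j. f (of_real (r j) * rot2 \<theta>))"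
proof -
  obtain c where c: "\<And>z. norm z < 1 \<Longrightarrow> (\<lambda>k. c k * z ^ k) sums f z" "c 0 = f 0"
    "\<And>r. 0 \<le> r \<Longrightarrow> r < 1 \<Longrightarrow> summable (\<lambda>k. norm (c k * of_real r ^ k))"
    using holomorphic_disc_coeffs[OF f] by metis
  have fser: "f (of_real r * rot2 \<theta>) = (\<Sum>k. c k * of_real r ^ k * rot2 \<theta> ^ k)"
    "summable (\<lambda>k. c k * of_real r ^ k * rot2 \<theta> ^ k)" if "0 \<le> r" "r < 1" for r \<theta>
    using c(1)[of "of_real r * rot2 \<theta>"] that by (auto simp: sums_iff norm_mult power_mult_distrib mult_ac)
  have fm: "(\<lambda>\<theta>. f (of_real r * rot2 \<theta>)) \<in> borel_measurable borel" if "0 \<le> r" "r < 1" for r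
    unfolding fser(1)[OF that] by (rule measurable_rot2_series[OF c(3)[OF that]])
  \<comment> \<open>Parseval on the circle of radius r bounds the damped sum by the mean of |f|^2;
    in a finite sum r may then tend to 1.\<close>
  have part: "(\<Sum>k<n. (norm (c k))\<^sup>2) \<le> 1" for n
  proof -
    have le: "(\<Sum>k<n. (norm (c k) * r ^ k)\<^sup>2) \<le> 1" if "0 \<le> r" "r < 1" for r
    proof -
      have "(\<lambda>k. (norm (c k * of_real r ^ k))\<^sup>2) sums (\<integral>\<theta>. (norm (f (of_real r * rot2 \<theta>)))\<^sup>2 \<partial>lebesgue_circle)"
        unfolding fser(1)[OF that] by (rule parseval_rot2_series[OF c(3)[OF that]])
      then have "(\<Sum>k<n. (norm (c k * of_real r ^ k))\<^sup>2) \<le> (\<integral>\<theta>. (norm (f (of_real r * rot2 \<theta>)))\<^sup>2 \<partial>lebesgue_circle)"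
        using sum_le_suminf[of "\<lambda>k. (norm (c k * of_real r ^ k))\<^sup>2" "{..<n}"] by (auto simp: sums_iff)
      also have "\<dots> \<le> (\<integral>\<theta>. 1 \<partial>lebesgue_circle)"
      proof (rule integral_mono)
        have n1: "(norm (f (of_real r * rot2 \<theta>)))\<^sup>2 \<le> 1" for \<theta>
          using b[of "of_real r * rot2 \<theta>"] that by (simp add: norm_mult power_le_one)
        show "integrable lebesgue_circle (\<lambda>\<theta>. (norm (f (of_real r * rot2 \<theta>)))\<^sup>2)"
          by (rule lebesgue_circle.integrable_const_bound[where B=1]) (use n1 fm[OF that] in auto)
      qed (use b that in \<open>auto simp: norm_mult power_le_one\<close>)
      finally show ?thesis using that by (simp add: norm_mult norm_power)
    qed
    have "((\<lambda>r. \<Sum>k<n. (norm (c k) * r ^ k)\<^sup>2) \<longlongrightarrow> (\<Sum>k<n. (norm (c k) * 1 ^ k)\<^sup>2)) (at_left 1)"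
      by (intro tendsto_intros)
    moreover have "\<forall>\<^sub>F r in at_left (1::real). (\<Sum>k<n. (norm (c k) * r ^ k)\<^sup>2) \<le> 1"
      using eventually_at_left_real[of 0 "1::real"] by (auto elim!: eventually_mono intro!: le)
    ultimately have "(\<Sum>k<n. (norm (c k) * 1 ^ k)\<^sup>2) \<le> 1"
      by (intro tendsto_upperbound) auto
    then show ?thesis by simp
  qed
  have csum: "summable (\<lambda>k. (norm (c k))\<^sup>2)"
    by (rule bounded_imp_summable[where B=1]) (use part[of "Suc _"] in \<open>auto simp: lessThan_Suc_atMost\<close>)
  \<comment> \<open>\<open>D r\<close> is the squared mean distance between f on the circle of
    radius r and the boundary function with coefficients c, which is not yet available. Tannery's
    theorem lets it tend to 0.\<close>
  define D where "D r = (\<Sum>k. (norm (c k))\<^sup>2 * (1 - r ^ k)\<^sup>2)" for r :: real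
  have bnd: "norm ((norm (c k))\<^sup>2 * (1 - r ^ k)\<^sup>2) \<le> (norm (c k))\<^sup>2" if "0 \<le> r" "r < 1" for r k
    using that power_le_one[of r k] zero_le_power[of r k] by (simp add: mult_left_le power_le_one)
  have bnd': "(norm (c k))\<^sup>2 * (1 - r ^ k)\<^sup>2 \<le> (norm (c k))\<^sup>2" if "0 \<le> r" "r < 1" for r k
    using bnd[OF that, of k] by simp
  have Dsum: "summable (\<lambda>k. (norm (c k))\<^sup>2 * (1 - r ^ k)\<^sup>2)" if "0 \<le> r" "r < 1" for r :: real
    by (rule summable_comparison_test'[OF csum]) (use bnd[OF that] in auto)
  have Dlim: "(D \<longlongrightarrow> 0) (at_left 1)"
  proof -
    have ev: "\<forall>\<^sub>F r in at_left (1::real). 0 \<le> r \<and> r < 1"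
      using eventually_at_left_real[of 0 "1::real"] by (auto elim!: eventually_mono)
    have "((\<lambda>r. \<Sum>k. (norm (c k))\<^sup>2 * (1 - r ^ k)\<^sup>2) \<longlongrightarrow> (\<Sum>k. (norm (c k))\<^sup>2 * (1 - 1 ^ k)\<^sup>2)) (at_left 1)"
    proof (rule tannerys_theorem[THEN conjunct2, THEN conjunct2])
      show "\<forall>\<^sub>F (k, r) in at_top \<times>\<^sub>F at_left 1. norm ((norm (c k))\<^sup>2 * (1 - r ^ k)\<^sup>2) \<le> (norm (c k))\<^sup>2"
        using eventually_prodI[OF always_eventually[of "\<lambda>_. True" sequentially] ev]
        by (auto elim!: eventually_mono intro!: bnd')
      show "((\<lambda>r. (norm (c k))\<^sup>2 * (1 - r ^ k)\<^sup>2) \<longlongrightarrow> (norm (c k))\<^sup>2 * (1 - 1 ^ k)\<^sup>2) (at_left 1)" for k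
        by (intro tendsto_intros)
    qed (auto intro: csum)
    then show ?thesis by (simp add: D_def[abs_def])
  qed
  \<comment> \<open>The bound 16^(-j) for mean squares leaves 4^(-j) for the differences themselves,
    which is summable; the lower bound on r forces the radii to tend to 1.\<close>
  have ex: "\<exists>r. 1 - 1 / (real j + 2) < r \<and> r < 1 \<and> D r < (1/16) ^ j" for j
  proof -
    have "\<forall>\<^sub>F r in at_left 1. D r < (1/16) ^ j" using order_tendstoD(2)[OF Dlim, of "(1/16) ^ j"] by simp
    moreover have "\<forall>\<^sub>F r in at_left (1::real). r \<in> {1 - 1 / (real j + 2)<..<1}"
      by (rule eventually_at_left_real) simp
    ultimately have "\<forall>\<^sub>F r in at_left 1. 1 - 1 / (real j + 2) < r \<and> r < 1 \<and> D r < (1/16) ^ j"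
      by eventually_elim auto
    then show ?thesis using eventually_happens[of _ "at_left (1::real)"] by (auto simp: trivial_limit_at_left_real)
  qed
  then obtain r where r: "\<And>j. 1 - 1 / (real j + 2) < r j" "\<And>j. r j < 1" "\<And>j. D (r j) < (1/16) ^ j" by metis
  have r0: "0 \<le> r j" for j
  proof -
    have "1 / (real j + 2) \<le> 1" by simp
    then show ?thesis using r(1)[of j] by linarith
  qed
  have rlim: "r \<longlonglongrightarrow> 1"
  proof (rule tendsto_sandwich[of "\<lambda>j. 1 - 1 / (real j + 2)" _ _ "\<lambda>_. 1"])
    have "(\<lambda>j. 1 / (real (j + 2))) \<longlonglongrightarrow> 0" using LIMSEQ_ignore_initial_segment[OF lim_1_over_n, of 2] by simp
    then have "(\<lambda>j. 1 - 1 / (real j + 2)) \<longlonglongrightarrow> 1 - 0" by (intro tendsto_diff) (auto simp: add.commute)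
    then show "(\<lambda>j. 1 - 1 / (real j + 2)) \<longlonglongrightarrow> 1" by simp
  qed (use r in \<open>auto intro!: always_eventually less_imp_le\<close>)
  define g where "g j \<theta> = f (of_real (r j) * rot2 \<theta>)" for j \<theta>
  have [measurable]: "g j \<in> borel_measurable borel" for j unfolding g_def[abs_def] by (rule fm[OF r0 r(2)])
  have gb: "norm (g j \<theta>) \<le> 1" for j \<theta> unfolding g_def by (rule b) (use r0 r(2) in \<open>simp add: norm_mult\<close>)
  have sq: "(\<integral>\<theta>. (norm (g (Suc j) \<theta> - g j \<theta>))\<^sup>2 \<partial>lebesgue_circle) \<le> 4 * (1/16) ^ j" for j
  proof -
    define d where "d k = c k * of_real (r (Suc j)) ^ k - c k * of_real (r j) ^ k" for k
    have ds: "summable (\<lambda>k. norm (d k))"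
      by (rule summable_comparison_test'[OF summable_add[OF c(3)[OF r0 r(2), of "Suc j"] c(3)[OF r0 r(2), of j]]])
         (use norm_triangle_ineq4 in \<open>auto simp: d_def\<close>)
    have "g (Suc j) \<theta> - g j \<theta> = (\<Sum>k. d k * rot2 \<theta> ^ k)" for \<theta>
      unfolding g_def d_def left_diff_distrib fser(1)[OF r0 r(2)]
      by (rule suminf_diff[OF fser(2)[OF r0 r(2)] fser(2)[OF r0 r(2)]])
    then have S: "(\<lambda>k. (norm (d k))\<^sup>2) sums (\<integral>\<theta>. (norm (g (Suc j) \<theta> - g j \<theta>))\<^sup>2 \<partial>lebesgue_circle)"
      using parseval_rot2_series[OF ds] by simp
    have dk: "(norm (d k))\<^sup>2 \<le> 2 * ((norm (c k))\<^sup>2 * (1 - r (Suc j) ^ k)\<^sup>2) + 2 * ((norm (c k))\<^sup>2 * (1 - r j ^ k)\<^sup>2)" for k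
    proof -
      have "d k = c k * of_real (r (Suc j) ^ k - r j ^ k)" by (simp add: d_def algebra_simps)
      then have eq: "(norm (d k))\<^sup>2 = (norm (c k))\<^sup>2 * (r (Suc j) ^ k - r j ^ k)\<^sup>2"
        by (simp add: norm_mult power_mult_distrib del: of_real_diff of_real_power)
      have "(r (Suc j) ^ k - r j ^ k)\<^sup>2 \<le> 2 * (1 - r (Suc j) ^ k)\<^sup>2 + 2 * (1 - r j ^ k)\<^sup>2"
        using zero_le_power2[of "(1 - r (Suc j) ^ k) + (1 - r j ^ k)"] by (simp add: power2_eq_square algebra_simps)
      from mult_left_mono[OF this, of "(norm (c k))\<^sup>2"] show ?thesis
        unfolding eq by (simp add: distrib_left mult.left_commute)
    qed
    have "(\<integral>\<theta>. (norm (g (Suc j) \<theta> - g j \<theta>))\<^sup>2 \<partial>lebesgue_circle) = (\<Sum>k. (norm (d k))\<^sup>2)" using S by (simp add: sums_iff)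
    also have "\<dots> \<le> (\<Sum>k. 2 * ((norm (c k))\<^sup>2 * (1 - r (Suc j) ^ k)\<^sup>2) + 2 * ((norm (c k))\<^sup>2 * (1 - r j ^ k)\<^sup>2))"
      by (rule suminf_le[OF dk]) (use S in \<open>auto simp: sums_iff intro!: summable_add summable_mult Dsum r0 r(2)\<close>)
    also have "\<dots> = 2 * D (r (Suc j)) + 2 * D (r j)"
      unfolding D_def using Dsum[OF r0 r(2)]
      by (subst suminf_add[symmetric]) (auto simp: suminf_mult intro!: summable_mult)
    also have "\<dots> \<le> 2 * (1/16) ^ Suc j + 2 * (1/16) ^ j" using r(3)[of j] r(3)[of "Suc j"] by (intro add_mono) auto
    also have "\<dots> \<le> 4 * (1/16) ^ j" by simp
    finally show ?thesis .
  qed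
  have l1: "(\<integral>\<^sup>+\<theta>. ennreal (norm (g (Suc j) \<theta> - g j \<theta>)) \<partial>lebesgue_circle) \<le> ennreal (3 * (1/4) ^ j)" for j
  proof -
    have i2: "integrable lebesgue_circle (\<lambda>\<theta>. (norm (g (Suc j) \<theta> - g j \<theta>))\<^sup>2)"
    proof (rule lebesgue_circle.integrable_const_bound[where B=4])
      have "norm (g (Suc j) \<theta> - g j \<theta>) \<le> 2" for \<theta>
        using norm_triangle_ineq4[of "g (Suc j) \<theta>" "g j \<theta>"] gb[of j \<theta>] gb[of "Suc j" \<theta>] by linarith
      then have "(norm (g (Suc j) \<theta> - g j \<theta>))\<^sup>2 \<le> 2\<^sup>2" for \<theta> by (intro power_mono) auto
      then show "AE \<theta> in lebesgue_circle. norm ((norm (g (Suc j) \<theta> - g j \<theta>))\<^sup>2) \<le> 4" by simp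
    qed simp
    \<comment> \<open>The arithmetic-geometric inequality with weights 4^(-j) and 4^j replaces
      Cauchy-Schwarz: a mean square of 4 * 16^(-j) yields a mean of at most (1 + 4) / 2 *
      4^(-j).\<close>
    have pw: "norm (g (Suc j) \<theta> - g j \<theta>) \<le> ((1/4) ^ j + 4 ^ j * (norm (g (Suc j) \<theta> - g j \<theta>))\<^sup>2) / 2" for \<theta>
    proof -
      define x where "x = norm (g (Suc j) \<theta> - g j \<theta>)"
      have "0 \<le> 4 ^ j * (x - (1/4) ^ j)\<^sup>2" by simp
      also have "\<dots> = 4 ^ j * x\<^sup>2 - 2 * x * (4 ^ j * (1/4) ^ j) + (4 ^ j * (1/4) ^ j) * (1/4) ^ j"
        by (simp add: algebra_simps power2_eq_square)
      also have "(4::real) ^ j * (1/4) ^ j = 1" by (simp flip: power_mult_distrib)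
      finally show ?thesis unfolding x_def by simp
    qed
    have int: "integrable lebesgue_circle (\<lambda>\<theta>. ((1/4) ^ j + 4 ^ j * (norm (g (Suc j) \<theta> - g j \<theta>))\<^sup>2) / 2)"
      using i2 by simp
    have "(\<integral>\<^sup>+\<theta>. ennreal (norm (g (Suc j) \<theta> - g j \<theta>)) \<partial>lebesgue_circle)
        \<le> (\<integral>\<^sup>+\<theta>. ennreal (((1/4) ^ j + 4 ^ j * (norm (g (Suc j) \<theta> - g j \<theta>))\<^sup>2) / 2) \<partial>lebesgue_circle)"
      by (intro nn_integral_mono ennreal_leI pw)
    also have "\<dots> = ennreal (\<integral>\<theta>. ((1/4) ^ j + 4 ^ j * (norm (g (Suc j) \<theta> - g j \<theta>))\<^sup>2) / 2 \<partial>lebesgue_circle)"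
      by (rule nn_integral_eq_integral[OF int]) simp
    also have "\<dots> \<le> ennreal (3 * (1/4) ^ j)"
    proof (rule ennreal_leI)
      have "(\<integral>\<theta>. ((1/4) ^ j + 4 ^ j * (norm (g (Suc j) \<theta> - g j \<theta>))\<^sup>2) / 2 \<partial>lebesgue_circle)
          = ((1/4) ^ j + 4 ^ j * (\<integral>\<theta>. (norm (g (Suc j) \<theta> - g j \<theta>))\<^sup>2 \<partial>lebesgue_circle)) / 2"
        using i2 by simp
      also have "\<dots> \<le> ((1/4) ^ j + 4 ^ j * (4 * (1/16) ^ j)) / 2"
        using sq[of j] by (intro divide_right_mono add_left_mono mult_left_mono) auto
      also have "(4::real) ^ j * (4 * (1/16) ^ j) = 4 * (1/4) ^ j"
        by (simp add: power_mult_distrib[symmetric])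
      also have "((1/4) ^ j + 4 * (1/4) ^ j) / 2 \<le> 3 * (1/4 :: real) ^ j" by simp
      finally show "(\<integral>\<theta>. ((1/4) ^ j + 4 ^ j * (norm (g (Suc j) \<theta> - g j \<theta>))\<^sup>2) / 2 \<partial>lebesgue_circle) \<le> 3 * (1/4) ^ j" .
    qed
    finally show ?thesis .
  qed
  have "(\<integral>\<^sup>+\<theta>. (\<Sum>j. ennreal (norm (g (Suc j) \<theta> - g j \<theta>))) \<partial>lebesgue_circle)
      = (\<Sum>j. \<integral>\<^sup>+\<theta>. ennreal (norm (g (Suc j) \<theta> - g j \<theta>)) \<partial>lebesgue_circle)"
    by (rule nn_integral_suminf) simp
  also have "\<dots> \<le> (\<Sum>j. ennreal (3 * (1/4) ^ j))" by (intro suminf_le l1) auto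
  also have "\<dots> = ennreal (\<Sum>j. 3 * (1/4) ^ j)"
    by (rule suminf_ennreal2) (auto intro!: summable_mult summable_geometric)
  finally have "(\<integral>\<^sup>+\<theta>. (\<Sum>j. ennreal (norm (g (Suc j) \<theta> - g j \<theta>))) \<partial>lebesgue_circle) \<noteq> \<infinity>"
    by (auto simp: top_unique)
  then have "AE \<theta> in lebesgue_circle. (\<Sum>j. ennreal (norm (g (Suc j) \<theta> - g j \<theta>))) \<noteq> \<infinity>"
    by (intro nn_integral_PInf_AE) simp
  then have "AE \<theta> in lebesgue_circle. convergent (\<lambda>j. g j \<theta>)"
  proof eventually_elim
    case (elim \<theta>)
    then have "summable (\<lambda>j. norm (g (Suc j) \<theta> - g j \<theta>))" by (intro summable_suminf_not_top) auto
    then have "summable (\<lambda>j. g (Suc j) \<theta> - g j \<theta>)" by (rule summable_norm_cancel)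
    then have "convergent (\<lambda>n. \<Sum>j<n. g (Suc j) \<theta> - g j \<theta>)" by (simp add: summable_iff_convergent)
    then have "convergent (\<lambda>n. g n \<theta> - g 0 \<theta>)" using sum_lessThan_telescope[of "\<lambda>j. g j \<theta>"] by simp
    then show ?case using convergent_add_const_iff[of "- g 0 \<theta>" "\<lambda>n. g n \<theta>"] by simp
  qed
  then show thesis using that[OF r0 r(2) rlim] by (simp add: g_def)
qed

text \<open>The modulus of the derivative of \<open>mob \<kappa>\<close> at \<zeta>; on the unit
  circle, the rate at which the projective action contracts or expands.\<close>

definition mob_rate :: "real \<Rightarrow> complex \<Rightarrow> real" where
  "mob_rate \<kappa> \<zeta> = (1 - \<kappa>\<^sup>2) / (norm (1 + of_real \<kappa> * \<zeta>))\<^sup>2"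

lemma mob_rate_pos:
  assumes "0 < \<kappa>" "\<kappa> < 1" "norm \<zeta> \<le> 1"
  shows "0 < mob_rate \<kappa> \<zeta>"
  using mob_denom(4)[OF assms] assms by (simp add: mob_rate_def power_less_one_iff)

lemma ln_mob_rate:
  assumes "0 < \<kappa>" "\<kappa> < 1" "norm \<zeta> \<le> 1"
  shows "ln (mob_rate \<kappa> \<zeta>) = ln (1 - \<kappa>\<^sup>2) - 2 * ln (norm (1 + of_real \<kappa> * \<zeta>))"
proof -
  have "0 < 1 - \<kappa>\<^sup>2" using assms by (simp add: power_less_one_iff)
  then show ?thesis using mob_denom(4)[OF assms] by (simp add: mob_rate_def ln_div ln_realpow)
qed

text \<open>The lower bound 1 - \<kappa> dominates both sides because (1 + \<kappa>) * (1 -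
  \<kappa>) is at most 1. It serves as the dominating constant for passing logarithms to the
  boundary.\<close>

lemma abs_ln_mob_denom_le:
  fixes \<zeta> :: complex
  assumes "0 < \<kappa>" "\<kappa> < 1" "norm \<zeta> \<le> 1"
  shows "\<bar>ln (norm (1 + of_real \<kappa> * \<zeta>))\<bar> \<le> - ln (1 - \<kappa>)"
proof -
  note d = mob_denom[OF assms]
  have pos: "0 < norm (1 + of_real \<kappa> * \<zeta>)" using d(4) by simp
  have l1: "ln (1 - \<kappa>) \<le> ln (norm (1 + of_real \<kappa> * \<zeta>))" using d(2) pos assms by (subst ln_le_cancel_iff) auto
  have "ln (norm (1 + of_real \<kappa> * \<zeta>)) \<le> ln (1 + \<kappa>)" using d(3) pos assms by (subst ln_le_cancel_iff) auto
  moreover have "ln (1 + \<kappa>) + ln (1 - \<kappa>) \<le> 0"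
  proof -
    have "ln (1 + \<kappa>) + ln (1 - \<kappa>) = ln ((1 + \<kappa>) * (1 - \<kappa>))" using assms by (simp add: ln_mult)
    also have "(1 + \<kappa>) * (1 - \<kappa>) \<le> 1" using assms by (simp add: algebra_simps)
    then have "ln ((1 + \<kappa>) * (1 - \<kappa>)) \<le> ln 1" using assms by (subst ln_le_cancel_iff) auto
    finally show ?thesis by simp
  qed
  ultimately show ?thesis using l1 by linarith
qed

lemma mob_measurable [measurable]:
  assumes [measurable]: "f \<in> borel_measurable M"
  shows "(\<lambda>x. mob \<kappa> (f x)) \<in> borel_measurable M" "(\<lambda>x. mob_rate \<kappa> (f x)) \<in> borel_measurable M"
  unfolding mob_def mob_rate_def by measurable

text \<open>\<open>\<psi>\<close> is the boundary function of the holomorphic invariant graph. The mean value property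
  makes the mean of \<open>ln |1 + \<kappa> s f(s)|\<close> vanish, so the cocycle \<open>mob_rate\<close> has negative mean; as it also
  governs \<open>1 - |\<psi>|\<^sup>2\<close>, recurrence forces \<open>|\<psi>| = 1\<close>.\<close>

theorem unimodular_invariant_graph:
  assumes irr: "\<omega> \<notin> \<rat>" and k: "0 < \<kappa>" "\<kappa> < 1"
  obtains \<psi> G c where "\<psi> \<in> borel_measurable borel" "G \<in> sets borel" "AE \<theta> in lebesgue_circle. \<theta> \<in> G"
    "\<And>\<theta>. norm (\<psi> \<theta>) = 1"
    "\<And>\<theta>. \<theta> \<in> G \<Longrightarrow> \<theta> + to_circle \<omega> \<in> G"
    "\<And>\<theta>. \<theta> \<in> G \<Longrightarrow> \<psi> (\<theta> + to_circle \<omega>) = mob \<kappa> (rot2 \<theta> * \<psi> \<theta>)"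
    "0 < c"
    "\<And>\<theta>. \<theta> \<in> G \<Longrightarrow> \<exists>B. \<forall>n. birkhoff_sum \<omega> (\<lambda>\<theta>. ln (mob_rate \<kappa> (rot2 \<theta> * \<psi> \<theta>))) n \<theta> \<le> B - c * real n"
proof -
  define T where "T \<theta> = \<theta> + to_circle \<omega>" for \<theta>
  define \<rho> where "\<rho> = rot2 (to_circle \<omega>)"
  have \<rho>: "norm \<rho> = 1" by (simp add: \<rho>_def)
  obtain f where f: "f holomorphic_on ball 0 1" "\<And>s. norm s < 1 \<Longrightarrow> norm (f s) \<le> 1"
    "\<And>s. norm s < 1 \<Longrightarrow> f (\<rho> * s) = mob \<kappa> (s * f s)"
    using holomorphic_invariant_graph[OF k \<rho>] by metis
  obtain r where r: "\<And>j::nat. 0 \<le> r j" "\<And>j. r j < 1" "r \<longlonglongrightarrow> 1"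
    "AE \<theta> in lebesgue_circle. convergent (\<lambda>j. f (of_real (r j) * rot2 \<theta>))"
    using bounded_holomorphic_radial_limits[OF f(1,2)] by metis
  have fcont: "continuous_on (ball 0 1) f" using f(1) holomorphic_on_imp_continuous_on by blast
  define g where "g j \<theta> = f (of_real (r j) * rot2 \<theta>)" for j \<theta>
  have rn: "norm (of_real (r j) * rot2 \<theta>) < 1" for j \<theta> using r by (simp add: norm_mult)
  have [measurable]: "g j \<in> borel_measurable borel" for j
    unfolding g_def[abs_def]
    by (rule borel_measurable_continuous_onI, rule continuous_on_compose2[OF fcont])
       (use rn in \<open>auto intro!: continuous_intros\<close>)
  have gb: "norm (g j \<theta>) \<le> 1" for j \<theta> unfolding g_def by (rule f(2)[OF rn])
  have gT: "g j (T \<theta>) = mob \<kappa> (of_real (r j) * rot2 \<theta> * g j \<theta>)" for j \<theta>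
    using f(3)[OF rn, of j \<theta>] by (simp add: g_def T_def rot2_add \<rho>_def mult_ac)
  \<comment> \<open>Convergence is demanded along the whole forward orbit, which makes the set
    forward invariant and still of full measure.\<close>
  define G0 where "G0 = {\<theta>. \<forall>n::nat. convergent (\<lambda>j. g j (\<theta> + to_circle (real n * \<omega>)))}"
  have G0m [measurable]: "G0 \<in> sets borel"
  proof -
    have "G0 = {\<theta>. \<forall>n::nat. Cauchy (\<lambda>j. g j (\<theta> + to_circle (real n * \<omega>)))}"
      unfolding G0_def by (simp add: Cauchy_convergent_iff)
    also have "\<dots> \<in> sets borel" by measurable
    finally show ?thesis .
  qed
  have G0AE: "AE \<theta> in lebesgue_circle. \<theta> \<in> G0"
    unfolding G0_def mem_Collect_eq AE_all_countable
    using AE_circle_shift[OF r(4)] by (simp add: g_def)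
  have G0T: "T \<theta> \<in> G0" if "\<theta> \<in> G0" for \<theta>
    unfolding G0_def mem_Collect_eq
  proof
    fix n :: nat
    have "T \<theta> + to_circle (real n * \<omega>) = \<theta> + to_circle (real (Suc n) * \<omega>)"
      by (simp add: T_def distrib_right to_circle_add algebra_simps)
    then show "convergent (\<lambda>j. g j (T \<theta> + to_circle (real n * \<omega>)))"
      using that unfolding G0_def by (metis mem_Collect_eq)
  qed
  \<comment> \<open>The default value 1 keeps the norm at most 1 everywhere, so that the estimates
    for \<open>mob\<close> apply at every \<theta>.\<close>
  define \<psi>0 where "\<psi>0 \<theta> = (if \<theta> \<in> G0 then lim (\<lambda>j. g j \<theta>) else 1)" for \<theta>
  have [measurable]: "\<psi>0 \<in> borel_measurable borel" unfolding \<psi>0_def[abs_def] by measurable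
  have conv: "(\<lambda>j. g j \<theta>) \<longlonglongrightarrow> \<psi>0 \<theta>" if "\<theta> \<in> G0" for \<theta>
  proof -
    have "convergent (\<lambda>j. g j (\<theta> + to_circle (real 0 * \<omega>)))" using that unfolding G0_def by blast
    then show ?thesis using that by (simp add: \<psi>0_def convergent_LIMSEQ_iff)
  qed
  have nb: "norm (\<psi>0 \<theta>) \<le> 1" for \<theta>
  proof (cases "\<theta> \<in> G0")
    case True
    show ?thesis by (rule LIMSEQ_le_const2[OF tendsto_norm[OF conv[OF True]]]) (use gb in blast)
  qed (simp add: \<psi>0_def)
  have nb': "norm (rot2 \<theta> * \<psi>0 \<theta>) \<le> 1" for \<theta> using nb by (simp add: norm_mult)
  have rg: "norm (of_real (r j) * rot2 \<theta> * g j \<theta>) \<le> 1" for j \<theta>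
    using gb[of j \<theta>] r(1,2)[of j] by (simp add: norm_mult mult_le_one less_imp_le)
  have rlim: "(\<lambda>j. of_real (r j) * rot2 \<theta> * g j \<theta>) \<longlonglongrightarrow> rot2 \<theta> * \<psi>0 \<theta>" if "\<theta> \<in> G0" for \<theta>
  proof -
    have "(\<lambda>j. of_real (r j) * rot2 \<theta> * g j \<theta>) \<longlonglongrightarrow> of_real 1 * rot2 \<theta> * \<psi>0 \<theta>"
      by (intro tendsto_intros conv[OF that] r(3))
    then show ?thesis by simp
  qed
  have \<psi>0T: "\<psi>0 (T \<theta>) = mob \<kappa> (rot2 \<theta> * \<psi>0 \<theta>)" if "\<theta> \<in> G0" for \<theta>
  proof (rule LIMSEQ_unique)
    show "(\<lambda>j. g j (T \<theta>)) \<longlonglongrightarrow> \<psi>0 (T \<theta>)" by (rule conv[OF G0T[OF that]])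
    show "(\<lambda>j. g j (T \<theta>)) \<longlonglongrightarrow> mob \<kappa> (rot2 \<theta> * \<psi>0 \<theta>)"
      unfolding gT mob_def by (intro tendsto_intros rlim[OF that] mob_denom(4)[OF k nb'])
  qed
  define u where "u \<theta> = ln (mob_rate \<kappa> (rot2 \<theta> * \<psi>0 \<theta>))" for \<theta>
  define l where "l \<theta> = ln (norm (1 + of_real \<kappa> * (rot2 \<theta> * \<psi>0 \<theta>)))" for \<theta>
  have [measurable]: "u \<in> borel_measurable borel" "l \<in> borel_measurable borel"
    unfolding u_def[abs_def] l_def[abs_def] by measurable
  have lb: "\<bar>l \<theta>\<bar> \<le> - ln (1 - \<kappa>)" for \<theta> unfolding l_def by (rule abs_ln_mob_denom_le[OF k nb'])
  have ul: "u \<theta> = ln (1 - \<kappa>\<^sup>2) - 2 * l \<theta>" for \<theta> unfolding u_def l_def by (rule ln_mob_rate[OF k nb'])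
  have l0: "(\<integral>\<theta>. l \<theta> \<partial>lebesgue_circle) = 0"
  proof -
    define lj where "lj j \<theta> = ln (norm (1 + of_real \<kappa> * (of_real (r j) * rot2 \<theta> * g j \<theta>)))" for j \<theta>
    have [measurable]: "lj j \<in> borel_measurable borel" for j unfolding lj_def[abs_def] by measurable
    have "(\<lambda>j. \<integral>\<theta>. lj j \<theta> \<partial>lebesgue_circle) \<longlonglongrightarrow> (\<integral>\<theta>. l \<theta> \<partial>lebesgue_circle)"
    proof (rule integral_dominated_convergence[where w="\<lambda>_. - ln (1 - \<kappa>)"])
      show "AE \<theta> in lebesgue_circle. (\<lambda>j. lj j \<theta>) \<longlonglongrightarrow> l \<theta>"
        using G0AE
      proof eventually_elim
        case (elim \<theta>)
        show ?case unfolding lj_def l_def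
          using mob_denom(4)[OF k nb'[of \<theta>]] by (intro tendsto_intros rlim[OF elim]) simp
      qed
      show "AE \<theta> in lebesgue_circle. norm (lj j \<theta>) \<le> - ln (1 - \<kappa>)" for j
        unfolding lj_def using abs_ln_mob_denom_le[OF k rg] by simp
    qed (auto intro: lebesgue_circle.integrable_const)
    moreover have "(\<integral>\<theta>. lj j \<theta> \<partial>lebesgue_circle) = 0" for j
    proof -
      \<comment> \<open>The real part of the argument is at least 1 - \<kappa>, so the principal
        logarithm is holomorphic; the factor s gives h 0 = 0, which is the mean.\<close>
      define h where "h s = Ln (1 + of_real \<kappa> * (s * f s))" for s
      have fs: "norm (s * f s) \<le> 1" if "norm s < 1" for s
        using f(2)[OF that] that by (simp add: norm_mult mult_le_one)
      have re: "0 < Re (1 + of_real \<kappa> * (s * f s))" if "norm s < 1" for s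
        using mob_denom(1)[OF k fs[OF that]] k by linarith
      have hol: "h holomorphic_on ball 0 1"
        unfolding h_def
      proof (intro holomorphic_intros f(1))
        fix s :: complex assume "s \<in> ball 0 1"
        then have "0 < Re (1 + of_real \<kappa> * (s * f s))" using re by simp
        then show "1 + of_real \<kappa> * (s * f s) \<notin> \<real>\<^sub>\<le>\<^sub>0" using complex_nonpos_Reals_iff by fastforce
      qed
      have h0: "(\<integral>\<theta>. h (of_real (r j) * rot2 \<theta>) \<partial>lebesgue_circle) = 0"
        using holomorphic_mean_value[OF hol r(1,2)] by (simp add: h_def)
      have lh: "lj j \<theta> = Re (h (of_real (r j) * rot2 \<theta>))" for \<theta>
        using mob_denom(4)[OF k fs[OF rn]] by (simp add: lj_def h_def g_def Re_Ln mult.assoc)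
      have hint: "integrable lebesgue_circle (\<lambda>\<theta>. h (of_real (r j) * rot2 \<theta>))"
      proof (rule lebesgue_circle.integrable_const_bound[where B="- ln (1 - \<kappa>) + pi"])
        show "(\<lambda>\<theta>. h (of_real (r j) * rot2 \<theta>)) \<in> borel_measurable lebesgue_circle"
          unfolding measurable_cong_sets[OF sets_lebesgue_circle refl]
          by (rule borel_measurable_continuous_onI, rule continuous_on_compose2[OF holomorphic_on_imp_continuous_on[OF hol]])
             (use rn in \<open>auto intro!: continuous_intros\<close>)
        show "AE \<theta> in lebesgue_circle. norm (h (of_real (r j) * rot2 \<theta>)) \<le> - ln (1 - \<kappa>) + pi"
        proof (rule AE_I2)
          fix \<theta>
          have nz: "1 + of_real \<kappa> * (of_real (r j) * rot2 \<theta> * f (of_real (r j) * rot2 \<theta>)) \<noteq> 0"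
            using mob_denom(4)[OF k fs[OF rn]] .
          have "\<bar>Im (h (of_real (r j) * rot2 \<theta>))\<bar> \<le> pi"
            unfolding h_def using Im_Ln_le_pi[OF nz] mpi_less_Im_Ln[OF nz] by linarith
          moreover have "\<bar>Re (h (of_real (r j) * rot2 \<theta>))\<bar> \<le> - ln (1 - \<kappa>)"
            using abs_ln_mob_denom_le[OF k rg, of j \<theta>] lh[of \<theta>] by (simp add: lj_def)
          ultimately show "norm (h (of_real (r j) * rot2 \<theta>)) \<le> - ln (1 - \<kappa>) + pi"
            using cmod_le[of "h (of_real (r j) * rot2 \<theta>)"] by linarith
        qed
      qed
      show ?thesis unfolding lh using integral_Re[OF hint] h0 by simp
    qed
    ultimately show ?thesis using LIMSEQ_unique[of "\<lambda>_. 0::real"] by fastforce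
  qed
  have k2: "0 < 1 - \<kappa>\<^sup>2" "1 - \<kappa>\<^sup>2 < 1" using k by (auto simp: power_less_one_iff)
  \<comment> \<open>Half of the available rate, so that the mean of u lies strictly below -
    c.\<close>
  define c where "c = - ln (1 - \<kappa>\<^sup>2) / 2"
  have c: "0 < c" using k2 by (simp add: c_def)
  have intl: "integrable lebesgue_circle l"
    by (rule lebesgue_circle.integrable_const_bound[where B="- ln (1 - \<kappa>)"]) (use lb in auto)
  have "(\<integral>\<theta>. u \<theta> \<partial>lebesgue_circle) = ln (1 - \<kappa>\<^sup>2)"
    unfolding ul using intl l0 by (subst Bochner_Integration.integral_diff) auto
  then have "(\<integral>\<theta>. u \<theta> \<partial>lebesgue_circle) < - c" using c by (simp add: c_def)
  moreover have ub: "\<bar>u \<theta>\<bar> \<le> \<bar>ln (1 - \<kappa>\<^sup>2)\<bar> + 2 * - ln (1 - \<kappa>)" for \<theta> using ul[of \<theta>] lb[of \<theta>] by linarith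
  ultimately have decay: "AE \<theta> in lebesgue_circle. \<exists>B. \<forall>n. birkhoff_sum \<omega> u n \<theta> \<le> B - c * real n"
    using birkhoff_sum_linear_decay[OF irr _ ub] by simp
  define D where "D \<theta> = 1 - (norm (\<psi>0 \<theta>))\<^sup>2" for \<theta>
  have [measurable]: "D \<in> borel_measurable borel" unfolding D_def[abs_def] by measurable
  have Db: "0 \<le> D \<theta>" "D \<theta> \<le> 1" for \<theta> using nb[of \<theta>] by (auto simp: D_def power_le_one)
  have DT: "D (T \<theta>) = D \<theta> * exp (u \<theta>)" if "\<theta> \<in> G0" for \<theta>
    unfolding D_def \<psi>0T[OF that] one_minus_norm_mob[OF k nb'] u_def exp_ln[OF mob_rate_pos[OF k nb']]
    by (simp add: mob_rate_def norm_mult)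
  have Tn: "\<theta> + to_circle (real (Suc n) * \<omega>) = T \<theta> + to_circle (real n * \<omega>)" for n \<theta>
    by (simp add: T_def distrib_right to_circle_add algebra_simps)
  have DTn: "D (\<theta> + to_circle (real n * \<omega>)) = D \<theta> * exp (birkhoff_sum \<omega> u n \<theta>)" if "\<theta> \<in> G0" for n \<theta>
    using that
  proof (induction n arbitrary: \<theta>)
    case (Suc n)
    show ?case using Suc.IH[OF G0T[OF Suc.prems]] DT[OF Suc.prems]
      unfolding Tn birkhoff_sum_Suc by (simp add: exp_add T_def)
  qed (simp add: birkhoff_sum_def)
  \<comment> \<open>Rotation invariance makes all these integrals equal to that of D, while the
    integrand decays almost everywhere by \<open>DTn\<close>; hence D has integral 0.\<close>
  have "(\<lambda>n. \<integral>\<theta>. D (\<theta> + to_circle (real n * \<omega>)) \<partial>lebesgue_circle) \<longlonglongrightarrow> (\<integral>\<theta>. 0 \<partial>lebesgue_circle)"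
  proof (rule integral_dominated_convergence[where w="\<lambda>_. 1"])
    show "AE \<theta> in lebesgue_circle. (\<lambda>n. D (\<theta> + to_circle (real n * \<omega>))) \<longlonglongrightarrow> 0"
      using G0AE decay
    proof eventually_elim
      case (elim \<theta>)
      then obtain B where B: "\<And>n. birkhoff_sum \<omega> u n \<theta> \<le> B - c * real n" by blast
      have "(\<lambda>n. exp B * exp (- c) ^ n) \<longlonglongrightarrow> exp B * 0"
        using c by (intro tendsto_intros LIMSEQ_power_zero) auto
      then have lim: "(\<lambda>n. exp B * exp (- c) ^ n) \<longlonglongrightarrow> 0" by simp
      show ?case
      proof (rule tendsto_sandwich[OF _ _ tendsto_const lim])
        have "D (\<theta> + to_circle (real n * \<omega>)) \<le> exp B * exp (- c) ^ n" for n
        proof -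
          have "D \<theta> * exp (birkhoff_sum \<omega> u n \<theta>) \<le> 1 * exp (B - c * real n)"
            using Db[of \<theta>] B[of n] by (intro mult_mono) auto
          also have "\<dots> = exp B * exp (- c) ^ n"
            by (simp add: exp_diff exp_minus field_simps exp_of_nat_mult[symmetric] flip: exp_of_nat2_mult)
          finally show ?thesis using DTn elim by simp
        qed
        then show "\<forall>\<^sub>F n in sequentially. D (\<theta> + to_circle (real n * \<omega>)) \<le> exp B * exp (- c) ^ n" by simp
      qed (use Db in simp)
    qed
  qed (use Db in \<open>auto intro: lebesgue_circle.integrable_const\<close>)
  then have D0: "(\<integral>\<theta>. D \<theta> \<partial>lebesgue_circle) = 0"
    using LIMSEQ_unique[OF tendsto_const] by (auto simp: integral_circle_shift)
  have Dint: "integrable lebesgue_circle D"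
    by (rule lebesgue_circle.integrable_const_bound[where B=1]) (use Db in auto)
  have DAE: "AE \<theta> in lebesgue_circle. D \<theta> = 0"
    using integral_nonneg_eq_0_iff_AE[OF Dint] D0 Db by simp
  have unim: "norm (\<psi>0 \<theta>) = 1" if "D \<theta> = 0" for \<theta>
    using that nb[of \<theta>] by (simp add: D_def power2_eq_1_iff) (metis norm_ge_zero not_one_le_zero neg_0_le_iff_le)
  define \<psi> where "\<psi> \<theta> = (if D \<theta> = 0 then \<psi>0 \<theta> else 1)" for \<theta>
  \<comment> \<open>Natural bounds B make the condition a countable union, so that E is Borel. All
    three conditions persist under the rotation.\<close>
  define E where "E = {\<theta>\<in>G0. D \<theta> = 0 \<and> (\<exists>B::nat. \<forall>n. birkhoff_sum \<omega> u n \<theta> \<le> B - c * real n)}"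
  have ET: "T \<theta> \<in> E" if "\<theta> \<in> E" for \<theta>
  proof -
    have \<theta>: "\<theta> \<in> G0" "D \<theta> = 0" using that by (auto simp: E_def)
    obtain B :: nat where "\<forall>n. birkhoff_sum \<omega> u n \<theta> \<le> B - c * real n"
      using \<open>\<theta> \<in> E\<close> unfolding E_def by auto
    then have B: "birkhoff_sum \<omega> u n \<theta> \<le> B - c * real n" for n by blast
    obtain B' :: nat where B': "real B - u \<theta> \<le> B'" using real_arch_simple by blast
    have "birkhoff_sum \<omega> u n (T \<theta>) \<le> B' - c * real n" for n
      using B[of "Suc n"] B' c unfolding birkhoff_sum_Suc T_def by (simp add: algebra_simps)
    then show ?thesis using G0T[OF \<theta>(1)] DT[OF \<theta>(1)] \<theta>(2) unfolding E_def by auto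
  qed
  have En: "\<theta> + to_circle (real n * \<omega>) \<in> E" if "\<theta> \<in> E" for n \<theta>
    using that
  proof (induction n arbitrary: \<theta>)
    case (Suc n) then show ?case unfolding Tn using ET by blast
  qed simp
  show thesis
  proof (rule that[of \<psi> E c])
    show "\<psi> \<in> borel_measurable borel" unfolding \<psi>_def[abs_def] by measurable
    show "E \<in> sets borel" unfolding E_def by measurable
    show "AE \<theta> in lebesgue_circle. \<theta> \<in> E" using G0AE DAE decay
    proof eventually_elim
      case (elim \<theta>)
      then obtain B where B: "\<And>n. birkhoff_sum \<omega> u n \<theta> \<le> B - c * real n" by blast
      obtain B' :: nat where "B \<le> B'" using real_arch_simple by blast
      then have "\<exists>B::nat. \<forall>n. birkhoff_sum \<omega> u n \<theta> \<le> B - c * real n"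
        using B by (intro exI[of _ B']) (meson diff_right_mono order.trans)
      with elim show ?case unfolding E_def by blast
    qed
    show "norm (\<psi> \<theta>) = 1" for \<theta> using unim by (simp add: \<psi>_def)
    show "0 < c" by (rule c)
    fix \<theta> assume \<theta>: "\<theta> \<in> E"
    show "\<theta> + to_circle \<omega> \<in> E" using ET[OF \<theta>] by (simp add: T_def)
    show "\<psi> (\<theta> + to_circle \<omega>) = mob \<kappa> (rot2 \<theta> * \<psi> \<theta>)"
      using \<theta> ET[OF \<theta>] \<psi>0T[of \<theta>] unfolding E_def \<psi>_def by (auto simp: T_def)
    have "birkhoff_sum \<omega> (\<lambda>\<theta>. ln (mob_rate \<kappa> (rot2 \<theta> * \<psi> \<theta>))) n \<theta> = birkhoff_sum \<omega> u n \<theta>" for n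
      unfolding birkhoff_sum_def
      by (rule sum.cong[OF refl]) (use En[OF \<theta>] in \<open>auto simp: E_def \<psi>_def u_def\<close>)
    then show "\<exists>B. \<forall>n. birkhoff_sum \<omega> (\<lambda>\<theta>. ln (mob_rate \<kappa> (rot2 \<theta> * \<psi> \<theta>))) n \<theta> \<le> B - c * real n"
      using \<theta> unfolding E_def by auto
  qed
qed

section \<open>The planar cocycle\<close>

definition cv :: "real^2 \<Rightarrow> complex" where "cv \<xi> = Complex (\<xi> $ 1) (\<xi> $ 2)"
definition vc :: "complex \<Rightarrow> real^2" where "vc z = vector [Re z, Im z]"

lemma cv_vc [simp]: "cv (vc z) = z" by (simp add: cv_def vc_def complex_eq_iff)
lemma vc_cv [simp]: "vc (cv \<xi>) = \<xi>" by (simp add: cv_def vc_def vec_eq_iff forall_2)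
lemma cv_eq_iff [simp]: "cv \<xi> = cv \<eta> \<longleftrightarrow> \<xi> = \<eta>" by (metis vc_cv)
lemma vc_eq_iff [simp]: "vc z = vc w \<longleftrightarrow> z = w" by (metis cv_vc)
lemma norm_cv [simp]: "norm (cv \<xi>) = norm \<xi>"
  by (simp add: cv_def norm_complex_def norm_vec_def L2_set_def sum_2)
lemma norm_vc [simp]: "norm (vc z) = norm z" by (metis cv_vc norm_cv)

lemma linear_cv: "linear cv" by (rule linearI) (simp_all add: cv_def complex_eq_iff)
lemma linear_vc: "linear vc"
  by (rule linearI) (simp_all add: vc_def vec_eq_iff forall_2)
lemmas cv_simps [simp] = linear_add[OF linear_cv] linear_diff[OF linear_cv] linear_0[OF linear_cv] linear_neg[OF linear_cv] linear_scale[OF linear_cv]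
lemmas vc_simps [simp] = linear_add[OF linear_vc] linear_diff[OF linear_vc] linear_0[OF linear_vc] linear_neg[OF linear_vc] linear_scale[OF linear_vc]
lemma cv_eq_0 [simp]: "cv \<xi> = 0 \<longleftrightarrow> \<xi> = 0" by (metis cv_simps(3) cv_eq_iff)
lemma vc_eq_0 [simp]: "vc z = 0 \<longleftrightarrow> z = 0" by (metis vc_simps(3) vc_eq_iff)

lemma bounded_linear_cv: "bounded_linear cv" using linear_cv by (simp add: linear_conv_bounded_linear)
lemma bounded_linear_vc: "bounded_linear vc" using linear_vc by (simp add: linear_conv_bounded_linear)
lemmas continuous_on_cv [continuous_intros] = bounded_linear.continuous_on[OF bounded_linear_cv]
lemmas continuous_on_vc [continuous_intros] = bounded_linear.continuous_on[OF bounded_linear_vc]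

section \<open>The linear part of the fibre maps\<close>

definition stretch :: "real \<Rightarrow> complex \<Rightarrow> complex" where
  "stretch \<gamma> w = Complex (Re w) (\<gamma> * Im w)"

text \<open>The splitting into a complex linear and an antilinear part. The quotient of the two
  coefficients, (1 - \<gamma>) / (1 + \<gamma>), becomes the parameter of the Moebius map.\<close>

lemma stretch_eq: "stretch \<gamma> w = of_real ((1 + \<gamma>) / 2) * w + of_real ((1 - \<gamma>) / 2) * cnj w"
  by (simp add: stretch_def complex_eq_iff field_simps)

lemma continuous_on_stretch [continuous_intros]:
  "continuous_on S f \<Longrightarrow> continuous_on S (\<lambda>x. stretch \<gamma> (f x))"
  unfolding stretch_eq by (intro continuous_intros)

definition flin :: "real \<Rightarrow> circle \<Rightarrow> real^2 \<Rightarrow> real^2" where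
  "flin \<gamma> \<theta> \<xi> = vc (stretch \<gamma> (cnj (circle_cis \<theta>) * cv \<xi>))"

definition flin_inv :: "real \<Rightarrow> circle \<Rightarrow> real^2 \<Rightarrow> real^2" where
  "flin_inv \<gamma> \<theta> \<xi> = vc (circle_cis \<theta> * stretch (1 / \<gamma>) (cv \<xi>))"

lemma Lam_eq: "Lam \<omega> \<beta> \<gamma> (\<theta>, \<xi>) = (\<theta> + to_circle \<omega>, (\<beta> / (1 + (norm \<xi>)\<^sup>2)) *\<^sub>R flin \<gamma> \<theta> \<xi>)"
proof -
  have "(vector [vector [1, 0], vector [0, \<gamma>]] ** R_mat \<theta>) *v \<xi> = flin \<gamma> \<theta> \<xi>"
    by (simp add: vec_eq_iff forall_2 flin_def vc_def stretch_def cv_def circle_cis_def R_mat_def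
        matrix_vector_mult_def matrix_matrix_mult_def sum_2 algebra_simps)
  then show ?thesis by (simp add: Lam_def)
qed

lemma circle_cis_cnj: "circle_cis \<theta> * cnj (circle_cis \<theta>) = 1" "cnj (circle_cis \<theta>) * circle_cis \<theta> = 1"
  using complex_norm_square[of "circle_cis \<theta>"] by (auto simp: mult.commute)

lemma flin_flin_inv [simp]: "\<gamma> \<noteq> 0 \<Longrightarrow> flin \<gamma> \<theta> (flin_inv \<gamma> \<theta> \<xi>) = \<xi>"
  unfolding flin_def flin_inv_def
  by (simp add: mult.assoc[symmetric] circle_cis_cnj) (simp add: stretch_def)

lemma flin_inv_flin [simp]: "\<gamma> \<noteq> 0 \<Longrightarrow> flin_inv \<gamma> \<theta> (flin \<gamma> \<theta> \<xi>) = \<xi>"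
proof -
  assume "\<gamma> \<noteq> 0"
  then have "stretch (1/\<gamma>) (stretch \<gamma> w) = w" for w by (simp add: stretch_def complex_eq_iff)
  then show ?thesis unfolding flin_def flin_inv_def
    by (simp add: mult.assoc[symmetric] circle_cis_cnj)
qed

lemma linear_stretch: "linear (stretch \<gamma>)"
  by (rule linearI) (simp_all add: stretch_def complex_eq_iff algebra_simps)

lemma linear_mult_complex: "linear (\<lambda>z. c * z)" for c :: complex
  by (rule linearI) (simp_all add: algebra_simps)

lemma linear_flin: "linear (flin \<gamma> \<theta>)"
proof -
  have "flin \<gamma> \<theta> = vc \<circ> (stretch \<gamma> \<circ> ((\<lambda>z. cnj (circle_cis \<theta>) * z) \<circ> cv))" by (auto simp: flin_def)
  then show ?thesis by (metis linear_compose linear_vc linear_stretch linear_mult_complex linear_cv)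
qed

lemma linear_flin_inv: "linear (flin_inv \<gamma> \<theta>)"
proof -
  have "flin_inv \<gamma> \<theta> = vc \<circ> ((\<lambda>z. circle_cis \<theta> * z) \<circ> (stretch (1/\<gamma>) \<circ> cv))" by (auto simp: flin_inv_def)
  then show ?thesis by (metis linear_compose linear_vc linear_stretch linear_mult_complex linear_cv)
qed

lemmas flin_simps [simp] = linear_add[OF linear_flin] linear_diff[OF linear_flin] linear_0[OF linear_flin] linear_neg[OF linear_flin] linear_scale[OF linear_flin]
lemmas flin_inv_simps [simp] = linear_add[OF linear_flin_inv] linear_diff[OF linear_flin_inv] linear_0[OF linear_flin_inv] linear_neg[OF linear_flin_inv] linear_scale[OF linear_flin_inv]

lemma flin_eq_0 [simp]: "\<gamma> \<noteq> 0 \<Longrightarrow> flin \<gamma> \<theta> \<xi> = 0 \<longleftrightarrow> \<xi> = 0"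
  by (metis flin_inv_flin flin_inv_simps(3) flin_simps(3))
lemma flin_inv_eq_0 [simp]: "\<gamma> \<noteq> 0 \<Longrightarrow> flin_inv \<gamma> \<theta> \<xi> = 0 \<longleftrightarrow> \<xi> = 0"
  by (metis flin_flin_inv flin_inv_simps(3) flin_simps(3))

lemma continuous_on_flin [continuous_intros]:
  "continuous_on S f \<Longrightarrow> continuous_on S g \<Longrightarrow> continuous_on S (\<lambda>x. flin \<gamma> (f x) (g x))"
  unfolding flin_def by (intro continuous_intros)
lemma continuous_on_flin_inv [continuous_intros]:
  "continuous_on S f \<Longrightarrow> continuous_on S g \<Longrightarrow> continuous_on S (\<lambda>x. flin_inv \<gamma> (f x) (g x))"
  unfolding flin_inv_def by (intro continuous_intros)

text \<open>The case of equality is what \<open>flin_three_step_growth\<close> exploits: full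
  contraction occurs only on the imaginary axis.\<close>

lemma norm_stretch:
  assumes "0 < \<gamma>" "\<gamma> < 1"
  shows "norm (stretch \<gamma> w) \<le> norm w" "\<gamma> * norm w \<le> norm (stretch \<gamma> w)"
    "norm (stretch \<gamma> w) = \<gamma> * norm w \<Longrightarrow> Re w = 0"
proof -
  have g: "\<gamma>\<^sup>2 < 1" using assms by (simp add: power_less_one_iff)
  have eq: "(norm (stretch \<gamma> w))\<^sup>2 = (Re w)\<^sup>2 + \<gamma>\<^sup>2 * (Im w)\<^sup>2"
    by (simp add: cmod_power2 stretch_def power_mult_distrib)
  have "(norm (stretch \<gamma> w))\<^sup>2 \<le> (norm w)\<^sup>2"
    unfolding eq cmod_power2[of w] using g mult_right_mono[of "\<gamma>\<^sup>2" 1 "(Im w)\<^sup>2"] by simp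
  then show "norm (stretch \<gamma> w) \<le> norm w" by (rule power2_le_imp_le) simp
  have "(\<gamma> * norm w)\<^sup>2 \<le> (norm (stretch \<gamma> w))\<^sup>2"
    unfolding eq power_mult_distrib cmod_power2[of w] using g mult_right_mono[of "\<gamma>\<^sup>2" 1 "(Re w)\<^sup>2"] by (simp add: distrib_left)
  then show "\<gamma> * norm w \<le> norm (stretch \<gamma> w)" by (rule power2_le_imp_le) simp
  assume "norm (stretch \<gamma> w) = \<gamma> * norm w"
  then have "(Re w)\<^sup>2 + \<gamma>\<^sup>2 * (Im w)\<^sup>2 = \<gamma>\<^sup>2 * ((Re w)\<^sup>2 + (Im w)\<^sup>2)"
    using eq by (simp add: power_mult_distrib cmod_power2)
  then have "(1 - \<gamma>\<^sup>2) * (Re w)\<^sup>2 = 0" by (simp add: algebra_simps)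
  then show "Re w = 0" using g by simp
qed

lemma norm_flin:
  assumes "0 < \<gamma>" "\<gamma> < 1"
  shows "norm (flin \<gamma> \<theta> \<xi>) \<le> norm \<xi>" "\<gamma> * norm \<xi> \<le> norm (flin \<gamma> \<theta> \<xi>)"
  using norm_stretch(1,2)[OF assms, of "cnj (circle_cis \<theta>) * cv \<xi>"] by (simp_all add: flin_def norm_mult)

text \<open>Three steps are needed since a single step may contract by the full factor \<open>\<gamma>\<close>
  and \<open>\<beta> \<gamma> = 1\<close> is allowed.\<close>

lemma flin_three_step_growth:
  assumes \<gamma>: "0 < \<gamma>" "\<gamma> < 1" and \<beta>\<gamma>: "1 \<le> \<beta> * \<gamma>" and irr: "\<omega> \<notin> \<rat>"
  defines "\<alpha> \<equiv> to_circle \<omega>"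
  obtains \<sigma> where "1 < \<sigma>"
    "\<And>\<theta> \<xi>. \<sigma> * norm \<xi> \<le> \<beta> ^ 3 * norm (flin \<gamma> (\<theta> + \<alpha> + \<alpha>) (flin \<gamma> (\<theta> + \<alpha>) (flin \<gamma> \<theta> \<xi>)))"
proof -
  have \<beta>: "0 < \<beta>" using \<gamma> \<beta>\<gamma> by (smt (verit) mult_nonpos_nonneg)
  define F where "F p = flin \<gamma> (fst p + \<alpha> + \<alpha>) (flin \<gamma> (fst p + \<alpha>) (flin \<gamma> (fst p) (snd p)))" for p
  define K where "K = (UNIV :: circle set) \<times> sphere (0 :: real^2) 1"
  have "compact K" unfolding K_def by (intro compact_Times compact_UNIV_circle compact_sphere)
  moreover have "K \<noteq> {}" using vector_choose_size[of 1, where 'a="real^2"] unfolding K_def by auto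
  moreover have "continuous_on K (\<lambda>p. norm (F p))" unfolding F_def by (intro continuous_intros)
  ultimately obtain p where p: "p \<in> K" "\<And>q. q \<in> K \<Longrightarrow> norm (F p) \<le> norm (F q)"
    using continuous_attains_inf by metis
  obtain \<theta> \<xi> where p\<theta>: "p = (\<theta>, \<xi>)" by fastforce
  have n\<xi>: "norm \<xi> = 1" using p(1) by (simp add: p\<theta> K_def)
  define x1 x2 x3 where x: "x1 = flin \<gamma> \<theta> \<xi>" "x2 = flin \<gamma> (\<theta> + \<alpha>) x1" "x3 = flin \<gamma> (\<theta> + \<alpha> + \<alpha>) x2"
  have nx: "norm (F p) = norm x3" by (simp add: F_def p\<theta> x)
  have le: "\<gamma> * 1 \<le> norm x1" "\<gamma> * norm x1 \<le> norm x2" "\<gamma> * norm x2 \<le> norm x3"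
    using norm_flin(2)[OF \<gamma>] n\<xi> unfolding x by (metis, metis, metis)
  \<comment> \<open>Otherwise every step contracts by exactly \<gamma>. The first step then leaves
    its image on the imaginary axis, and the other two force the sine to vanish at both \<theta> +
    \<alpha> and \<theta> + \<alpha> + \<alpha>, so 2 * \<omega> would be an integer.\<close>
  have g3: "\<gamma> ^ 3 < norm x3"
  proof (rule ccontr)
    assume "\<not> ?thesis"
    then have a: "norm x3 \<le> \<gamma> * (\<gamma> * \<gamma>)" by (simp add: power3_eq_cube mult.assoc)
    then have "\<gamma> * norm x2 \<le> \<gamma> * (\<gamma> * \<gamma>)" using le by linarith
    then have b: "norm x2 \<le> \<gamma> * \<gamma>" using \<gamma> by simp
    then have "\<gamma> * norm x1 \<le> \<gamma> * \<gamma>" using le by linarith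
    then have "norm x1 \<le> \<gamma>" using \<gamma> by simp
    then have n1: "norm x1 = \<gamma>" using le by simp
    then have n2: "norm x2 = \<gamma> * norm x1" using b le by simp
    then have n3: "norm x3 = \<gamma> * norm x2" using a le n1 by simp
    have str: "Re (cnj (circle_cis t) * cv y) = 0" if "norm (flin \<gamma> t y) = \<gamma> * norm y" for t y
      using norm_stretch(3)[OF \<gamma>, of "cnj (circle_cis t) * cv y"] that by (simp add: flin_def norm_mult)
    have cs: "sin_turn t = 0" if "Re (cv y) = 0" "y \<noteq> 0" "norm (flin \<gamma> t y) = \<gamma> * norm y" for t y
    proof -
      have "Im (cv y) \<noteq> 0" using that by (metis complex_eq_iff cv_eq_0 zero_complex.sel)
      then show ?thesis using str[OF that(3)] that(1) by (simp add: circle_cis_def)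
    qed
    have re: "Re (cv (flin \<gamma> t y)) = 0" if "norm (flin \<gamma> t y) = \<gamma> * norm y" for t y
      using str[OF that] by (simp add: flin_def stretch_def)
    have nz: "x1 \<noteq> 0" "x2 \<noteq> 0" using n1 n2 \<gamma> by auto
    have s1: "sin_turn (\<theta> + \<alpha>) = 0" using cs[of x1 "\<theta> + \<alpha>"] re[of \<theta> \<xi>] n1 n\<xi> n2 nz by (simp add: x)
    have s2: "sin_turn (\<theta> + \<alpha> + \<alpha>) = 0" using cs[of x2 "\<theta> + \<alpha> + \<alpha>"] re[of "\<theta> + \<alpha>" x1] n2 n3 nz by (simp add: x)
    have sq: "circle_cis t ^ 2 = 1" if "sin_turn t = 0" for t
    proof -
      have "\<bar>cos_turn t\<bar> = 1" using norm_circle_cis[of t] that by (simp add: circle_cis_def complex_norm)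
      then have "(cos_turn t)\<^sup>2 = 1" by (metis power2_abs one_power2)
      then show ?thesis using that by (simp add: circle_cis_def complex_eq_iff power2_eq_square)
    qed
    have "circle_cis (\<theta> + \<alpha> + \<alpha>) ^ 2 = circle_cis (\<theta> + \<alpha>) ^ 2 * circle_cis \<alpha> ^ 2"
      by (simp add: circle_cis_add power_mult_distrib)
    then have "circle_cis \<alpha> ^ 2 = 1" using sq[OF s1] sq[OF s2] by simp
    then have "circle_cis (to_circle (2 * \<omega>)) = circle_cis (to_circle 0)"
      unfolding \<alpha>_def circle_cis_to_circle by (simp add: Complex.DeMoivre mult_ac)
    then have "2 * \<omega> \<in> \<int>" unfolding circle_cis_inj to_circle_eq_iff by simp
    then obtain i :: int where "2 * \<omega> = of_int i" by (rule Ints_cases)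
    then have "\<omega> = of_int i / 2" by simp
    then have "\<omega> \<in> \<rat>" by (metis Rats_divide Rats_of_int Rats_number_of)
    with irr show False by simp
  qed
  show thesis
  proof
    have "1 \<le> (\<beta> * \<gamma>) ^ 3" using \<beta>\<gamma> by simp
    also have "\<dots> < \<beta> ^ 3 * norm x3" using g3 \<beta> by (simp add: power_mult_distrib)
    finally show "1 < \<beta> ^ 3 * norm x3" .
    fix t and y :: "real^2"
    show "\<beta> ^ 3 * norm x3 * norm y \<le> \<beta> ^ 3 * norm (flin \<gamma> (t + \<alpha> + \<alpha>) (flin \<gamma> (t + \<alpha>) (flin \<gamma> t y)))"
    proof (cases "y = 0")
      case False
      define y' where "y' = (1 / norm y) *\<^sub>R y"
      have "y = norm y *\<^sub>R y'" using False by (simp add: y'_def)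
      then have "norm (flin \<gamma> (t + \<alpha> + \<alpha>) (flin \<gamma> (t + \<alpha>) (flin \<gamma> t y))) = norm y * norm (F (t, y'))"
        by (simp add: F_def) (metis abs_norm_cancel flin_simps(5) norm_scaleR)
      moreover have "norm x3 \<le> norm (F (t, y'))"
        using p(2)[of "(t, y')"] False by (simp add: K_def y'_def nx)
      ultimately have "norm x3 * norm y \<le> norm (flin \<gamma> (t + \<alpha> + \<alpha>) (flin \<gamma> (t + \<alpha>) (flin \<gamma> t y)))"
        using mult_right_mono[of "norm x3" "norm (F (t, y'))" "norm y"] by (simp add: mult.commute)
      from mult_left_mono[OF this, of "\<beta> ^ 3"] show ?thesis using \<beta> by (simp add: mult.assoc)
    qed simp
  qed
qed

section \<open>The radial map\<close>

definition rad :: "real \<Rightarrow> real \<Rightarrow> real" where "rad s r = s * r / (1 + r\<^sup>2)"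

text \<open>Since r / (1 + r^2) is at most 1/2, a gain of at most 2 confines radii to (0, 1], the
  range on which \<open>rad s\<close> is increasing. This is the role of \<beta> \<le> 2.\<close>

lemma rad_bounds:
  assumes "1 \<le> s" "s \<le> 2" "0 < r"
  shows "0 < rad s r" "rad s r \<le> 1" "rad s r \<le> 2 * r" "r \<le> 1 \<Longrightarrow> r / 2 \<le> rad s r"
proof -
  have p: "0 < 1 + r\<^sup>2" by (simp add: add_pos_nonneg)
  show "0 < rad s r" using assms p by (simp add: rad_def)
  have "2 * r \<le> 1 + r\<^sup>2" using zero_le_power2[of "1 - r"] by (simp add: power2_eq_square algebra_simps)
  moreover have "s * r \<le> 2 * r" using assms by simp
  ultimately show "rad s r \<le> 1" using p by (simp add: rad_def)
  have "s * r \<le> 2 * r * (1 + r\<^sup>2)" using \<open>s * r \<le> 2 * r\<close> assms p by (simp add: algebra_simps add_increasing2)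
  then show "rad s r \<le> 2 * r" using p by (simp add: rad_def field_simps)
  assume "r \<le> 1"
  then have "r\<^sup>2 \<le> 1" using assms by (simp add: power_le_one)
  then have "r * (1 + r\<^sup>2) \<le> r * 2" using assms by (intro mult_left_mono) auto
  also have "\<dots> \<le> 2 * (s * r)" using assms by simp
  finally show "r / 2 \<le> rad s r" using p by (simp add: rad_def field_simps)
qed

lemma rad_mono:
  assumes "0 \<le> s" "0 \<le> r" "r \<le> r'" "r' \<le> 1"
  shows "rad s r \<le> rad s r'"
proof -
  have "0 \<le> (r' - r) * (1 - r * r')" using assms mult_le_one[of r r'] by (intro mult_nonneg_nonneg) auto
  then have "r * (1 + r'\<^sup>2) \<le> r' * (1 + r\<^sup>2)" by (simp add: power2_eq_square algebra_simps)
  then have "s * r * (1 + r'\<^sup>2) \<le> s * r' * (1 + r\<^sup>2)" using assms(1) by (simp add: mult.assoc mult_left_mono)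
  then show ?thesis by (simp add: rad_def divide_simps add_pos_nonneg)
qed

definition rate :: "real \<Rightarrow> real" where "rate m = (1 - m\<^sup>2) / (1 + m\<^sup>2)"

lemma rate_bounds: assumes "0 < m" "m \<le> 1" shows "0 \<le> rate m" "rate m < 1"
proof -
  have "m\<^sup>2 \<le> 1" "0 < m\<^sup>2" using assms by (auto simp: power_le_one)
  moreover from this have "0 < 1 + m\<^sup>2" by linarith
  ultimately show "0 \<le> rate m" "rate m < 1" unfolding rate_def by (simp, subst divide_less_eq_1_pos) auto
qed

text \<open>In the logarithmic coordinate \<open>x = ln r\<close> the radial map has derivative \<open>(1 - r\<^sup>2) / (1 + r\<^sup>2)\<close>,
  independently of \<open>s\<close>.\<close>

lemma rad_log_contraction:
  assumes "0 < s" "0 < m" "m \<le> a" "a \<le> 1" "m \<le> b" "b \<le> 1"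
  shows "\<bar>ln (rad s a) - ln (rad s b)\<bar> \<le> rate m * \<bar>ln a - ln b\<bar>"
proof -
  \<comment> \<open>Up to the additive constant \<open>ln s\<close>, which cancels in differences,
    this is \<open>rad s\<close> in the coordinate ln r.\<close>
  define \<phi> where "\<phi> x = x - ln (1 + exp (2 * x))" for x :: real
  have "norm (\<phi> (ln a) - \<phi> (ln b)) \<le> rate m * norm (ln a - ln b)"
  proof (rule field_differentiable_bound[where S="{ln m..0}" and f'="\<lambda>x. (1 - exp (2*x)) / (1 + exp (2*x))"])
    show "(\<phi> has_field_derivative (1 - exp (2*x)) / (1 + exp (2*x))) (at x within {ln m..0})" for x
    proof -
      have "1 - 2 * y / (1 + y) = (1 - y) / (1 + y)" if "0 < y" for y :: real
        using that by (simp add: field_simps)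
      from this[of "exp (2 * x)"] show ?thesis
        unfolding \<phi>_def by (auto intro!: derivative_eq_intros simp: add_pos_pos mult.commute)
    qed
    fix x assume x: "x \<in> {ln m..0}"
    define y where "y = exp (2 * x)"
    have y: "m\<^sup>2 \<le> y" "y \<le> 1" "0 < y"
    proof -
      have "exp (2 * ln m) \<le> y" using x by (simp add: y_def)
      also have "exp (2 * ln m) = m\<^sup>2" using assms by (simp add: exp_double)
      finally show "m\<^sup>2 \<le> y" .
    qed (use x in \<open>auto simp: y_def\<close>)
    have "(1 - y) / (1 + y) \<le> (1 - m\<^sup>2) / (1 + m\<^sup>2)"
      using y by (simp add: divide_simps add_pos_nonneg) (auto simp: algebra_simps add_nonneg_eq_0_iff)
    then show "norm ((1 - exp (2*x)) / (1 + exp (2*x))) \<le> rate m"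
      using y unfolding y_def[symmetric] rate_def by simp
  qed (use assms in auto)
  moreover have "ln (rad s r) = ln s + \<phi> (ln r)" if "0 < r" for r
  proof -
    have "0 < 1 + r\<^sup>2" by (simp add: add_pos_nonneg)
    then show ?thesis using that assms(1) by (simp add: rad_def \<phi>_def ln_div ln_mult exp_double)
  qed
  ultimately show ?thesis using assms by simp
qed

section \<open>The invariant torus\<close>

locale sna_system =
  fixes \<omega> \<beta> \<gamma> :: real
  assumes irr: "\<omega> \<notin> \<rat>" and \<beta>: "1 < \<beta>" "\<beta> \<le> 2" and \<gamma>: "0 < \<gamma>" "\<gamma> < 1" and \<beta>\<gamma>: "1 \<le> \<beta> * \<gamma>"
begin

abbreviation "\<alpha> \<equiv> to_circle \<omega>"
abbreviation "\<Lambda> \<equiv> Lam \<omega> \<beta> \<gamma>"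
abbreviation "A \<equiv> flin \<gamma>"

lemma \<gamma>0: "\<gamma> \<noteq> 0" using \<gamma> by simp

text \<open>The multiplier s for which \<Lambda> acts on the radius in direction \<xi> as
  \<open>rad s\<close>. It depends on the direction only, and its lower bound 1 is the hypothesis on
  \<beta> * \<gamma>.\<close>

definition gain :: "circle \<Rightarrow> real^2 \<Rightarrow> real" where
  "gain \<theta> \<xi> = \<beta> * norm (A \<theta> \<xi>) / norm \<xi>"

lemma gain_bounds:
  assumes "\<xi> \<noteq> 0" shows "1 \<le> gain \<theta> \<xi>" "gain \<theta> \<xi> \<le> \<beta>" "gain \<theta> \<xi> \<le> 2" "0 < gain \<theta> \<xi>"
proof -
  have "1 * norm \<xi> \<le> \<beta> * \<gamma> * norm \<xi>" using \<beta>\<gamma> by (intro mult_right_mono) auto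
  also have "\<dots> \<le> \<beta> * norm (A \<theta> \<xi>)"
    using norm_flin(2)[OF \<gamma>, of \<xi> \<theta>] \<beta> by (simp add: mult.assoc)
  finally show 1: "1 \<le> gain \<theta> \<xi>" using assms by (simp add: gain_def field_simps)
  show "gain \<theta> \<xi> \<le> \<beta>" using norm_flin(1)[OF \<gamma>, of \<theta> \<xi>] \<beta> assms by (simp add: gain_def field_simps)
  then show "gain \<theta> \<xi> \<le> 2" using \<beta> by simp
  show "0 < gain \<theta> \<xi>" using 1 by simp
qed

lemma fibre_preimage:
  obtains \<theta> \<xi> where "\<theta>' = \<theta> + \<alpha>" "\<xi>' = A \<theta> \<xi>"
  using that[of "\<theta>' - \<alpha>" "flin_inv \<gamma> (\<theta>' - \<alpha>) \<xi>'"] \<gamma>0 by simp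

text \<open>\<open>pull n\<close> is the radius in direction \<open>\<xi>\<close> of the image under \<open>\<Lambda>\<^sup>n\<close> of the unit circle bundle.\<close>

primrec pull :: "nat \<Rightarrow> circle \<Rightarrow> real^2 \<Rightarrow> real" where
  "pull 0 = (\<lambda>\<theta> \<xi>. 1)"
| "pull (Suc n) = (\<lambda>\<theta> \<xi>. rad (\<beta> * norm \<xi> / norm (flin_inv \<gamma> (\<theta> - \<alpha>) \<xi>)) (pull n (\<theta> - \<alpha>) (flin_inv \<gamma> (\<theta> - \<alpha>) \<xi>)))"

lemma pull_Suc: "pull (Suc n) (\<theta> + \<alpha>) (A \<theta> \<xi>) = rad (gain \<theta> \<xi>) (pull n \<theta> \<xi>)"
  using \<gamma>0 by (simp add: gain_def)

lemma pull_pos_le: "\<xi> \<noteq> 0 \<Longrightarrow> 0 < pull n \<theta> \<xi> \<and> pull n \<theta> \<xi> \<le> 1"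
proof (induction n arbitrary: \<theta> \<xi>)
  case (Suc n)
  obtain \<theta>0 \<xi>0 where eq: "\<theta> = \<theta>0 + \<alpha>" "\<xi> = A \<theta>0 \<xi>0" by (rule fibre_preimage)
  then have nz: "\<xi>0 \<noteq> 0" using Suc.prems by auto
  show ?case unfolding eq pull_Suc
    using rad_bounds(1,2)[OF gain_bounds(1)[OF nz] gain_bounds(3)[OF nz]] Suc.IH[OF nz] by blast
qed simp

lemma pull_scale: "t \<noteq> 0 \<Longrightarrow> pull n \<theta> (t *\<^sub>R \<xi>) = pull n \<theta> \<xi>"
  by (induction n arbitrary: \<theta> \<xi>) simp_all

text \<open>A small radius m does not decrease over three steps: the three gains multiply to at
  least \<sigma> > 1, whereas the three denominators multiply to at most \<sigma>. The induction
  goes in steps of three from the radii 1, 1/2 and 1/4.\<close>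

lemma pull_lower: "\<exists>m. 0 < m \<and> m \<le> 1 \<and> (\<forall>n \<theta> \<xi>. \<xi> \<noteq> 0 \<longrightarrow> m \<le> pull n \<theta> \<xi>)"
proof -
  obtain \<sigma> where \<sigma>: "1 < \<sigma>"
    "\<And>\<theta> \<xi>. \<sigma> * norm \<xi> \<le> \<beta> ^ 3 * norm (A (\<theta> + \<alpha> + \<alpha>) (A (\<theta> + \<alpha>) (A \<theta> \<xi>)))"
    using flin_three_step_growth[OF \<gamma> \<beta>\<gamma> irr] by metis
  define \<tau> where "\<tau> = root 3 \<sigma>"
  have \<tau>: "1 < \<tau>" "\<tau> ^ 3 = \<sigma>" using \<sigma>(1) by (auto simp: \<tau>_def)
  \<comment> \<open>Radii at most double per step, so they stay below 4 * m before the third step,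
    and 1 + 16 * m^2 is at most the cube root \<tau> of \<sigma>. The cap 1/4 covers the starting
    cases.\<close>
  define m where "m = min (1/4) (sqrt ((\<tau> - 1) / 16))"
  have m: "0 < m" "m \<le> 1/4" using \<tau> by (auto simp: m_def)
  have "m \<le> sqrt ((\<tau> - 1) / 16)" by (simp add: m_def)
  then have "m\<^sup>2 \<le> (sqrt ((\<tau> - 1) / 16))\<^sup>2" using m by (intro power_mono) auto
  then have m2: "1 + 16 * m\<^sup>2 \<le> \<tau>" using \<tau> by simp
  have three: "m \<le> rad (gain (\<theta> + \<alpha> + \<alpha>) (A (\<theta> + \<alpha>) (A \<theta> \<xi>))) (rad (gain (\<theta> + \<alpha>) (A \<theta> \<xi>)) (rad (gain \<theta> \<xi>) m))"
    if nz: "\<xi> \<noteq> 0" for \<theta> \<xi>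
  proof -
    define s1 s2 s3 where s: "s1 = gain \<theta> \<xi>" "s2 = gain (\<theta> + \<alpha>) (A \<theta> \<xi>)" "s3 = gain (\<theta> + \<alpha> + \<alpha>) (A (\<theta> + \<alpha>) (A \<theta> \<xi>))"
    have nz2: "A \<theta> \<xi> \<noteq> 0" "A (\<theta> + \<alpha>) (A \<theta> \<xi>) \<noteq> 0" using nz \<gamma>0 by auto
    have sb: "1 \<le> s1" "s1 \<le> 2" "1 \<le> s2" "s2 \<le> 2" "1 \<le> s3" "s3 \<le> 2"
      unfolding s using gain_bounds nz nz2 by auto
    define r1 r2 r3 where r: "r1 = rad s1 m" "r2 = rad s2 r1" "r3 = rad s3 r2"
    have rp: "0 < r1" "0 < r2" using rad_bounds(1) sb m unfolding r by auto
    have r1: "r1 \<le> 2 * m" using rad_bounds(3)[OF sb(1,2) m(1)] by (simp add: r)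
    have r2: "r2 \<le> 2 * r1" using rad_bounds(3)[OF sb(3,4) rp(1)] by (simp add: r)
    have "r1\<^sup>2 \<le> (4 * m)\<^sup>2" "r2\<^sup>2 \<le> (4 * m)\<^sup>2" using r1 r2 rp m by (intro power_mono; simp)+
    then have "r1\<^sup>2 \<le> 16 * m\<^sup>2" "r2\<^sup>2 \<le> 16 * m\<^sup>2" by (simp_all add: power_mult_distrib)
    then have q: "1 + m\<^sup>2 \<le> \<tau>" "1 + r1\<^sup>2 \<le> \<tau>" "1 + r2\<^sup>2 \<le> \<tau>"
      using m2 zero_le_power2[of m] by linarith+
    have "s1 * s2 * s3 = \<beta> ^ 3 * norm (A (\<theta> + \<alpha> + \<alpha>) (A (\<theta> + \<alpha>) (A \<theta> \<xi>))) / norm \<xi>"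
      using nz2 unfolding s gain_def by (simp add: power3_eq_cube)
    then have "s1 * s2 * s3 * norm \<xi> = \<beta> ^ 3 * norm (A (\<theta> + \<alpha> + \<alpha>) (A (\<theta> + \<alpha>) (A \<theta> \<xi>)))"
      using nz by simp
    then have sp: "\<sigma> \<le> s1 * s2 * s3" using \<sigma>(2)[of \<xi> \<theta>] nz mult_right_le_imp_le[of \<sigma> "norm \<xi>" "s1 * s2 * s3"] by simp
    have "r3 = s1 * s2 * s3 * m / ((1 + m\<^sup>2) * (1 + r1\<^sup>2) * (1 + r2\<^sup>2))"
      unfolding r rad_def by (simp add: field_simps)
    also have "\<dots> \<ge> \<sigma> * m / (\<tau> * \<tau> * \<tau>)"
      using sp sb m q \<tau> \<sigma> by (intro frac_le mult_right_mono mult_mono mult_pos_pos mult_nonneg_nonneg) (auto simp: add_pos_nonneg)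
    finally have "m \<le> r3" using \<tau> \<sigma> by (simp add: power3_eq_cube mult.assoc)
    then show ?thesis by (simp add: r s)
  qed
  have "m \<le> pull n \<theta> \<xi>" if "\<xi> \<noteq> 0" for n \<theta> \<xi>
    using that
  proof (induction n arbitrary: \<theta> \<xi> rule: less_induct)
    case (less n)
    have small: "r / 2 \<le> pull (Suc k) \<theta> \<xi>" if "\<And>\<theta> \<xi>. \<xi> \<noteq> 0 \<Longrightarrow> r \<le> pull k \<theta> \<xi>" "\<xi> \<noteq> 0" for r k \<theta> \<xi>
    proof -
      obtain \<theta>0 \<xi>0 where eq: "\<theta> = \<theta>0 + \<alpha>" "\<xi> = A \<theta>0 \<xi>0" by (rule fibre_preimage)
      then have nz: "\<xi>0 \<noteq> 0" using that(2) by auto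
      have "pull k \<theta>0 \<xi>0 / 2 \<le> pull (Suc k) \<theta> \<xi>" unfolding eq pull_Suc
        using pull_pos_le[OF nz, of k \<theta>0] by (intro rad_bounds(4)[OF gain_bounds(1,3)[OF nz]]) auto
      then show ?thesis using that(1)[OF nz, of \<theta>0] by linarith
    qed
    have p1: "1 / 2 \<le> pull (Suc 0) \<theta> \<xi>" if "\<xi> \<noteq> 0" for \<theta> \<xi> using small[of 1 0] that by simp
    have p2: "1 / 4 \<le> pull (Suc (Suc 0)) \<theta> \<xi>" if "\<xi> \<noteq> 0" for \<theta> \<xi> using small[of "1/2" "Suc 0"] p1 that by simp
    consider "n = 0" | "n = Suc 0" | "n = Suc (Suc 0)" | k where "n = Suc (Suc (Suc k))"
      by (metis not0_implies_Suc)
    then show ?case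
    proof cases
      case 4
      obtain \<theta>2 \<xi>2 where e2: "\<theta> = \<theta>2 + \<alpha>" "\<xi> = A \<theta>2 \<xi>2" by (rule fibre_preimage)
      obtain \<theta>1 \<xi>1 where e1: "\<theta>2 = \<theta>1 + \<alpha>" "\<xi>2 = A \<theta>1 \<xi>1" by (rule fibre_preimage)
      obtain \<theta>0 \<xi>0 where e0: "\<theta>1 = \<theta>0 + \<alpha>" "\<xi>1 = A \<theta>0 \<xi>0" by (rule fibre_preimage)
      have nz: "\<xi>0 \<noteq> 0" "\<xi>1 \<noteq> 0" "\<xi>2 \<noteq> 0" using less.prems e0 e1 e2 by auto
      have "m \<le> pull k \<theta>0 \<xi>0" using less.IH[of k] nz 4 by simp
      then have "rad (gain \<theta>0 \<xi>0) m \<le> pull (Suc k) \<theta>1 \<xi>1"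
        unfolding e0 pull_Suc using pull_pos_le[OF nz(1), of k \<theta>0] m gain_bounds(4)[OF nz(1), of \<theta>0]
        by (intro rad_mono) auto
      moreover have "0 < rad (gain \<theta>0 \<xi>0) m" using rad_bounds(1) gain_bounds[OF nz(1)] m by blast
      ultimately have "rad (gain \<theta>1 \<xi>1) (rad (gain \<theta>0 \<xi>0) m) \<le> pull (Suc (Suc k)) \<theta>2 \<xi>2"
        unfolding e1 pull_Suc using pull_pos_le[OF nz(2), of "Suc k" \<theta>1] gain_bounds(4)[OF nz(2), of \<theta>1]
        by (intro rad_mono) auto
      moreover have "0 < rad (gain \<theta>1 \<xi>1) (rad (gain \<theta>0 \<xi>0) m)"
        using rad_bounds(1) gain_bounds[OF nz(2)] \<open>0 < rad (gain \<theta>0 \<xi>0) m\<close> by blast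
      ultimately have "rad (gain \<theta>2 \<xi>2) (rad (gain \<theta>1 \<xi>1) (rad (gain \<theta>0 \<xi>0) m)) \<le> pull n \<theta> \<xi>"
        unfolding e2 pull_Suc 4 using pull_pos_le[OF nz(3), of "Suc (Suc k)" \<theta>2] gain_bounds(4)[OF nz(3), of \<theta>2]
        by (intro rad_mono) auto
      then show ?thesis using three[OF nz(1), of \<theta>0] unfolding e1 e0 by linarith
    next
      case 2 then show ?thesis using p1[OF less.prems, of \<theta>] m by simp
    next
      case 3 then show ?thesis using p2[OF less.prems, of \<theta>] m by simp
    qed (use m in simp)
  qed
  then show ?thesis using m by (intro exI[of _ m]) auto
qed

definition rmin :: real where
  "rmin = (SOME m. 0 < m \<and> m \<le> 1 \<and> (\<forall>n \<theta> \<xi>. \<xi> \<noteq> 0 \<longrightarrow> m \<le> pull n \<theta> \<xi>))"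

lemma rmin: "0 < rmin" "rmin \<le> 1" "\<xi> \<noteq> 0 \<Longrightarrow> rmin \<le> pull n \<theta> \<xi>"
  using someI_ex[OF pull_lower] unfolding rmin_def[symmetric] by auto

lemma continuous_on_pull: "continuous_on (UNIV \<times> - {0}) (\<lambda>p. pull n (fst p) (snd p))"
proof (induction n)
  case (Suc n)
  have sub: "continuous_on (UNIV \<times> - {0::real^2}) (\<lambda>p :: phase. fst p - \<alpha>)"
    unfolding diff_conv_add_uminus by (intro continuous_intros)
  have inv: "continuous_on (UNIV \<times> - {0}) (\<lambda>p :: phase. flin_inv \<gamma> (fst p - \<alpha>) (snd p))"
    by (intro continuous_intros sub)
  have "(\<lambda>p. (fst p - \<alpha>, flin_inv \<gamma> (fst p - \<alpha>) (snd p))) ` (UNIV \<times> - {0}) \<subseteq> UNIV \<times> - {0}"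
    using \<gamma>0 by auto
  from continuous_on_compose2[OF Suc continuous_on_Pair[OF sub inv] this]
  have IH: "continuous_on (UNIV \<times> - {0}) (\<lambda>p. pull n (fst p - \<alpha>) (flin_inv \<gamma> (fst p - \<alpha>) (snd p)))"
    by simp
  show ?case unfolding pull.simps rad_def
    using \<gamma>0 add_pos_nonneg[of "1::real"] by (intro continuous_intros IH inv) (auto simp: add_nonneg_eq_0_iff)
qed simp

declare pull.simps(2) [simp del]

text \<open>Consecutive pullbacks are radii driven by the same gains, so each step contracts their
  logarithmic distance. At the start both lie between \<open>rmin\<close> and 1.\<close>

lemma pull_cauchy:
  assumes "\<xi> \<noteq> 0"
  shows "\<bar>ln (pull (Suc n) \<theta> \<xi>) - ln (pull n \<theta> \<xi>)\<bar> \<le> - ln rmin * rate rmin ^ n"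
  using assms
proof (induction n arbitrary: \<theta> \<xi>)
  case 0
  have "ln rmin \<le> ln (pull (Suc 0) \<theta> \<xi>)"
    using rmin(1) rmin(3)[OF 0, of "Suc 0" \<theta>] pull_pos_le[OF 0, of "Suc 0" \<theta>] by (subst ln_le_cancel_iff) auto
  moreover have "ln (pull (Suc 0) \<theta> \<xi>) \<le> 0"
    using pull_pos_le[OF 0, of "Suc 0" \<theta>] by simp
  ultimately show ?case by simp
next
  case (Suc n)
  obtain \<theta>0 \<xi>0 where eq: "\<theta> = \<theta>0 + \<alpha>" "\<xi> = A \<theta>0 \<xi>0" by (rule fibre_preimage)
  then have nz: "\<xi>0 \<noteq> 0" using Suc.prems by auto
  have "\<bar>ln (pull (Suc (Suc n)) \<theta> \<xi>) - ln (pull (Suc n) \<theta> \<xi>)\<bar>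
      \<le> rate rmin * \<bar>ln (pull (Suc n) \<theta>0 \<xi>0) - ln (pull n \<theta>0 \<xi>0)\<bar>"
    unfolding eq pull_Suc using rmin nz pull_pos_le[OF nz] gain_bounds(4)[OF nz]
    by (intro rad_log_contraction) auto
  also have "\<dots> \<le> rate rmin * (- ln rmin * rate rmin ^ n)"
    using Suc.IH[OF nz] rate_bounds[OF rmin(1,2)] by (intro mult_left_mono) auto
  finally show ?case by (simp add: mult_ac)
qed

text \<open>The limit of \<open>pull n\<close>, since the series telescopes and
  \<open>pull 0\<close> is 1. The exponential makes it positive for every argument, the zero vector
  included.\<close>

definition rplus :: "circle \<Rightarrow> real^2 \<Rightarrow> real" where
  "rplus \<theta> \<xi> = exp (\<Sum>n. ln (pull (Suc n) \<theta> \<xi>) - ln (pull n \<theta> \<xi>))"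

lemma uniform_limit_pull:
  "uniform_limit (UNIV \<times> - {0}) (\<lambda>n p. ln (pull n (fst p) (snd p))) (\<lambda>p. ln (rplus (fst p) (snd p))) sequentially"
proof -
  have "uniform_limit (UNIV \<times> - {0::real^2})
      (\<lambda>n p. \<Sum>i<n. ln (pull (Suc i) (fst p) (snd p)) - ln (pull i (fst p) (snd p)))
      (\<lambda>p. \<Sum>i. ln (pull (Suc i) (fst p) (snd p)) - ln (pull i (fst p) (snd p))) sequentially"
  proof (rule Weierstrass_m_test[where M="\<lambda>n. - ln rmin * rate rmin ^ n"])
    show "summable (\<lambda>n. - ln rmin * rate rmin ^ n)"
      by (intro summable_mult summable_geometric) (use rate_bounds[OF rmin(1,2)] in auto)
  qed (use pull_cauchy in \<open>simp add: mem_Times_iff\<close>)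
  moreover have "(\<Sum>i<n. ln (pull (Suc i) \<theta> \<xi>) - ln (pull i \<theta> \<xi>)) = ln (pull n \<theta> \<xi>)" for n \<theta> \<xi>
    using sum_lessThan_telescope[of "\<lambda>i. ln (pull i \<theta> \<xi>)" n] by simp
  ultimately show ?thesis by (simp add: rplus_def)
qed

lemma pull_tendsto:
  assumes "\<xi> \<noteq> 0" shows "(\<lambda>n. pull n \<theta> \<xi>) \<longlonglongrightarrow> rplus \<theta> \<xi>"
proof -
  have "(\<lambda>n. exp (ln (pull n \<theta> \<xi>))) \<longlonglongrightarrow> exp (ln (rplus \<theta> \<xi>))"
    using tendsto_uniform_limitI[OF uniform_limit_pull, of "(\<theta>, \<xi>)"] assms by (intro tendsto_exp) auto
  then show ?thesis using pull_pos_le[OF assms] by (simp add: rplus_def)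
qed

lemma rplus_pos [simp]: "0 < rplus \<theta> \<xi>" by (simp add: rplus_def)

lemma rplus_nz [simp]: "rplus \<theta> \<xi> \<noteq> 0" by (simp add: rplus_def)

lemma rplus_abs [simp]: "\<bar>rplus \<theta> \<xi>\<bar> = rplus \<theta> \<xi>" by (simp add: rplus_def)

lemma rplus_bounds:
  assumes "\<xi> \<noteq> 0" shows "rmin \<le> rplus \<theta> \<xi>" "rplus \<theta> \<xi> \<le> 1" "0 < rplus \<theta> \<xi>"
proof -
  show "rmin \<le> rplus \<theta> \<xi>"
    by (rule LIMSEQ_le_const[OF pull_tendsto[OF assms]]) (use rmin(3)[OF assms] in blast)
  show "rplus \<theta> \<xi> \<le> 1"
    by (rule LIMSEQ_le_const2[OF pull_tendsto[OF assms]]) (use pull_pos_le[OF assms] in blast)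
qed simp

lemma rplus_scale [simp]: "t \<noteq> 0 \<Longrightarrow> rplus \<theta> (t *\<^sub>R \<xi>) = rplus \<theta> \<xi>"
  by (simp add: rplus_def pull_scale)

lemma rplus_minus [simp]: "rplus \<theta> (- \<xi>) = rplus \<theta> \<xi>" using rplus_scale[of "-1"] by simp

lemma rplus_step:
  assumes "\<xi> \<noteq> 0" shows "rplus (\<theta> + \<alpha>) (A \<theta> \<xi>) = rad (gain \<theta> \<xi>) (rplus \<theta> \<xi>)"
proof (rule LIMSEQ_unique)
  have "A \<theta> \<xi> \<noteq> 0" using assms \<gamma>0 by simp
  from LIMSEQ_Suc[OF pull_tendsto[OF this, of "\<theta> + \<alpha>"]] show "(\<lambda>n. rad (gain \<theta> \<xi>) (pull n \<theta> \<xi>)) \<longlonglongrightarrow> rplus (\<theta> + \<alpha>) (A \<theta> \<xi>)"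
    unfolding pull_Suc .
  have "1 + (rplus \<theta> \<xi>)\<^sup>2 \<noteq> 0" using add_pos_nonneg[of 1 "(rplus \<theta> \<xi>)\<^sup>2"] by simp
  then show "(\<lambda>n. rad (gain \<theta> \<xi>) (pull n \<theta> \<xi>)) \<longlonglongrightarrow> rad (gain \<theta> \<xi>) (rplus \<theta> \<xi>)"
    unfolding rad_def by (intro tendsto_intros pull_tendsto[OF assms])
qed

lemma continuous_on_rplus: "continuous_on (UNIV \<times> - {0}) (\<lambda>p. rplus (fst p) (snd p))"
proof -
  have "continuous_on (UNIV \<times> - {0}) (\<lambda>p. ln (pull n (fst p) (snd p)))" for n
    by (intro continuous_intros continuous_on_pull) (use pull_pos_le in \<open>auto simp: mem_Times_iff, metis less_irrefl\<close>)
  then have "continuous_on (UNIV \<times> - {0}) (\<lambda>p. ln (rplus (fst p) (snd p)))"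
    by (intro uniform_limit_theorem[OF _ uniform_limit_pull]) auto
  then have "continuous_on (UNIV \<times> - {0}) (\<lambda>p. exp (ln (rplus (fst p) (snd p))))" by (rule continuous_on_exp)
  then show ?thesis by (simp add: rplus_def)
qed

section \<open>The torus, its invariance and its topology\<close>

definition torus :: "phase set" where
  "torus = {p. snd p \<noteq> 0 \<and> norm (snd p) = rplus (fst p) (snd p)}"

lemma Lam_ray:
  assumes \<eta>: "\<eta> \<noteq> 0"
  shows "\<Lambda> (\<theta>, (t / norm \<eta>) *\<^sub>R \<eta>) = (\<theta> + \<alpha>, (rad (gain \<theta> \<eta>) t / norm (A \<theta> \<eta>)) *\<^sub>R A \<theta> \<eta>)"
  using \<eta> \<gamma>0 by (simp add: Lam_eq rad_def gain_def mult_ac)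

lemma norm_Lam:
  assumes "\<xi> \<noteq> 0" shows "norm (snd (\<Lambda> (\<theta>, \<xi>))) = rad (gain \<theta> \<xi>) (norm \<xi>)"
  using Lam_ray[OF assms, of \<theta> "norm \<xi>"] assms \<gamma>0
    rad_bounds(1)[OF gain_bounds(1,3)[OF assms], of "norm \<xi>" \<theta>] by (simp add: less_imp_le)

lemma rplus_Lam:
  assumes "\<xi> \<noteq> 0" shows "rplus (\<theta> + \<alpha>) (snd (\<Lambda> (\<theta>, \<xi>))) = rad (gain \<theta> \<xi>) (rplus \<theta> \<xi>)"
proof -
  have "\<beta> / (1 + (norm \<xi>)\<^sup>2) \<noteq> 0" using \<beta> add_pos_nonneg[of 1 "(norm \<xi>)\<^sup>2"] by simp
  then show ?thesis using rplus_step[OF assms] by (simp add: Lam_eq)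
qed

lemma Lam_eq_0: "snd (\<Lambda> (\<theta>, \<xi>)) = 0 \<longleftrightarrow> \<xi> = 0"
  using \<beta> \<gamma>0 add_pos_nonneg[of 1 "(norm \<xi>)\<^sup>2"] by (auto simp: Lam_eq)

lemma fst_Lam [simp]: "fst (\<Lambda> p) = fst p + \<alpha>" by (cases p) (simp add: Lam_eq)

lemma torus_invariant: "\<Lambda> ` torus = torus"
proof (intro equalityI subsetI)
  fix q assume "q \<in> \<Lambda> ` torus"
  then obtain \<theta> \<xi> where q: "q = \<Lambda> (\<theta>, \<xi>)" "\<xi> \<noteq> 0" "norm \<xi> = rplus \<theta> \<xi>" by (auto simp: torus_def)
  show "q \<in> torus" using norm_Lam[OF q(2), of \<theta>] rplus_Lam[OF q(2), of \<theta>] q Lam_eq_0 by (simp add: torus_def)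
next
  fix q assume q: "q \<in> torus"
  obtain \<theta> \<eta> where e: "fst q = \<theta> + \<alpha>" "snd q = A \<theta> \<eta>" by (rule fibre_preimage)
  have \<eta>: "\<eta> \<noteq> 0" "A \<theta> \<eta> \<noteq> 0" using q e by (auto simp: torus_def)
  define \<xi> where "\<xi> = (rplus \<theta> \<eta> / norm \<eta>) *\<^sub>R \<eta>"
  have r: "0 < rplus \<theta> \<eta>" using rplus_bounds[OF \<eta>(1)] by blast
  have "\<Lambda> (\<theta>, \<xi>) = (\<theta> + \<alpha>, (rplus (\<theta> + \<alpha>) (A \<theta> \<eta>) / norm (A \<theta> \<eta>)) *\<^sub>R A \<theta> \<eta>)"
    unfolding \<xi>_def Lam_ray[OF \<eta>(1)] rplus_step[OF \<eta>(1)] ..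
  also have "\<dots> = q" using q e \<eta> by (simp add: torus_def prod_eq_iff)
  finally have "\<Lambda> (\<theta>, \<xi>) = q" .
  moreover have "(\<theta>, \<xi>) \<in> torus" using r \<eta> by (simp add: torus_def \<xi>_def)
  ultimately show "q \<in> \<Lambda> ` torus" by force
qed

text \<open>Angle and base point determine a point of the torus because its radius is
  \<open>rplus\<close>; a continuous bijection from a compact space is a homeomorphism.\<close>

lemma torus_homeomorphic: "torus homeomorphic (UNIV :: (circle \<times> circle) set)"
proof -
  define H where "H p = (fst p, rplus (fst p) (vc (circle_cis (snd p))) *\<^sub>R vc (circle_cis (snd p)))" for p :: "circle \<times> circle"
  have nz: "circle_cis \<phi> \<noteq> 0" for \<phi> using norm_circle_cis[of \<phi>] by force
  have comp: "compact (UNIV :: (circle \<times> circle) set)"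
    using compact_Times[OF compact_UNIV_circle compact_UNIV_circle] by simp
  have c1: "continuous_on UNIV (\<lambda>p :: circle \<times> circle. (fst p, vc (circle_cis (snd p))))" by (intro continuous_intros)
  have c: "continuous_on UNIV H"
    unfolding H_def
    by (intro continuous_intros continuous_on_compose2[OF continuous_on_rplus c1, simplified]) (use nz in auto)
  have "inj_on H UNIV"
  proof (rule inj_onI)
    fix p q assume eq: "H p = H q"
    have f: "fst p = fst q" using eq by (simp add: H_def)
    let ?a = "rplus (fst p) (vc (circle_cis (snd p)))" and ?b = "rplus (fst q) (vc (circle_cis (snd q)))"
    have ab: "0 < ?a" "0 < ?b" using rplus_bounds(3) nz by simp_all
    have s: "?a *\<^sub>R vc (circle_cis (snd p)) = ?b *\<^sub>R vc (circle_cis (snd q))" using eq unfolding H_def prod.inject by blast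
    then have "norm (?a *\<^sub>R vc (circle_cis (snd p))) = norm (?b *\<^sub>R vc (circle_cis (snd q)))" by metis
    then have "?a = ?b" using ab by simp
    then have "circle_cis (snd p) = circle_cis (snd q)" using s ab by simp
    then show "p = q" using f by (simp add: circle_cis_inj prod_eq_iff)
  qed
  moreover have "H ` UNIV = torus"
  proof (intro equalityI subsetI)
    fix q assume "q \<in> H ` UNIV"
    then obtain p where q: "q = H p" by auto
    have "0 < rplus (fst p) (vc (circle_cis (snd p)))" using rplus_bounds(3) nz by simp
    then show "q \<in> torus" using nz unfolding q H_def torus_def by simp
  next
    fix q assume q: "q \<in> torus"
    then have s: "snd q \<noteq> 0" "norm (snd q) = rplus (fst q) (snd q)" by (auto simp: torus_def)
    define u where "u = (1 / norm (snd q)) *\<^sub>R snd q"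
    have "norm (cv u) = 1" using s(1) by (simp add: u_def del: cv_simps)
    then obtain \<phi> where \<phi>: "circle_cis \<phi> = cv u" by (rule circle_cis_surj)
    have "rplus (fst q) u = norm (snd q)" unfolding u_def s(2) using s(1) by (subst rplus_scale) auto
    then have "H (fst q, \<phi>) = q" using s(1) \<phi> by (simp add: H_def prod_eq_iff) (simp add: u_def)
    then show "q \<in> H ` UNIV" by (metis rangeI)
  qed
  ultimately show ?thesis using homeomorphic_compact[OF comp c] homeomorphic_sym by blast
qed

section \<open>The global attractor and its boundary\<close>

definition gauge_fun :: "phase \<Rightarrow> real" where
  "gauge_fun p = norm (snd p) / rplus (fst p) (snd p)"

lemma gauge_fun_le_1: "gauge_fun p \<le> 1 \<longleftrightarrow> snd p = 0 \<or> norm (snd p) \<le> rplus (fst p) (snd p)"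
  by (auto simp: gauge_fun_def divide_le_eq less_imp_le)

lemma gauge_fun_eq_1: "gauge_fun p = 1 \<longleftrightarrow> p \<in> torus"
  by (auto simp: gauge_fun_def torus_def)

text \<open>On the zero section \<open>rplus\<close> has no continuous extension to rely on; there
  the bound \<open>norm (snd q) / rmin\<close> gives continuity directly.\<close>

lemma continuous_on_gauge_fun: "continuous_on UNIV gauge_fun"
  unfolding continuous_on_eq_continuous_at[OF open_UNIV]
proof
  fix p :: phase
  show "isCont gauge_fun p"
  proof (cases "snd p = 0")
    case True
    have "(gauge_fun \<longlongrightarrow> 0) (at p)"
    proof (rule Lim_null_comparison)
      have "norm (gauge_fun q) \<le> norm (snd q) / rmin" for q
      proof (cases "snd q = 0")
        case False
        then show ?thesis using rplus_bounds[of "snd q" "fst q"] rmin(1) by (simp add: gauge_fun_def frac_le)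
      qed (simp add: gauge_fun_def)
      then show "\<forall>\<^sub>F q in at p. norm (gauge_fun q) \<le> norm (snd q) / rmin" by simp
      have "((\<lambda>q. norm (snd q) / rmin) \<longlongrightarrow> norm (snd p) / rmin) (at p)"
        using rmin(1) by (intro tendsto_intros) auto
      then show "((\<lambda>q. norm (snd q) / rmin) \<longlongrightarrow> 0) (at p)" using True by simp
    qed
    then show ?thesis using True by (simp add: isCont_def gauge_fun_def)
  next
    case False
    have op: "open ((UNIV :: circle set) \<times> - {0 :: real^2})" by (intro open_Times) auto
    have "continuous_on (UNIV \<times> - {0}) gauge_fun"
      unfolding gauge_fun_def by (intro continuous_intros continuous_on_rplus) (auto simp: rplus_def)
    then show ?thesis using op False by (cases p) (auto simp: continuous_on_eq_continuous_at)
  qed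
qed

text \<open>Moving a point of the torus outward along its ray multiplies the gauge, so no such point
  is interior.\<close>

lemma frontier_gauge: "frontier {p. gauge_fun p \<le> 1} = torus"
proof (intro equalityI subsetI)
  have cl: "closed {p. gauge_fun p \<le> 1}"
    using continuous_closed_preimage[OF continuous_on_gauge_fun closed_UNIV closed_atMost[of 1]] by (simp add: vimage_def)
  have op: "open {p. gauge_fun p < 1}"
    using continuous_open_preimage[OF continuous_on_gauge_fun open_UNIV open_lessThan[of 1]] by (simp add: vimage_def)
  {
    fix p assume "p \<in> frontier {p. gauge_fun p \<le> 1}"
    then have "gauge_fun p \<le> 1" "p \<notin> interior {p. gauge_fun p \<le> 1}" using cl by (auto simp: frontier_def)
    moreover have "{p. gauge_fun p < 1} \<subseteq> interior {p. gauge_fun p \<le> 1}" by (rule interior_maximal[OF _ op]) auto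
    ultimately have "gauge_fun p = 1" by force
    then show "p \<in> torus" by (simp add: gauge_fun_eq_1)
  next
    fix p assume p: "p \<in> torus"
    then have g: "gauge_fun p = 1" by (simp add: gauge_fun_eq_1)
    have "p \<notin> interior {p. gauge_fun p \<le> 1}"
    proof
      assume "p \<in> interior {p. gauge_fun p \<le> 1}"
      then obtain e where e: "0 < e" "ball p e \<subseteq> {p. gauge_fun p \<le> 1}" unfolding mem_interior by blast
      define t where "t = e / (2 * (norm (snd p) + 1))"
      have t: "0 < t" "t * norm (snd p) < e"
      proof -
        show "0 < t" using e by (simp add: t_def add_nonneg_pos)
        have "t * (norm (snd p) + 1) = e / 2" using norm_ge_zero[of "snd p"] by (simp add: t_def field_simps add_nonneg_eq_0_iff)
        then show "t * norm (snd p) < e" using \<open>0 < t\<close> e by (simp add: distrib_left)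
      qed
      define q where "q = (fst p, (1 + t) *\<^sub>R snd p)"
      have "dist p q = t * norm (snd p)" using t by (simp add: q_def dist_prod_def dist_norm scaleR_left_distrib)
      then have "q \<in> ball p e" using t by simp
      then have "gauge_fun q \<le> 1" using e by blast
      moreover have "gauge_fun q = (1 + t) * gauge_fun p" using t by (simp add: gauge_fun_def q_def)
      ultimately show False using g t by simp
    qed
    then show "p \<in> frontier {p. gauge_fun p \<le> 1}" using cl g by (simp add: frontier_def)
  }
qed

text \<open>By the intermediate value theorem on each ray, the set of gauge at most 1 is covered by
  its own image, hence contained in every image of X. Conversely, points in all images lie below
  every \<open>pull n\<close> and thus below the limit \<open>rplus\<close>.\<close>

lemma global_attractor_eq:
  assumes C: "0 < C" and sub: "\<Lambda> ` phase_ball C \<subseteq> interior (phase_ball C)"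
  shows "global_attractor \<Lambda> (phase_ball C) = {p. gauge_fun p \<le> 1}" "{p. gauge_fun p \<le> 1} \<subseteq> phase_ball C"
proof -
  \<comment> \<open>For C < 1 the absorbing hypothesis is tested at the vector (C, 0) over \<theta>
    = 0, where the linear part acts as the identity; this gives \<beta> < 1 + C^2. The maximal torus
    radius R satisfies R \<le> \<beta> * R / (1 + R^2), hence R < C.\<close>
  have rC: "rplus \<theta> \<xi> \<le> C" if "\<xi> \<noteq> 0" for \<theta> \<xi>
  proof (cases "1 \<le> C")
    case True then show ?thesis using rplus_bounds(2)[OF that, of \<theta>] by simp
  next
    case False
    define x where "x = vc (of_real C)"
    have "(0, x) \<in> phase_ball C" using C by (simp add: phase_ball_def x_def)
    then have "\<Lambda> (0, x) \<in> interior (phase_ball C)" using sub by blast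
    then have "norm (snd (\<Lambda> (0, x))) < C" by (auto simp: phase_ball_def interior_Times interior_cball mem_Times_iff)
    moreover have "circle_cis 0 = 1" using circle_cis_to_circle[of 0] by simp
    then have "flin \<gamma> 0 x = x" by (simp add: flin_def x_def stretch_def complex_eq_iff)
    then have "norm (snd (\<Lambda> (0, x))) = \<beta> * C / (1 + C\<^sup>2)" using C \<beta> by (simp add: Lam_eq x_def)
    ultimately have "C * \<beta> < C * (1 + C\<^sup>2)" using C add_pos_nonneg[of 1 "C\<^sup>2"] by (simp add: field_simps)
    then have b: "\<beta> < 1 + C\<^sup>2" using C mult_less_cancel_left_pos by blast
    define K where "K = (UNIV :: circle set) \<times> sphere (0 :: real^2) 1"
    have "compact K" unfolding K_def by (intro compact_Times compact_UNIV_circle compact_sphere)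
    moreover have "K \<noteq> {}" using vector_choose_size[of 1, where 'a="real^2"] unfolding K_def by auto
    moreover have "continuous_on K (\<lambda>p. rplus (fst p) (snd p))"
      by (rule continuous_on_subset[OF continuous_on_rplus]) (auto simp: K_def)
    ultimately obtain p where p: "p \<in> K" "\<And>q. q \<in> K \<Longrightarrow> rplus (fst q) (snd q) \<le> rplus (fst p) (snd p)"
      using continuous_attains_sup[of K "\<lambda>p. rplus (fst p) (snd p)"] by blast
    define R where "R = rplus (fst p) (snd p)"
    have R: "rplus \<theta> \<xi> \<le> R" if "\<xi> \<noteq> 0" for \<theta> \<xi>
      using p(2)[of "(\<theta>, (1 / norm \<xi>) *\<^sub>R \<xi>)"] that by (simp add: K_def R_def)
    have pz: "snd p \<noteq> 0" using p(1) by (auto simp: K_def)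
    have R1: "0 < R" "R \<le> 1" using rplus_bounds[OF pz] unfolding R_def by auto
    obtain \<theta>0 \<eta> where e: "fst p = \<theta>0 + \<alpha>" "snd p = A \<theta>0 \<eta>" by (rule fibre_preimage)
    then have \<eta>: "\<eta> \<noteq> 0" using pz by auto
    have "R = rad (gain \<theta>0 \<eta>) (rplus \<theta>0 \<eta>)" unfolding R_def e rplus_step[OF \<eta>] ..
    also have "\<dots> \<le> rad (gain \<theta>0 \<eta>) R"
      using R[OF \<eta>] R1 rplus_bounds[OF \<eta>, of \<theta>0] gain_bounds(4)[OF \<eta>, of \<theta>0]
      by (intro rad_mono) (auto simp: less_imp_le)
    also have "\<dots> \<le> \<beta> * R / (1 + R\<^sup>2)"
      unfolding rad_def using gain_bounds(2)[OF \<eta>, of \<theta>0] R1 by (intro divide_right_mono mult_right_mono) auto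
    finally have "R * (1 + R\<^sup>2) \<le> R * \<beta>" using add_pos_nonneg[of 1 "R\<^sup>2"] by (simp add: field_simps)
    then have "1 + R\<^sup>2 \<le> \<beta>" using R1 by simp
    then have "R\<^sup>2 < C\<^sup>2" using b by simp
    then have "R < C" using C by (simp add: power2_less_imp_less)
    then show ?thesis using R[OF that, of \<theta>] by simp
  qed
  show inC: "{p. gauge_fun p \<le> 1} \<subseteq> phase_ball C"
  proof
    fix p assume "p \<in> {p. gauge_fun p \<le> 1}"
    then have "snd p = 0 \<or> norm (snd p) \<le> rplus (fst p) (snd p)" by (simp add: gauge_fun_le_1)
    then have "norm (snd p) \<le> C" using rC[of "snd p" "fst p"] C by (cases "snd p = 0") auto
    then show "p \<in> phase_ball C" by (simp add: phase_ball_def mem_Times_iff)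
  qed
  have onto: "{p. gauge_fun p \<le> 1} \<subseteq> \<Lambda> ` {p. gauge_fun p \<le> 1}"
  proof
    fix q assume q: "q \<in> {p. gauge_fun p \<le> 1}"
    obtain \<theta> \<eta> where e: "fst q = \<theta> + \<alpha>" "snd q = A \<theta> \<eta>" by (rule fibre_preimage)
    show "q \<in> \<Lambda> ` {p. gauge_fun p \<le> 1}"
    proof (cases "\<eta> = 0")
      case True
      have "\<Lambda> (\<theta>, 0) = q" using True e by (simp add: Lam_eq prod_eq_iff)
      moreover have "gauge_fun (\<theta>, 0) \<le> 1" by (simp add: gauge_fun_le_1)
      ultimately show ?thesis by (metis (mono_tags) imageI mem_Collect_eq)
    next
      case False
      have nz: "A \<theta> \<eta> \<noteq> 0" using False \<gamma>0 by simp
      have "norm (A \<theta> \<eta>) \<le> rad (gain \<theta> \<eta>) (rplus \<theta> \<eta>)"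
        using q e nz unfolding rplus_step[OF False, symmetric] by (simp add: gauge_fun_le_1)
      moreover have "continuous_on {0..rplus \<theta> \<eta>} (rad (gain \<theta> \<eta>))"
        unfolding rad_def by (intro continuous_intros) (auto simp: add_nonneg_eq_0_iff)
      ultimately obtain t where t: "0 \<le> t" "t \<le> rplus \<theta> \<eta>" "rad (gain \<theta> \<eta>) t = norm (A \<theta> \<eta>)"
        using IVT'[of "rad (gain \<theta> \<eta>)" 0 "norm (A \<theta> \<eta>)" "rplus \<theta> \<eta>"] rplus_bounds(3)[OF False, of \<theta>]
        by (auto simp: rad_def)
      have "\<Lambda> (\<theta>, (t / norm \<eta>) *\<^sub>R \<eta>) = q"
        unfolding Lam_ray[OF False] t(3) using nz e by (simp add: prod_eq_iff)
      moreover have "gauge_fun (\<theta>, (t / norm \<eta>) *\<^sub>R \<eta>) \<le> 1"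
        using t False by (cases "t = 0") (auto simp: gauge_fun_le_1)
      ultimately show ?thesis by (metis (mono_tags) imageI mem_Collect_eq)
    qed
  qed
  have iter: "{p. gauge_fun p \<le> 1} \<subseteq> (\<Lambda> ^^ n) ` {p. gauge_fun p \<le> 1}" for n
  proof (induction n)
    case (Suc n)
    have "{p. gauge_fun p \<le> 1} \<subseteq> \<Lambda> ` (\<Lambda> ^^ n) ` {p. gauge_fun p \<le> 1}" using onto Suc by blast
    then show ?case by (simp add: image_comp)
  qed simp
  have upper: "snd p = 0 \<or> norm (snd ((\<Lambda> ^^ n) p)) \<le> pull n (fst ((\<Lambda> ^^ n) p)) (snd ((\<Lambda> ^^ n) p)) \<and> snd ((\<Lambda> ^^ n) p) \<noteq> 0"
    if "norm (snd p) \<le> 1" for n p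
  proof (induction n)
    case (Suc n)
    show ?case
    proof (cases "snd p = 0")
      case False
      define q where "q = (\<Lambda> ^^ n) p"
      have q: "norm (snd q) \<le> pull n (fst q) (snd q)" "snd q \<noteq> 0" using Suc False by (auto simp: q_def)
      have L: "\<Lambda> q = (fst q + \<alpha>, (\<beta> / (1 + (norm (snd q))\<^sup>2)) *\<^sub>R A (fst q) (snd q))"
        using Lam_eq[of \<omega> \<beta> \<gamma> "fst q" "snd q"] by simp
      have c: "\<beta> / (1 + (norm (snd q))\<^sup>2) \<noteq> 0" using \<beta> add_pos_nonneg[of 1 "(norm (snd q))\<^sup>2"] by simp
      have "norm (snd (\<Lambda> q)) = rad (gain (fst q) (snd q)) (norm (snd q))" using norm_Lam[OF q(2), of "fst q"] by simp
      also have "\<dots> \<le> rad (gain (fst q) (snd q)) (pull n (fst q) (snd q))"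
        using q pull_pos_le[OF q(2)] gain_bounds(4)[OF q(2), of "fst q"] by (intro rad_mono) auto
      also have "\<dots> = pull (Suc n) (fst (\<Lambda> q)) (snd (\<Lambda> q))"
        unfolding L using pull_Suc[of n "fst q" "snd q"] pull_scale[OF c, of "Suc n"] by simp
      finally have "norm (snd (\<Lambda> q)) \<le> pull (Suc n) (fst (\<Lambda> q)) (snd (\<Lambda> q))" .
      moreover have "snd (\<Lambda> q) \<noteq> 0" using Lam_eq_0[of "fst q" "snd q"] q by simp
      ultimately show ?thesis by (simp add: q_def)
    qed simp
  qed (use that in auto)
  show "global_attractor \<Lambda> (phase_ball C) = {p. gauge_fun p \<le> 1}"
  proof (intro equalityI subsetI)
    fix p assume p: "p \<in> global_attractor \<Lambda> (phase_ball C)"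
    show "p \<in> {p. gauge_fun p \<le> 1}"
    proof (cases "snd p = 0")
      case False
      have "norm (snd p) \<le> pull n (fst p) (snd p)" for n
      proof -
        \<comment> \<open>The additional iterate first brings points of X to norm at most 1, where
          the comparison with \<open>pull n\<close> starts.\<close>
        have "p \<in> (\<Lambda> ^^ Suc n) ` phase_ball C" using p unfolding global_attractor_def by blast
        then obtain x where x: "p = (\<Lambda> ^^ n) (\<Lambda> x)" by (auto simp: funpow_swap1)
        have "norm (snd (\<Lambda> x)) \<le> 1"
        proof (cases "snd x = 0")
          case True then show ?thesis using Lam_eq_0[of "fst x" "snd x"] by (metis norm_zero prod.collapse zero_le_one)
        next
          case xz: False
          then show ?thesis using norm_Lam[OF xz, of "fst x"] rad_bounds(2)[OF gain_bounds(1,3)[OF xz], of "norm (snd x)" "fst x"]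
            by simp
        qed
        from upper[OF this, of n] show ?thesis
        proof
          assume z: "snd (\<Lambda> x) = 0"
          have "snd ((\<Lambda> ^^ k) (\<Lambda> x)) = 0" for k
          proof (induction k)
            case (Suc k) then show ?case using Lam_eq_0[of "fst ((\<Lambda> ^^ k) (\<Lambda> x))" 0]
              by (metis funpow.simps(2) o_apply prod.collapse)
          qed (use z in simp)
          then show ?thesis using x False by simp
        qed (simp add: x)
      qed
      then have "norm (snd p) \<le> rplus (fst p) (snd p)"
        using LIMSEQ_le_const[OF pull_tendsto[OF False]] by blast
      then show ?thesis by (simp add: gauge_fun_le_1)
    qed (simp add: gauge_fun_le_1)
  next
    fix p assume "p \<in> {p. gauge_fun p \<le> 1}"
    then show "p \<in> global_attractor \<Lambda> (phase_ball C)"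
      unfolding global_attractor_def using iter inC by blast
  qed
qed

end

section \<open>Attraction to the two-point graph\<close>

text \<open>The logarithm has slope at least 1 on (0, 1], so convergence in the coordinate ln r
  implies convergence of the radii.\<close>

lemma abs_diff_le_ln:
  fixes a b :: real
  assumes "0 < a" "a \<le> 1" "0 < b" "b \<le> 1"
  shows "\<bar>a - b\<bar> \<le> \<bar>ln a - ln b\<bar>"
proof -
  have *: "y - x \<le> ln y - ln x" if "0 < x" "x \<le> y" "y \<le> 1" for x y :: real
  proof -
    have "ln (x / y) \<le> x / y - 1" using that by (intro ln_le_minus_one) simp
    then have "1 - x / y \<le> ln y - ln x" using that by (simp add: ln_div)
    moreover have "y * (1 - x / y) \<le> 1 * (1 - x / y)" using that by (intro mult_right_mono) auto
    moreover have "y * (1 - x / y) = y - x" using that by (simp add: field_simps)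
    ultimately have "y - x \<le> 1 - x / y" "1 - x / y \<le> ln y - ln x" by simp_all
    then show ?thesis by linarith
  qed
  show ?thesis
    using *[of a b] *[of b a] assms by (cases "a \<le> b") (auto simp: abs_if)
qed

text \<open>The logarithmic distance does not grow after the first step, so orbit a stays above m *
  exp (- d 1), and this gives one contraction rate for all later steps. Indices start at 1 because a
  0 may exceed 1.\<close>

lemma rad_orbits_synchronise:
  fixes a b s :: "nat \<Rightarrow> real"
  assumes s: "\<And>n. 1 \<le> s n" "\<And>n. s n \<le> 2"
    and a: "0 < a 0" "\<And>n. a (Suc n) = rad (s n) (a n)"
    and b: "\<And>n. b (Suc n) = rad (s n) (b n)" "\<And>n. m \<le> b n" "\<And>n. b n \<le> 1" and m: "0 < m"
  shows "(\<lambda>n. a n - b n) \<longlonglongrightarrow> 0"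
proof -
  have apos: "0 < a n" for n by (induction n) (auto simp: a rad_bounds(1)[OF s])
  have a1: "a (Suc n) \<le> 1" for n unfolding a(2) by (rule rad_bounds(2)[OF s apos])
  have bpos: "0 < b n" for n using b(2)[of n] m by linarith
  define d where "d n = \<bar>ln (a n) - ln (b n)\<bar>" for n
  have contr: "d (Suc (Suc n)) \<le> rate k * d (Suc n)" if "0 < k" "k \<le> a (Suc n)" "k \<le> b (Suc n)" for n k
    unfolding d_def a(2)[of "Suc n"] b(1)[of "Suc n"]
    using that a1 b(3) s(1)[of "Suc n"] by (intro rad_log_contraction) auto
  have mono: "d (Suc (Suc n)) \<le> d (Suc n)" for n
  proof -
    define k where "k = min (a (Suc n)) (b (Suc n))"
    have k: "0 < k" "k \<le> 1" using apos bpos a1 by (auto simp: k_def min_le_iff_disj)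
    have "d (Suc (Suc n)) \<le> rate k * d (Suc n)" using k by (intro contr) (auto simp: k_def)
    also have "\<dots> \<le> 1 * d (Suc n)" using rate_bounds[OF k] by (intro mult_right_mono) (auto simp: d_def)
    finally show ?thesis by simp
  qed
  have d1: "d (Suc n) \<le> d 1" for n
  proof (induction n)
    case (Suc n) then show ?case using mono[of n] by linarith
  qed simp
  define k where "k = m * exp (- d 1)"
  have m1: "m \<le> 1" using b(2)[of 0] b(3)[of 0] by linarith
  have "m * exp (- d 1) \<le> 1 * 1" using m m1 by (intro mult_mono) (auto simp: d_def)
  then have k: "0 < k" "k \<le> 1" using m by (auto simp: k_def)
  have kb: "k \<le> b n" for n
  proof -
    have "m * exp (- d 1) \<le> m * 1" using m by (intro mult_left_mono) (auto simp: d_def)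
    then show ?thesis using b(2)[of n] by (simp add: k_def)
  qed
  have ka: "k \<le> a (Suc n)" for n
  proof -
    have "ln m \<le> ln (b (Suc n))" using b(2)[of "Suc n"] m bpos by (subst ln_le_cancel_iff) auto
    then have "ln m - d 1 \<le> ln (a (Suc n))" using d1[of n] unfolding d_def by linarith
    then have "exp (ln m - d 1) \<le> a (Suc n)" using apos[of "Suc n"] by (simp add: ln_ge_iff)
    then show ?thesis using m by (simp add: k_def exp_diff exp_minus field_simps)
  qed
  have geo: "d (Suc n) \<le> rate k ^ n * d 1" for n
  proof (induction n)
    case (Suc n)
    have "d (Suc (Suc n)) \<le> rate k * d (Suc n)" by (rule contr[OF k(1) ka kb])
    also have "\<dots> \<le> rate k * (rate k ^ n * d 1)" using Suc rate_bounds[OF k] by (intro mult_left_mono) auto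
    finally show ?case by (simp add: mult.assoc)
  qed simp
  have "(\<lambda>n. rate k ^ n * d 1) \<longlonglongrightarrow> 0 * d 1" using rate_bounds[OF k] by (intro tendsto_intros LIMSEQ_power_zero) auto
  then have lim: "(\<lambda>n. rate k ^ n * d 1) \<longlonglongrightarrow> 0" by simp
  have "norm (a (Suc n) - b (Suc n)) \<le> rate k ^ n * d 1" for n
    using abs_diff_le_ln[OF apos a1 bpos b(3), of n "Suc n"] geo[of n] by (simp add: d_def)
  then have "(\<lambda>n. a (Suc n) - b (Suc n)) \<longlonglongrightarrow> 0"
    by (intro Lim_null_comparison[OF _ lim]) simp
  then show ?thesis by (rule LIMSEQ_imp_Suc)
qed

text \<open>The square of the unit direction of \<open>\<xi>\<close>, i.e. the point of the projective line seen as a circle.\<close>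

definition zdir :: "real^2 \<Rightarrow> complex" where "zdir \<xi> = cv \<xi> / cnj (cv \<xi>)"

lemma norm_zdir: "\<xi> \<noteq> 0 \<Longrightarrow> norm (zdir \<xi>) = 1"
  by (simp add: zdir_def norm_divide)

lemma zdir_scale [simp]: "t \<noteq> 0 \<Longrightarrow> zdir (t *\<^sub>R \<xi>) = zdir \<xi>"
  by (simp add: zdir_def) (simp only: scaleR_conv_of_real complex_cnj_mult complex_cnj_complex_of_real, simp)

lemma zdir_diff_le:
  assumes "\<xi> \<noteq> 0" "\<eta> \<noteq> 0"
  shows "norm (zdir \<xi> - zdir \<eta>) \<le> 2 * norm (\<xi> - \<eta>) / norm \<xi>"
proof -
  define x y where xy: "x = cv \<xi>" "y = cv \<eta>"
  have nz: "x \<noteq> 0" "y \<noteq> 0" using assms by (auto simp: xy)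
  have "zdir \<xi> - zdir \<eta> = ((x - y) * cnj y - y * cnj (x - y)) / (cnj x * cnj y)"
    using nz by (simp add: zdir_def xy[symmetric] field_simps)
  then have "norm (zdir \<xi> - zdir \<eta>) \<le> (norm ((x - y) * cnj y) + norm (y * cnj (x - y))) / (norm x * norm y)"
    using norm_triangle_ineq4[of "(x - y) * cnj y" "y * cnj (x - y)"] by (simp add: norm_divide norm_mult divide_right_mono)
  also have "norm (x - y) = norm (\<xi> - \<eta>)" by (metis xy cv_simps(2) norm_cv)
  then have "(norm ((x - y) * cnj y) + norm (y * cnj (x - y))) / (norm x * norm y) = 2 * norm (\<xi> - \<eta>) / norm \<xi>"
    using nz unfolding norm_mult complex_mod_cnj by (simp add: xy field_simps)
  finally show ?thesis .
qed

lemma zdir_eq_imp_parallel: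
  assumes "\<xi> \<noteq> 0" "\<eta> \<noteq> 0" "zdir \<xi> = zdir \<eta>"
  obtains t where "t \<noteq> 0" "\<xi> = t *\<^sub>R \<eta>"
proof -
  define x y where xy: "x = cv \<xi>" "y = cv \<eta>"
  have nz: "x \<noteq> 0" "y \<noteq> 0" using assms by (auto simp: xy)
  have "x * cnj y = y * cnj x" using assms(3) nz by (simp add: zdir_def xy[symmetric] field_simps)
  then have "cnj (x / y) = x / y" using nz by (simp add: field_simps)
  then obtain t where t: "x / y = of_real t" by (metis Reals_cases Reals_cnj_iff)
  have "t \<noteq> 0" using t nz by auto
  moreover have "cv \<xi> = t *\<^sub>R cv \<eta>" using t nz unfolding xy by (simp add: scaleR_conv_of_real field_simps)
  then have "cv \<xi> = cv (t *\<^sub>R \<eta>)" by simp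
  then have "\<xi> = t *\<^sub>R \<eta>" by (simp only: cv_eq_iff)
  ultimately show thesis by (rule that)
qed

text \<open>The determinant of the pair \<xi>, \<eta>, i.e. the signed area they span.\<close>

definition cross :: "real^2 \<Rightarrow> real^2 \<Rightarrow> real" where "cross \<xi> \<eta> = Im (cnj (cv \<xi>) * cv \<eta>)"

text \<open>The distance of squared directions is twice the sine of the angle between the vectors.
  Since determinants evolve exactly, it can be estimated from norms alone.\<close>

lemma zdir_diff_cross:
  assumes "\<xi> \<noteq> 0" "\<eta> \<noteq> 0"
  shows "norm (zdir \<xi> - zdir \<eta>) = 2 * \<bar>cross \<xi> \<eta>\<bar> / (norm \<xi> * norm \<eta>)"
proof -
  define x y where xy: "x = cv \<xi>" "y = cv \<eta>"
  have nz: "x \<noteq> 0" "y \<noteq> 0" using assms by (auto simp: xy)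
  have "zdir \<xi> - zdir \<eta> = (x * cnj y - y * cnj x) / (cnj x * cnj y)"
    using nz by (simp add: zdir_def xy[symmetric] field_simps)
  also have "x * cnj y - y * cnj x = - 2 * \<i> * of_real (cross \<xi> \<eta>)"
    by (simp add: cross_def xy[symmetric] complex_eq_iff algebra_simps)
  finally show ?thesis by (simp add: norm_divide norm_mult xy)
qed

lemma cross_le: "\<bar>cross \<xi> \<eta>\<bar> \<le> norm \<xi> * norm \<eta>"
  using abs_Im_le_cmod[of "cnj (cv \<xi>) * cv \<eta>"] by (simp add: cross_def norm_mult)

lemma cross_flin: "cross (flin \<gamma> \<theta> \<xi>) (flin \<gamma> \<theta> \<eta>) = \<gamma> * cross \<xi> \<eta>"
proof -
  define c where "c = circle_cis \<theta>"
  have st: "Im (cnj (stretch \<gamma> x) * stretch \<gamma> y) = \<gamma> * Im (cnj x * y)" for x y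
    by (simp add: stretch_def algebra_simps)
  have "cnj (cnj c * cv \<xi>) * (cnj c * cv \<eta>) = (c * cnj c) * (cnj (cv \<xi>) * cv \<eta>)" by (simp add: mult_ac)
  also have "\<dots> = cnj (cv \<xi>) * cv \<eta>" by (simp add: c_def circle_cis_cnj)
  finally have e: "cnj (cnj c * cv \<xi>) * (cnj c * cv \<eta>) = cnj (cv \<xi>) * cv \<eta>" .
  show ?thesis unfolding cross_def flin_def c_def[symmetric] cv_vc st e ..
qed

section \<open>The linear cocycle as a Moebius map\<close>

definition mobk :: "real \<Rightarrow> real" where "mobk \<gamma> = (1 - \<gamma>) / (1 + \<gamma>)"

lemma mobk: assumes "0 < \<gamma>" "\<gamma> < 1" shows "0 < mobk \<gamma>" "mobk \<gamma> < 1"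
  using assms by (auto simp: mobk_def field_simps)

text \<open>With w the rotated vector, w = z * cnj w. Both terms of \<open>stretch_eq\<close> then
  have the factor cnj w, and the quotient of the result by its conjugate is the Moebius map; the
  modulus of the denominator is the growth of the norm.\<close>

lemma flin_zdir_norm:
  assumes \<gamma>: "0 < \<gamma>" "\<gamma> < 1" and \<xi>: "\<xi> \<noteq> 0"
  shows "zdir (flin \<gamma> \<theta> \<xi>) = mob (mobk \<gamma>) (rot2 \<theta> * zdir \<xi>)"
    and "norm (flin \<gamma> \<theta> \<xi>) = (1 + \<gamma>) / 2 * norm (1 + of_real (mobk \<gamma>) * (rot2 \<theta> * zdir \<xi>)) * norm \<xi>"
proof -
  define w where "w = cnj (circle_cis \<theta>) * cv \<xi>"
  define a b where ab: "a = (1 + \<gamma>) / 2" "b = (1 - \<gamma>) / 2"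
  define z where "z = rot2 \<theta> * zdir \<xi>"
  have a: "0 < a" using \<gamma> by (simp add: ab)
  have k: "mobk \<gamma> = b / a" unfolding ab mobk_def using \<gamma> by (simp add: divide_simps) (simp add: algebra_simps)
  have cc: "circle_cis \<theta> \<noteq> 0" using norm_circle_cis[of \<theta>] by force
  have w: "w \<noteq> 0" using \<xi> cc by (simp add: w_def)
  have "inverse (circle_cis \<theta>) = cnj (circle_cis \<theta>)" using circle_cis_cnj[of \<theta>] by (simp add: inverse_unique)
  then have wz: "w = cnj w * z" using \<xi> cc
    by (simp add: w_def z_def rot2_def zdir_def power2_eq_square field_simps)
  have nz: "norm z = 1" using norm_zdir[OF \<xi>] by (simp add: z_def norm_mult)
  have cst: "cnj (stretch \<gamma> w) = cnj w * (of_real a * (1 + of_real (mobk \<gamma>) * z))"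
  proof -
    have "cnj (stretch \<gamma> w) = of_real a * cnj w + of_real b * w" unfolding stretch_eq ab by simp
    also have "\<dots> = cnj w * (of_real a + of_real b * z)" by (subst (2) wz) (simp add: algebra_simps)
    also have "of_real a + of_real b * z = of_real a * (1 + of_real (mobk \<gamma>) * z)" using a by (simp add: k field_simps)
    finally show ?thesis .
  qed
  have st: "stretch \<gamma> w = cnj w * (of_real a * (z + of_real (mobk \<gamma>)))"
  proof -
    have "stretch \<gamma> w = of_real a * w + of_real b * cnj w" unfolding stretch_eq ab by simp
    also have "\<dots> = cnj w * (of_real a * z + of_real b)" by (subst (1) wz) (simp add: algebra_simps)
    also have "of_real a * z + of_real b = of_real a * (z + of_real (mobk \<gamma>))" using a by (simp add: k field_simps)
    finally show ?thesis .
  qed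
  have cvf: "cv (flin \<gamma> \<theta> \<xi>) = stretch \<gamma> w" by (simp add: flin_def w_def)
  have "zdir (flin \<gamma> \<theta> \<xi>) = stretch \<gamma> w / cnj (stretch \<gamma> w)" by (simp add: zdir_def cvf)
  also have "\<dots> = (z + of_real (mobk \<gamma>)) / (1 + of_real (mobk \<gamma>) * z)"
    unfolding cst unfolding st using w a by simp
  finally show "zdir (flin \<gamma> \<theta> \<xi>) = mob (mobk \<gamma>) (rot2 \<theta> * zdir \<xi>)" by (simp add: mob_def z_def)
  have "norm (flin \<gamma> \<theta> \<xi>) = norm (cnj (stretch \<gamma> w))" by (metis cvf norm_cv complex_mod_cnj)
  also have "\<dots> = norm w * (a * norm (1 + of_real (mobk \<gamma>) * z))" unfolding cst using a by (simp add: norm_mult)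
  also have "norm w = norm \<xi>" by (simp add: w_def norm_mult)
  finally show "norm (flin \<gamma> \<theta> \<xi>) = (1 + \<gamma>) / 2 * norm (1 + of_real (mobk \<gamma>) * (rot2 \<theta> * zdir \<xi>)) * norm \<xi>"
    by (simp add: ab z_def mult_ac)
qed

text \<open>The derivative of the projective action is the determinant divided by the squared
  growth; with a = (1 + \<gamma>) / 2 one has 1 - \<open>mobk \<gamma>\<close>^2 = \<gamma> /
  a^2.\<close>

lemma flin_rate:
  assumes \<gamma>: "0 < \<gamma>" "\<gamma> < 1" and \<xi>: "\<xi> \<noteq> 0"
  shows "\<gamma> * (norm \<xi>)\<^sup>2 / (norm (flin \<gamma> \<theta> \<xi>))\<^sup>2 = mob_rate (mobk \<gamma>) (rot2 \<theta> * zdir \<xi>)"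
proof -
  define a where "a = (1 + \<gamma>) / 2"
  have a: "0 < a" using \<gamma> by (simp add: a_def)
  have "norm (1 + of_real (mobk \<gamma>) * (rot2 \<theta> * zdir \<xi>)) \<noteq> 0"
    using mob_denom(4)[OF mobk[OF \<gamma>], of "rot2 \<theta> * zdir \<xi>"] norm_zdir[OF \<xi>] by (simp add: norm_mult)
  moreover have "1 - (mobk \<gamma>)\<^sup>2 = \<gamma> / a\<^sup>2"
    unfolding a_def using \<gamma> by (simp add: mobk_def power_divide field_simps) (simp add: power2_eq_square algebra_simps)
  ultimately show ?thesis unfolding flin_zdir_norm(2)[OF \<gamma> \<xi>, folded a_def] mob_rate_def
    using a \<xi> by (simp add: power_mult_distrib)
qed

lemma det_matrix_flin: "det (matrix (flin \<gamma> \<theta>)) = \<gamma>"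
proof -
  have c: "cos_turn \<theta> * cos_turn \<theta> + sin_turn \<theta> * sin_turn \<theta> = 1"
    using norm_circle_cis[of \<theta>] by (simp add: circle_cis_def complex_norm power2_eq_square real_sqrt_eq_1_iff)
  have "det (matrix (flin \<gamma> \<theta>)) = \<gamma> * (cos_turn \<theta> * cos_turn \<theta> + sin_turn \<theta> * sin_turn \<theta>)"
    by (simp add: det_2 matrix_def flin_def vc_def stretch_def cv_def circle_cis_def axis_def algebra_simps)
  then show ?thesis by (simp only: c)
qed

context sna_system
begin

section \<open>Fibre orbits and the linear cocycle\<close>

definition at_time :: "circle \<Rightarrow> nat \<Rightarrow> circle" where "at_time \<theta> n = \<theta> + to_circle (real n * \<omega>)"

lemma at_time_0 [simp]: "at_time \<theta> 0 = \<theta>" by (simp add: at_time_def)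
lemma at_time_Suc: "at_time \<theta> (Suc n) = at_time \<theta> n + \<alpha>"
  by (simp add: at_time_def distrib_right to_circle_add algebra_simps)

lemma Lam_iter: "(\<Lambda> ^^ n) (\<theta>, \<xi>) = (at_time \<theta> n, fibre_iter \<Lambda> n \<theta> \<xi>)"
proof -
  have "fst ((\<Lambda> ^^ n) (\<theta>, \<xi>)) = at_time \<theta> n" by (induction n) (simp_all add: at_time_Suc)
  then show ?thesis by (simp add: fibre_iter_def prod_eq_iff)
qed

lemma fibre_iter_0 [simp]: "fibre_iter \<Lambda> 0 \<theta> \<xi> = \<xi>" by (simp add: fibre_iter_def)

lemma fibre_iter_Suc: "fibre_iter \<Lambda> (Suc n) \<theta> \<xi> = snd (\<Lambda> (at_time \<theta> n, fibre_iter \<Lambda> n \<theta> \<xi>))"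
  unfolding fibre_iter_def[of _ "Suc n"] by (simp add: Lam_iter)

lemma fibre_iter_nz: "\<xi> \<noteq> 0 \<Longrightarrow> fibre_iter \<Lambda> n \<theta> \<xi> \<noteq> 0"
  by (induction n) (simp_all add: fibre_iter_Suc Lam_eq_0)

text \<open>The radius of the orbit and the torus radius in the direction of the orbit are driven by
  the same gains.\<close>

lemma radial_attraction:
  assumes \<xi>: "\<xi> \<noteq> 0"
  shows "(\<lambda>n. norm (fibre_iter \<Lambda> n \<theta> \<xi>) - rplus (at_time \<theta> n) (fibre_iter \<Lambda> n \<theta> \<xi>)) \<longlonglongrightarrow> 0"
proof (rule rad_orbits_synchronise[where s="\<lambda>n. gain (at_time \<theta> n) (fibre_iter \<Lambda> n \<theta> \<xi>)" and m=rmin])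
  note nz = fibre_iter_nz[OF \<xi>]
  fix n
  show "norm (fibre_iter \<Lambda> (Suc n) \<theta> \<xi>) = rad (gain (at_time \<theta> n) (fibre_iter \<Lambda> n \<theta> \<xi>)) (norm (fibre_iter \<Lambda> n \<theta> \<xi>))"
    unfolding fibre_iter_Suc by (rule norm_Lam[OF nz])
  show "rplus (at_time \<theta> (Suc n)) (fibre_iter \<Lambda> (Suc n) \<theta> \<xi>)
      = rad (gain (at_time \<theta> n) (fibre_iter \<Lambda> n \<theta> \<xi>)) (rplus (at_time \<theta> n) (fibre_iter \<Lambda> n \<theta> \<xi>))"
    unfolding fibre_iter_Suc at_time_Suc by (rule rplus_Lam[OF nz])
qed (use fibre_iter_nz[OF \<xi>] gain_bounds rplus_bounds rmin \<xi> in auto)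

primrec lin_iter :: "nat \<Rightarrow> circle \<Rightarrow> real^2 \<Rightarrow> real^2" where
  "lin_iter 0 \<theta> \<xi> = \<xi>"
| "lin_iter (Suc n) \<theta> \<xi> = A (at_time \<theta> n) (lin_iter n \<theta> \<xi>)"

lemma lin_iter_nz [simp]: "lin_iter n \<theta> \<xi> = 0 \<longleftrightarrow> \<xi> = 0"
  using \<gamma>0 by (induction n) auto

lemma linear_lin_iter: "linear (lin_iter n \<theta>)"
proof (induction n)
  case 0 show ?case by (rule linearI) simp_all
next
  case (Suc n)
  have "lin_iter (Suc n) \<theta> = A (at_time \<theta> n) \<circ> lin_iter n \<theta>" by auto
  then show ?case using linear_compose[OF Suc linear_flin] by metis
qed

text \<open>The nonlinearity only rescales vectors, so directions of fibre orbits are those of the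
  linear cocycle.\<close>

lemma fibre_iter_lin: "\<exists>t>0. fibre_iter \<Lambda> n \<theta> \<xi> = t *\<^sub>R lin_iter n \<theta> \<xi>"
proof (induction n)
  case 0 show ?case by (intro exI[of _ 1]) simp
next
  case (Suc n)
  then obtain t where t: "0 < t" "fibre_iter \<Lambda> n \<theta> \<xi> = t *\<^sub>R lin_iter n \<theta> \<xi>" by blast
  define u where "u = \<beta> / (1 + (norm (fibre_iter \<Lambda> n \<theta> \<xi>))\<^sup>2)"
  have "0 < u" using \<beta> add_pos_nonneg[of 1 "(norm (fibre_iter \<Lambda> n \<theta> \<xi>))\<^sup>2"] by (simp add: u_def)
  moreover have "fibre_iter \<Lambda> (Suc n) \<theta> \<xi> = (u * t) *\<^sub>R lin_iter (Suc n) \<theta> \<xi>"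
    unfolding fibre_iter_Suc Lam_eq snd_conv u_def[symmetric] by (simp add: t(2))
  ultimately show ?case using t(1) by (intro exI[of _ "u * t"]) simp
qed

lemma cross_lin_iter: "cross (lin_iter n \<theta> \<xi>) (lin_iter n \<theta> \<eta>) = \<gamma> ^ n * cross \<xi> \<eta>"
  by (induction n) (simp_all add: cross_flin)

lemma continuous_on_at_time: "continuous_on S (\<lambda>p. at_time (fst p) n)"
  unfolding at_time_def by (intro continuous_intros)

lemma continuous_on_lin_iter: "continuous_on S (\<lambda>p. lin_iter n (fst p) (snd p))"
  by (induction n) (auto intro!: continuous_intros continuous_on_at_time)

lemma lin_iter_lower: "\<gamma> ^ n * norm \<xi> \<le> norm (lin_iter n \<theta> \<xi>)"
proof (induction n)
  case (Suc n)
  have "\<gamma> * (\<gamma> ^ n * norm \<xi>) \<le> \<gamma> * norm (lin_iter n \<theta> \<xi>)" using Suc \<gamma> by (intro mult_left_mono) auto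
  also have "\<dots> \<le> norm (lin_iter (Suc n) \<theta> \<xi>)" using norm_flin(2)[OF \<gamma>] by simp
  finally show ?case by simp
qed simp

lemma det_matrix_lin_iter: "det (matrix (lin_iter n \<theta>)) = \<gamma> ^ n"
proof (induction n)
  case 0
  have "lin_iter 0 \<theta> = id" by auto
  then show ?case unfolding \<open>lin_iter 0 \<theta> = id\<close> matrix_id_mat_1 by simp
next
  case (Suc n)
  have e: "lin_iter (Suc n) \<theta> = A (at_time \<theta> n) \<circ> lin_iter n \<theta>" by auto
  show ?case
    unfolding e matrix_compose[OF linear_lin_iter linear_flin] det_mul det_matrix_flin Suc by simp
qed

text \<open>The set is the preimage of a disc under a linear bijection of determinant
  \<gamma>^n.\<close>

lemma measure_lin_iter_sublevel:
  assumes "0 < \<rho>"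
  shows "measure lborel {\<xi>. norm (lin_iter n \<theta> \<xi>) < \<rho>} = pi * \<rho>\<^sup>2 / \<gamma> ^ n" "open {\<xi>. norm (lin_iter n \<theta> \<xi>) < \<rho>}"
    "bounded {\<xi>. norm (lin_iter n \<theta> \<xi>) < \<rho>}"
proof -
  define S where "S = {\<xi>. norm (lin_iter n \<theta> \<xi>) < \<rho>}"
  have "continuous_on UNIV (\<lambda>\<xi>. (\<theta>, \<xi>))" by (rule continuous_on_Pair[OF continuous_on_const continuous_on_id])
  from continuous_on_compose2[OF continuous_on_lin_iter[of UNIV n] this]
  have cont: "continuous_on UNIV (lin_iter n \<theta>)" by simp
  show op: "open {\<xi>. norm (lin_iter n \<theta> \<xi>) < \<rho>}" by (intro open_Collect_less continuous_intros cont)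
  have "norm \<xi> \<le> \<rho> / \<gamma> ^ n" if "norm (lin_iter n \<theta> \<xi>) < \<rho>" for \<xi>
    using lin_iter_lower[of n \<xi> \<theta>] that \<gamma> by (simp add: field_simps)
  then show bd: "bounded {\<xi>. norm (lin_iter n \<theta> \<xi>) < \<rho>}" unfolding bounded_iff by blast
  have S: "S \<in> lmeasurable" unfolding S_def by (rule lmeasurable_open[OF bd op])
  have "lin_iter n \<theta> ` S = ball 0 \<rho>"
  proof (intro equalityI subsetI)
    fix y :: "real^2" assume y: "y \<in> ball 0 \<rho>"
    have "inj (lin_iter n \<theta>)" using linear_lin_iter by (simp add: linear_injective_0)
    then have "surj (lin_iter n \<theta>)" using linear_lin_iter linear_injective_imp_surjective by blast
    then obtain x where "y = lin_iter n \<theta> x" by auto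
    then show "y \<in> lin_iter n \<theta> ` S" using y by (auto simp: S_def)
  qed (auto simp: S_def)
  moreover have "measure lebesgue (lin_iter n \<theta> ` S) = \<gamma> ^ n * measure lebesgue S"
    using measure_linear_image[OF linear_lin_iter[of n \<theta>] S] \<gamma> by (simp add: det_matrix_lin_iter)
  moreover have "measure lebesgue (ball (0::real^2) \<rho>) = pi * \<rho>\<^sup>2"
    using assms content_ball[of \<rho> "0 :: real^2"] by (simp add: unit_ball_vol_2)
  ultimately have "measure lebesgue S = pi * \<rho>\<^sup>2 / \<gamma> ^ n" using \<gamma> by (simp add: field_simps)
  then show "measure lborel {\<xi>. norm (lin_iter n \<theta> \<xi>) < \<rho>} = pi * \<rho>\<^sup>2 / \<gamma> ^ n"
    using op by (simp add: S_def)
qed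

end

text \<open>A Borel square root on the unit circle: the direction bisecting 1 and z, with \<i>
  chosen at z = -1, where the bisector degenerates.\<close>

definition halfdir :: "complex \<Rightarrow> complex" where
  "halfdir z = (if z = -1 then \<i> else (1 + z) / of_real (norm (1 + z)))"

lemma halfdir:
  assumes "norm z = 1"
  shows "norm (halfdir z) = 1" "halfdir z / cnj (halfdir z) = z"
proof -
  have nz: "1 + z \<noteq> 0" if "z \<noteq> -1" using that by (metis add.inverse_unique minus_minus)
  then show "norm (halfdir z) = 1" by (auto simp: halfdir_def norm_divide)
  show "halfdir z / cnj (halfdir z) = z"
  proof (cases "z = -1")
    case False
    have zz: "z * cnj z = 1" using complex_norm_square[of z] assms by simp
    have "cnj (1 + z) \<noteq> 0" using nz[OF False] by (simp del: complex_cnj_add)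
    then have nz': "1 + cnj z \<noteq> 0" by simp
    have "z * (1 + cnj z) = 1 + z" using zz by (simp add: distrib_left add.commute)
    then show ?thesis using nz[OF False] nz' False by (simp add: halfdir_def) (metis nonzero_mult_div_cancel_right)
  qed (simp add: halfdir_def)
qed

lemma measurable_vc [measurable]: "vc \<in> borel_measurable borel"
  by (rule borel_measurable_continuous_onI) (rule continuous_on_vc[OF continuous_on_id, simplified])

lemma halfdir_measurable [measurable]: "halfdir \<in> borel_measurable borel"
  unfolding halfdir_def[abs_def] by measurable

section \<open>The two-point graph and its basin\<close>

locale sna_graph = sna_system +
  fixes \<psi> :: "circle \<Rightarrow> complex" and Gd :: "circle set" and c :: real
  assumes \<psi>m [measurable]: "\<psi> \<in> borel_measurable borel" and Gm [measurable]: "Gd \<in> sets borel"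
    and GAE: "AE \<theta> in lebesgue_circle. \<theta> \<in> Gd"
    and \<psi>1: "\<And>\<theta>. norm (\<psi> \<theta>) = 1"
    and GT: "\<And>\<theta>. \<theta> \<in> Gd \<Longrightarrow> \<theta> + to_circle \<omega> \<in> Gd"
    and \<psi>T: "\<And>\<theta>. \<theta> \<in> Gd \<Longrightarrow> \<psi> (\<theta> + to_circle \<omega>) = mob (mobk \<gamma>) (rot2 \<theta> * \<psi> \<theta>)"
    and c: "0 < c"
    and decay: "\<And>\<theta>. \<theta> \<in> Gd \<Longrightarrow>
      \<exists>B. \<forall>n. birkhoff_sum \<omega> (\<lambda>\<theta>. ln (mob_rate (mobk \<gamma>) (rot2 \<theta> * \<psi> \<theta>))) n \<theta> \<le> B - c * real n"
begin

definition dirv :: "circle \<Rightarrow> real^2" where "dirv \<theta> = vc (halfdir (\<psi> \<theta>))"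

lemma dirv: "norm (dirv \<theta>) = 1" "zdir (dirv \<theta>) = \<psi> \<theta>" "dirv \<theta> \<noteq> 0"
  using halfdir[OF \<psi>1, of \<theta>] by (auto simp: dirv_def zdir_def)

definition pt :: "circle \<Rightarrow> real^2" where "pt \<theta> = rplus \<theta> (dirv \<theta>) *\<^sub>R dirv \<theta>"

lemma dirv_measurable [measurable]: "dirv \<in> borel_measurable borel"
  unfolding dirv_def[abs_def] by measurable

lemma pt_measurable [measurable]: "pt \<in> borel_measurable borel"
proof -
  have [measurable]: "gauge_fun \<in> borel_measurable borel"
    by (rule borel_measurable_continuous_onI[OF continuous_on_gauge_fun])
  have [measurable]: "(\<lambda>\<theta>. (\<theta>, dirv \<theta>)) \<in> borel_measurable borel"
    unfolding borel_prod[symmetric] by measurable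
  have "pt \<theta> = (1 / gauge_fun (\<theta>, dirv \<theta>)) *\<^sub>R dirv \<theta>" for \<theta>
    by (simp add: pt_def gauge_fun_def dirv)
  then show ?thesis by (simp add: fun_eq_iff[symmetric] cong: measurable_cong) measurable
qed

lemma pt: "pt \<theta> \<noteq> 0" "zdir (pt \<theta>) = \<psi> \<theta>" "norm (pt \<theta>) = rplus \<theta> (dirv \<theta>)" "rplus \<theta> (pt \<theta>) = rplus \<theta> (dirv \<theta>)"
    "rmin \<le> norm (pt \<theta>)" "norm (pt \<theta>) \<le> 1"
  using dirv[of \<theta>] rplus_bounds[OF dirv(3), of \<theta>] by (auto simp: pt_def)

lemma pt_torus: "(\<theta>, pt \<theta>) \<in> torus" "(\<theta>, - pt \<theta>) \<in> torus"
  using pt[of \<theta>] by (auto simp: torus_def)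

lemma torus_zdir_unique:
  assumes "(\<theta>, \<xi>) \<in> torus" "zdir \<xi> = \<psi> \<theta>"
  shows "\<xi> = pt \<theta> \<or> \<xi> = - pt \<theta>"
proof -
  have \<xi>: "\<xi> \<noteq> 0" "norm \<xi> = rplus \<theta> \<xi>" using assms(1) by (auto simp: torus_def)
  obtain t where t: "t \<noteq> 0" "\<xi> = t *\<^sub>R pt \<theta>"
    using zdir_eq_imp_parallel[OF \<xi>(1) pt(1)[of \<theta>]] assms(2) pt(2) by metis
  have "\<bar>t\<bar> * norm (pt \<theta>) = 1 * norm (pt \<theta>)" using \<xi>(2) t(1) pt(3,4)[of \<theta>] unfolding t(2) by simp
  then have "\<bar>t\<bar> = 1" using pt(1)[of \<theta>] unfolding mult_cancel_right by simp
  then show ?thesis using t by (auto simp: abs_if split: if_splits)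
qed

lemma Lam_minus: "snd (\<Lambda> (\<theta>, - \<xi>)) = - snd (\<Lambda> (\<theta>, \<xi>))"
  by (simp add: Lam_eq)

text \<open>The root chosen by \<open>halfdir\<close> takes no account of the dynamics, so the sign
  is uncontrolled and only the pair \<open>{pt \<theta>, - pt \<theta>}\<close> is
  invariant.\<close>

lemma pt_step:
  assumes "\<theta> \<in> Gd"
  shows "snd (\<Lambda> (\<theta>, pt \<theta>)) = pt (\<theta> + \<alpha>) \<or> snd (\<Lambda> (\<theta>, pt \<theta>)) = - pt (\<theta> + \<alpha>)"
proof (rule torus_zdir_unique)
  have "\<Lambda> (\<theta>, pt \<theta>) \<in> torus" using pt_torus(1) torus_invariant by blast
  moreover have "\<Lambda> (\<theta>, pt \<theta>) = (\<theta> + \<alpha>, snd (\<Lambda> (\<theta>, pt \<theta>)))" by (simp add: Lam_eq)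
  ultimately show "(\<theta> + \<alpha>, snd (\<Lambda> (\<theta>, pt \<theta>))) \<in> torus" by metis
  have "\<beta> / (1 + (norm (pt \<theta>))\<^sup>2) \<noteq> 0" using \<beta> add_pos_nonneg[of 1 "(norm (pt \<theta>))\<^sup>2"] by simp
  then show "zdir (snd (\<Lambda> (\<theta>, pt \<theta>))) = \<psi> (\<theta> + \<alpha>)"
    using flin_zdir_norm(1)[OF \<gamma> pt(1)[of \<theta>], of \<theta>] by (simp add: Lam_eq \<psi>T[OF assms] pt(2))
qed

lemma Gd_at_time: "\<theta> \<in> Gd \<Longrightarrow> at_time \<theta> n \<in> Gd"
  by (induction n) (auto simp: at_time_Suc GT)

lemma fibre_iter_minus: "fibre_iter \<Lambda> n \<theta> (- \<xi>) = - fibre_iter \<Lambda> n \<theta> \<xi>"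
  by (induction n) (simp_all add: fibre_iter_Suc Lam_minus)

lemma fibre_iter_pt:
  assumes "\<theta> \<in> Gd"
  shows "fibre_iter \<Lambda> n \<theta> (pt \<theta>) = pt (at_time \<theta> n) \<or> fibre_iter \<Lambda> n \<theta> (pt \<theta>) = - pt (at_time \<theta> n)"
proof (induction n)
  case (Suc n)
  then show ?case
    using pt_step[OF Gd_at_time[OF assms, of n]] Lam_minus[of "at_time \<theta> n" "pt (at_time \<theta> n)"]
    unfolding fibre_iter_Suc at_time_Suc by (elim disjE) simp_all
qed simp

definition graph :: "circle \<Rightarrow> (real^2) set" where
  "graph \<theta> = (if \<theta> \<in> Gd then {pt \<theta>, - pt \<theta>} else {})"

lemma pt_neq_minus: "pt \<theta> \<noteq> - pt \<theta>"
proof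
  assume "pt \<theta> = - pt \<theta>"
  then have "pt \<theta> + pt \<theta> = 0" by (simp only: eq_neg_iff_add_eq_0)
  then have "(2 :: real) *\<^sub>R pt \<theta> = 0" by (simp add: scaleR_2)
  then show False using pt(1)[of \<theta>] by simp
qed

lemma two_valued_graph:
  assumes "{p. gauge_fun p \<le> 1} \<subseteq> phase_ball C"
  shows "two_valued_invariant_graph \<omega> \<Lambda> C graph"
  unfolding two_valued_invariant_graph_def
proof (intro conjI allI impI)
  fix U :: "(real^2) set" assume "open U"
  then have [measurable]: "U \<in> sets borel" by simp
  have "{\<theta>. graph \<theta> \<inter> U \<noteq> {}} = Gd \<inter> ({\<theta>. pt \<theta> \<in> U} \<union> {\<theta>. - pt \<theta> \<in> U})" by (auto simp: graph_def)
  moreover have "Gd \<inter> ({\<theta>. pt \<theta> \<in> U} \<union> {\<theta>. - pt \<theta> \<in> U}) \<in> sets borel" by measurable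
  ultimately show "{\<theta>. graph \<theta> \<inter> U \<noteq> {}} \<in> sets (completion lebesgue_circle)"
    by (intro sets_completionI_sets) simp
next
  show "AE \<theta> in lebesgue_circle. card (graph \<theta>) = 2 \<and> graph \<theta> \<subseteq> cball 0 C"
    using GAE
  proof eventually_elim
    case (elim \<theta>)
    have "(\<theta>, pt \<theta>) \<in> {p. gauge_fun p \<le> 1}" using pt_torus(1)[of \<theta>] by (simp flip: gauge_fun_eq_1)
    then have "norm (pt \<theta>) \<le> C" using assms by (auto simp: phase_ball_def)
    then show ?case using elim pt_neq_minus[of \<theta>] by (simp add: graph_def)
  qed
  show "AE \<theta> in lebesgue_circle. fibre_iter \<Lambda> 1 \<theta> ` graph \<theta> = graph (\<theta> + to_circle \<omega>)"
    using GAE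
  proof eventually_elim
    case (elim \<theta>)
    have "fibre_iter \<Lambda> 1 \<theta> \<xi> = snd (\<Lambda> (\<theta>, \<xi>))" for \<xi> by (simp add: fibre_iter_def)
    then show ?case using elim GT[OF elim] pt_step[OF elim] Lam_minus[of \<theta> "pt \<theta>"] by (auto simp: graph_def)
  qed
qed

text \<open>Determinant over squared growth: the derivative of the n-th iterate of the projective
  action at the invariant direction, hence the product of \<open>mob_rate\<close> along the
  orbit.\<close>

definition pn :: "nat \<Rightarrow> circle \<Rightarrow> real" where
  "pn n \<theta> = \<gamma> ^ n / (norm (lin_iter n \<theta> (dirv \<theta>)))\<^sup>2"

lemma zdir_lin_iter_dirv:
  assumes "\<theta> \<in> Gd" shows "zdir (lin_iter n \<theta> (dirv \<theta>)) = \<psi> (at_time \<theta> n)"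
proof (induction n)
  case (Suc n)
  have nz: "lin_iter n \<theta> (dirv \<theta>) \<noteq> 0" using dirv(3)[of \<theta>] by simp
  show ?case using flin_zdir_norm(1)[OF \<gamma> nz, of "at_time \<theta> n"] Suc \<psi>T[OF Gd_at_time[OF assms, of n]]
    by (simp add: at_time_Suc)
qed (simp add: dirv)

lemma pn_Suc:
  assumes "\<theta> \<in> Gd"
  shows "pn (Suc n) \<theta> = pn n \<theta> * (\<gamma> * (norm (lin_iter n \<theta> (dirv \<theta>)))\<^sup>2 / (norm (lin_iter (Suc n) \<theta> (dirv \<theta>)))\<^sup>2)"
    and "\<gamma> * (norm (lin_iter n \<theta> (dirv \<theta>)))\<^sup>2 / (norm (lin_iter (Suc n) \<theta> (dirv \<theta>)))\<^sup>2
      = mob_rate (mobk \<gamma>) (rot2 (at_time \<theta> n) * \<psi> (at_time \<theta> n))"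
proof -
  have nz: "lin_iter n \<theta> (dirv \<theta>) \<noteq> 0" using dirv(3)[of \<theta>] by simp
  then show "pn (Suc n) \<theta> = pn n \<theta> * (\<gamma> * (norm (lin_iter n \<theta> (dirv \<theta>)))\<^sup>2 / (norm (lin_iter (Suc n) \<theta> (dirv \<theta>)))\<^sup>2)"
    by (simp add: pn_def)
  show "\<gamma> * (norm (lin_iter n \<theta> (dirv \<theta>)))\<^sup>2 / (norm (lin_iter (Suc n) \<theta> (dirv \<theta>)))\<^sup>2
      = mob_rate (mobk \<gamma>) (rot2 (at_time \<theta> n) * \<psi> (at_time \<theta> n))"
    using flin_rate[OF \<gamma> nz, of "at_time \<theta> n"] zdir_lin_iter_dirv[OF assms, of n] by simp
qed

lemma pn_eq_exp:
  assumes "\<theta> \<in> Gd"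
  shows "pn n \<theta> = exp (birkhoff_sum \<omega> (\<lambda>\<theta>. ln (mob_rate (mobk \<gamma>) (rot2 \<theta> * \<psi> \<theta>))) n \<theta>)"
proof (induction n)
  case (Suc n)
  have "0 < mob_rate (mobk \<gamma>) (rot2 (at_time \<theta> n) * \<psi> (at_time \<theta> n))"
    using mob_rate_pos[OF mobk[OF \<gamma>]] by (simp add: norm_mult \<psi>1)
  moreover have "pn (Suc n) \<theta> = exp (birkhoff_sum \<omega> (\<lambda>\<theta>. ln (mob_rate (mobk \<gamma>) (rot2 \<theta> * \<psi> \<theta>))) n \<theta>)
      * mob_rate (mobk \<gamma>) (rot2 (at_time \<theta> n) * \<psi> (at_time \<theta> n))"
    unfolding pn_Suc(1)[OF assms] pn_Suc(2)[OF assms] Suc ..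
  ultimately show ?case by (simp add: birkhoff_sum_def exp_add at_time_def)
qed (simp add: pn_def birkhoff_sum_def dirv)

lemma pn_decay:
  assumes "\<theta> \<in> Gd" obtains K where "0 < K" "\<And>n. pn n \<theta> \<le> K * exp (- c) ^ n"
proof -
  obtain B where B: "\<And>n. birkhoff_sum \<omega> (\<lambda>\<theta>. ln (mob_rate (mobk \<gamma>) (rot2 \<theta> * \<psi> \<theta>))) n \<theta> \<le> B - c * real n"
    using decay[OF assms] by blast
  have "pn n \<theta> \<le> exp B * exp (- c) ^ n" for n
  proof -
    have "pn n \<theta> \<le> exp (B + real n * (- c))" unfolding pn_eq_exp[OF assms] using B[of n] by (simp add: mult.commute)
    then show ?thesis by (simp only: exp_add exp_of_nat_mult)
  qed
  then show thesis by (intro that[of "exp B"]) auto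
qed

text \<open>The threshold balances two demands. The vectors mapped below it have area pi * exp (- c
  / 2)^n, which is summable, while \<gamma>^n / (thr n)^2 = exp (c / 2)^n is still beaten by the
  decay exp (- c)^n of \<open>pn\<close>.\<close>

definition thr :: "nat \<Rightarrow> real" where "thr n = sqrt ((\<gamma> * exp (- c / 2)) ^ n)"

lemma thr: "0 < thr n" "(thr n)\<^sup>2 = \<gamma> ^ n * exp (- c / 2) ^ n"
  using \<gamma> by (auto simp: thr_def power_mult_distrib)

text \<open>The linear map \<open>lin_iter n \<theta>\<close> has determinant \<open>\<gamma>\<^sup>n\<close>, so the set of vectors that it contracts too
  strongly has summable measure and Borel--Cantelli applies.\<close>

lemma AE_lin_iter_lower:
  "AE \<xi> in lborel. \<xi> \<noteq> 0 \<and> (\<exists>N. \<forall>n\<ge>N. thr n \<le> norm (lin_iter n \<theta> \<xi>))"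
proof -
  define S where "S n = {\<xi>. norm (lin_iter n \<theta> \<xi>) < thr n}" for n
  note S = measure_lin_iter_sublevel[OF thr(1), of _ \<theta>]
  have m: "measure lborel (S n) = pi * exp (- c / 2) ^ n" for n
    using \<gamma> by (simp add: S_def S(1) thr(2))
  have "AE \<xi> in lborel. \<forall>\<^sub>F n in sequentially. \<xi> \<in> space lborel - S n"
  proof (rule borel_cantelli_AE1)
    show "S n \<in> sets lborel" for n using S(2) by (simp add: S_def)
    show "emeasure lborel (S n) < \<infinity>" for n
      using S(3) emeasure_bounded_finite by (auto simp: S_def)
    show "summable (\<lambda>n. measure lborel (S n))" unfolding m
      using c by (intro summable_mult summable_geometric) simp
  qed
  moreover have "AE \<xi> in lborel. \<xi> \<noteq> (0 :: real^2)" by (rule AE_lborel_singleton)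
  ultimately show ?thesis
    by eventually_elim (auto simp: S_def eventually_sequentially not_less)
qed

text \<open>For unit numbers the two quotients are squares, and |u^2 - v^2| = |u - v| * |u + v|; one
  square root is lost in passing from squared directions to directions up to sign.\<close>

lemma unit_dist_squares:
  fixes u v :: complex
  assumes "norm u = 1" "norm v = 1"
  shows "min (norm (u - v)) (norm (u + v)) ^ 2 \<le> norm (u / cnj u - v / cnj v)"
proof -
  have "u * cnj u = 1" "v * cnj v = 1" using complex_norm_square[of u] complex_norm_square[of v] assms by simp_all
  moreover have "u \<noteq> 0" "v \<noteq> 0" using assms by auto
  ultimately have "u / cnj u = u ^ 2" "v / cnj v = v ^ 2"
    by (simp_all add: field_simps power2_eq_square)
  then have "norm (u / cnj u - v / cnj v) = norm (u - v) * norm (u + v)"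
    by (simp add: power2_eq_square norm_mult[symmetric] algebra_simps)
  moreover have "min (norm (u - v)) (norm (u + v)) * min (norm (u - v)) (norm (u + v)) \<le> norm (u - v) * norm (u + v)"
    by (intro mult_mono) auto
  ultimately show ?thesis by (simp add: power2_eq_square)
qed

text \<open>By the determinant, the squared distance is 4 times the initial squared determinant
  times \<open>pn n \<theta>\<close> times \<gamma>^n / |x|^2. The last factor costs exp (c / 2)^n
  and \<open>pn\<close> gains exp (- c)^n.\<close>

lemma zdir_attraction:
  assumes \<theta>: "\<theta> \<in> Gd" and \<xi>: "\<xi> \<noteq> 0" and N: "\<forall>n\<ge>N. thr n \<le> norm (lin_iter n \<theta> \<xi>)"
  shows "(\<lambda>n. norm (zdir (fibre_iter \<Lambda> n \<theta> \<xi>) - \<psi> (at_time \<theta> n))) \<longlonglongrightarrow> 0"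
proof -
  obtain K where K: "0 < K" "\<And>n. pn n \<theta> \<le> K * exp (- c) ^ n" using pn_decay[OF \<theta>] by metis
  define d where "d n = norm (zdir (fibre_iter \<Lambda> n \<theta> \<xi>) - \<psi> (at_time \<theta> n))" for n
  have bound: "(d n)\<^sup>2 \<le> 4 * (norm \<xi>)\<^sup>2 * K * exp (- c / 2) ^ n" if "n \<ge> N" for n
  proof -
    define x v where xv: "x = lin_iter n \<theta> \<xi>" "v = lin_iter n \<theta> (dirv \<theta>)"
    have nz: "x \<noteq> 0" "v \<noteq> 0" using \<xi> dirv(3) by (auto simp: xv)
    obtain t where "0 < t" "fibre_iter \<Lambda> n \<theta> \<xi> = t *\<^sub>R x" using fibre_iter_lin xv by metis
    then have "zdir (fibre_iter \<Lambda> n \<theta> \<xi>) = zdir x" by simp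
    then have "d n = norm (zdir x - zdir v)"
      using zdir_lin_iter_dirv[OF \<theta>, of n] by (simp add: d_def xv)
    also have "\<dots> = 2 * (\<gamma> ^ n * \<bar>cross \<xi> (dirv \<theta>)\<bar>) / (norm x * norm v)"
      using \<gamma> cross_lin_iter[of n \<theta> \<xi> "dirv \<theta>"] unfolding zdir_diff_cross[OF nz] by (simp add: xv abs_mult)
    finally have "(d n)\<^sup>2 = 4 * (cross \<xi> (dirv \<theta>))\<^sup>2 * pn n \<theta> * (\<gamma> ^ n / (norm x)\<^sup>2)"
      by (simp add: pn_def xv power_mult_distrib power_divide) (simp add: power2_eq_square mult_ac)
    also have "\<dots> \<le> 4 * (norm \<xi>)\<^sup>2 * (K * exp (- c) ^ n) * (1 / exp (- c / 2) ^ n)"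
    proof (intro mult_mono)
      have "\<bar>cross \<xi> (dirv \<theta>)\<bar> \<le> norm \<xi>" using cross_le[of \<xi> "dirv \<theta>"] dirv(1) by simp
      then show "(cross \<xi> (dirv \<theta>))\<^sup>2 \<le> (norm \<xi>)\<^sup>2" by (metis abs_le_square_iff abs_norm_cancel)
      have "(thr n)\<^sup>2 \<le> (norm x)\<^sup>2" using N that thr(1)[of n] unfolding xv by (intro power_mono) (auto simp: less_imp_le)
      then show "\<gamma> ^ n / (norm x)\<^sup>2 \<le> 1 / exp (- c / 2) ^ n" using nz by (simp add: thr(2) field_simps)
    qed (use K \<gamma> in \<open>auto simp: pn_def\<close>)
    also have "exp (- c) ^ n = exp (- c / 2) ^ n * exp (- c / 2) ^ n"
      by (simp add: power_mult_distrib[symmetric] exp_add[symmetric])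
    finally show ?thesis by simp
  qed
  have "(\<lambda>n. 4 * (norm \<xi>)\<^sup>2 * K * exp (- c / 2) ^ n) \<longlonglongrightarrow> 4 * (norm \<xi>)\<^sup>2 * K * 0"
    using c by (intro tendsto_intros LIMSEQ_power_zero) auto
  then have "(\<lambda>n. 4 * (norm \<xi>)\<^sup>2 * K * exp (- c / 2) ^ n) \<longlonglongrightarrow> 0" by simp
  moreover have "\<forall>\<^sub>F n in sequentially. norm ((d n)\<^sup>2) \<le> 4 * (norm \<xi>)\<^sup>2 * K * exp (- c / 2) ^ n"
    using bound by (auto simp: eventually_sequentially)
  ultimately have "(\<lambda>n. (d n)\<^sup>2) \<longlonglongrightarrow> 0" by (rule Lim_null_comparison[rotated])
  then have "(\<lambda>n. sqrt ((d n)\<^sup>2)) \<longlonglongrightarrow> sqrt 0" by (rule tendsto_real_sqrt)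
  then show ?thesis by (simp add: d_def)
qed

lemma rplus_uniform_continuity:
  assumes "0 < e"
  obtains d where "0 < d"
    "\<And>\<theta> u v. norm u = 1 \<Longrightarrow> norm v = 1 \<Longrightarrow> norm (u - v) < d \<Longrightarrow> \<bar>rplus \<theta> u - rplus \<theta> v\<bar> < e"
proof -
  define K where "K = (UNIV :: circle set) \<times> sphere (0 :: real^2) 1"
  have "compact K" unfolding K_def by (intro compact_Times compact_UNIV_circle compact_sphere)
  moreover have "continuous_on K (\<lambda>p. rplus (fst p) (snd p))"
    by (rule continuous_on_subset[OF continuous_on_rplus]) (auto simp: K_def)
  ultimately have "uniformly_continuous_on K (\<lambda>p. rplus (fst p) (snd p))" by (rule compact_uniformly_continuous[rotated])
  then obtain d where d: "0 < d" "\<And>p q. p \<in> K \<Longrightarrow> q \<in> K \<Longrightarrow> dist q p < d \<Longrightarrow> dist (rplus (fst q) (snd q)) (rplus (fst p) (snd p)) < e"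
    using assms unfolding uniformly_continuous_on_def by metis
  show thesis
  proof (rule that[OF d(1)])
    fix \<theta> :: circle and u v :: "real^2"
    assume "norm u = 1" "norm v = 1" "norm (u - v) < d"
    then show "\<bar>rplus \<theta> u - rplus \<theta> v\<bar> < e"
      using d(2)[of "(\<theta>, v)" "(\<theta>, u)"] by (simp add: K_def dist_Pair_Pair dist_norm)
  qed
qed

text \<open>The distance splits into the radial gap to the torus, the change of \<open>rplus\<close>
  between two nearby directions, and the gap between these directions, each below e / 3. The sign s
  is there because \<open>zdir\<close> sees directions only up to sign.\<close>

lemma graph_attraction:
  assumes \<theta>: "\<theta> \<in> Gd" and \<xi>: "\<xi> \<noteq> 0" and N: "\<forall>n\<ge>N. thr n \<le> norm (lin_iter n \<theta> \<xi>)"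
  shows "(\<lambda>n. infdist (fibre_iter \<Lambda> n \<theta> \<xi>) (graph (at_time \<theta> n))) \<longlonglongrightarrow> 0"
proof (rule LIMSEQ_I)
  fix e :: real assume e: "0 < e"
  obtain d where d: "0 < d" "\<And>\<theta> u v. norm u = 1 \<Longrightarrow> norm v = 1 \<Longrightarrow> norm (u - v) < d \<Longrightarrow> \<bar>rplus \<theta> u - rplus \<theta> v\<bar> < e / 3"
    using rplus_uniform_continuity[of "e / 3"] e by auto
  define r where "r = min d (e / 3)"
  have r: "0 < r" using d e by (simp add: r_def)
  obtain N1 where N1: "\<And>n. n \<ge> N1 \<Longrightarrow> norm (zdir (fibre_iter \<Lambda> n \<theta> \<xi>) - \<psi> (at_time \<theta> n)) < r\<^sup>2"
    using LIMSEQ_D[OF zdir_attraction[OF \<theta> \<xi> N], of "r\<^sup>2"] r by auto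
  obtain N2 where N2: "\<And>n. n \<ge> N2 \<Longrightarrow> \<bar>norm (fibre_iter \<Lambda> n \<theta> \<xi>) - rplus (at_time \<theta> n) (fibre_iter \<Lambda> n \<theta> \<xi>)\<bar> < e / 3"
    using LIMSEQ_D[OF radial_attraction[OF \<xi>, of \<theta>], of "e / 3"] e by auto
  have "infdist (fibre_iter \<Lambda> n \<theta> \<xi>) (graph (at_time \<theta> n)) < e" if n: "n \<ge> max N1 N2" for n
  proof -
    define t x where tx: "t = at_time \<theta> n" "x = fibre_iter \<Lambda> n \<theta> \<xi>"
    have x: "x \<noteq> 0" using fibre_iter_nz[OF \<xi>] by (simp add: tx)
    define u where "u = (1 / norm x) *\<^sub>R x"
    have u: "norm u = 1" "x = norm x *\<^sub>R u" "zdir u = zdir x" "rplus t u = rplus t x" using x by (auto simp: u_def)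
    have "min (norm (cv u - cv (dirv t))) (norm (cv u + cv (dirv t))) ^ 2 < r ^ 2"
      using unit_dist_squares[of "cv u" "cv (dirv t)"] u(1,3) dirv[of t] N1[of n] n
      by (simp add: zdir_def[symmetric] tx)
    then have "min (norm (cv u - cv (dirv t))) (norm (cv u + cv (dirv t))) < r"
      using r by (intro power_less_imp_less_base[of _ 2 r]) auto
    then have "\<exists>s\<in>{1,-1::real}. norm (u - s *\<^sub>R dirv t) < r"
      by (auto simp: min_less_iff_disj simp flip: cv_simps)
    then obtain s :: real where s: "s \<in> {1,-1}" "norm (u - s *\<^sub>R dirv t) < r" by blast
    have rs: "rplus t (s *\<^sub>R dirv t) = rplus t (dirv t)" using s(1) by auto
    have "norm (s *\<^sub>R dirv t) = 1" using s(1) dirv(1) by auto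
    then have rr: "\<bar>rplus t u - rplus t (dirv t)\<bar> < e / 3" using d(2)[OF u(1), of "s *\<^sub>R dirv t" t] s(2) rs by (simp add: r_def)
    have mem: "s *\<^sub>R pt t \<in> graph t" using Gd_at_time[OF \<theta>, of n] s(1) by (auto simp: graph_def tx)
    have "x - s *\<^sub>R pt t = (norm x - rplus t x) *\<^sub>R u + (rplus t u - rplus t (dirv t)) *\<^sub>R u + rplus t (dirv t) *\<^sub>R (u - s *\<^sub>R dirv t)"
      by (subst (1) u(2)) (simp add: pt_def u(4) algebra_simps)
    then have "norm (x - s *\<^sub>R pt t) \<le> norm ((norm x - rplus t x) *\<^sub>R u) + norm ((rplus t u - rplus t (dirv t)) *\<^sub>R u)
        + norm (rplus t (dirv t) *\<^sub>R (u - s *\<^sub>R dirv t))"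
      by (metis norm_triangle_mono norm_triangle_ineq order_refl)
    also have "\<dots> = \<bar>norm x - rplus t x\<bar> + \<bar>rplus t u - rplus t (dirv t)\<bar> + rplus t (dirv t) * norm (u - s *\<^sub>R dirv t)"
      using u(1) by simp
    also have "\<dots> < e / 3 + e / 3 + e / 3"
    proof (intro add_strict_mono)
      show "\<bar>norm x - rplus t x\<bar> < e / 3" using N2[of n] n by (simp add: tx)
      have "rplus t (dirv t) * norm (u - s *\<^sub>R dirv t) \<le> 1 * norm (u - s *\<^sub>R dirv t)"
        using rplus_bounds[OF dirv(3)[of t], of t] by (intro mult_right_mono) auto
      also have "\<dots> < e / 3" using s(2) by (simp add: r_def)
      finally show "rplus t (dirv t) * norm (u - s *\<^sub>R dirv t) < e / 3" .
    qed (rule rr)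
    finally have "dist x (s *\<^sub>R pt t) < e" by (simp add: dist_norm)
    then show ?thesis using infdist_le[OF mem, of x] by (simp add: tx)
  qed
  then show "\<exists>no. \<forall>n\<ge>no. norm (infdist (fibre_iter \<Lambda> n \<theta> \<xi>) (graph (at_time \<theta> n)) - 0) < e"
    by (auto simp: infdist_nonneg intro!: exI[of _ "max N1 N2"])
qed

lemma AE_good_initial_conditions:
  "AE p in lebesgue_circle \<Otimes>\<^sub>M lborel. fst p \<in> Gd \<and> snd p \<noteq> 0 \<and> (\<exists>N. \<forall>n\<ge>N. thr n \<le> norm (lin_iter n (fst p) (snd p)))"
proof -
  interpret pair_sigma_finite lebesgue_circle "lborel :: (real^2) measure" ..
  have [measurable]: "(\<lambda>p. lin_iter n (fst p) (snd p)) \<in> borel_measurable (borel \<Otimes>\<^sub>M borel)" for n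
    unfolding borel_prod by (rule borel_measurable_continuous_onI) (rule continuous_on_lin_iter)
  show ?thesis
  proof (rule AE_pair_measure)
    show "{x \<in> space (lebesgue_circle \<Otimes>\<^sub>M lborel). fst x \<in> Gd \<and> snd x \<noteq> 0 \<and> (\<exists>N. \<forall>n\<ge>N. thr n \<le> norm (lin_iter n (fst x) (snd x)))}
        \<in> sets (lebesgue_circle \<Otimes>\<^sub>M lborel)"
      by measurable
    show "AE \<theta> in lebesgue_circle. AE \<xi> in lborel. fst (\<theta>, \<xi>) \<in> Gd \<and> snd (\<theta>, \<xi>) \<noteq> 0 \<and> (\<exists>N. \<forall>n\<ge>N. thr n \<le> norm (lin_iter n (fst (\<theta>, \<xi>)) (snd (\<theta>, \<xi>))))"
      using GAE
    proof eventually_elim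
      case (elim \<theta>)
      show ?case using AE_lin_iter_lower[of \<theta>] by eventually_elim (use elim in auto)
    qed
  qed
qed

lemma attracts: "attracts_ae \<omega> \<Lambda> X graph"
  unfolding attracts_ae_def using AE_good_initial_conditions
proof eventually_elim
  case (elim p)
  then show ?case using graph_attraction by (auto simp: at_time_def split: prod.split)
qed

end

section \<open>Lyapunov exponents\<close>

text \<open>Fekete's lemma: the linear lower bound keeps the infimum finite, and one negative term
  makes it negative.\<close>

lemma subadditive_LIMSEQ:
  fixes a :: "nat \<Rightarrow> real"
  assumes sub: "\<And>m n. a (m + n) \<le> a m + a n" and low: "\<And>n. - B * real n \<le> a n" and neg: "0 < N0" "a N0 < 0"
  obtains L where "L < 0" "(\<lambda>n. a n / real n) \<longlonglongrightarrow> L"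
proof -
  define L where "L = (INF n\<in>{1..}. a n / real n)"
  have bdd: "bdd_below ((\<lambda>n. a n / real n) ` {1..})"
    by (rule bdd_belowI2[where m="- B"]) (use low in \<open>simp add: field_simps\<close>)
  have Lle: "L \<le> a n / real n" if "1 \<le> n" for n unfolding L_def using that bdd by (intro cINF_lower) auto
  have "L \<le> a N0 / real N0" using neg by (intro Lle) simp
  also have "\<dots> < 0" using neg by (simp add: divide_neg_pos)
  finally have "L < 0" .
  moreover have "(\<lambda>n. a n / real n) \<longlonglongrightarrow> L"
  proof (rule LIMSEQ_I)
    fix e :: real assume e: "0 < e"
    have "\<exists>N\<in>{1..}. a N / real N < L + e / 2"
    proof (rule ccontr)
      assume "\<not> ?thesis"
      then have "L + e / 2 \<le> L" unfolding L_def by (intro cINF_greatest) (auto simp: not_less)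
      then show False using e by simp
    qed
    then obtain N where N: "1 \<le> N" "a N / real N < L + e / 2" by auto
    have mult: "a (q * N + r) \<le> real q * a N + a r" for q r
    proof (induction q)
      case (Suc q)
      have "a (Suc q * N + r) \<le> a N + a (q * N + r)" using sub[of N "q * N + r"] by (simp add: add.assoc)
      then show ?case using Suc by (simp add: algebra_simps)
    qed simp
    define C where "C = Max ((\<lambda>r. \<bar>a r - real r * (a N / real N)\<bar>) ` {..<N})"
    have C: "\<bar>a r - real r * (a N / real N)\<bar> \<le> C" if "r < N" for r
      unfolding C_def using that by (intro Max_ge) auto
    have up: "a n \<le> real n * (a N / real N) + C" for n
    proof -
      have "n = (n div N) * N + n mod N" by simp
      then have "a n \<le> real (n div N) * a N + a (n mod N)" using mult by metis
      moreover have "real n = real (n div N) * real N + real (n mod N)" by (metis \<open>n = _\<close> of_nat_add of_nat_mult)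
      then have "real n * (a N / real N) = real (n div N) * a N + real (n mod N) * (a N / real N)"
        using N by (simp add: field_simps)
      moreover have "a (n mod N) - real (n mod N) * (a N / real N) \<le> C" using C[of "n mod N"] N by fastforce
      ultimately show ?thesis by linarith
    qed
    obtain M :: nat where M: "2 * C / e < real M" using reals_Archimedean2 by blast
    have "norm (a n / real n - L) < e" if n: "n \<ge> max M 1" for n
    proof -
      have n0: "0 < real n" using n by simp
      have "a n / real n \<le> a N / real N + C / real n" using up[of n] n0 by (simp add: field_simps)
      moreover have "2 * C < e * real n"
      proof -
        have "2 * C < e * real M" using M e by (simp add: field_simps)
        also have "\<dots> \<le> e * real n" using n e by simp
        finally show ?thesis .
      qed
      then have "C / real n < e / 2" using n0 by (simp add: field_simps)
      moreover have "L \<le> a n / real n" using n by (intro Lle) simp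
      ultimately show ?thesis using N(2) unfolding real_norm_def abs_less_iff by linarith
    qed
    then show "\<exists>no. \<forall>n\<ge>no. norm (a n / real n - L) < e" by blast
  qed
  ultimately show thesis by (rule that)
qed

lemma bounded_linear_flin: "bounded_linear (flin \<gamma> \<theta>)"
  using linear_flin by (simp add: linear_conv_bounded_linear)

context sna_system
begin

section \<open>The derivative cocycle\<close>

definition dstep :: "circle \<Rightarrow> real^2 \<Rightarrow> real^2 \<Rightarrow> real^2" where
  "dstep \<theta> \<xi> \<eta> = (\<beta> / (1 + (norm \<xi>)\<^sup>2)) *\<^sub>R A \<theta> \<eta> - (2 * \<beta> * (\<xi> \<bullet> \<eta>) / (1 + (norm \<xi>)\<^sup>2)\<^sup>2) *\<^sub>R A \<theta> \<xi>"

lemma has_derivative_Lam: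
  "((\<lambda>\<xi>. snd (\<Lambda> (\<theta>, \<xi>))) has_derivative dstep \<theta> \<xi>) (at \<xi>)"
proof -
  have nz: "1 + \<xi> \<bullet> \<xi> \<noteq> 0" using add_pos_nonneg[of 1 "\<xi> \<bullet> \<xi>"] by simp
  have 1: "(A \<theta> has_derivative A \<theta>) (at \<xi>)" by (rule bounded_linear_imp_has_derivative[OF bounded_linear_flin])
  have 2: "((\<lambda>\<xi>. \<beta> / (1 + \<xi> \<bullet> \<xi>)) has_derivative (\<lambda>\<eta>. - (2 * \<beta> * (\<xi> \<bullet> \<eta>) / (1 + \<xi> \<bullet> \<xi>)\<^sup>2))) (at \<xi>)"
    using nz by (auto intro!: derivative_eq_intros simp: inner_commute power2_eq_square field_simps)
  have "((\<lambda>\<xi>. (\<beta> / (1 + \<xi> \<bullet> \<xi>)) *\<^sub>R A \<theta> \<xi>) has_derivative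
      (\<lambda>\<eta>. (\<beta> / (1 + \<xi> \<bullet> \<xi>)) *\<^sub>R A \<theta> \<eta> + (- (2 * \<beta> * (\<xi> \<bullet> \<eta>) / (1 + \<xi> \<bullet> \<xi>)\<^sup>2)) *\<^sub>R A \<theta> \<xi>)) (at \<xi>)"
    by (rule has_derivative_scaleR[OF 2 1])
  then show ?thesis unfolding Lam_eq snd_conv dstep_def power2_norm_eq_inner by simp
qed

primrec dn :: "nat \<Rightarrow> circle \<Rightarrow> real^2 \<Rightarrow> real^2 \<Rightarrow> real^2" where
  "dn 0 \<theta> \<xi> \<eta> = \<eta>"
| "dn (Suc n) \<theta> \<xi> \<eta> = dstep (at_time \<theta> n) (fibre_iter \<Lambda> n \<theta> \<xi>) (dn n \<theta> \<xi> \<eta>)"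

lemma has_derivative_fibre_iter: "(fibre_iter \<Lambda> n \<theta> has_derivative dn n \<theta> \<xi>) (at \<xi>)"
proof (induction n)
  case 0
  have "fibre_iter \<Lambda> 0 \<theta> = (\<lambda>\<xi>. \<xi>)" "dn 0 \<theta> \<xi> = (\<lambda>\<eta>. \<eta>)" by auto
  then show ?case by (simp add: has_derivative_ident)
next
  case (Suc n)
  have "((\<lambda>\<xi>. snd (\<Lambda> (at_time \<theta> n, fibre_iter \<Lambda> n \<theta> \<xi>))) has_derivative
      (\<lambda>\<eta>. dstep (at_time \<theta> n) (fibre_iter \<Lambda> n \<theta> \<xi>) (dn n \<theta> \<xi> \<eta>))) (at \<xi>)"
    by (rule has_derivative_compose[OF Suc has_derivative_Lam])
  moreover have "fibre_iter \<Lambda> (Suc n) \<theta> = (\<lambda>\<xi>. snd (\<Lambda> (at_time \<theta> n, fibre_iter \<Lambda> n \<theta> \<xi>)))"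
    "dn (Suc n) \<theta> \<xi> = (\<lambda>\<eta>. dstep (at_time \<theta> n) (fibre_iter \<Lambda> n \<theta> \<xi>) (dn n \<theta> \<xi> \<eta>))"
    by (auto simp: fibre_iter_Suc)
  ultimately show ?case by simp
qed

text \<open>The operator norm taken in the space of bounded linear functions, where continuity can
  be checked on basis vectors.\<close>

definition dnorm :: "nat \<Rightarrow> phase \<Rightarrow> real" where
  "dnorm n p = norm (Blinfun (dn n (fst p) (snd p)))"

lemma bounded_linear_dn: "bounded_linear (dn n \<theta> \<xi>)"
  using has_derivative_fibre_iter has_derivative_bounded_linear by blast

lemma dnorm_onorm: "dnorm n (\<theta>, \<xi>) = onorm (dn n \<theta> \<xi>)"
  by (simp add: dnorm_def norm_blinfun.rep_eq bounded_linear_Blinfun_apply[OF bounded_linear_dn])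

lemma fibre_deriv_norm_eq: "fibre_deriv_norm \<Lambda> n = dnorm n"
proof
  fix p :: phase
  obtain \<theta> \<xi> where p: "p = (\<theta>, \<xi>)" by fastforce
  have "frechet_derivative (fibre_iter \<Lambda> n \<theta>) (at \<xi>) = dn n \<theta> \<xi>"
    using has_derivative_fibre_iter by (metis frechet_derivative_at)
  then show "fibre_deriv_norm \<Lambda> n p = dnorm n p" by (simp add: p fibre_deriv_norm_def dnorm_onorm)
qed

lemma continuous_on_fibre_iter: "continuous_on UNIV (\<lambda>p. fibre_iter \<Lambda> n (fst p) (snd p))"
proof (induction n)
  case (Suc n)
  show ?case unfolding fibre_iter_Suc Lam_eq snd_conv
    by (intro continuous_intros Suc continuous_on_at_time) (auto simp: add_nonneg_eq_0_iff)
qed (simp add: continuous_on_snd continuous_on_id)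

lemma continuous_on_dn: "continuous_on UNIV (\<lambda>p. dn n (fst p) (snd p) \<eta>)"
proof (induction n)
  case (Suc n)
  show ?case unfolding dn.simps dstep_def
    by (intro continuous_intros Suc continuous_on_at_time continuous_on_fibre_iter) (auto simp: add_nonneg_eq_0_iff)
qed simp

lemma continuous_on_dnorm: "continuous_on UNIV (dnorm n)"
  unfolding dnorm_def
proof (rule continuous_on_norm, rule continuous_on_blinfun_componentwise)
  fix i :: "real^2"
  show "continuous_on UNIV (\<lambda>p. blinfun_apply (Blinfun (dn n (fst p) (snd p))) i)"
    unfolding bounded_linear_Blinfun_apply[OF bounded_linear_dn] by (rule continuous_on_dn)
qed

lemma dnorm_measurable [measurable]: "dnorm n \<in> borel_measurable borel"
  by (rule borel_measurable_continuous_onI[OF continuous_on_dnorm])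

lemma at_time_add: "at_time (at_time \<theta> k) n = at_time \<theta> (n + k)"
  by (simp add: at_time_def distrib_right to_circle_add algebra_simps)

lemma fibre_iter_add: "fibre_iter \<Lambda> (n + k) \<theta> \<xi> = fibre_iter \<Lambda> n (at_time \<theta> k) (fibre_iter \<Lambda> k \<theta> \<xi>)"
  by (induction n) (simp_all add: fibre_iter_Suc at_time_add)

lemma dn_add: "dn (n + k) \<theta> \<xi> \<eta> = dn n (at_time \<theta> k) (fibre_iter \<Lambda> k \<theta> \<xi>) (dn k \<theta> \<xi> \<eta>)"
  by (induction n) (simp_all add: fibre_iter_add at_time_add)

lemma dnorm_add: "dnorm (n + k) (\<theta>, \<xi>) \<le> dnorm n (at_time \<theta> k, fibre_iter \<Lambda> k \<theta> \<xi>) * dnorm k (\<theta>, \<xi>)"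
proof -
  have "dn (n + k) \<theta> \<xi> = dn n (at_time \<theta> k) (fibre_iter \<Lambda> k \<theta> \<xi>) \<circ> dn k \<theta> \<xi>" by (auto simp: dn_add)
  then show ?thesis unfolding dnorm_onorm by (metis onorm_compose bounded_linear_dn)
qed

lemma dn_minus: "dn n \<theta> (- \<xi>) \<eta> = dn n \<theta> \<xi> \<eta>"
proof (induction n)
  case (Suc n)
  have "fibre_iter \<Lambda> n \<theta> (- \<xi>) = - fibre_iter \<Lambda> n \<theta> \<xi>"
    by (induction n) (simp_all add: fibre_iter_Suc Lam_eq)
  then show ?case using Suc by (simp add: dstep_def)
qed simp

lemma dnorm_minus: "dnorm n (\<theta>, - \<xi>) = dnorm n (\<theta>, \<xi>)"
  by (simp add: dnorm_def dn_minus[abs_def] fun_eq_iff cong: arg_cong[where f=Blinfun])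

lemma conformal_factor_bounds: "0 < \<beta> / (1 + (norm \<xi>)\<^sup>2)" "\<beta> / (1 + (norm \<xi>)\<^sup>2) \<le> 2"
  "norm \<xi> \<le> 1 \<Longrightarrow> 1 / 2 \<le> \<beta> / (1 + (norm \<xi>)\<^sup>2)"
proof -
  have p: "0 < 1 + (norm \<xi>)\<^sup>2" by (simp add: add_pos_nonneg)
  show "0 < \<beta> / (1 + (norm \<xi>)\<^sup>2)" using p \<beta> by simp
  show "\<beta> / (1 + (norm \<xi>)\<^sup>2) \<le> 2" using p \<beta> by (simp add: field_simps add_increasing2)
  assume "norm \<xi> \<le> 1"
  then have "(norm \<xi>)\<^sup>2 \<le> 1" by (simp add: power_le_one)
  then show "1 / 2 \<le> \<beta> / (1 + (norm \<xi>)\<^sup>2)" using p \<beta> by (simp add: field_simps)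
qed

text \<open>The constant is 2 + 4: the scalar factor is at most 2, and its derivative contributes
  another factor 2 * |\<xi>|^2 / (1 + |\<xi>|^2) below 2.\<close>

lemma dstep_upper: "norm (dstep \<theta> \<xi> \<eta>) \<le> 6 * norm \<eta>"
proof -
  define k where "k = \<beta> / (1 + (norm \<xi>)\<^sup>2)"
  have k: "0 < k" "k \<le> 2" using conformal_factor_bounds[of \<xi>] by (auto simp: k_def)
  have p: "0 < 1 + (norm \<xi>)\<^sup>2" by (simp add: add_pos_nonneg)
  have eq: "dstep \<theta> \<xi> \<eta> = k *\<^sub>R A \<theta> \<eta> - (k * (2 * (\<xi> \<bullet> \<eta>) / (1 + (norm \<xi>)\<^sup>2))) *\<^sub>R A \<theta> \<xi>"
    unfolding dstep_def k_def using p by (simp add: power2_eq_square)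
  have "norm (k *\<^sub>R A \<theta> \<eta>) \<le> 2 * norm \<eta>"
    using k norm_flin(1)[OF \<gamma>, of \<theta> \<eta>] by (simp add: mult_mono)
  moreover have "norm ((k * (2 * (\<xi> \<bullet> \<eta>) / (1 + (norm \<xi>)\<^sup>2))) *\<^sub>R A \<theta> \<xi>) \<le> 4 * norm \<eta>"
  proof -
    have "norm ((k * (2 * (\<xi> \<bullet> \<eta>) / (1 + (norm \<xi>)\<^sup>2))) *\<^sub>R A \<theta> \<xi>)
        = k * (2 * \<bar>\<xi> \<bullet> \<eta>\<bar> / (1 + (norm \<xi>)\<^sup>2)) * norm (A \<theta> \<xi>)"
      using k p by (simp add: abs_mult abs_divide)
    also have "\<dots> \<le> 2 * (2 * (norm \<xi> * norm \<eta>) / (1 + (norm \<xi>)\<^sup>2)) * norm \<xi>"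
      using k p norm_flin(1)[OF \<gamma>, of \<theta> \<xi>] Cauchy_Schwarz_ineq2[of \<xi> \<eta>]
      by (intro mult_mono divide_right_mono mult_left_mono) auto
    also have "\<dots> = 4 * ((norm \<xi>)\<^sup>2 / (1 + (norm \<xi>)\<^sup>2)) * norm \<eta>" by (simp add: power2_eq_square)
    also have "\<dots> \<le> 4 * 1 * norm \<eta>" using p by (intro mult_right_mono mult_left_mono) auto
    finally show ?thesis by simp
  qed
  ultimately show ?thesis unfolding eq using norm_triangle_ineq4[of "k *\<^sub>R A \<theta> \<eta>"] by (smt (verit))
qed

lemma dn_upper: "norm (dn n \<theta> \<xi> \<eta>) \<le> 6 ^ n * norm \<eta>"
proof (induction n)
  case (Suc n)
  then show ?case using dstep_upper[of "at_time \<theta> n" "fibre_iter \<Lambda> n \<theta> \<xi>" "dn n \<theta> \<xi> \<eta>"] by simp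
qed simp

lemma dnorm_upper: "dnorm n (\<theta>, \<xi>) \<le> 6 ^ n"
  unfolding dnorm_onorm by (rule onorm_le) (rule dn_upper)

lemma cross_scaleR [simp]: "cross (a *\<^sub>R \<xi>) \<eta> = a * cross \<xi> \<eta>" "cross \<xi> (a *\<^sub>R \<eta>) = a * cross \<xi> \<eta>"
  by (simp_all add: cross_def scaleR_conv_of_real[symmetric])

lemma cross_self [simp]: "cross \<xi> \<xi> = 0" by (simp add: cross_def)

lemma cross_diff: "cross \<xi> (\<eta> - \<zeta>) = cross \<xi> \<eta> - cross \<xi> \<zeta>"
  by (simp add: cross_def algebra_simps)

text \<open>The derivative of the scalar factor points along the image vector and drops out of the
  determinant.\<close>

lemma cross_dstep:
  "cross (snd (\<Lambda> (\<theta>, \<xi>))) (dstep \<theta> \<xi> \<eta>) = (\<beta> / (1 + (norm \<xi>)\<^sup>2))\<^sup>2 * \<gamma> * cross \<xi> \<eta>"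
  by (simp add: Lam_eq dstep_def cross_diff cross_flin power2_eq_square)

definition perp :: "real^2 \<Rightarrow> real^2" where "perp \<xi> = vc (\<i> * cv \<xi>)"

lemma norm_perp [simp]: "norm (perp \<xi>) = norm \<xi>" by (simp add: perp_def norm_mult)

lemma inner_cv: "\<xi> \<bullet> \<eta> = Re (cnj (cv \<xi>) * cv \<eta>)"
  by (simp add: cv_def inner_vec_def sum_2)

lemma inner_perp [simp]: "\<xi> \<bullet> perp \<xi> = 0" by (simp add: inner_cv perp_def)

lemma cross_perp: "cross \<xi> (perp \<xi>) = (norm \<xi>)\<^sup>2"
  using cmod_power2[of "cv \<xi>"] by (simp add: cross_def perp_def power2_eq_square)

lemma perp_frame:
  assumes "\<xi> \<noteq> 0"
  shows "\<eta> = ((\<xi> \<bullet> \<eta>) / (norm \<xi>)\<^sup>2) *\<^sub>R \<xi> + (cross \<xi> \<eta> / (norm \<xi>)\<^sup>2) *\<^sub>R perp \<xi>"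
proof -
  define x y where xy: "x = cv \<xi>" "y = cv \<eta>"
  have x: "x \<noteq> 0" using assms by (simp add: xy)
  have n: "of_real ((norm \<xi>)\<^sup>2) = x * cnj x" using complex_norm_square[of x] by (simp add: xy)
  have "cnj x * y = of_real (\<xi> \<bullet> \<eta>) + \<i> * of_real (cross \<xi> \<eta>)"
    by (simp add: complex_eq_iff inner_cv cross_def xy)
  then have "x * cnj x * y = x * (of_real (\<xi> \<bullet> \<eta>) + \<i> * of_real (cross \<xi> \<eta>))" by (simp add: mult_ac)
  then have "y = (of_real (\<xi> \<bullet> \<eta>) * x + of_real (cross \<xi> \<eta>) * (\<i> * x)) / of_real ((norm \<xi>)\<^sup>2)"
    unfolding n using x by (simp add: field_simps)
  then have "y = cv (((\<xi> \<bullet> \<eta>) / (norm \<xi>)\<^sup>2) *\<^sub>R \<xi> + (cross \<xi> \<eta> / (norm \<xi>)\<^sup>2) *\<^sub>R perp \<xi>)"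
    by (simp add: perp_def xy(1)[symmetric] add_divide_distrib) (simp add: scaleR_conv_of_real)
  then show ?thesis by (simp only: xy cv_eq_iff)
qed

lemma torus_iter:
  assumes "(\<theta>, \<xi>) \<in> torus" shows "(at_time \<theta> n, fibre_iter \<Lambda> n \<theta> \<xi>) \<in> torus"
proof -
  have "(\<Lambda> ^^ n) (\<theta>, \<xi>) \<in> torus"
  proof (induction n)
    case (Suc n) then show ?case using torus_invariant by auto
  qed (simp add: assms)
  then show ?thesis by (simp add: Lam_iter)
qed

lemma torus_norm:
  assumes "(\<theta>, \<xi>) \<in> torus" shows "\<xi> \<noteq> 0" "rmin \<le> norm \<xi>" "norm \<xi> \<le> 1"
  using assms rplus_bounds[of \<xi> \<theta>] by (auto simp: torus_def)

text \<open>The derivative is tested on the perpendicular vector: on the torus the scalar factor is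
  at least 1/2, so each step keeps at least \<gamma> / 4 of the determinant. This bound makes the
  logarithms integrable and the exponent finite.\<close>

lemma dnorm_lower:
  assumes "(\<theta>, \<xi>) \<in> torus" shows "rmin * (\<gamma> / 4) ^ n \<le> dnorm n (\<theta>, \<xi>)"
proof -
  have "(\<gamma> / 4) ^ n * \<bar>cross \<xi> \<eta>\<bar> \<le> \<bar>cross (fibre_iter \<Lambda> n \<theta> \<xi>) (dn n \<theta> \<xi> \<eta>)\<bar>" for \<eta>
  proof (induction n)
    case (Suc n)
    define y where "y = fibre_iter \<Lambda> n \<theta> \<xi>"
    define k where "k = \<beta> / (1 + (norm y)\<^sup>2)"
    have "norm y \<le> 1" using torus_norm(3)[OF torus_iter[OF assms]] by (simp add: y_def)
    then have "1 / 2 \<le> k" using conformal_factor_bounds(3) by (simp add: k_def)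
    then have "(1 / 2)\<^sup>2 \<le> k\<^sup>2" by (intro power_mono) auto
    then have k: "1 / 4 \<le> k\<^sup>2" by (simp add: power2_eq_square)
    have "(\<gamma> / 4) ^ Suc n * \<bar>cross \<xi> \<eta>\<bar> = (1 / 4 * \<gamma>) * ((\<gamma> / 4) ^ n * \<bar>cross \<xi> \<eta>\<bar>)" by simp
    also have "\<dots> \<le> (k\<^sup>2 * \<gamma>) * \<bar>cross y (dn n \<theta> \<xi> \<eta>)\<bar>"
      using Suc k \<gamma> unfolding y_def by (intro mult_mono mult_right_mono) auto
    also have "\<dots> = \<bar>cross (fibre_iter \<Lambda> (Suc n) \<theta> \<xi>) (dn (Suc n) \<theta> \<xi> \<eta>)\<bar>"
      using \<gamma> unfolding fibre_iter_Suc dn.simps cross_dstep by (simp add: abs_mult k_def y_def)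
    finally show ?case .
  qed simp
  from this[of "perp \<xi>"] have "(\<gamma> / 4) ^ n * (norm \<xi>)\<^sup>2 \<le> \<bar>cross (fibre_iter \<Lambda> n \<theta> \<xi>) (dn n \<theta> \<xi> (perp \<xi>))\<bar>"
    by (simp add: cross_perp)
  also have "\<dots> \<le> norm (fibre_iter \<Lambda> n \<theta> \<xi>) * norm (dn n \<theta> \<xi> (perp \<xi>))" by (rule cross_le)
  also have "\<dots> \<le> 1 * (dnorm n (\<theta>, \<xi>) * norm \<xi>)"
    using torus_norm(3)[OF torus_iter[OF assms, of n]] onorm[OF bounded_linear_dn, of n \<theta> \<xi> "perp \<xi>"]
    by (intro mult_mono) (auto simp: dnorm_onorm)
  finally have "norm \<xi> * ((\<gamma> / 4) ^ n * norm \<xi>) \<le> norm \<xi> * dnorm n (\<theta>, \<xi>)" by (simp add: power2_eq_square mult_ac)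
  then have "(\<gamma> / 4) ^ n * norm \<xi> \<le> dnorm n (\<theta>, \<xi>)" using torus_norm(1)[OF assms] by simp
  moreover have "(\<gamma> / 4) ^ n * rmin \<le> (\<gamma> / 4) ^ n * norm \<xi>" using torus_norm(2)[OF assms] \<gamma> by (intro mult_left_mono) auto
  ultimately show ?thesis by (simp add: mult.commute)
qed

text \<open>In the frame \<open>\<xi>, perp \<xi>\<close> the derivative of one step is triangular: the radial direction contracts
  by \<open>(1 - r\<^sup>2) / (1 + r\<^sup>2)\<close> and the transverse one by the rate of the projective action.\<close>

lemma dstep_frame:
  assumes "(\<theta>, \<xi>) \<in> torus"
  obtains s where "\<bar>s\<bar> \<le> 2 / rmin"
    "\<And>x y. dstep \<theta> \<xi> (x *\<^sub>R \<xi> + y *\<^sub>R perp \<xi>)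
      = (rate (norm \<xi>) * x + s * y) *\<^sub>R snd (\<Lambda> (\<theta>, \<xi>)) + (\<gamma> * (norm \<xi>)\<^sup>2 / (norm (A \<theta> \<xi>))\<^sup>2 * y) *\<^sub>R perp (snd (\<Lambda> (\<theta>, \<xi>)))"
proof -
  define k where "k = \<beta> / (1 + (norm \<xi>)\<^sup>2)"
  define \<xi>' where "\<xi>' = snd (\<Lambda> (\<theta>, \<xi>))"
  have k: "0 < k" "k \<le> 2" using conformal_factor_bounds[of \<xi>] by (auto simp: k_def)
  have \<xi>': "\<xi>' = k *\<^sub>R A \<theta> \<xi>" by (simp add: \<xi>'_def Lam_eq k_def)
  note \<xi> = torus_norm[OF assms]
  have "\<Lambda> (\<theta>, \<xi>) \<in> torus" using assms torus_invariant by blast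
  then have "(\<theta> + \<alpha>, \<xi>') \<in> torus" by (simp add: \<xi>'_def Lam_eq)
  note tn = torus_norm[OF this]
  have p: "0 < 1 + (norm \<xi>)\<^sup>2" by (simp add: add_pos_nonneg)
  have d1: "dstep \<theta> \<xi> \<xi> = rate (norm \<xi>) *\<^sub>R \<xi>'"
  proof -
    have "dstep \<theta> \<xi> \<xi> = (k - k * (2 * (norm \<xi>)\<^sup>2 / (1 + (norm \<xi>)\<^sup>2))) *\<^sub>R A \<theta> \<xi>"
      unfolding dstep_def power2_norm_eq_inner[symmetric] k_def scaleR_left_diff_distrib
      using p by (simp add: power2_eq_square[of "1 + (norm \<xi>)\<^sup>2"])
    also have "k - k * (2 * (norm \<xi>)\<^sup>2 / (1 + (norm \<xi>)\<^sup>2)) = rate (norm \<xi>) * k"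
    proof -
      have "1 - 2 * (norm \<xi>)\<^sup>2 / (1 + (norm \<xi>)\<^sup>2) = rate (norm \<xi>)" unfolding rate_def using p by (simp add: field_simps)
      then show ?thesis by (metis mult.commute mult.right_neutral right_diff_distrib)
    qed
    finally show ?thesis by (simp add: \<xi>')
  qed
  have d2: "dstep \<theta> \<xi> (perp \<xi>) = k *\<^sub>R A \<theta> (perp \<xi>)" by (simp add: dstep_def k_def)
  define s where "s = (\<xi>' \<bullet> (k *\<^sub>R A \<theta> (perp \<xi>))) / (norm \<xi>')\<^sup>2"
  have "\<bar>s\<bar> \<le> norm \<xi>' * norm (k *\<^sub>R A \<theta> (perp \<xi>)) / (norm \<xi>')\<^sup>2"
    unfolding s_def abs_divide using Cauchy_Schwarz_ineq2[of \<xi>' "k *\<^sub>R A \<theta> (perp \<xi>)"]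
    by (simp add: divide_right_mono)
  also have "\<dots> = norm (k *\<^sub>R A \<theta> (perp \<xi>)) / norm \<xi>'" using tn(1) by (simp add: power2_eq_square)
  also have "\<dots> \<le> 2 / rmin"
  proof (rule frac_le)
    have "norm (A \<theta> (perp \<xi>)) \<le> 1" using norm_flin(1)[OF \<gamma>, of \<theta> "perp \<xi>"] \<xi>(3) by simp
    then show "norm (k *\<^sub>R A \<theta> (perp \<xi>)) \<le> 2" using k mult_mono[of k 2 "norm (A \<theta> (perp \<xi>))" 1] by simp
  qed (use tn rmin in auto)
  finally have s: "\<bar>s\<bar> \<le> 2 / rmin" .
  have nA: "norm \<xi>' = k * norm (A \<theta> \<xi>)" using k by (simp add: \<xi>')
  have "cross \<xi>' (k *\<^sub>R A \<theta> (perp \<xi>)) = k\<^sup>2 * \<gamma> * (norm \<xi>)\<^sup>2"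
    by (simp add: \<xi>' cross_flin cross_perp power2_eq_square)
  then have c: "cross \<xi>' (k *\<^sub>R A \<theta> (perp \<xi>)) / (norm \<xi>')\<^sup>2 = \<gamma> * (norm \<xi>)\<^sup>2 / (norm (A \<theta> \<xi>))\<^sup>2"
    unfolding nA using k by (simp add: power_mult_distrib)
  have fr: "k *\<^sub>R A \<theta> (perp \<xi>) = s *\<^sub>R \<xi>' + (\<gamma> * (norm \<xi>)\<^sup>2 / (norm (A \<theta> \<xi>))\<^sup>2) *\<^sub>R perp \<xi>'"
    using perp_frame[OF tn(1), of "k *\<^sub>R A \<theta> (perp \<xi>)"] unfolding c s_def[symmetric] .
  show thesis
  proof (rule that[OF s])
    fix x y
    have "linear (dstep \<theta> \<xi>)" using has_derivative_Lam has_derivative_linear by blast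
    then have "dstep \<theta> \<xi> (x *\<^sub>R \<xi> + y *\<^sub>R perp \<xi>) = x *\<^sub>R dstep \<theta> \<xi> \<xi> + y *\<^sub>R dstep \<theta> \<xi> (perp \<xi>)"
      by (simp add: linear_add linear_scale)
    also have "\<dots> = (rate (norm \<xi>) * x + s * y) *\<^sub>R \<xi>' + (\<gamma> * (norm \<xi>)\<^sup>2 / (norm (A \<theta> \<xi>))\<^sup>2 * y) *\<^sub>R perp \<xi>'"
      unfolding d1 d2 fr by (simp add: scaleR_add_left scaleR_add_right mult.commute)
    finally show "dstep \<theta> \<xi> (x *\<^sub>R \<xi> + y *\<^sub>R perp \<xi>)
      = (rate (norm \<xi>) * x + s * y) *\<^sub>R snd (\<Lambda> (\<theta>, \<xi>)) + (\<gamma> * (norm \<xi>)\<^sup>2 / (norm (A \<theta> \<xi>))\<^sup>2 * y) *\<^sub>R perp (snd (\<Lambda> (\<theta>, \<xi>)))"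
      by (simp only: \<xi>'_def)
  qed
qed

lemma rate_antimono: "0 < a \<Longrightarrow> a \<le> b \<Longrightarrow> rate b \<le> rate a"
proof -
  assume ab: "0 < a" "a \<le> b"
  then have "a\<^sup>2 \<le> b\<^sup>2" by (intro power_mono) auto
  moreover have "rate x = 2 / (1 + x\<^sup>2) - 1" for x
    using add_pos_nonneg[of 1 "x\<^sup>2"] by (simp add: rate_def field_simps)
  ultimately show ?thesis by (simp add: frac_le add_pos_nonneg)
qed

end

context sna_graph
begin

text \<open>\<open>measure_of\<close> returns the intended values only for a countably additive set
  function. Half the image of the product of Lebesgue measure with two-point counting measure, under
  the two sheets of the graph, supplies this.\<close>

lemma graph_measure_eq:
  "graph_measure graph = scale_measure (1/2) (distr (lebesgue_circle \<Otimes>\<^sub>M count_space (UNIV :: bool set)) borel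
    (\<lambda>(\<theta>, b). (\<theta>, if b then pt \<theta> else - pt \<theta>)))" (is "_ = ?M")
  and nn_integral_graph_measure: "f \<in> borel_measurable borel \<Longrightarrow>
    (\<integral>\<^sup>+ p. f p \<partial>graph_measure graph) = (1/2) * (\<integral>\<^sup>+ \<theta>. (f (\<theta>, pt \<theta>) + f (\<theta>, - pt \<theta>)) \<partial>lebesgue_circle)"
proof -
  interpret B: sigma_finite_measure "count_space (UNIV :: bool set)"
    by (rule sigma_finite_measure_count_space_finite) simp
  define h where "h = (\<lambda>(\<theta>, b). (\<theta>, if b then pt \<theta> else - pt \<theta>))"
  have [measurable]: "h \<in> borel_measurable (lebesgue_circle \<Otimes>\<^sub>M count_space UNIV)"
    unfolding h_def borel_prod[symmetric] by measurable
  have int: "(\<integral>\<^sup>+ p. f p \<partial>?M) = (1/2) * (\<integral>\<^sup>+ \<theta>. (f (\<theta>, pt \<theta>) + f (\<theta>, - pt \<theta>)) \<partial>lebesgue_circle)"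
    if f [measurable]: "f \<in> borel_measurable borel" for f
  proof -
    have "(\<integral>\<^sup>+ p. f p \<partial>?M) = (1/2) * (\<integral>\<^sup>+ q. f (h q) \<partial>(lebesgue_circle \<Otimes>\<^sub>M count_space UNIV))"
      unfolding h_def[symmetric] by (subst nn_integral_scale_measure) (auto simp: nn_integral_distr)
    also have "(\<integral>\<^sup>+ q. f (h q) \<partial>(lebesgue_circle \<Otimes>\<^sub>M count_space UNIV))
        = (\<integral>\<^sup>+ \<theta>. \<integral>\<^sup>+ b. f (h (\<theta>, b)) \<partial>count_space UNIV \<partial>lebesgue_circle)"
      by (rule B.nn_integral_fst[symmetric]) measurable
    also have "\<dots> = (\<integral>\<^sup>+ \<theta>. (f (\<theta>, pt \<theta>) + f (\<theta>, - pt \<theta>)) \<partial>lebesgue_circle)"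
      by (rule nn_integral_cong) (simp add: nn_integral_count_space_finite UNIV_bool h_def add.commute)
    finally show ?thesis .
  qed
  have sM: "sets ?M = sets borel" by simp
  from sets_eq_imp_space_eq[OF this] have sM': "space ?M = UNIV" by simp
  have "graph_measure graph = measure_of UNIV (sets borel) (emeasure ?M)"
    unfolding graph_measure_def
  proof (rule measure_of_eq)
    fix B :: "phase set" assume "B \<in> sigma_sets UNIV (sets borel)"
    then have B [measurable]: "B \<in> sets borel" using sets.sigma_sets_eq[of "borel :: phase measure"] by simp
    have "emeasure ?M B = (\<integral>\<^sup>+ p. indicator B p \<partial>?M)" by simp
    also have "\<dots> = (1/2) * (\<integral>\<^sup>+ \<theta>. (indicator B (\<theta>, pt \<theta>) + indicator B (\<theta>, - pt \<theta>)) \<partial>lebesgue_circle)"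
      by (rule int) simp
    also have "(\<integral>\<^sup>+ \<theta>. (indicator B (\<theta>, pt \<theta>) + indicator B (\<theta>, - pt \<theta>)) \<partial>lebesgue_circle)
        = (\<integral>\<^sup>+ \<theta>. of_nat (card {\<xi> \<in> graph \<theta>. (\<theta>, \<xi>) \<in> B}) \<partial>lebesgue_circle)"
      using GAE
    proof (intro nn_integral_cong_AE, eventually_elim)
      case (elim \<theta>)
      have "{\<xi> \<in> graph \<theta>. (\<theta>, \<xi>) \<in> B} = (if (\<theta>, pt \<theta>) \<in> B then {pt \<theta>} else {}) \<union> (if (\<theta>, - pt \<theta>) \<in> B then {- pt \<theta>} else {})"
        using elim by (auto simp: graph_def)
      then show ?case using pt_neq_minus[of \<theta>] by (simp split: split_indicator)
    qed
    finally show "1/2 * (\<integral>\<^sup>+ \<theta>. of_nat (card {\<xi> \<in> graph \<theta>. (\<theta>, \<xi>) \<in> B}) \<partial>lebesgue_circle) = emeasure ?M B" ..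
  qed simp
  also have "\<dots> = ?M" using measure_of_of_measure[of ?M] by (simp only: sM sM')
  finally show eq: "graph_measure graph = ?M" .
  show "(\<integral>\<^sup>+ p. f p \<partial>graph_measure graph) = (1/2) * (\<integral>\<^sup>+ \<theta>. (f (\<theta>, pt \<theta>) + f (\<theta>, - pt \<theta>)) \<partial>lebesgue_circle)"
    if "f \<in> borel_measurable borel" unfolding eq by (rule int[OF that])
qed

lemma sets_graph_measure [simp, measurable_cong]: "sets (graph_measure graph) = sets borel"
  by (simp add: graph_measure_eq)

lemma space_graph_measure [simp]: "space (graph_measure graph) = UNIV"
  using sets_eq_imp_space_eq[OF sets_graph_measure] by simp

lemma emeasure_graph_measure:
  assumes [measurable]: "B \<in> sets borel"
  shows "emeasure (graph_measure graph) B = (1/2) * (\<integral>\<^sup>+ \<theta>. (indicator B (\<theta>, pt \<theta>) + indicator B (\<theta>, - pt \<theta>)) \<partial>lebesgue_circle)"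
  using nn_integral_graph_measure[of "indicator B"] by simp

lemma ereal_integral_graph_measure:
  assumes [measurable]: "g \<in> borel_measurable borel" and b: "\<And>\<theta>. \<bar>g (\<theta>, pt \<theta>)\<bar> \<le> K"
    and sym: "\<And>\<theta>. g (\<theta>, - pt \<theta>) = g (\<theta>, pt \<theta>)"
  shows "ereal_integral (graph_measure graph) (\<lambda>p. ereal (g p)) = ereal (\<integral>\<theta>. g (\<theta>, pt \<theta>) \<partial>lebesgue_circle)"
proof -
  have [measurable]: "(\<lambda>\<theta>. (\<theta>, pt \<theta>)) \<in> borel_measurable borel" unfolding borel_prod[symmetric] by measurable
  have gm: "(\<lambda>\<theta>. g (\<theta>, pt \<theta>)) \<in> borel_measurable borel" by measurable
  have int: "integrable lebesgue_circle (\<lambda>\<theta>. g (\<theta>, pt \<theta>))"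
    by (rule lebesgue_circle.integrable_const_bound[where B=K]) (use b gm in auto)
  have I: "(\<integral>\<^sup>+ p. e2ennreal (ereal (h p)) \<partial>graph_measure graph) = (\<integral>\<^sup>+ \<theta>. ennreal (h (\<theta>, pt \<theta>)) \<partial>lebesgue_circle)"
    if [measurable]: "h \<in> borel_measurable borel" and s: "\<And>\<theta>. h (\<theta>, - pt \<theta>) = h (\<theta>, pt \<theta>)" for h :: "phase \<Rightarrow> real"
  proof -
    have hm: "(\<lambda>\<theta>. ennreal (h (\<theta>, pt \<theta>))) \<in> borel_measurable lebesgue_circle" by measurable
    have "(\<integral>\<^sup>+ p. e2ennreal (ereal (h p)) \<partial>graph_measure graph)
        = (1/2) * (\<integral>\<^sup>+ \<theta>. (ennreal (h (\<theta>, pt \<theta>)) + ennreal (h (\<theta>, pt \<theta>))) \<partial>lebesgue_circle)"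
      by (subst nn_integral_graph_measure) (simp_all add: s)
    also have "\<dots> = (1/2) * (2 * (\<integral>\<^sup>+ \<theta>. ennreal (h (\<theta>, pt \<theta>)) \<partial>lebesgue_circle))"
      by (subst nn_integral_add[OF hm hm]) (simp add: mult_2)
    also have "\<dots> = (\<integral>\<^sup>+ \<theta>. ennreal (h (\<theta>, pt \<theta>)) \<partial>lebesgue_circle)"
    proof -
      have "(1/2 :: ennreal) * 2 = 1"
        using ennreal_divide_self[of "2 :: ennreal"] by (simp add: ennreal_times_divide mult.commute)
      then show ?thesis by (simp add: mult.assoc[symmetric])
    qed
    finally show ?thesis .
  qed
  define P where "P = (\<integral>\<^sup>+ \<theta>. ennreal (g (\<theta>, pt \<theta>)) \<partial>lebesgue_circle)"
  define N where "N = (\<integral>\<^sup>+ \<theta>. ennreal (- g (\<theta>, pt \<theta>)) \<partial>lebesgue_circle)"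
  have fin: "P \<noteq> \<infinity>" "N \<noteq> \<infinity>" using int unfolding real_integrable_def P_def N_def by auto
  have "ereal_integral (graph_measure graph) (\<lambda>p. ereal (g p)) = enn2ereal P - enn2ereal N"
    unfolding ereal_integral_def P_def N_def using I[of g] I[of "\<lambda>p. - g p"] sym by simp
  also have "\<dots> = ereal (enn2real P - enn2real N)"
    using fin by (cases P; cases N) (auto simp: enn2ereal_ennreal)
  also have "enn2real P - enn2real N = (\<integral>\<theta>. g (\<theta>, pt \<theta>) \<partial>lebesgue_circle)"
    unfolding P_def N_def by (rule real_lebesgue_integral_def[OF int, symmetric])
  finally show ?thesis .
qed

section \<open>Integrated exponents along the graph\<close>

definition lyap :: "nat \<Rightarrow> real" where
  "lyap n = (\<integral>\<theta>. ln (dnorm n (\<theta>, pt \<theta>)) \<partial>lebesgue_circle)"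

lemma dnorm_pt_pos: "0 < dnorm n (\<theta>, pt \<theta>)"
proof -
  have "0 < rmin * (\<gamma> / 4) ^ n" using rmin \<gamma> by simp
  then show ?thesis using dnorm_lower[OF pt_torus(1), of n \<theta>] by linarith
qed

lemma ln_dnorm_bounds:
  "ln (dnorm n (\<theta>, pt \<theta>)) \<le> real n * ln 6" "ln rmin + real n * ln (\<gamma> / 4) \<le> ln (dnorm n (\<theta>, pt \<theta>))"
proof -
  have "ln (dnorm n (\<theta>, pt \<theta>)) \<le> ln (6 ^ n)"
    using dnorm_upper[of n \<theta> "pt \<theta>"] dnorm_pt_pos[of n \<theta>] by (subst ln_le_cancel_iff) auto
  then show "ln (dnorm n (\<theta>, pt \<theta>)) \<le> real n * ln 6" by (simp add: ln_realpow)
  have "ln (rmin * (\<gamma> / 4) ^ n) \<le> ln (dnorm n (\<theta>, pt \<theta>))"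
    using dnorm_lower[OF pt_torus(1), of n \<theta>] dnorm_pt_pos[of n \<theta>] rmin \<gamma> by (subst ln_le_cancel_iff) auto
  moreover have "ln (rmin * (\<gamma> / 4) ^ n) = ln rmin + real n * ln (\<gamma> / 4)"
    using rmin \<gamma> by (subst ln_mult) (auto simp: ln_realpow)
  ultimately show "ln rmin + real n * ln (\<gamma> / 4) \<le> ln (dnorm n (\<theta>, pt \<theta>))" by simp
qed

lemma abs_ln_dnorm: "\<bar>ln (dnorm n (\<theta>, pt \<theta>))\<bar> \<le> real n * ln 6 + (- ln rmin + real n * (- ln (\<gamma> / 4)))"
proof -
  have "0 \<le> real n * ln 6" by simp
  moreover have "0 \<le> - ln rmin" using rmin by simp
  moreover have "ln (\<gamma> / 4) \<le> 0" using \<gamma> by (subst ln_le_zero_iff) auto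
  then have "0 \<le> real n * (- ln (\<gamma> / 4))" by (intro mult_nonneg_nonneg) auto
  ultimately show ?thesis using ln_dnorm_bounds[of n \<theta>] by linarith
qed

lemma pt_pair_measurable [measurable]: "(\<lambda>\<theta>. (\<theta>, pt \<theta>)) \<in> borel_measurable borel"
  unfolding borel_prod[symmetric] by measurable

lemma integrable_ln_dnorm: "integrable lebesgue_circle (\<lambda>\<theta>. ln (dnorm n (\<theta>, pt \<theta>)))"
  by (rule lebesgue_circle.integrable_const_bound[OF AE_I2]) (use abs_ln_dnorm[of n] in auto)

text \<open>On the graph the derivative norm is positive, so the value - \<infinity> of
  \<open>ereal_log\<close> never enters and the extended integral is an ordinary one.\<close>

lemma ereal_integral_lyap:
  "ereal_integral (graph_measure graph) (\<lambda>p. ereal_log (fibre_deriv_norm \<Lambda> n p)) = ereal (lyap n)"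
proof -
  have "ereal_integral (graph_measure graph) (\<lambda>p. ereal_log (dnorm n p))
      = ereal_integral (graph_measure graph) (\<lambda>p. ereal (ln (dnorm n p)))"
  proof -
    have m [measurable]: "(\<lambda>p. ereal_log (dnorm n p)) \<in> borel_measurable borel"
      unfolding ereal_log_def by measurable
    have pos: "ereal_log (dnorm n (\<theta>, pt \<theta>)) = ereal (ln (dnorm n (\<theta>, pt \<theta>)))"
      "ereal_log (dnorm n (\<theta>, - pt \<theta>)) = ereal (ln (dnorm n (\<theta>, - pt \<theta>)))" for \<theta>
      using dnorm_pt_pos[of n \<theta>] by (simp_all add: ereal_log_def dnorm_minus)
    show ?thesis unfolding ereal_integral_def
      by (simp add: nn_integral_graph_measure pos)
  qed
  also have "\<dots> = ereal (lyap n)"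
    unfolding lyap_def 
    by (rule ereal_integral_graph_measure[where g="\<lambda>p. ln (dnorm n p)"
          and K="real n * ln 6 + (- ln rmin + real n * (- ln (\<gamma> / 4)))"])
       (use abs_ln_dnorm in \<open>simp_all add: dnorm_minus\<close>)
  finally show ?thesis by (simp add: fibre_deriv_norm_eq)
qed

lemma dnorm_fibre_iter_pt:
  assumes "\<theta> \<in> Gd"
  shows "dnorm n (at_time \<theta> k, fibre_iter \<Lambda> k \<theta> (pt \<theta>)) = dnorm n (at_time \<theta> k, pt (at_time \<theta> k))"
  using fibre_iter_pt[OF assms, of k] by (auto simp: dnorm_minus)

text \<open>The chain rule and rotation invariance; the uncontrolled sign along the orbit disappears
  since the derivative is the same at \<xi> and - \<xi>.\<close>

lemma lyap_subadditive: "lyap (m + n) \<le> lyap m + lyap n"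
proof -
  have i: "integrable lebesgue_circle (\<lambda>\<theta>. ln (dnorm m (at_time \<theta> n, pt (at_time \<theta> n))))"
  proof (rule lebesgue_circle.integrable_const_bound[OF AE_I2])
    show "norm (ln (dnorm m (at_time \<theta> n, pt (at_time \<theta> n)))) \<le> real m * ln 6 + (- ln rmin + real m * (- ln (\<gamma> / 4)))" for \<theta>
      using abs_ln_dnorm[of m "at_time \<theta> n"] by simp
  qed (simp add: at_time_def)
  have shift: "(\<integral>\<theta>. ln (dnorm m (at_time \<theta> n, pt (at_time \<theta> n))) \<partial>lebesgue_circle) = lyap m"
    unfolding lyap_def at_time_def
    by (rule integral_circle_shift[where f="\<lambda>\<theta>. ln (dnorm m (\<theta>, pt \<theta>))"]) measurable
  have "lyap (m + n) \<le> (\<integral>\<theta>. ln (dnorm m (at_time \<theta> n, pt (at_time \<theta> n))) + ln (dnorm n (\<theta>, pt \<theta>)) \<partial>lebesgue_circle)"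
    unfolding lyap_def
  proof (rule integral_mono_AE)
    show "AE \<theta> in lebesgue_circle. ln (dnorm (m + n) (\<theta>, pt \<theta>))
        \<le> ln (dnorm m (at_time \<theta> n, pt (at_time \<theta> n))) + ln (dnorm n (\<theta>, pt \<theta>))"
      using GAE
    proof eventually_elim
      case (elim \<theta>)
      have "dnorm (m + n) (\<theta>, pt \<theta>) \<le> dnorm m (at_time \<theta> n, pt (at_time \<theta> n)) * dnorm n (\<theta>, pt \<theta>)"
        using dnorm_add[of m n \<theta> "pt \<theta>"] dnorm_fibre_iter_pt[OF elim] by simp
      then have "ln (dnorm (m + n) (\<theta>, pt \<theta>)) \<le> ln (dnorm m (at_time \<theta> n, pt (at_time \<theta> n)) * dnorm n (\<theta>, pt \<theta>))"
        using dnorm_pt_pos by (subst ln_le_cancel_iff) auto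
      then show ?case using dnorm_pt_pos by (simp add: ln_mult_pos)
    qed
  qed (use i integrable_ln_dnorm in auto)
  also have "\<dots> = lyap m + lyap n"
    using i integrable_ln_dnorm[of n] by (subst Bochner_Integration.integral_add) (auto simp: shift lyap_def)
  finally show ?thesis .
qed

text \<open>In the moving frame the transverse coordinate is exactly
  \<open>pn n \<theta> * y0\<close>. The radial one obeys a linear recursion of rate at most
  \<open>rate rmin\<close> < \<mu>, forced by a term of order \<mu>^n; M is large enough for M *
  \<mu>^n to be a supersolution.\<close>

lemma dn_frame:
  assumes \<theta>: "\<theta> \<in> Gd" and K: "0 < K" "\<And>n. pn n \<theta> \<le> K * \<mu> ^ n" and l: "rate rmin < \<mu>"
    and xy: "\<bar>x0\<bar> \<le> 1 / rmin" "\<bar>y0\<bar> \<le> 1 / rmin"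
  defines "M \<equiv> 1 / rmin + (2 / rmin) * (K / rmin) / (\<mu> - rate rmin)"
  shows "\<exists>x. \<bar>x\<bar> \<le> M * \<mu> ^ n \<and> dn n \<theta> (pt \<theta>) (x0 *\<^sub>R pt \<theta> + y0 *\<^sub>R perp (pt \<theta>))
    = x *\<^sub>R fibre_iter \<Lambda> n \<theta> (pt \<theta>) + (pn n \<theta> * y0) *\<^sub>R perp (fibre_iter \<Lambda> n \<theta> (pt \<theta>))"
proof (induction n)
  case 0
  have "0 \<le> (2 / rmin) * (K / rmin) / (\<mu> - rate rmin)" using K rmin l by simp
  then show ?case using xy by (intro exI[of _ x0]) (auto simp: M_def pn_def dirv)
next
  case (Suc n)
  then obtain x where x: "\<bar>x\<bar> \<le> M * \<mu> ^ n"
    "dn n \<theta> (pt \<theta>) (x0 *\<^sub>R pt \<theta> + y0 *\<^sub>R perp (pt \<theta>)) = x *\<^sub>R fibre_iter \<Lambda> n \<theta> (pt \<theta>) + (pn n \<theta> * y0) *\<^sub>R perp (fibre_iter \<Lambda> n \<theta> (pt \<theta>))"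
    by blast
  define \<xi> t where xt: "\<xi> = fibre_iter \<Lambda> n \<theta> (pt \<theta>)" "t = at_time \<theta> n"
  have tor: "(t, \<xi>) \<in> torus" unfolding xt by (rule torus_iter[OF pt_torus(1)])
  note \<xi> = torus_norm[OF tor]
  obtain s where s: "\<bar>s\<bar> \<le> 2 / rmin"
    "\<And>x y. dstep t \<xi> (x *\<^sub>R \<xi> + y *\<^sub>R perp \<xi>)
      = (rate (norm \<xi>) * x + s * y) *\<^sub>R snd (\<Lambda> (t, \<xi>)) + (\<gamma> * (norm \<xi>)\<^sup>2 / (norm (A t \<xi>))\<^sup>2 * y) *\<^sub>R perp (snd (\<Lambda> (t, \<xi>)))"
    using dstep_frame[OF tor] by metis
  have l0: "0 \<le> rate rmin" "0 < \<mu>" using rate_bounds[OF rmin(1,2)] l by auto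
  have pn0: "0 \<le> pn n \<theta>" using \<gamma> by (simp add: pn_def)
  have ratio: "\<gamma> * (norm \<xi>)\<^sup>2 / (norm (A t \<xi>))\<^sup>2 * (pn n \<theta> * y0) = pn (Suc n) \<theta> * y0"
  proof -
    have "zdir \<xi> = \<psi> t"
      using fibre_iter_pt[OF \<theta>, of n] pt(2) zdir_scale[of "-1" "pt t"] by (auto simp: xt)
    then have "\<gamma> * (norm \<xi>)\<^sup>2 / (norm (A t \<xi>))\<^sup>2 = mob_rate (mobk \<gamma>) (rot2 t * \<psi> t)"
      using flin_rate[OF \<gamma> \<xi>(1), of t] by simp
    moreover have "pn (Suc n) \<theta> = pn n \<theta> * mob_rate (mobk \<gamma>) (rot2 t * \<psi> t)"
      unfolding pn_Suc(1)[OF \<theta>] pn_Suc(2)[OF \<theta>] xt ..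
    ultimately show ?thesis by simp
  qed
  have eq: "dn (Suc n) \<theta> (pt \<theta>) (x0 *\<^sub>R pt \<theta> + y0 *\<^sub>R perp (pt \<theta>))
      = (rate (norm \<xi>) * x + s * (pn n \<theta> * y0)) *\<^sub>R fibre_iter \<Lambda> (Suc n) \<theta> (pt \<theta>)
        + (pn (Suc n) \<theta> * y0) *\<^sub>R perp (fibre_iter \<Lambda> (Suc n) \<theta> (pt \<theta>))"
    unfolding dn.simps x(2) fibre_iter_Suc xt[symmetric] s(2) ratio ..
  have "\<bar>rate (norm \<xi>) * x + s * (pn n \<theta> * y0)\<bar> \<le> rate (norm \<xi>) * \<bar>x\<bar> + \<bar>s\<bar> * (pn n \<theta> * \<bar>y0\<bar>)"
    using rate_bounds[of "norm \<xi>"] \<xi> rmin pn0 abs_triangle_ineq[of "rate (norm \<xi>) * x" "s * (pn n \<theta> * y0)"]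
    by (simp add: abs_mult)
  also have "\<dots> \<le> rate rmin * (M * \<mu> ^ n) + (2 / rmin) * (K * \<mu> ^ n * (1 / rmin))"
    using rate_antimono[OF rmin(1) \<xi>(2)] x(1) s(1) K xy(2) l0 pn0 rmin(1)
    by (intro add_mono mult_mono mult_nonneg_nonneg) auto
  also have "\<dots> \<le> M * \<mu> ^ Suc n"
  proof -
    have "(2 / rmin) * (K / rmin) = ((2 / rmin) * (K / rmin) / (\<mu> - rate rmin)) * (\<mu> - rate rmin)" using l by simp
    also have "\<dots> \<le> M * (\<mu> - rate rmin)" unfolding M_def using l rmin by (intro mult_right_mono) auto
    finally have "\<mu> ^ n * (rate rmin * M + (2 / rmin) * (K / rmin)) \<le> \<mu> ^ n * (M * \<mu>)"
      using l0 by (intro mult_left_mono) (auto simp: algebra_simps)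
    then show ?thesis by (simp add: algebra_simps)
  qed
  finally show ?case using eq by blast
qed

lemma dnorm_exponential_decay:
  assumes \<theta>: "\<theta> \<in> Gd" and l: "rate rmin < \<mu>" "exp (- c) \<le> \<mu>" "\<mu> < 1"
  obtains K where "0 < K" "\<And>n. dnorm n (\<theta>, pt \<theta>) \<le> K * \<mu> ^ n"
proof -
  obtain K where K: "0 < K" "\<And>n. pn n \<theta> \<le> K * exp (- c) ^ n" using pn_decay[OF \<theta>] by metis
  have K': "pn n \<theta> \<le> K * \<mu> ^ n" for n
    using K(2)[of n] K(1) power_mono[OF l(2), of n] by (smt (verit) exp_ge_zero mult_left_mono)
  define M where "M = 1 / rmin + (2 / rmin) * (K / rmin) / (\<mu> - rate rmin)"
  have M: "0 < M" using rmin K l by (simp add: M_def add_pos_nonneg)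
  have l0: "0 < \<mu>" using l(2) exp_gt_zero[of "- c"] by linarith
  have "dnorm n (\<theta>, pt \<theta>) \<le> (M + K / rmin) * \<mu> ^ n" for n
    unfolding dnorm_onorm
  proof (rule onorm_le)
    fix \<eta>
    show "norm (dn n \<theta> (pt \<theta>) \<eta>) \<le> (M + K / rmin) * \<mu> ^ n * norm \<eta>"
    proof (cases "\<eta> = 0")
      case True
      then show ?thesis using linear_0[OF bounded_linear.linear[OF bounded_linear_dn]] by simp
    next
      case False
      define e where "e = (1 / norm \<eta>) *\<^sub>R \<eta>"
      have ne: "norm e = 1" using False by (simp add: e_def)
      define x0 y0 where xy: "x0 = (pt \<theta> \<bullet> e) / (norm (pt \<theta>))\<^sup>2" "y0 = cross (pt \<theta>) e / (norm (pt \<theta>))\<^sup>2"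
      have fr: "e = x0 *\<^sub>R pt \<theta> + y0 *\<^sub>R perp (pt \<theta>)" unfolding xy by (rule perp_frame[OF pt(1)])
      have le: "a / (norm (pt \<theta>))\<^sup>2 \<le> 1 / rmin" if "a \<le> norm (pt \<theta>) * 1" for a
      proof -
        have "a / (norm (pt \<theta>))\<^sup>2 \<le> norm (pt \<theta>) * 1 / (norm (pt \<theta>))\<^sup>2" using that by (rule divide_right_mono) simp
        also have "\<dots> = 1 / norm (pt \<theta>)" using pt(1) by (simp add: power2_eq_square)
        also have "\<dots> \<le> 1 / rmin" using pt(1,5)[of \<theta>] rmin(1) by (intro divide_left_mono) auto
        finally show ?thesis .
      qed
      have b: "\<bar>x0\<bar> \<le> 1 / rmin" "\<bar>y0\<bar> \<le> 1 / rmin"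
        using le[of "\<bar>pt \<theta> \<bullet> e\<bar>"] le[of "\<bar>cross (pt \<theta>) e\<bar>"] Cauchy_Schwarz_ineq2[of "pt \<theta>" e] cross_le[of "pt \<theta>" e] ne
        by (simp_all add: xy abs_divide)
      obtain x where x: "\<bar>x\<bar> \<le> M * \<mu> ^ n" "dn n \<theta> (pt \<theta>) e
          = x *\<^sub>R fibre_iter \<Lambda> n \<theta> (pt \<theta>) + (pn n \<theta> * y0) *\<^sub>R perp (fibre_iter \<Lambda> n \<theta> (pt \<theta>))"
        using dn_frame[OF \<theta> K(1) K' l(1) b, of n] unfolding fr[symmetric] M_def by blast
      define r where "r = norm (fibre_iter \<Lambda> n \<theta> (pt \<theta>))"
      have r: "0 \<le> r" "r \<le> 1" using torus_norm(3)[OF torus_iter[OF pt_torus(1), of \<theta> n]] by (auto simp: r_def)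
      have pn0: "0 \<le> pn n \<theta>" using \<gamma> by (simp add: pn_def)
      have "norm (dn n \<theta> (pt \<theta>) e) \<le> \<bar>x\<bar> * r + pn n \<theta> * \<bar>y0\<bar> * r"
        unfolding x(2) using pn0 by (intro norm_triangle_le) (simp add: r_def abs_mult)
      also have "\<dots> \<le> (M * \<mu> ^ n) * 1 + (K * \<mu> ^ n) * (1 / rmin) * 1"
        using x(1) r K' b pn0 K M l0 rmin by (intro add_mono mult_mono mult_nonneg_nonneg) auto
      also have "\<dots> = (M + K / rmin) * \<mu> ^ n" by (simp add: algebra_simps)
      finally have "norm (dn n \<theta> (pt \<theta>) e) \<le> (M + K / rmin) * \<mu> ^ n" .
      moreover have "\<eta> = norm \<eta> *\<^sub>R e" using False by (simp add: e_def)
      then have "norm (dn n \<theta> (pt \<theta>) \<eta>) = norm \<eta> * norm (dn n \<theta> (pt \<theta>) e)"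
        using linear_scale[OF bounded_linear.linear[OF bounded_linear_dn], of n \<theta> "pt \<theta>" "norm \<eta>" e] by simp
      ultimately show ?thesis by (simp add: mult.commute mult_left_mono)
    qed
  qed
  moreover have "0 < M + K / rmin" using M K rmin by (simp add: add_pos_pos)
  ultimately show thesis using that by blast
qed

text \<open>The exponential decay of the derivative has a constant depending on \<theta>, so it
  cannot be integrated directly; bounded convergence is applied to truncated logarithms
  instead.\<close>

lemma lyap_negative: "\<exists>n>0. lyap n < 0"
proof -
  define \<mu> where "\<mu> = (1 + max (rate rmin) (exp (- c))) / 2"
  define M where "M = max (rate rmin) (exp (- c))"
  have M: "rate rmin \<le> M" "exp (- c) \<le> M" "M < 1"
    using rate_bounds[OF rmin(1,2)] c by (auto simp: M_def)
  have \<mu>: "\<mu> = (1 + M) / 2" by (simp add: \<mu>_def M_def)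
  have l1: "rate rmin < \<mu>" unfolding \<mu> using M(1,3) by simp
  have l2: "exp (- c) \<le> \<mu>" unfolding \<mu> using M(2,3) by simp
  have l3: "\<mu> < 1" unfolding \<mu> using M(3) by simp
  have l4: "0 < \<mu>" using l2 exp_gt_zero[of "- c"] by linarith
  note l = l1 l2 l3 l4
  define b where "b = ln \<mu> / 2"
  have b: "b < 0" "ln \<mu> < b" using l by (auto simp: b_def)
  \<comment> \<open>Truncation at b, strictly between ln \<mu> and 0, makes the sequence eventually
    equal to b at almost every \<theta> and bounded uniformly, whatever the constant K of that
    \<theta> is.\<close>
  define g where "g n \<theta> = max (ln (dnorm n (\<theta>, pt \<theta>)) / real n) b" for n \<theta>
  have [measurable]: "g n \<in> borel_measurable borel" for n unfolding g_def[abs_def] by measurable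
  have gb: "\<bar>g n \<theta>\<bar> \<le> ln 6 + \<bar>b\<bar>" for n \<theta>
  proof -
    have "ln (dnorm n (\<theta>, pt \<theta>)) / real n \<le> ln 6"
      using ln_dnorm_bounds(1)[of n \<theta>] by (cases "n = 0") (auto simp: field_simps)
    moreover have "0 \<le> ln (6::real)" by simp
    ultimately show ?thesis unfolding g_def using b by linarith
  qed
  have "(\<lambda>n. \<integral>\<theta>. g n \<theta> \<partial>lebesgue_circle) \<longlonglongrightarrow> (\<integral>\<theta>. b \<partial>lebesgue_circle)"
  proof (rule integral_dominated_convergence[where w="\<lambda>_. ln 6 + \<bar>b\<bar>"])
    show "AE \<theta> in lebesgue_circle. (\<lambda>n. g n \<theta>) \<longlonglongrightarrow> b"
      using GAE
    proof eventually_elim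
      case (elim \<theta>)
      obtain K where K: "0 < K" "\<And>n. dnorm n (\<theta>, pt \<theta>) \<le> K * \<mu> ^ n"
        using dnorm_exponential_decay[OF elim l(1-3)] by metis
      have "(\<lambda>n. ln K / real n + ln \<mu>) \<longlonglongrightarrow> 0 + ln \<mu>"
        by (intro tendsto_add lim_const_over_n tendsto_const)
      then have "\<forall>\<^sub>F n in sequentially. ln K / real n + ln \<mu> < b" using b by (simp add: order_tendstoD(2))
      then have "\<forall>\<^sub>F n in sequentially. g n \<theta> = b"
        using eventually_gt_at_top[of 0]
      proof eventually_elim
        case (elim n)
        have "ln (dnorm n (\<theta>, pt \<theta>)) \<le> ln (K * \<mu> ^ n)"
          using K(2)[of n] dnorm_pt_pos[of n \<theta>] by (subst ln_le_cancel_iff) (auto intro: less_le_trans)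
        also have "\<dots> = ln K + real n * ln \<mu>" using K l by (simp add: ln_mult ln_realpow)
        finally have "ln (dnorm n (\<theta>, pt \<theta>)) / real n \<le> ln K / real n + ln \<mu>" using elim by (simp add: field_simps)
        then show ?case using elim by (simp add: g_def)
      qed
      then show ?case by (rule tendsto_eventually)
    qed
    show "AE \<theta> in lebesgue_circle. norm (g n \<theta>) \<le> ln 6 + \<bar>b\<bar>" for n using gb by simp
  qed auto
  then have "\<forall>\<^sub>F n in sequentially. (\<integral>\<theta>. g n \<theta> \<partial>lebesgue_circle) < 0"
    using b by (intro order_tendstoD(2)) auto
  then obtain n where n: "0 < n" "(\<integral>\<theta>. g n \<theta> \<partial>lebesgue_circle) < 0"
    using eventually_happens[OF eventually_conj[OF _ eventually_gt_at_top[of 0]]] by (metis (no_types, lifting) sequentially_bot)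
  have "lyap n / real n = (\<integral>\<theta>. ln (dnorm n (\<theta>, pt \<theta>)) / real n \<partial>lebesgue_circle)" by (simp add: lyap_def)
  also have "\<dots> \<le> (\<integral>\<theta>. g n \<theta> \<partial>lebesgue_circle)"
  proof (rule integral_mono)
    show "integrable lebesgue_circle (g n)"
      by (rule lebesgue_circle.integrable_const_bound[where B="ln 6 + \<bar>b\<bar>"]) (use gb in auto)
  qed (use integrable_ln_dnorm in \<open>auto simp: g_def\<close>)
  finally have "lyap n / real n < 0" using n by simp
  then have "lyap n < 0" using n by (simp add: divide_less_0_iff)
  then show ?thesis using n by blast
qed

lemma negative_exponent: "\<exists>L<0. is_max_fibre_exponent \<Lambda> (graph_measure graph) L"
proof -
  obtain N where N: "0 < N" "lyap N < 0" using lyap_negative by blast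
  define B where "B = - ln rmin - ln (\<gamma> / 4)"
  have low: "- B * real n \<le> lyap n" for n
  proof (cases "n = 0")
    \<comment> \<open>At n = 0 the claim is 0 \<le> \<open>lyap 0\<close>: the identity has norm 1,
      whereas the general bound would leave the negative term ln \<open>rmin\<close>.\<close>
    case True
    have "dn 0 \<theta> \<xi> = (\<lambda>\<eta>. \<eta>)" for \<theta> \<xi> by auto
    then have "dnorm 0 (\<theta>, \<xi>) = 1" for \<theta> \<xi> using onorm_id[where 'a="real^2"] by (simp add: dnorm_onorm id_def)
    then show ?thesis using True by (simp add: lyap_def)
  next
    case False
    have "(\<integral>\<theta>. ln rmin + real n * ln (\<gamma> / 4) \<partial>lebesgue_circle) \<le> lyap n"
      unfolding lyap_def using ln_dnorm_bounds(2)[of n] integrable_ln_dnorm[of n] by (intro integral_mono) auto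
    then have "ln rmin + real n * ln (\<gamma> / 4) \<le> lyap n" by simp
    moreover have "real n * ln rmin \<le> 1 * ln rmin" using rmin False by (intro mult_right_mono_neg) auto
    ultimately show ?thesis by (simp add: B_def algebra_simps)
  qed
  obtain L where L: "L < 0" "(\<lambda>n. lyap n / real n) \<longlonglongrightarrow> L"
    using subadditive_LIMSEQ[of lyap B N, OF lyap_subadditive low N] by metis
  have "is_max_fibre_exponent \<Lambda> (graph_measure graph) (ereal L)"
    unfolding is_max_fibre_exponent_def ereal_integral_lyap using L(2) by simp
  then show ?thesis using L(1) by (intro exI[of _ "ereal L"]) simp
qed

end

section \<open>Winding numbers and sensitivity\<close>

lemma mob_lipschitz:
  assumes k: "0 < \<kappa>" "\<kappa> < 1" and ab: "norm a \<le> 1" "norm b \<le> 1"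
  shows "norm (mob \<kappa> a - mob \<kappa> b) \<le> (1 + \<kappa>) / (1 - \<kappa>) * norm (a - b)"
proof -
  have "norm (mob \<kappa> a - mob \<kappa> b) = \<bar>1 - \<kappa>\<^sup>2\<bar> * norm (a - b) / (norm (1 + of_real \<kappa> * a) * norm (1 + of_real \<kappa> * b))"
    unfolding mob_diff[OF k ab] norm_divide norm_mult
    by (metis norm_of_real of_real_1 of_real_diff of_real_power)
  also have "\<bar>1 - \<kappa>\<^sup>2\<bar> = (1 - \<kappa>) * (1 + \<kappa>)" using k by (simp add: power2_eq_square algebra_simps mult_le_one)
  also have "(1 - \<kappa>) * (1 + \<kappa>) * norm (a - b) / (norm (1 + of_real \<kappa> * a) * norm (1 + of_real \<kappa> * b))
      \<le> (1 - \<kappa>) * (1 + \<kappa>) * norm (a - b) / ((1 - \<kappa>) * (1 - \<kappa>))"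
    using k mob_denom(2)[OF k ab(1)] mob_denom(2)[OF k ab(2)] by (intro divide_left_mono mult_mono mult_nonneg_nonneg mult_pos_pos) auto
  also have "\<dots> = (1 + \<kappa>) / (1 - \<kappa>) * norm (a - b)" using k by simp
  finally show ?thesis .
qed

text \<open>For unimodular \<zeta> the product equals p / cnj p, where p has real part at least 1 -
  \<kappa>: the map turns \<zeta> by less than a half turn. For \<kappa> =
  \<open>mobk \<gamma>\<close> the margin is \<gamma>.\<close>

lemma mob_avoids_nonpos:
  assumes k: "0 < \<kappa>" "\<kappa> < 1" and z: "norm \<zeta> = 1" and s: "0 \<le> s"
  shows "(1 - \<kappa>) / (1 + \<kappa>) \<le> norm (mob \<kappa> \<zeta> * cnj \<zeta> + of_real s)"
proof -
  define p where "p = 1 + of_real \<kappa> * cnj \<zeta>"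
  have z': "norm (cnj \<zeta>) \<le> 1" using z by simp
  note d = mob_denom[OF k z', folded p_def]
  have cp: "cnj p = 1 + of_real \<kappa> * \<zeta>" by (simp add: p_def)
  have "\<zeta> * cnj \<zeta> = 1" using complex_norm_square[of \<zeta>] z by simp
  then have "(\<zeta> + of_real \<kappa>) * cnj \<zeta> = p" by (simp add: p_def algebra_simps)
  then have "mob \<kappa> \<zeta> * cnj \<zeta> = p / cnj p" unfolding mob_def cp by simp
  moreover have "cnj p \<noteq> 0" using d(4) by simp
  ultimately have "mob \<kappa> \<zeta> * cnj \<zeta> + of_real s = (p + of_real s * cnj p) / cnj p" by (simp add: add_divide_distrib)
  then have eq: "norm (mob \<kappa> \<zeta> * cnj \<zeta> + of_real s) = norm (p + of_real s * cnj p) / norm p" by (simp add: norm_divide)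
  have "1 * (1 - \<kappa>) \<le> (1 + s) * Re p" using d(1) s k by (intro mult_mono) auto
  also have "\<dots> = Re (p + of_real s * cnj p)" by (simp add: algebra_simps)
  also have "\<dots> \<le> norm (p + of_real s * cnj p)" by (rule complex_Re_le_cmod)
  finally have "1 - \<kappa> \<le> norm (p + of_real s * cnj p)" by simp
  then show ?thesis unfolding eq using d k by (intro frac_le) auto
qed

lemma dist_rot2: "norm (rot2 \<theta> - rot2 \<phi>) \<le> 4 * pi * dist \<theta> \<phi>"
proof -
  define x y where xy: "x = cnj (circle_cis \<theta>)" "y = cnj (circle_cis \<phi>)"
  have "rot2 \<theta> - rot2 \<phi> = (x - y) * (x + y)" by (simp add: rot2_def xy power2_eq_square algebra_simps)
  moreover have "norm (x + y) \<le> 2" using norm_triangle_ineq[of x y] by (simp add: xy)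
  moreover have "norm (x - y) = dist (circle_cis \<theta>) (circle_cis \<phi>)"
    by (metis xy complex_cnj_diff complex_mod_cnj dist_norm)
  ultimately have "norm (rot2 \<theta> - rot2 \<phi>) \<le> dist (circle_cis \<theta>) (circle_cis \<phi>) * 2"
    by (simp add: norm_mult mult_left_mono)
  then show ?thesis using dist_circle_cis[of \<theta> \<phi>] by linarith
qed

text \<open>The values lie in the discrete set of multiples of 2 * pi * \<i>.\<close>

lemma continuous_exp_eq_1_const:
  fixes h :: "real \<Rightarrow> complex"
  assumes c: "continuous_on UNIV h" and e: "\<And>x. exp (h x) = 1"
  shows "h x = h y"
proof -
  have "h constant_on UNIV"
  proof (rule continuous_discrete_range_constant[OF connected_UNIV c])
    fix x
    show "\<exists>e>0. \<forall>y. y \<in> UNIV \<and> h y \<noteq> h x \<longrightarrow> e \<le> norm (h y - h x)"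
    proof (intro exI[of _ 1] conjI allI impI)
      fix y assume y: "y \<in> UNIV \<and> h y \<noteq> h x"
      obtain m where m: "Re (h y) = 0" "Im (h y) = of_int (2 * m) * pi" using e[of y] unfolding exp_eq_1 by auto
      obtain n where n: "Re (h x) = 0" "Im (h x) = of_int (2 * n) * pi" using e[of x] unfolding exp_eq_1 by auto
      have "m \<noteq> n" using y m n by (auto simp: complex_eq_iff)
      then have "1 \<le> \<bar>real_of_int (m - n)\<bar>" by linarith
      then have "1 * 1 \<le> \<bar>real_of_int (m - n)\<bar> * (2 * pi)" using pi_gt3 by (intro mult_mono) auto
      also have "\<dots> = \<bar>real_of_int (m - n) * (2 * pi)\<bar>" by (simp add: abs_mult)
      also have "real_of_int (m - n) * (2 * pi) = Im (h y - h x)" using m n by (simp add: algebra_simps)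
      also have "\<bar>Im (h y - h x)\<bar> \<le> norm (h y - h x)" by (rule abs_Im_le_cmod)
      finally show "1 \<le> norm (h y - h x)" by simp
    qed simp
  qed
  then show ?thesis unfolding constant_on_def by auto
qed

text \<open>A loop \<open>W\<close> of nonzero directions cannot be carried to a nearby loop by the cocycle: the rotation
  part \<open>rot2\<close> changes the winding number by two.\<close>

lemma no_almost_invariant_loop:
  assumes W: "continuous_on UNIV W"
    and g: "\<And>t. W (t + to_circle \<omega>) * cnj (rot2 (\<theta>0 + t) * W t) \<notin> \<real>\<^sub>\<le>\<^sub>0"
  shows False
proof -
  obtain x0 where x0: "\<theta>0 = to_circle x0" by (metis to_circle_surj)
  define f where "f x = W (to_circle x)" for x
  define G where "G x = W (to_circle x + to_circle \<omega>) * cnj (rot2 (\<theta>0 + to_circle x) * W (to_circle x))" for x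
  have G0: "G x \<notin> \<real>\<^sub>\<le>\<^sub>0" for x unfolding G_def by (rule g)
  have nz: "f x \<noteq> 0" for x using G0[of x] by (auto simp: G_def f_def)
  have fc: "continuous_on UNIV f" unfolding f_def
    by (rule continuous_on_compose2[OF W continuous_on_to_circle]) auto
  have Gc: "continuous_on UNIV G" unfolding G_def
    by (intro continuous_intros continuous_on_compose2[OF W] continuous_on_to_circle) auto
  obtain l where l: "continuous_on UNIV l" "\<And>x. f x = exp (l x)"
    using continuous_logarithm_on_contractible[OF fc contractible_UNIV] nz by (metis UNIV_I)
  have per: "f (x + 1) = f x" "G (x + 1) = G x" for x by (simp_all add: f_def G_def to_circle_add)
  \<comment> \<open>A continuous logarithm of the constant 1, assembled from the definition of G;
    the last term compensates |f|^2, as W need not be unimodular. Over one period the increments of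
    l cancel by \<open>lconst\<close>, G and |f| are periodic, and only the rotation term remains,
    with increment 4 * pi * \<i>.\<close>
  define h where "h x = l (x + \<omega>) - l x - Ln (G x) + \<i> * of_real (4 * pi * (x0 + x)) + 2 * of_real (ln (norm (f x)))" for x
  have lc: "continuous_on UNIV (\<lambda>x. l (x + a))" for a
    by (rule continuous_on_compose2[OF l(1)]) (auto intro!: continuous_intros)
  have hc: "continuous_on UNIV h"
    unfolding h_def by (intro continuous_intros lc l(1) Gc fc) (use G0 nz in auto)
  have he: "exp (h x) = 1" for x
  proof -
    define q where "q = \<i> * complex_of_real (4 * pi * (x0 + x))"
    have r: "rot2 (\<theta>0 + to_circle x) = exp (- q)"
      unfolding x0 to_circle_add[symmetric] rot2_to_circle cis_conv_exp q_def by simp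
    have Gx: "G x \<noteq> 0" using G0[of x] by auto
    define R where "R = rot2 (\<theta>0 + to_circle x)"
    have R: "R \<noteq> 0" "R * cnj R = 1" using complex_norm_square[of R] norm_rot2[of "\<theta>0 + to_circle x"] by (auto simp: R_def)
    have n: "exp (2 * of_real (ln (norm (f x)))) = f x * cnj (f x)"
    proof -
      have "exp (2 * of_real (ln (norm (f x)))) = (of_real (exp (ln (norm (f x)))) :: complex) ^ 2"
        by (simp add: exp_double exp_of_real[symmetric])
      then show ?thesis using nz[of x] complex_norm_square[of "f x"] by simp
    qed
    have "exp (h x) = f (x + \<omega>) / f x / G x / R * (f x * cnj (f x))"
    proof -
      have "exp q = 1 / R" using r by (simp add: R_def exp_minus divide_inverse)
      then show ?thesis unfolding h_def q_def[symmetric] exp_add exp_diff n l(2)[symmetric] exp_Ln[OF Gx] by simp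
    qed
    also have "G x = f (x + \<omega>) * cnj R * cnj (f x)" by (simp add: G_def f_def R_def to_circle_add mult_ac)
    finally have "(R * cnj R) * exp (h x) = 1" using nz[of x] nz[of "x + \<omega>"] R(1) by (simp add: field_simps)
    then show ?thesis using R(2) by simp
  qed
  have "exp (l (x + 1) - l x) = 1" for x using per(1)[of x] nz[of x] l(2) by (simp add: exp_diff)
  then have lconst: "l (x + 1) - l x = l (y + 1) - l y" for x y
    by (intro continuous_exp_eq_1_const[where h="\<lambda>x. l (x + 1) - l x"] continuous_intros lc l(1))
  have "h 1 = h 0" by (rule continuous_exp_eq_1_const[OF hc he])
  moreover have "h 1 - h 0 = \<i> * of_real (4 * pi)"
  proof -
    have "l (1 + \<omega>) - l \<omega> = l 1 - l 0" using lconst[of \<omega> 0] by (simp add: add.commute)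
    then show ?thesis using per(1)[of 0] per(2)[of 0] unfolding h_def by (simp add: algebra_simps)
  qed
  ultimately show False by simp
qed

context sna_graph
begin

text \<open>The errors in \<open>no_common_shadow\<close> add up to at most 7 *
  \<open>trap_eps\<close> / \<gamma>. The value makes this \<gamma> / 2, half of the margin in
  \<open>mob_avoids_nonpos\<close>.\<close>

definition trap_eps :: real where "trap_eps = \<gamma>\<^sup>2 / 14"

lemma trap_eps: "0 < trap_eps" "trap_eps < 1" "7 * trap_eps / \<gamma> = \<gamma> / 2"
proof -
  have "\<gamma>\<^sup>2 \<le> 1" using \<gamma> by (simp add: power_le_one)
  then show "trap_eps < 1" by (simp add: trap_eps_def)
  show "0 < trap_eps" "7 * trap_eps / \<gamma> = \<gamma> / 2" using \<gamma> by (simp_all add: trap_eps_def power2_eq_square)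
qed

text \<open>If all points of \<open>E\<close> shadowed a single sequence of directions, then by Steinhaus the directions \<open>z\<^sub>n\<close>
  would depend almost continuously on \<open>n\<omega>\<close>, and a partition of unity would produce an almost invariant
  loop.\<close>

lemma no_common_shadow:
  assumes E [measurable]: "E \<in> sets borel" and pos: "0 < emeasure lebesgue_circle E" and sub: "E \<subseteq> Gd"
    and z: "\<And>n. N \<le> n \<Longrightarrow> norm (z n) = 1"
    and near: "\<And>\<theta> n. \<theta> \<in> E \<Longrightarrow> N \<le> n \<Longrightarrow> norm (\<psi> (at_time \<theta> n) - z n) \<le> trap_eps"
  shows False
proof -
  define e where "e = trap_eps"
  have e: "0 < e" using trap_eps by (simp add: e_def)
  define O' where "O' n = to_circle (real n * \<omega>)" for n
  have at: "at_time \<theta> n = \<theta> + O' n" for \<theta> n by (simp add: at_time_def O'_def)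
  \<comment> \<open>\<open>rot2\<close> is Lipschitz with constant 4 * pi, so replacing the base
    points of a ball of radius r by its centre costs at most e.\<close>
  define r where "r = e / (4 * pi)"
  have r: "0 < r" "4 * pi * r = e" using e by (auto simp: r_def)
  obtain \<theta>0 where \<theta>0: "0 < emeasure lebesgue_circle (E \<inter> ball \<theta>0 r)"
  proof -
    have "UNIV \<subseteq> (\<Union>x\<in>UNIV. ball (x :: circle) r)" using r by auto
    then obtain F where F: "finite F" "UNIV \<subseteq> (\<Union>x\<in>F. ball (x :: circle) r)"
      using compactE_image[OF compact_UNIV_circle, of UNIV "\<lambda>x. ball x r"] by (metis open_ball)
    have "\<exists>x\<in>F. 0 < emeasure lebesgue_circle (E \<inter> ball x r)"
    proof (rule ccontr)
      assume "\<not> ?thesis"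
      then have "E \<inter> ball x r \<in> null_sets lebesgue_circle" if "x \<in> F" for x using that by (auto simp: null_sets_def)
      then have "(\<Union>x\<in>F. E \<inter> ball x r) \<in> null_sets lebesgue_circle" using F(1) by (intro null_sets.finite_UN) auto
      moreover have "E = (\<Union>x\<in>F. E \<inter> ball x r)" using F(2) by auto
      ultimately show False using pos by auto
    qed
    then show thesis using that by blast
  qed
  define E' where "E' = E \<inter> ball \<theta>0 r"
  have E'm: "E' \<in> sets borel" unfolding E'_def by simp
  obtain d where d: "0 < d" "\<And>t. dist t 0 < d \<Longrightarrow> \<exists>\<theta>\<in>E'. \<theta> + t \<in> E'"
    using steinhaus_circle[OF E'm] \<theta>0 unfolding E'_def by metis
  \<comment> \<open>Steinhaus' theorem provides two points of E' differing by O' i - O' n. One at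
    time i and the other at time n are at the same base point, whose direction is within e of both z
    i and z n.\<close>
  have zz: "norm (z i - z n) \<le> 2 * e" if "N \<le> i" "N \<le> n" "dist (O' i) (O' n) < d" for i n
  proof -
    have "dist (O' i - O' n) 0 < d" using that(3) dist_circle_diff by metis
    then obtain \<theta> where \<theta>: "\<theta> \<in> E'" "\<theta> + (O' i - O' n) \<in> E'" using d(2) by blast
    have "at_time (\<theta> + (O' i - O' n)) n = at_time \<theta> i" by (simp add: at)
    then have "norm (\<psi> (at_time \<theta> i) - z n) \<le> e" "norm (\<psi> (at_time \<theta> i) - z i) \<le> e"
      using near[of "\<theta> + (O' i - O' n)" n] near[of \<theta> i] \<theta> that by (auto simp: E'_def e_def)
    then show ?thesis using norm_triangle_ineq4[of "\<psi> (at_time \<theta> i) - z n" "\<psi> (at_time \<theta> i) - z i"] by simp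
  qed
  have k: "0 < mobk \<gamma>" "mobk \<gamma> < 1" using mobk[OF \<gamma>] .
  have kg: "(1 - mobk \<gamma>) / (1 + mobk \<gamma>) = \<gamma>" "(1 + mobk \<gamma>) / (1 - mobk \<gamma>) = 1 / \<gamma>"
  proof -
    have e: "1 + mobk \<gamma> = 2 / (1 + \<gamma>)" "1 - mobk \<gamma> = 2 * \<gamma> / (1 + \<gamma>)" using \<gamma> by (simp_all add: mobk_def field_simps)
    show e': "(1 - mobk \<gamma>) / (1 + mobk \<gamma>) = \<gamma>"
      unfolding e using \<gamma> by (simp add: field_simps)
    have "1 / ((1 - mobk \<gamma>) / (1 + mobk \<gamma>)) = (1 + mobk \<gamma>) / (1 - mobk \<gamma>)" by simp
    then show "(1 + mobk \<gamma>) / (1 - mobk \<gamma>) = 1 / \<gamma>" unfolding e' ..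
  qed
  \<comment> \<open>One e is the shadowing error at time n + 1. Shadowing at time n and the moved
    rotation give 2 * e, amplified by the Lipschitz constant 1 / \<gamma> of the Moebius
    map.\<close>
  have step: "norm (z (Suc n) - mob (mobk \<gamma>) (rot2 (\<theta>0 + O' n) * z n)) \<le> e + 2 * e / \<gamma>" if n: "N \<le> n" for n
  proof -
    obtain \<theta> where "\<theta> \<in> E'" using \<theta>0 unfolding E'_def by (metis emeasure_empty ex_in_conv less_irrefl)
    then have \<theta>: "\<theta> \<in> E" "dist \<theta> \<theta>0 < r" by (auto simp: E'_def dist_commute)
    define t where "t = at_time \<theta> n"
    have tG: "t \<in> Gd" unfolding t_def using Gd_at_time \<theta>(1) sub by blast
    have 1: "norm (\<psi> (t + \<alpha>) - z (Suc n)) \<le> e"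
      using near[OF \<theta>(1), of "Suc n"] n by (simp add: t_def at_time_Suc e_def)
    have "norm (rot2 t * \<psi> t - rot2 (\<theta>0 + O' n) * z n) \<le> norm (rot2 t * (\<psi> t - z n)) + norm ((rot2 t - rot2 (\<theta>0 + O' n)) * z n)"
      using norm_triangle_ineq[of "rot2 t * (\<psi> t - z n)" "(rot2 t - rot2 (\<theta>0 + O' n)) * z n"] by (simp add: algebra_simps)
    also have "\<dots> = norm (\<psi> t - z n) + norm (rot2 t - rot2 (\<theta>0 + O' n))" using z[OF n] by (simp add: norm_mult)
    also have "\<dots> \<le> e + e"
    proof (rule add_mono)
      show "norm (\<psi> t - z n) \<le> e" using near[OF \<theta>(1) n] by (simp add: t_def e_def)
      have "norm (rot2 t - rot2 (\<theta>0 + O' n)) \<le> 4 * pi * dist \<theta> \<theta>0" using dist_rot2[of t "\<theta>0 + O' n"] by (simp add: t_def at)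
      also have "\<dots> \<le> 4 * pi * r" using \<theta>(2) by simp
      finally show "norm (rot2 t - rot2 (\<theta>0 + O' n)) \<le> e" using r(2) by simp
    qed
    finally have "norm (rot2 t * \<psi> t - rot2 (\<theta>0 + O' n) * z n) \<le> 2 * e" by simp
    moreover have "norm (mob (mobk \<gamma>) (rot2 t * \<psi> t) - mob (mobk \<gamma>) (rot2 (\<theta>0 + O' n) * z n))
        \<le> 1 / \<gamma> * norm (rot2 t * \<psi> t - rot2 (\<theta>0 + O' n) * z n)"
      using mob_lipschitz[OF k, of "rot2 t * \<psi> t" "rot2 (\<theta>0 + O' n) * z n"] \<psi>1 z[OF n] unfolding kg by (simp add: norm_mult)
    ultimately have 2: "norm (\<psi> (t + \<alpha>) - mob (mobk \<gamma>) (rot2 (\<theta>0 + O' n) * z n)) \<le> 2 * e / \<gamma>"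
      unfolding \<psi>T[OF tG] using \<gamma> by (simp add: field_simps)
    show ?thesis
      using 1 2 norm_triangle_ineq4[of "\<psi> (t + \<alpha>) - mob (mobk \<gamma>) (rot2 (\<theta>0 + O' n) * z n)" "\<psi> (t + \<alpha>) - z (Suc n)"] by simp
  qed
  have dense: "t \<in> S" if cl: "closed S" and S: "\<And>n. N \<le> n \<Longrightarrow> O' n \<in> S" for S :: "circle set" and t
  proof -
    have "\<exists>y\<in>S. dist y t < e" if "0 < e" for e
      using irrational_orbit_dense[OF irr that, of N t] S unfolding O'_def by metis
    then show ?thesis using closed_approachable[OF cl] by blast
  qed
  obtain F where F: "finite F" "F \<subseteq> {N..}" "UNIV \<subseteq> (\<Union>i\<in>F. ball (O' i) (d / 2))"
  proof -
    have "UNIV \<subseteq> (\<Union>i\<in>{N..}. ball (O' i) (d / 2))"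
    proof
      fix t :: circle
      obtain n where "n \<ge> N" "dist (O' n) t < d / 2"
        using irrational_orbit_dense[OF irr, of "d / 2" N t] d(1) unfolding O'_def by auto
      then show "t \<in> (\<Union>i\<in>{N..}. ball (O' i) (d / 2))" by auto
    qed
    then show thesis using compactE_image[OF compact_UNIV_circle, of "{N..}" "\<lambda>i. ball (O' i) (d / 2)"] that by (metis open_ball)
  qed
  \<comment> \<open>Tent functions around finitely many orbit points with index at least N, the
    weights of the averaged loop W.\<close>
  define w where "w i t = max 0 (d / 2 - dist t (O' i))" for i t
  have w0: "0 \<le> w i t" for i t by (simp add: w_def)
  define S where "S t = (\<Sum>i\<in>F. w i t)" for t
  have Spos: "0 < S t" for t
  proof -
    have "t \<in> (\<Union>i\<in>F. ball (O' i) (d / 2))" using F(3) by blast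
    then obtain i where i: "i \<in> F" "dist (O' i) t < d / 2" by auto
    then have "0 < w i t" by (simp add: w_def dist_commute)
    then show ?thesis unfolding S_def using F(1) i(1) w0 by (intro sum_pos2[of F i]) auto
  qed
  define W where "W t = (\<Sum>i\<in>F. of_real (w i t) * z i) / of_real (S t)" for t
  have Wc: "continuous_on UNIV W"
    unfolding W_def S_def w_def
    by (intro continuous_intros) (use Spos in \<open>auto simp: S_def w_def of_real_sum[symmetric] simp del: of_real_sum\<close>, metis less_irrefl)
  have Wle: "norm (W t) \<le> 1" for t
  proof -
    have "norm (\<Sum>i\<in>F. of_real (w i t) * z i) \<le> S t" unfolding S_def
      by (rule sum_norm_le) (use z F(2) w0 in \<open>auto simp: norm_mult\<close>)
    then show ?thesis using Spos[of t] by (simp add: W_def norm_divide)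
  qed
  have Wz: "norm (W (O' n) - z n) \<le> 2 * e" if n: "N \<le> n" for n
  proof -
    have "(\<Sum>i\<in>F. of_real (w i (O' n)) * (z i - z n)) = (\<Sum>i\<in>F. of_real (w i (O' n)) * z i) - of_real (S (O' n)) * z n"
      by (simp add: right_diff_distrib sum_subtractf S_def sum_distrib_right)
    then have eqW: "W (O' n) - z n = (\<Sum>i\<in>F. of_real (w i (O' n)) * (z i - z n)) / of_real (S (O' n))"
      using Spos[of "O' n"] by (simp add: W_def diff_divide_distrib)
    have "norm (\<Sum>i\<in>F. of_real (w i (O' n)) * (z i - z n)) \<le> (\<Sum>i\<in>F. w i (O' n) * (2 * e))"
    proof (rule sum_norm_le)
      fix i assume i: "i \<in> F"
      show "norm (of_real (w i (O' n)) * (z i - z n)) \<le> w i (O' n) * (2 * e)"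
      proof (cases "w i (O' n) = 0")
        case False
        then have "dist (O' i) (O' n) < d" using d(1) by (auto simp: w_def max_def dist_commute split: if_splits)
        then show ?thesis using zz[of i n] i F(2) n w0[of i "O' n"] by (auto simp: norm_mult mult_left_mono)
      qed simp
    qed
    also have "(\<Sum>i\<in>F. w i (O' n) * (2 * e)) = S (O' n) * (2 * e)" by (simp add: S_def sum_distrib_right)
    finally show ?thesis unfolding eqW norm_divide using Spos[of "O' n"] by (simp add: divide_le_eq mult_ac)
  qed
  define g where "g t = W (t + to_circle \<omega>) * cnj (rot2 (\<theta>0 + t) * W t)" for t
  have gc: "continuous_on UNIV g"
    unfolding g_def by (intro continuous_intros continuous_on_compose2[OF Wc] Wc) auto
  \<comment> \<open>The errors 2 * e + (e + 2 * e / \<gamma>) + 2 * e are at most 7 * e / \<gamma>.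
    For each s the estimate is a closed condition, so it extends from the dense orbit to the whole
    circle.\<close>
  have gn: "\<gamma> / 2 \<le> norm (g (O' n) + of_real s)" if n: "N \<le> n" and s: "0 \<le> s" for n s
  proof -
    define \<zeta> where "\<zeta> = rot2 (\<theta>0 + O' n) * z n"
    have n\<zeta>: "norm \<zeta> = 1" using z[OF n] by (simp add: \<zeta>_def norm_mult)
    define a where "a = W (O' n + \<alpha>)"
    define b where "b = rot2 (\<theta>0 + O' n) * W (O' n)"
    have "O' n + \<alpha> = O' (Suc n)" by (simp add: O'_def distrib_right to_circle_add add.commute)
    then have "norm (a - z (Suc n)) \<le> 2 * e" using Wz[of "Suc n"] n by (simp add: a_def)
    then have a: "norm (a - mob (mobk \<gamma>) \<zeta>) \<le> 2 * e + (e + 2 * e / \<gamma>)"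
      using step[OF n] norm_triangle_ineq[of "a - z (Suc n)" "z (Suc n) - mob (mobk \<gamma>) \<zeta>"] by (simp add: \<zeta>_def)
    have "b - \<zeta> = rot2 (\<theta>0 + O' n) * (W (O' n) - z n)" by (simp add: b_def \<zeta>_def algebra_simps)
    then have b: "norm (b - \<zeta>) \<le> 2 * e" using Wz[OF n] by (simp add: norm_mult)
    have nb: "norm b \<le> 1" using Wle by (simp add: b_def norm_mult)
    have nm: "norm (mob (mobk \<gamma>) \<zeta>) = 1" by (rule norm_mob_unit[OF k n\<zeta>])
    have "a * cnj b - mob (mobk \<gamma>) \<zeta> * cnj \<zeta> = (a - mob (mobk \<gamma>) \<zeta>) * cnj b + mob (mobk \<gamma>) \<zeta> * cnj (b - \<zeta>)"
      by (simp add: algebra_simps)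
    then have "norm (a * cnj b - mob (mobk \<gamma>) \<zeta> * cnj \<zeta>) \<le> norm (a - mob (mobk \<gamma>) \<zeta>) * norm b + norm (b - \<zeta>)"
      using norm_triangle_ineq[of "(a - mob (mobk \<gamma>) \<zeta>) * cnj b" "mob (mobk \<gamma>) \<zeta> * cnj (b - \<zeta>)"] nm
      unfolding norm_mult complex_mod_cnj by simp
    also have "\<dots> \<le> (2 * e + (e + 2 * e / \<gamma>)) * 1 + 2 * e"
      using a b nb order.trans[OF norm_ge_zero a] by (intro add_mono mult_mono) auto
    also have "\<dots> \<le> 7 * e / \<gamma>"
    proof -
      have "5 * e \<le> 5 * e / \<gamma>" using \<gamma> e by (simp add: field_simps)
      then show ?thesis by (simp add: add_divide_distrib)
    qed
    finally have "norm (a * cnj b - mob (mobk \<gamma>) \<zeta> * cnj \<zeta>) \<le> \<gamma> / 2" using trap_eps(3) by (simp add: e_def)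
    moreover have "\<gamma> \<le> norm (mob (mobk \<gamma>) \<zeta> * cnj \<zeta> + of_real s)"
      using mob_avoids_nonpos[OF k n\<zeta> s] unfolding kg .
    moreover have "g (O' n) = a * cnj b" by (simp add: g_def a_def b_def)
    ultimately show ?thesis
      using norm_triangle_ineq2[of "mob (mobk \<gamma>) \<zeta> * cnj \<zeta> + of_real s" "mob (mobk \<gamma>) \<zeta> * cnj \<zeta> - a * cnj b"]
      by (simp add: norm_minus_commute add.commute)
  qed
  have "g t \<notin> \<real>\<^sub>\<le>\<^sub>0" for t
  proof
    assume "g t \<in> \<real>\<^sub>\<le>\<^sub>0"
    then obtain s where s: "0 \<le> s" "g t = - of_real s" by (auto elim!: nonpos_Reals_cases) (metis neg_0_le_iff_le minus_minus of_real_minus)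
    have "closed {t. \<gamma> / 2 \<le> norm (g t + of_real s)}"
      by (intro closed_Collect_le continuous_intros gc)
    then have "t \<in> {t. \<gamma> / 2 \<le> norm (g t + of_real s)}" by (rule dense) (use gn s in auto)
    then show False using s(2) \<gamma> by simp
  qed
  then show False using no_almost_invariant_loop[OF Wc] unfolding g_def by blast
qed

text \<open>Passing from vectors of norm at least \<open>rmin\<close> to squared directions costs a
  factor 2 / \<open>rmin\<close>, by \<open>zdir_diff_le\<close>.\<close>

definition shadow_eps :: real where "shadow_eps = trap_eps * rmin / 2"

lemma shadow_eps: "0 < shadow_eps" "shadow_eps < rmin"
  using trap_eps rmin(1) mult_strict_right_mono[of trap_eps 1 rmin] by (simp_all add: shadow_eps_def)

text \<open>The sequence v is arbitrary and need not be an orbit: for non-continuity it consists of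
  values of the hypothetical continuous graph.\<close>

lemma no_common_vector_shadow:
  assumes E: "E \<in> sets borel" and pos: "0 < emeasure lebesgue_circle E" and sub: "E \<subseteq> Gd"
    and near: "\<And>\<theta> n. \<theta> \<in> E \<Longrightarrow> N \<le> n \<Longrightarrow> norm (v n - pt (at_time \<theta> n)) \<le> shadow_eps \<or> norm (v n + pt (at_time \<theta> n)) \<le> shadow_eps"
  shows False
proof (rule no_common_shadow[OF E pos sub, where N=N and z="\<lambda>n. zdir (v n)"])
  have nz: "v n \<noteq> 0" if "N \<le> n" for n
  proof -
    obtain \<theta> where "\<theta> \<in> E" using pos by (metis emeasure_empty ex_in_conv less_irrefl)
    then show ?thesis using near[of \<theta> n] that pt(5)[of "at_time \<theta> n"] shadow_eps by auto
  qed
  then show "norm (zdir (v n)) = 1" if "N \<le> n" for n using norm_zdir that by blast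
  fix \<theta> n assume \<theta>: "\<theta> \<in> E" and n: "N \<le> n"
  define p where "p = pt (at_time \<theta> n)"
  obtain s :: real where s: "s \<in> {1, -1}" "norm (s *\<^sub>R p - v n) \<le> shadow_eps"
  proof (cases "norm (v n - p) \<le> shadow_eps")
    case True then show thesis using that[of 1] by (simp add: norm_minus_commute)
  next
    case False
    then have "norm (v n + p) \<le> shadow_eps" using near[OF \<theta> n] by (simp add: p_def)
    moreover have "norm ((-1) *\<^sub>R p - v n) = norm (v n + p)" by (metis minus_add_distrib norm_minus_cancel scaleR_minus1_left add_uminus_conv_diff add.commute)
    ultimately show thesis using that[of "-1"] by simp
  qed
  have p: "p \<noteq> 0" "rmin \<le> norm p" "zdir p = \<psi> (at_time \<theta> n)" using pt by (auto simp: p_def)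
  have s0: "s \<noteq> 0" using s(1) by auto
  have sp: "s *\<^sub>R p \<noteq> 0" "norm (s *\<^sub>R p) = norm p" using s(1) p(1) by auto
  note sp = sp zdir_scale[OF s0, of p]
  have "norm (zdir (s *\<^sub>R p) - zdir (v n)) \<le> 2 * norm (s *\<^sub>R p - v n) / norm (s *\<^sub>R p)"
    by (rule zdir_diff_le[OF sp(1) nz[OF n]])
  also have "\<dots> \<le> 2 * shadow_eps / rmin"
    unfolding sp(2) using s(2) p rmin(1) shadow_eps by (intro frac_le) auto
  also have "\<dots> = trap_eps" using rmin(1) by (simp add: shadow_eps_def)
  finally show "norm (\<psi> (at_time \<theta> n) - zdir (v n)) \<le> trap_eps" using sp p by simp
qed

end

section \<open>Hausdorff distance and supports of measures\<close>

lemma hausdorff_dist_self: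
  assumes "finite A" "A \<noteq> {}" shows "hausdorff_dist A A = 0"
proof -
  have "(SUP a\<in>A. infdist a A) = (SUP a\<in>A. 0::real)" by (rule SUP_cong) auto
  also have "\<dots> = 0" using assms(2) by (rule cSUP_const)
  finally show ?thesis by (simp add: hausdorff_dist_def)
qed

lemma infdist_le_hausdorff_dist:
  assumes "finite B" "b \<in> B" shows "infdist b A \<le> hausdorff_dist A B"
proof -
  have "infdist b A \<le> (SUP b\<in>B. infdist b A)" using assms by (intro cSUP_upper) auto
  then show ?thesis by (simp add: hausdorff_dist_def)
qed

lemma infdist_pair_less:
  fixes p x :: "'a::euclidean_space"
  assumes "infdist x {p, - p} < e" shows "norm (x - p) \<le> e \<or> norm (x + p) \<le> e"
proof -
  have "closed {p, - p}" by (intro finite_imp_closed) auto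
  then obtain y where "y \<in> {p, - p}" "infdist x {p, - p} = dist x y"
    using infdist_attains_inf[of "{p, - p}" x] by auto
  then show ?thesis using assms by (auto simp: dist_norm)
qed

text \<open>The complement of the support is a union of open null sets, and by Lindelof's theorem a
  countable union of them.\<close>

lemma emeasure_compl_support:
  fixes \<mu> :: "'a::second_countable_topology measure"
  assumes "sets \<mu> = sets borel"
  shows "- measure_support \<mu> \<in> null_sets \<mu>" "closed (measure_support \<mu>)"
proof -
  define \<F> where "\<F> = {U. open U \<and> emeasure \<mu> U = 0}"
  have eq: "- measure_support \<mu> = \<Union> \<F>"
    by (auto simp: measure_support_def \<F>_def not_less)
  have "open (\<Union> \<F>)" by (auto simp: \<F>_def)
  then show "closed (measure_support \<mu>)" by (simp add: eq[symmetric] closed_def)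
  obtain \<F>' where F: "\<F>' \<subseteq> \<F>" "countable \<F>'" "\<Union> \<F>' = \<Union> \<F>"
    using Lindelof[of \<F>] unfolding \<F>_def by blast
  have "(\<Union>U\<in>\<F>'. U) \<in> null_sets \<mu>"
    using F(1,2) assms by (intro null_sets_UN') (auto simp: \<F>_def null_sets_def)
  then show "- measure_support \<mu> \<in> null_sets \<mu>" using F(3) eq by simp
qed

context sna_system
begin

lemma continuous_on_Lam: "continuous_on UNIV \<Lambda>"
proof -
  have "\<Lambda> = (\<lambda>p. (fst p + \<alpha>, (\<beta> / (1 + (norm (snd p))\<^sup>2)) *\<^sub>R A (fst p) (snd p)))"
    using Lam_eq[of \<omega> \<beta> \<gamma>] by (auto simp: fun_eq_iff)
  moreover have "continuous_on UNIV (\<lambda>p :: phase. (fst p + \<alpha>, (\<beta> / (1 + (norm (snd p))\<^sup>2)) *\<^sub>R A (fst p) (snd p)))"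
    by (intro continuous_intros) (auto simp: add_nonneg_eq_0_iff)
  ultimately show ?thesis by metis
qed

end

context sna_graph
begin

section \<open>The closure of the graph, sensitivity and non-continuity\<close>

lemma graph_closure_subset_torus: "graph_closure graph \<subseteq> torus"
proof
  fix p assume p: "p \<in> graph_closure graph"
  have "closed {p. gauge_fun p = 1}"
    using continuous_closed_preimage[OF continuous_on_gauge_fun closed_UNIV closed_singleton[of 1]] by (simp add: vimage_def)
  then have cl: "closed torus" by (simp add: gauge_fun_eq_1)
  show "p \<in> torus"
  proof (rule ccontr)
    assume "p \<notin> torus"
    moreover have "open (- torus)" using cl by (simp add: open_Compl)
    ultimately have "0 < emeasure (graph_measure graph) (- torus)"
      using p unfolding graph_closure_def measure_support_def by blast
    moreover have "emeasure (graph_measure graph) (- torus) = 0"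
      using cl pt_torus by (subst emeasure_graph_measure) (auto simp: borel_closed)
    ultimately show False by simp
  qed
qed

lemma pt_signed_measurable [measurable]: "(\<lambda>\<theta>. (\<theta>, - pt \<theta>)) \<in> borel_measurable borel"
  unfolding borel_prod[symmetric] by measurable

lemma AE_pt_in_closure: "AE \<theta> in lebesgue_circle. (\<theta>, pt \<theta>) \<in> graph_closure graph \<and> (\<theta>, - pt \<theta>) \<in> graph_closure graph"
proof -
  define Y where "Y = graph_closure graph"
  have Y: "- Y \<in> null_sets (graph_measure graph)" "closed Y"
    using emeasure_compl_support[of "graph_measure graph"] by (auto simp: Y_def graph_closure_def)
  have Ym [measurable]: "- Y \<in> sets borel" using Y(2) by (intro borel_open) (simp add: open_Compl)
  have "(1/2) * (\<integral>\<^sup>+ \<theta>. (indicator (- Y) (\<theta>, pt \<theta>) + indicator (- Y) (\<theta>, - pt \<theta>)) \<partial>lebesgue_circle) = (0 :: ennreal)"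
    using Y(1) emeasure_graph_measure[OF Ym] by (simp add: null_sets_def)
  then have "(\<integral>\<^sup>+ \<theta>. (indicator (- Y) (\<theta>, pt \<theta>) + indicator (- Y) (\<theta>, - pt \<theta>)) \<partial>lebesgue_circle) = (0 :: ennreal)"
    by (auto simp: ennreal_divide_eq_0_iff)
  then have "AE \<theta> in lebesgue_circle. (indicator (- Y) (\<theta>, pt \<theta>) + indicator (- Y) (\<theta>, - pt \<theta>)) = (0 :: ennreal)"
    by (subst (asm) nn_integral_0_iff_AE) simp_all
  then show ?thesis unfolding Y_def[symmetric] by eventually_elim (auto split: split_indicator_asm)
qed

text \<open>The graph measure is invariant under \<Lambda>: the step maps the two sheets to the two
  sheets, and an exchange of signs only swaps the two summands.\<close>

lemma graph_closure_invariant: "\<Lambda> ` graph_closure graph \<subseteq> graph_closure graph"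
proof
  fix q assume "q \<in> \<Lambda> ` graph_closure graph"
  then obtain p where p: "p \<in> graph_closure graph" "q = \<Lambda> p" by auto
  have "0 < emeasure (graph_measure graph) U" if U: "open U" "q \<in> U" for U
  proof -
    have [measurable]: "U \<in> sets borel" using U by simp
    have op: "open (\<Lambda> -` U)" using continuous_on_Lam U(1) by (simp add: continuous_on_open_vimage)
    have pre [measurable]: "\<Lambda> -` U \<in> sets borel" using op by simp
    have "p \<in> \<Lambda> -` U" using p U by simp
    then have "0 < emeasure (graph_measure graph) (\<Lambda> -` U)"
      using p(1) op unfolding graph_closure_def measure_support_def by blast
    also have "emeasure (graph_measure graph) (\<Lambda> -` U)
        = (1/2) * (\<integral>\<^sup>+ \<theta>. (indicator U (\<theta> + \<alpha>, pt (\<theta> + \<alpha>)) + indicator U (\<theta> + \<alpha>, - pt (\<theta> + \<alpha>))) \<partial>lebesgue_circle)"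
      unfolding emeasure_graph_measure[OF pre]
    proof (intro arg_cong[where f="\<lambda>x. 1/2 * x"] nn_integral_cong_AE)
      show "AE \<theta> in lebesgue_circle. indicator (\<Lambda> -` U) (\<theta>, pt \<theta>) + indicator (\<Lambda> -` U) (\<theta>, - pt \<theta>)
          = (indicator U (\<theta> + \<alpha>, pt (\<theta> + \<alpha>)) + indicator U (\<theta> + \<alpha>, - pt (\<theta> + \<alpha>)) :: ennreal)"
        using GAE
      proof eventually_elim
        case (elim \<theta>)
        have e: "\<Lambda> (\<theta>, \<xi>) = (\<theta> + \<alpha>, snd (\<Lambda> (\<theta>, \<xi>)))" for \<xi> by (simp add: Lam_eq)
        have i: "indicator (\<Lambda> -` U) (\<theta>, \<xi>) = (indicator U (\<theta> + \<alpha>, snd (\<Lambda> (\<theta>, \<xi>))) :: ennreal)" for \<xi>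
          by (metis e indicator_vimage comp_apply)
        show ?case unfolding i Lam_minus using pt_step[OF elim] by (elim disjE) (simp_all add: add.commute)
      qed
    qed
    also have "\<dots> = emeasure (graph_measure graph) U"
      unfolding emeasure_graph_measure[OF \<open>U \<in> sets borel\<close>]
      by (subst nn_integral_circle_shift[where f="\<lambda>\<theta>. indicator U (\<theta>, pt \<theta>) + indicator U (\<theta>, - pt \<theta>)"]) simp_all
    finally show ?thesis .
  qed
  then show "q \<in> graph_closure graph" unfolding graph_closure_def measure_support_def by blast
qed

lemma iter_pt_cases:
  assumes "\<theta> \<in> Gd" "\<xi> = pt \<theta> \<or> \<xi> = - pt \<theta>"
  shows "snd ((\<Lambda> ^^ n) (\<theta>, \<xi>)) = pt (at_time \<theta> n) \<or> snd ((\<Lambda> ^^ n) (\<theta>, \<xi>)) = - pt (at_time \<theta> n)"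
  using fibre_iter_pt[OF assms(1), of n] assms(2) fibre_iter_minus[of n \<theta> "pt \<theta>"] unfolding Lam_iter snd_conv
  by (elim disjE) simp_all

text \<open>If a ball around x never spread, all graph points in it would shadow the orbit of x.
  Their base points have positive measure because x lies in the support.\<close>

lemma sensitive_on_graph_closure: "sensitive_on (graph_closure graph) \<Lambda>"
  unfolding sensitive_on_def
proof (intro conjI graph_closure_invariant exI[of _ "shadow_eps"] allI impI ballI)
  define Y where "Y = graph_closure graph"
  fix d :: real and x assume d: "0 < d" and x: "x \<in> graph_closure graph"
  show "\<exists>n. \<exists>y\<in>graph_closure graph. dist x y < d \<and> shadow_eps < dist ((\<Lambda> ^^ n) x) ((\<Lambda> ^^ n) y)"
  proof (rule ccontr)
    assume "\<not> ?thesis"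
    then have stay: "dist ((\<Lambda> ^^ n) x) ((\<Lambda> ^^ n) y) \<le> shadow_eps" if "y \<in> Y" "dist x y < d" for n y
      using that by (force simp: Y_def not_less)
    have [measurable]: "Y \<in> sets borel" "ball x d \<in> sets borel"
      using emeasure_compl_support(2)[of "graph_measure graph"] by (auto simp: Y_def graph_closure_def)
    define E where "E = {\<theta>\<in>Gd. (\<theta>, pt \<theta>) \<in> Y \<and> (\<theta>, - pt \<theta>) \<in> Y \<and> ((\<theta>, pt \<theta>) \<in> ball x d \<or> (\<theta>, - pt \<theta>) \<in> ball x d)}"
    have Em: "E \<in> sets borel" unfolding E_def by measurable
    have "0 < emeasure (graph_measure graph) (ball x d)"
      using x d unfolding graph_closure_def measure_support_def by auto
    also have "emeasure (graph_measure graph) (ball x d)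
        = (1/2) * (\<integral>\<^sup>+ \<theta>. (indicator (ball x d) (\<theta>, pt \<theta>) + indicator (ball x d) (\<theta>, - pt \<theta>)) \<partial>lebesgue_circle)"
      by (rule emeasure_graph_measure) simp
    finally have ne: "(\<integral>\<^sup>+ \<theta>. (indicator (ball x d) (\<theta>, pt \<theta>) + indicator (ball x d) (\<theta>, - pt \<theta>)) \<partial>lebesgue_circle) \<noteq> (0 :: ennreal)"
      by auto
    have "emeasure lebesgue_circle E \<noteq> 0"
    proof
      assume "emeasure lebesgue_circle E = 0"
      then have "AE \<theta> in lebesgue_circle. \<theta> \<notin> E" using Em by (intro AE_I[of _ _ E]) auto
      with GAE AE_pt_in_closure have "AE \<theta> in lebesgue_circle. indicator (ball x d) (\<theta>, pt \<theta>) + indicator (ball x d) (\<theta>, - pt \<theta>) = (0 :: ennreal)"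
        by eventually_elim (auto simp: E_def Y_def split: split_indicator)
      then show False using ne by (subst (asm) nn_integral_0_iff_AE) simp_all
    qed
    then have pos: "0 < emeasure lebesgue_circle E" by (simp add: zero_less_iff_neq_zero)
    show False
    proof (rule no_common_vector_shadow[OF Em pos, where N=0 and v="\<lambda>n. snd ((\<Lambda> ^^ n) x)"])
      show "E \<subseteq> Gd" by (auto simp: E_def)
      fix \<theta> n assume \<theta>: "\<theta> \<in> E"
      then obtain \<xi> where \<xi>: "\<xi> = pt \<theta> \<or> \<xi> = - pt \<theta>" "(\<theta>, \<xi>) \<in> Y" "dist x (\<theta>, \<xi>) < d" unfolding E_def by auto
      have "dist (snd ((\<Lambda> ^^ n) x)) (snd ((\<Lambda> ^^ n) (\<theta>, \<xi>))) \<le> shadow_eps"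
        using stay[OF \<xi>(2,3), of n] dist_snd_le order.trans by blast
      then show "norm (snd ((\<Lambda> ^^ n) x) - pt (at_time \<theta> n)) \<le> shadow_eps \<or> norm (snd ((\<Lambda> ^^ n) x) + pt (at_time \<theta> n)) \<le> shadow_eps"
        using iter_pt_cases[of \<theta> \<xi> n] \<theta> \<xi>(1) by (auto simp: E_def dist_norm)
    qed
  qed
qed (use shadow_eps in simp)

text \<open>A ball in X need not meet the graph, but over almost every nearby \<theta> it contains
  an attracted point. From some time N on this point is within half of \<open>shadow_eps\<close> of
  the graph and, if the ball did not spread, within half of it of the orbit of x. Countably many N
  suffice, so one of the sets \<open>E N\<close> has positive measure.\<close>

lemma sensitive_on_phase_ball:
  assumes C: "0 < C" and inv: "\<Lambda> ` phase_ball C \<subseteq> phase_ball C"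
  shows "sensitive_on (phase_ball C) \<Lambda>"
  unfolding sensitive_on_def
proof (intro conjI inv exI[of _ "shadow_eps / 2"] allI impI ballI)
  fix d :: real and x assume d: "0 < d" and x: "x \<in> phase_ball C"
  show "\<exists>n. \<exists>y\<in>phase_ball C. dist x y < d \<and> shadow_eps / 2 < dist ((\<Lambda> ^^ n) x) ((\<Lambda> ^^ n) y)"
  proof (rule ccontr)
    assume "\<not> ?thesis"
    then have stay: "dist ((\<Lambda> ^^ n) x) ((\<Lambda> ^^ n) y) \<le> shadow_eps / 2" if "y \<in> phase_ball C" "dist x y < d" for n y
      using that by (force simp: not_less)
    define v where "v n = snd ((\<Lambda> ^^ n) x)" for n
    define I where "I = ball (fst x) (d / 2)"
    \<comment> \<open>The intersection with the open ball keeps V inside the fibre of X and nonempty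
      open even if x lies on the boundary.\<close>
    define V where "V = ball (snd x) (d / 2) \<inter> ball 0 C"
    have V: "open V" "V \<noteq> {}"
    proof -
      have "snd x \<in> closure (ball 0 C)" using x C by (simp add: phase_ball_def mem_Times_iff)
      moreover have "0 < d / 2" using d by simp
      ultimately obtain y where "y \<in> ball 0 C" "dist y (snd x) < d / 2" unfolding closure_approachable by blast
      then show "V \<noteq> {}" by (auto simp: V_def dist_commute)
    qed (simp add: V_def open_Int)
    define near where "near \<theta> n \<longleftrightarrow> norm (v n - pt (at_time \<theta> n)) \<le> shadow_eps \<or> norm (v n + pt (at_time \<theta> n)) \<le> shadow_eps" for \<theta> n
    have Im [measurable]: "I \<in> sets borel" by (simp add: I_def)
    have [measurable]: "(\<lambda>\<theta>. pt (at_time \<theta> n)) \<in> borel_measurable borel" for n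
      unfolding at_time_def by measurable
    define E where "E N = {\<theta> \<in> Gd \<inter> I. \<forall>n\<ge>N. near \<theta> n}" for N :: nat
    have Em: "E N \<in> sets borel" for N unfolding E_def near_def by measurable
    have cover: "\<exists>N. \<theta> \<in> E N" if \<theta>: "\<theta> \<in> Gd" "\<theta> \<in> I" for \<theta>
    proof -
      have "\<exists>\<xi>\<in>V. \<xi> \<noteq> 0 \<and> (\<exists>N. \<forall>n\<ge>N. thr n \<le> norm (lin_iter n \<theta> \<xi>))"
      proof (rule ccontr)
        assume neg: "\<not> ?thesis"
        obtain Z where Z: "{\<xi>. \<not> (\<xi> \<noteq> 0 \<and> (\<exists>N. \<forall>n\<ge>N. thr n \<le> norm (lin_iter n \<theta> \<xi>)))} \<subseteq> Z" "emeasure lborel Z = 0" "Z \<in> sets lborel"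
          by (rule AE_E[OF AE_lin_iter_lower[of \<theta>]]) auto
        have "V \<subseteq> Z" using neg Z(1) by blast
        moreover have "Z \<in> null_sets lborel" using Z by (simp add: null_sets_def)
        then have "negligible Z" by (simp add: negligible_iff_null_sets null_sets_completionI)
        ultimately have "negligible V" using negligible_subset by blast
        then show False using open_not_negligible[OF V] by simp
      qed
      then obtain \<xi> N where \<xi>: "\<xi> \<in> V" "\<xi> \<noteq> 0" "\<forall>n\<ge>N. thr n \<le> norm (lin_iter n \<theta> \<xi>)" by blast
      have inX: "(\<theta>, \<xi>) \<in> phase_ball C" using \<xi>(1) by (simp add: V_def phase_ball_def)
      have "dist x (\<theta>, \<xi>) \<le> dist (fst x) \<theta> + dist (snd x) \<xi>"
        unfolding dist_prod_def by (simp add: sqrt_sum_squares_le_sum)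
      also have "\<dots> < d" using \<theta>(2) \<xi>(1) by (simp add: I_def V_def)
      finally have near0: "dist x (\<theta>, \<xi>) < d" .
      obtain M where M: "\<And>n. n \<ge> M \<Longrightarrow> infdist (fibre_iter \<Lambda> n \<theta> \<xi>) (graph (at_time \<theta> n)) < shadow_eps / 2"
        using LIMSEQ_D[OF graph_attraction[OF \<theta>(1) \<xi>(2,3)], of "shadow_eps / 2"] shadow_eps
        by (auto simp: infdist_nonneg)
      have "near \<theta> n" if n: "n \<ge> M" for n
      proof -
        define w where "w = fibre_iter \<Lambda> n \<theta> \<xi>"
        have "dist (v n) w \<le> shadow_eps / 2"
          using stay[OF inX near0, of n] dist_snd_le[of "(\<Lambda> ^^ n) x" "(\<Lambda> ^^ n) (\<theta>, \<xi>)"] by (simp add: v_def w_def Lam_iter)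
        moreover have "norm (w - pt (at_time \<theta> n)) \<le> shadow_eps / 2 \<or> norm (w + pt (at_time \<theta> n)) \<le> shadow_eps / 2"
          using infdist_pair_less[of w "pt (at_time \<theta> n)" "shadow_eps / 2"] M[OF n] Gd_at_time[OF \<theta>(1), of n] by (simp add: graph_def w_def)
        ultimately show ?thesis
          using norm_triangle_ineq[of "v n - w" "w - pt (at_time \<theta> n)"] norm_triangle_ineq[of "v n - w" "w + pt (at_time \<theta> n)"]
          unfolding near_def dist_norm by (auto simp: algebra_simps)
      qed
      then show ?thesis using \<theta> by (auto simp: E_def)
    qed
    have "\<exists>N. 0 < emeasure lebesgue_circle (E N)"
    proof (rule ccontr)
      assume "\<not> ?thesis"
      then have "E N \<in> null_sets lebesgue_circle" for N using Em by (auto simp: null_sets_def)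
      then have "(\<Union>N. E N) \<in> null_sets lebesgue_circle" by (rule null_sets_UN)
      moreover have "Gd \<inter> I \<subseteq> (\<Union>N. E N)" using cover by auto
      moreover have "Gd \<inter> I \<in> sets lebesgue_circle" by simp
      ultimately have "Gd \<inter> I \<in> null_sets lebesgue_circle" using null_sets_subset by blast
      then have "AE \<theta> in lebesgue_circle. \<theta> \<notin> Gd \<inter> I" by (rule AE_not_in)
      with GAE have "AE \<theta> in lebesgue_circle. \<theta> \<notin> I" by eventually_elim auto
      then have "emeasure lebesgue_circle I = 0" using AE_iff_measurable[of I lebesgue_circle "\<lambda>\<theta>. \<theta> \<notin> I"] Im by simp
      then show False using emeasure_circle_ball_pos[of "d / 2" "fst x"] d by (simp add: I_def)
    qed
    then obtain N where pos: "0 < emeasure lebesgue_circle (E N)" by blast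
    show False
      by (rule no_common_vector_shadow[OF Em pos, where N=N and v=v]) (auto simp: E_def near_def)
  qed
qed (use shadow_eps in simp)

text \<open>A Lebesgue number e for the continuous representative allows one chosen value near each
  orbit point of 0 to approximate the graph over the whole ball of radius e. All \<theta> in
  \<open>ball 0 e\<close>, up to a null set, then shadow one sequence.\<close>

lemma noncontinuous: "noncontinuous_graph graph"
  unfolding noncontinuous_graph_def
proof
  assume "\<exists>\<Psi>. continuous_two_valued \<Psi> \<and> (AE \<theta> in lebesgue_circle. graph \<theta> = \<Psi> \<theta>)"
  then obtain \<Psi> where card: "\<And>\<theta>. card (\<Psi> \<theta>) = 2" and lim: "\<And>\<theta>. ((\<lambda>t. hausdorff_dist (\<Psi> t) (\<Psi> \<theta>)) \<longlongrightarrow> 0) (at \<theta>)"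
    and ae: "AE \<theta> in lebesgue_circle. graph \<theta> = \<Psi> \<theta>"
    unfolding continuous_two_valued_def by blast
  have fin: "finite (\<Psi> \<theta>)" "\<Psi> \<theta> \<noteq> {}" for \<theta> using card[of \<theta>] by (auto simp: card_ge_0_finite)
  have "\<exists>d>0. \<forall>t\<in>ball \<theta> d. hausdorff_dist (\<Psi> t) (\<Psi> \<theta>) < shadow_eps" for \<theta>
  proof -
    have "\<forall>\<^sub>F t in at \<theta>. hausdorff_dist (\<Psi> t) (\<Psi> \<theta>) < shadow_eps"
      using order_tendstoD(2)[OF lim] shadow_eps(1) by blast
    then obtain d where "0 < d" "\<And>t. t \<noteq> \<theta> \<Longrightarrow> dist t \<theta> < d \<Longrightarrow> hausdorff_dist (\<Psi> t) (\<Psi> \<theta>) < shadow_eps"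
      unfolding eventually_at by auto
    then show ?thesis using hausdorff_dist_self[OF fin, of \<theta>] shadow_eps(1)
      by (intro exI[of _ d]) (metis dist_commute mem_ball)
  qed
  then obtain D where D: "\<And>\<theta>. 0 < D \<theta>" "\<And>\<theta> t. t \<in> ball \<theta> (D \<theta>) \<Longrightarrow> hausdorff_dist (\<Psi> t) (\<Psi> \<theta>) < shadow_eps" by metis
  have "UNIV \<subseteq> \<Union> (range (\<lambda>\<theta>. ball \<theta> (D \<theta>)))" using D(1) by auto
  then obtain e where e: "0 < e" "\<And>x. x \<in> UNIV \<Longrightarrow> \<exists>G\<in>range (\<lambda>\<theta>. ball \<theta> (D \<theta>)). ball x e \<subseteq> G"
    by (rule Heine_Borel_lemma[OF compact_UNIV_circle]) auto
  have "\<exists>y. ball x e \<subseteq> ball y (D y)" for x using e(2)[of x] by auto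
  then obtain k where k: "\<And>x. ball x e \<subseteq> ball (k x) (D (k x))" by metis
  have "\<exists>y. y \<in> \<Psi> \<theta>" for \<theta> using fin(2) by blast
  then obtain q where q: "\<And>\<theta>. q \<theta> \<in> \<Psi> \<theta>" by metis
  \<comment> \<open>Equality almost everywhere is transported to all times at once, because
    shadowing concerns the whole forward orbit.\<close>
  have "AE \<theta> in lebesgue_circle. \<forall>n. graph (at_time \<theta> n) = \<Psi> (at_time \<theta> n)"
    unfolding AE_all_countable at_time_def using AE_circle_shift[OF ae] by blast
  then obtain Z where Z: "{\<theta>. \<not> (\<forall>n. graph (at_time \<theta> n) = \<Psi> (at_time \<theta> n))} \<subseteq> Z" "emeasure lebesgue_circle Z = 0" "Z \<in> sets borel"
    by (auto elim!: AE_E)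
  define E where "E = Gd \<inter> ball 0 e - Z"
  have Em: "E \<in> sets borel" using Z(3) by (simp add: E_def)
  have "emeasure lebesgue_circle E \<noteq> 0"
  proof
    assume "emeasure lebesgue_circle E = 0"
    then have "AE \<theta> in lebesgue_circle. \<theta> \<notin> E" using Em by (intro AE_I[of _ _ E]) auto
    moreover have "AE \<theta> in lebesgue_circle. \<theta> \<notin> Z" using Z by (intro AE_I[of _ _ Z]) auto
    ultimately have "AE \<theta> in lebesgue_circle. \<theta> \<notin> ball 0 e" using GAE by eventually_elim (auto simp: E_def)
    then have "emeasure lebesgue_circle (ball 0 e) = 0"
      using AE_iff_measurable[of "ball 0 e" lebesgue_circle "\<lambda>\<theta>. \<theta> \<notin> ball 0 e"] by (simp del: mem_ball)
    then show False using emeasure_circle_ball_pos[OF e(1), of 0] by simp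
  qed
  then have pos: "0 < emeasure lebesgue_circle E" by (simp add: zero_less_iff_neq_zero)
  show False
  proof (rule no_common_vector_shadow[OF Em pos, where N=0 and v="\<lambda>n. q (k (at_time 0 n))"])
    show "E \<subseteq> Gd" by (auto simp: E_def)
    fix \<theta> n assume \<theta>: "\<theta> \<in> E"
    define t where "t = at_time \<theta> n"
    define x where "x = k (at_time 0 n)"
    have "dist 0 \<theta> < e" using \<theta> by (simp add: E_def)
    then have "t \<in> ball (at_time 0 n) e" using dist_circle_add[of 0 "to_circle (real n * \<omega>)" \<theta>] by (simp add: t_def at_time_def)
    then have "t \<in> ball x (D x)" using k[of "at_time 0 n"] unfolding x_def by blast
    then have "hausdorff_dist (\<Psi> t) (\<Psi> x) < shadow_eps" by (rule D(2))
    then have "infdist (q x) (\<Psi> t) < shadow_eps" using infdist_le_hausdorff_dist[OF fin(1) q, of x "\<Psi> t"] by linarith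
    moreover have "\<Psi> t = {pt t, - pt t}"
    proof -
      have "graph t = \<Psi> t" using Z(1) \<theta> by (auto simp: E_def t_def)
      moreover have "t \<in> Gd" using \<theta> Gd_at_time by (simp add: E_def t_def)
      ultimately show ?thesis by (simp add: graph_def)
    qed
    ultimately show "norm (q (k (at_time 0 n)) - pt (at_time \<theta> n)) \<le> shadow_eps \<or> norm (q (k (at_time 0 n)) + pt (at_time \<theta> n)) \<le> shadow_eps"
      using infdist_pair_less[of "q x" "pt t" shadow_eps] by (simp add: t_def x_def)
  qed
qed

end

theorem mainTheorem7:
  fixes \<omega> \<beta> \<gamma> C :: real
    and X \<G> :: "phase set"
    and \<Lambda> :: "phase \<Rightarrow> phase"
  assumes "\<omega> \<notin> \<rat>"
    and "1 < \<beta>" and "\<beta> \<le> 2"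
    and "0 < \<gamma>" and "\<gamma> < 1"
    and "1 \<le> \<beta> * \<gamma>"
    and "0 < C"
  defines "\<Lambda> \<equiv> Lam \<omega> \<beta> \<gamma>"
    and "X \<equiv> phase_ball C"
    and "\<G> \<equiv> global_attractor \<Lambda> X"
  assumes "\<Lambda> ` X \<subseteq> interior X"
  shows "\<exists>\<Phi>.
    (two_valued_invariant_graph \<omega> \<Lambda> C \<Phi> \<and>
     noncontinuous_graph \<Phi> \<and>
     (\<exists>L<0. is_max_fibre_exponent \<Lambda> (graph_measure \<Phi>) L) \<and>
     attracts_ae \<omega> \<Lambda> X \<Phi>) \<and>
    (\<exists>T\<^sub>0. T\<^sub>0 \<subseteq> X \<and> \<Lambda> ` T\<^sub>0 = T\<^sub>0 \<and>
       T\<^sub>0 homeomorphic (UNIV :: (circle \<times> circle) set) \<and>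
       graph_closure \<Phi> \<subseteq> T\<^sub>0 \<and>
       T\<^sub>0 = frontier \<G>) \<and>
    (sensitive_on X \<Lambda> \<and> sensitive_on (graph_closure \<Phi>) \<Lambda>)"
proof -
  interpret sna_system \<omega> \<beta> \<gamma> using assms(1-6) by unfold_locales
  obtain \<psi> G c where "\<psi> \<in> borel_measurable borel" "G \<in> sets borel" "AE \<theta> in lebesgue_circle. \<theta> \<in> G"
    "\<And>\<theta>. norm (\<psi> \<theta>) = 1" "\<And>\<theta>. \<theta> \<in> G \<Longrightarrow> \<theta> + to_circle \<omega> \<in> G"
    "\<And>\<theta>. \<theta> \<in> G \<Longrightarrow> \<psi> (\<theta> + to_circle \<omega>) = mob (mobk \<gamma>) (rot2 \<theta> * \<psi> \<theta>)" "0 < c"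
    "\<And>\<theta>. \<theta> \<in> G \<Longrightarrow> \<exists>B. \<forall>n. birkhoff_sum \<omega> (\<lambda>\<theta>. ln (mob_rate (mobk \<gamma>) (rot2 \<theta> * \<psi> \<theta>))) n \<theta> \<le> B - c * real n"
    by (rule unimodular_invariant_graph[OF assms(1) mobk[OF assms(4,5)]], rule that)
  then interpret sna_graph \<omega> \<beta> \<gamma> \<psi> G c by unfold_locales
  have sub: "Lam \<omega> \<beta> \<gamma> ` phase_ball C \<subseteq> interior (phase_ball C)" using assms(11) unfolding \<Lambda>_def X_def .
  note att = global_attractor_eq[OF assms(7) sub]
  have front: "torus = frontier \<G>" unfolding \<G>_def \<Lambda>_def X_def att(1) frontier_gauge ..
  have tX: "torus \<subseteq> X" using att(2) unfolding X_def by (auto simp flip: gauge_fun_eq_1)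
  have inv: "Lam \<omega> \<beta> \<gamma> ` phase_ball C \<subseteq> phase_ball C" using sub interior_subset by blast
  have a: "two_valued_invariant_graph \<omega> \<Lambda> C graph \<and> noncontinuous_graph graph \<and>
     (\<exists>L<0. is_max_fibre_exponent \<Lambda> (graph_measure graph) L) \<and> attracts_ae \<omega> \<Lambda> X graph"
    unfolding \<Lambda>_def using two_valued_graph[OF att(2)] noncontinuous negative_exponent attracts by blast
  have b: "torus \<subseteq> X \<and> \<Lambda> ` torus = torus \<and> torus homeomorphic (UNIV :: (circle \<times> circle) set) \<and>
       graph_closure graph \<subseteq> torus \<and> torus = frontier \<G>"
    using tX torus_invariant torus_homeomorphic graph_closure_subset_torus front unfolding \<Lambda>_def by blast
  have c: "sensitive_on X \<Lambda> \<and> sensitive_on (graph_closure graph) \<Lambda>"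
    unfolding \<Lambda>_def X_def using sensitive_on_phase_ball[OF assms(7) inv] sensitive_on_graph_closure by blast
  show ?thesis using a b c by blast
qed

end
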